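(* Let $\Gamma_1=\{\Gamma_{1,n}\}_{n}$ and $\Gamma_2=\{\Gamma_{2,n}\}_{n}$ be sequences of admissible quantum spin networks in $\mathcal S(S^2)$ with edges colored $n$ or $2n$, such that each $\Gamma_{i,n}$ contains a distinguished trivalent vertex $\tau_{2n,2n,2n}$ (all three edges at it colored $2n$). Let $[\Gamma_1,\Gamma_2]_1=\{[\Gamma_{1,n},\Gamma_{2,n}]_1\}_n$ be the sequence of spin networks obtained by removing the distinguished vertex from $\Gamma_{1,n}$ and from $\Gamma_{2,n}$ and joining, planarly, the three resulting loose edges colored $2n$ of the first graph to the three resulting loose edges colored $2n$ of the second graph. Suppose that the tails $T_{\Gamma_1}$ and $T_{\Gamma_2}$ exist. Then for all $n$ $$[\Gamma_{1,n},\Gamma_{2,n}]_1\doteq_n\frac{1}{(q^2;q)_n}\,T_{\Gamma_1}\,T_{\Gamma_2}.$$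
   Context: $(a;q)_n=\prod_{j=0}^{n-1}(1-aq^j)$. Skein theory. Work over $\mathbb{Q}(A)$ and put $q=A^4$. $\mathcal S(S^2)$ is the Kauffman bracket skein module of the sphere: diagrams modulo (crossing) $=A\,(A\text{-smoothing})+A^{-1}(B\text{-smoothing})$ and $L\sqcup\bigcirc=-(A^2+A^{-2})L$; it is identified with $\mathbb{Q}(A)$ by sending the empty diagram to $1$. $f^{(n)}$ denotes the $n$-th Jones–Wenzl idempotent in $TL_n$. A triple $(a,b,c)$ of nonnegative integers is admissible if $a+b+c$ is even and $a+b\ge c\ge|a-b|$; then $\tau_{a,b,c}$ is the skein element in a disk with three boundary boxes $f^{(a)},f^{(b)},f^{(c)}$ in which $(a+b-c)/2$, $(a+c-b)/2$, $(b+c-a)/2$ parallel crossingless strands join the $a$- and $b$-boxes, the $a$- and $c$-boxes, and the $b$- and $c$-boxes respectively. A quantum spin network is a planar trivalent graph with edges labelled (colored) by nonnegative integers; it is admissible if the three colors at each vertex form an admissible triple. Its evaluation in $\mathcal S(S^2)=\mathbb{Q}(A)$ is obtained by replacing each edge colored $m$ by $f^{(m)}$ and each vertex colored $(a,b,c)$ by $\tau_{a,b,c}$. Tail. Rational functions are regarded as power series in $q$ after multiplication by a suitable (possibly fractional) power of $q$. $P_1\doteq_n P_2$ means that, once both are multiplied by powers of $q$ so as to be power series starting in degree $0$, their first $n$ coefficients agree up to a common sign. The tail $T_{\mathcal P}(q)\in\mathbb{Z}[[q]]$ of a sequence $\mathcal P=\{P_n\}$, if it exists, is the power series with $T_{\mathcal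 P}(q)\doteq_n P_n(q)$ for all $n$. The tail of a sequence of spin networks is the tail of the sequence of their evaluations. *)

theory Defs
  imports
    "HOL-Computational_Algebra.Computational_Algebra"
    "HOL-Library.Disjoint_Sets"
    "HOL-Library.FuncSet"
begin

section \<open>The coefficient field\<close>

type_synonym ratfun = "rat poly fract"

definition varA :: ratfun where
  "varA = Fract [:0, 1:] 1"

text \<open>The value of a trivial circle.\<close>

definition circle_value :: ratfun where
  "circle_value = - (varA powi 2 + varA powi (-2))"


section \<open>Crossingless diagrams\<close>

definition components :: "'p set \<Rightarrow> 'p set set \<Rightarrow> 'p set set" where
  "components P G = P // {(x, y). {x, y} \<in> G}\<^sup>*"

definition crossingless_matchings :: "nat \<Rightarrow> nat set set set" where
  "crossingless_matchings k = {M. partition_on {..<k} M \<and> (\<forall>p\<in>M. card p = 2) \<and>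
     (\<forall>a b c d. a < b \<and> b < c \<and> c < d \<longrightarrow> \<not> ({a, c} \<in> M \<and> {b, d} \<in> M))}"

text \<open>
  The basis of the Temperley--Lieb algebra on \<open>m\<close> strands is \<open>crossingless_matchings (2 * m)\<close>.
  The boundary points of the rectangle are numbered counterclockwise: \<open>0, \<dots>, m - 1\<close> on the bottom
  from left to right, \<open>m, \<dots>, 2 m - 1\<close> on the top from right to left. An element of the algebra is
  the function that gives the coefficient of each basis diagram.
\<close>

type_synonym tl = "nat set set \<Rightarrow> ratfun"

definition tl_basis :: "nat set set \<Rightarrow> tl" where
  "tl_basis D = (\<lambda>E. if E = D then 1 else 0)"

definition tl_one :: "nat \<Rightarrow> tl" where
  "tl_one m = tl_basis {{i, 2 * m - 1 - i} | i. i < m}"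

text \<open>
  Stacking \<open>E\<close> on top of \<open>D\<close>: the points of \<open>D\<close> are tagged \<open>False\<close>, those of \<open>E\<close> are tagged \<open>True\<close>,
  and the \<open>j\<close>-th top point of \<open>D\<close> is joined to the \<open>j\<close>-th bottom point of \<open>E\<close>.
  Components that contain no outer point are closed circles.
\<close>

definition stack_points :: "nat \<Rightarrow> (bool \<times> nat) set" where
  "stack_points m = UNIV \<times> {..<2 * m}"

definition stack_arcs :: "nat \<Rightarrow> nat set set \<Rightarrow> nat set set \<Rightarrow> (bool \<times> nat) set set" where
  "stack_arcs m D E = (\<lambda>p. Pair False ` p) ` D \<union> (\<lambda>p. Pair True ` p) ` E \<union>
     {{(False, 2 * m - 1 - j), (True, j)} | j. j < m}"

definition stack_outer :: "nat \<Rightarrow> (bool \<times> nat) set" where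
  "stack_outer m = {False} \<times> {..<m} \<union> {True} \<times> {m..<2 * m}"

definition stack_diagram :: "nat \<Rightarrow> nat set set \<Rightarrow> nat set set \<Rightarrow> nat set set" where
  "stack_diagram m D E =
     {snd ` (C \<inter> stack_outer m) | C.
        C \<in> components (stack_points m) (stack_arcs m D E) \<and> C \<inter> stack_outer m \<noteq> {}}"

definition stack_circles :: "nat \<Rightarrow> nat set set \<Rightarrow> nat set set \<Rightarrow> nat" where
  "stack_circles m D E =
     card {C \<in> components (stack_points m) (stack_arcs m D E). C \<inter> stack_outer m = {}}"

definition tl_mult :: "nat \<Rightarrow> tl \<Rightarrow> tl \<Rightarrow> tl" where
  "tl_mult m x y = (\<lambda>B. \<Sum>D\<in>crossingless_matchings (2 * m). \<Sum>E\<in>crossingless_matchings (2 * m).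
     if stack_diagram m D E = B then x D * y E * circle_value ^ stack_circles m D E else 0)"

text \<open>A further vertical strand at the right of a diagram, and its linear extension.\<close>

definition add_strand :: "nat \<Rightarrow> nat set set \<Rightarrow> nat set set" where
  "add_strand m D = (\<lambda>p. (\<lambda>i. if i < m then i else i + 2) ` p) ` D \<union> {{m, m + 1}}"

definition tl_add_strand :: "nat \<Rightarrow> tl \<Rightarrow> tl" where
  "tl_add_strand m x =
     (\<lambda>B. \<Sum>D\<in>crossingless_matchings (2 * m). if add_strand m D = B then x D else 0)"

text \<open>The generator with a cup and a cap at the last two of \<open>m + 2\<close> strands.\<close>

definition tl_hook :: "nat \<Rightarrow> tl" where
  "tl_hook m = tl_basis
     ({{i, 2 * (m + 2) - 1 - i} | i. i < m} \<union> {{m, m + 1}, {m + 2, m + 3}})"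

definition circle_poly :: "nat \<Rightarrow> ratfun" where
  "circle_poly n = (-1) ^ n * (varA powi (2 * (int n + 1)) - varA powi (- 2 * (int n + 1))) /
     (varA powi 2 - varA powi (-2))"

text \<open>The Jones--Wenzl idempotents, by Wenzl's recursion.\<close>

fun jones_wenzl :: "nat \<Rightarrow> tl" where
  "jones_wenzl 0 = tl_one 0"
| "jones_wenzl (Suc 0) = tl_one 1"
| "jones_wenzl (Suc (Suc m)) =
     (let f = tl_add_strand (m + 1) (jones_wenzl (Suc m)) in
      (\<lambda>B. f B - circle_poly m / circle_poly (m + 1) *
                 tl_mult (m + 2) f (tl_mult (m + 2) (tl_hook m) f) B))"


section \<open>Quantum spin networks on the sphere\<close>

text \<open>
  A graph embedded in the oriented sphere is given by its rotation system. The two ends of the edge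
  \<open>e\<close> are the darts \<open>(e, False)\<close> and \<open>(e, True)\<close>; \<open>rot\<close> sends a dart to the next one counterclockwise
  around the same vertex.

  Besides trivalent vertices (\<open>rot\<close>-orbits of length 3) we allow joints (\<open>rot\<close>-orbits of length 2).
  A joint is no vertex but a mere point of an edge, where two ends of segments of the same color are
  joined. Joints serve to describe closed edges without vertices and edges that arise by gluing.
\<close>

type_synonym 'e dart = "'e \<times> bool"

record 'e spin_network =
  edges :: "'e set"
  rot :: "'e dart \<Rightarrow> 'e dart"
  color :: "'e \<Rightarrow> nat"

definition darts :: "'e spin_network \<Rightarrow> 'e dart set" where
  "darts N = edges N \<times> UNIV"

definition flip :: "'e dart \<Rightarrow> 'e dart" where
  "flip d = (fst d, \<not> snd d)"

definition dcolor :: "'e spin_network \<Rightarrow> 'e dart \<Rightarrow> nat" where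
  "dcolor N d = color N (fst d)"

definition trivalent_at :: "'e spin_network \<Rightarrow> 'e dart \<Rightarrow> bool" where
  "trivalent_at N d \<longleftrightarrow> rot N d \<noteq> d \<and> rot N (rot N (rot N d)) = d"

definition joint_at :: "'e spin_network \<Rightarrow> 'e dart \<Rightarrow> bool" where
  "joint_at N d \<longleftrightarrow> rot N d \<noteq> d \<and> rot N (rot N d) = d \<and> dcolor N (rot N d) = dcolor N d"

text \<open>
  Planarity: \<open>V - E + F = 2 C\<close>, where \<open>C\<close> is the number of connected components. A component of
  genus \<open>g\<close> contributes \<open>2 - 2 g\<close> to the left-hand side, so this says that each one lies on a
  sphere. The relative position of different components on one common sphere is not recorded:
  circles may be removed in any order, so the evaluation does not depend on it.
\<close>

definition planar :: "'e spin_network \<Rightarrow> bool" where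
  "planar N \<longleftrightarrow>
     int (card (components (darts N) {{d, rot N d} | d. d \<in> darts N}))
       - int (card (edges N))
       + int (card (components (darts N) {{d, rot N (flip d)} | d. d \<in> darts N}))
     = 2 * int (card (components (darts N)
             ({{d, rot N d} | d. d \<in> darts N} \<union> {{d, flip d} | d. d \<in> darts N})))"

definition admissible_triple :: "nat \<Rightarrow> nat \<Rightarrow> nat \<Rightarrow> bool" where
  "admissible_triple a b c \<longleftrightarrow>
     even (a + b + c) \<and> a + b \<ge> c \<and> int c \<ge> \<bar>int a - int b\<bar>"

definition is_spin_network :: "'e spin_network \<Rightarrow> bool" where
  "is_spin_network N \<longleftrightarrow> finite (edges N) \<and> rot N ` darts N \<subseteq> darts N \<and>
     (\<forall>d\<in>darts N. trivalent_at N d \<or> joint_at N d) \<and> planar N"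

definition admissible :: "'e spin_network \<Rightarrow> bool" where
  "admissible N \<longleftrightarrow> (\<forall>d\<in>darts N. trivalent_at N d \<longrightarrow>
     admissible_triple (dcolor N d) (dcolor N (rot N d)) (dcolor N (rot N (rot N d))))"

definition distinguished_vertex :: "'e spin_network \<Rightarrow> nat \<Rightarrow> 'e dart \<Rightarrow> bool" where
  "distinguished_vertex N m d \<longleftrightarrow> d \<in> darts N \<and> trivalent_at N d \<and>
     dcolor N d = m \<and> dcolor N (rot N d) = m \<and> dcolor N (rot N (rot N d)) = m"


subsection \<open>Evaluation\<close>

text \<open>
  The strand \<open>(d, i)\<close> is the \<open>i\<close>-th one from the left of the \<open>dcolor N d\<close> parallel strands that
  leave the vertex (or joint) along the dart \<open>d\<close>, looking outwards along \<open>d\<close>. Hence the strands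
  between \<open>d\<close> and \<open>rot N d\<close> are the leftmost ones of \<open>d\<close> and the rightmost ones of \<open>rot N d\<close>.
\<close>

definition strand_points :: "'e spin_network \<Rightarrow> ('e dart \<times> nat) set" where
  "strand_points N = {(d, i). d \<in> darts N \<and> i < dcolor N d}"

definition corner_strands :: "'e spin_network \<Rightarrow> 'e dart \<Rightarrow> nat" where
  "corner_strands N d =
     (if trivalent_at N d
      then (dcolor N d + dcolor N (rot N d) - dcolor N (rot N (rot N d))) div 2
      else dcolor N d)"

definition vertex_arcs :: "'e spin_network \<Rightarrow> ('e dart \<times> nat) set set" where
  "vertex_arcs N = {{(d, i), (rot N d, dcolor N (rot N d) - 1 - i)} | d i.
     d \<in> darts N \<and> i < corner_strands N d}"

text \<open>
  A diagram placed on the edge \<open>e\<close> has its bottom at \<open>(e, False)\<close> and its top at \<open>(e, True)\<close>.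
\<close>

definition edge_point :: "'e spin_network \<Rightarrow> 'e \<Rightarrow> nat \<Rightarrow> 'e dart \<times> nat" where
  "edge_point N e i = (if i < color N e then ((e, False), i) else ((e, True), i - color N e))"

definition edge_arcs :: "'e spin_network \<Rightarrow> ('e \<Rightarrow> nat set set) \<Rightarrow> ('e dart \<times> nat) set set" where
  "edge_arcs N S = (\<Union>e\<in>edges N. (\<lambda>p. edge_point N e ` p) ` S e)"

text \<open>
  The vertex element \<open>\<tau>\<close> consists of the strands in \<open>vertex_arcs\<close> and of a box \<open>f\<close> at each of its
  three ends. The latter are stacked here with the box \<open>f\<close> of the edge.
\<close>

definition end_box :: "'e spin_network \<Rightarrow> 'e dart \<Rightarrow> tl" where
  "end_box N d = (if trivalent_at N d then jones_wenzl (dcolor N d) else tl_one (dcolor N d))"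

definition edge_box :: "'e spin_network \<Rightarrow> 'e \<Rightarrow> tl" where
  "edge_box N e = tl_mult (color N e) (end_box N (e, False))
     (tl_mult (color N e) (jones_wenzl (color N e)) (end_box N (e, True)))"

text \<open>
  Expanding all boxes gives a linear combination of disjoint unions of circles on the sphere. There
  are no crossings, so the Kauffman bracket replaces each circle by \<open>circle_value\<close>, and the empty
  diagram by 1.
\<close>

definition evaluation :: "'e spin_network \<Rightarrow> ratfun" where
  "evaluation N = (\<Sum>S\<in>(\<Pi>\<^sub>E e\<in>edges N. crossingless_matchings (2 * color N e)).
     (\<Prod>e\<in>edges N. edge_box N e (S e)) *
     circle_value ^ card (components (strand_points N) (vertex_arcs N \<union> edge_arcs N S)))"


subsection \<open>Gluing at trivalent vertices\<close>

definition inl_dart :: "'a dart \<Rightarrow> ('a + 'b) dart" where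
  "inl_dart = map_prod Inl id"

definition inr_dart :: "'b dart \<Rightarrow> ('a + 'b) dart" where
  "inr_dart = map_prod Inr id"

text \<open>
  The vertices at the darts \<open>a\<close> and \<open>b\<close> are removed, and the loose ends are joined. Since the discs
  around the two vertices are replaced by one annulus, the cyclic orders are matched in opposite
  directions: \<open>a\<close> is joined to \<open>b\<close>, the successor of \<open>a\<close> to the predecessor of \<open>b\<close>, and the
  predecessor of \<open>a\<close> to the successor of \<open>b\<close>. The choice of \<open>a\<close> and \<open>b\<close> at the given vertices
  accounts for the possible planar joinings.
\<close>

definition glue ::
  "'a spin_network \<Rightarrow> 'a dart \<Rightarrow> 'b spin_network \<Rightarrow> 'b dart \<Rightarrow> ('a + 'b) spin_network" where
  "glue M a N b =
     \<lparr> edges = edges M <+> edges N,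
       rot = (\<lambda>(e, s). case e of
           Inl x \<Rightarrow>
             if (x, s) = a then inr_dart b
             else if (x, s) = rot M a then inr_dart (rot N (rot N b))
             else if (x, s) = rot M (rot M a) then inr_dart (rot N b)
             else inl_dart (rot M (x, s))
         | Inr y \<Rightarrow>
             if (y, s) = b then inl_dart a
             else if (y, s) = rot N b then inl_dart (rot M (rot M a))
             else if (y, s) = rot N (rot N b) then inl_dart (rot M a)
             else inr_dart (rot N (y, s))),
       color = case_sum (color M) (color N) \<rparr>"


section \<open>Tails\<close>

text \<open>
  Rational functions in \<open>A\<close> and power series in \<open>q = A^4\<close> are both regarded as Laurent series in \<open>A\<close>.
\<close>

definition laurent_of_poly :: "rat poly \<Rightarrow> rat fls" where
  "laurent_of_poly p = fps_to_fls (fps_of_poly p)"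

definition laurent_of_ratfun :: "ratfun \<Rightarrow> rat fls" where
  "laurent_of_ratfun P =
     (THE F. \<exists>a b. b \<noteq> 0 \<and> P = Fract a b \<and> F = laurent_of_poly a / laurent_of_poly b)"

lemma laurent_of_ratfun_Fract:
  assumes "b \<noteq> 0"
  shows "laurent_of_ratfun (Fract a b) = laurent_of_poly a / laurent_of_poly b"
  unfolding laurent_of_ratfun_def
proof (rule the_equality)
  show "\<exists>a' b'. b' \<noteq> 0 \<and> Fract a b = Fract a' b' \<and>
      laurent_of_poly a / laurent_of_poly b = laurent_of_poly a' / laurent_of_poly b'"
    using assms by blast
next
  fix F
  assume "\<exists>c d. d \<noteq> 0 \<and> Fract a b = Fract c d \<and> F = laurent_of_poly c / laurent_of_poly d"
  then obtain c d where "d \<noteq> 0" "Fract a b = Fract c d"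
    and F: "F = laurent_of_poly c / laurent_of_poly d"
    by blast
  then have "a * d = c * b"
    using assms by (simp add: eq_fract)
  then have "laurent_of_poly (a * d) = laurent_of_poly (c * b)"
    by simp
  then have "laurent_of_poly a * laurent_of_poly d = laurent_of_poly c * laurent_of_poly b"
    by (simp add: laurent_of_poly_def fps_of_poly_mult fls_times_fps_to_fls)
  moreover have "laurent_of_poly b \<noteq> 0" "laurent_of_poly d \<noteq> 0"
    using assms \<open>d \<noteq> 0\<close> by (simp_all add: laurent_of_poly_def)
  ultimately show "F = laurent_of_poly a / laurent_of_poly b"
    unfolding F by (simp add: frac_eq_eq)
qed

definition laurent_of_qseries :: "rat fps \<Rightarrow> rat fls" where
  "laurent_of_qseries F = fps_to_fls (fps_compose F (fps_X ^ 4))"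

text \<open>
  Multiplication by the power \<open>q^(k/4)\<close> turns \<open>P\<close> into the power series \<open>F\<close> in \<open>q\<close>, which starts in
  degree 0. In particular \<open>P\<close> is not zero.
\<close>

definition normalizes_to :: "rat fls \<Rightarrow> rat fps \<Rightarrow> bool" where
  "normalizes_to P F \<longleftrightarrow>
     fps_nth F 0 \<noteq> 0 \<and> (\<exists>k::int. fls_X_intpow k * P = laurent_of_qseries F)"

definition doteq :: "nat \<Rightarrow> rat fls \<Rightarrow> rat fls \<Rightarrow> bool" where
  "doteq n P1 P2 \<longleftrightarrow> (\<exists>F1 F2 s. normalizes_to P1 F1 \<and> normalizes_to P2 F2 \<and> (s = 1 \<or> s = -1) \<and>
     (\<forall>i<n. fps_nth F1 i = s * fps_nth F2 i))"

definition rat_series :: "int fps \<Rightarrow> rat fps" where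
  "rat_series T = Abs_fps (\<lambda>i. of_int (fps_nth T i))"

definition is_tail :: "(nat \<Rightarrow> ratfun) \<Rightarrow> int fps \<Rightarrow> bool" where
  "is_tail P T \<longleftrightarrow>
     (\<forall>n. doteq n (laurent_of_qseries (rat_series T)) (laurent_of_ratfun (P n)))"

definition qpochhammer :: "'a::comm_ring_1 \<Rightarrow> 'a \<Rightarrow> nat \<Rightarrow> 'a" where
  "qpochhammer a q n = (\<Prod>j<n. 1 - a * q ^ j)"

end

(*
  Write f for the Jones-Wenzl idempotent on 2n strands and <Gamma> for the evaluation. Expand all
  boxes outside the distinguished vertex of Gamma_i. By planarity this leaves a linear combination
  of noncrossing matchings of the 6n strand ends at the vertex. The boxes f at the three edges
  annihilate every matching with an arc inside one edge, and the only matching without such an arc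
  is that of tau_{2n,2n,2n}. So the outside of the vertex is k_i times tau_{2n,2n,2n}, where k_i is
  a scalar. Hence <Gamma_i> = k_i theta and <[Gamma_1, Gamma_2]_1> = k_1 k_2 theta with
  theta = theta(2n,2n,2n), which gives <[Gamma_1, Gamma_2]_1> theta = <Gamma_1> <Gamma_2>.
  Up to sign and a power of q, theta is (q;q)_{3n+1} (q;q)_n^3 / ((1 - q) (q;q)_{2n}^3). It agrees
  with (q^2;q)_n below degree n, since (q;q)_m does not depend on m >= n there.

  A diagram without crossings is encoded as a fixed-point-free involution (a matching) of its end
  points, extended by the identity, and a box as an operator on functions of matchings.
*)

theory Submission
  imports Defs
begin

section \<open>Connected components\<close>

text \<open>Planarity of a network is given only by an Euler count, while the argument needs that
  closing up the outside of a vertex yields a noncrossing matching. The bridge is a pair of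
  permutations of the strand ends, the cyclic orders around the vertices and around the edges, which
  has genus zero. Genus zero survives replacing a cycle by a noncrossing matching of its points, and
  deleting a 2-cycle by capping. Together these carry it from the graph to the \<open>6 n\<close>
  ends at the vertex, where a count of cycles forces two neighbours to be joined. Boxes act on
  functions of arbitrary matchings, crossing or not. Every Temperley-Lieb relation becomes a finite
  case analysis on involutions, associativity is that of composition, and planarity is confined to
  the genus argument and to the comparison with the given diagrams. The value of theta is derived:
  Wenzl's recursion for one box gives a recursion in the number of strands between two boxes, and
  the product formula satisfies it by an identity for quantum integers.\<close>

definition conn :: "'p set set \<Rightarrow> 'p \<Rightarrow> 'p \<Rightarrow> bool" where
  "conn G x y \<longleftrightarrow> (x, y) \<in> {(x, y). {x, y} \<in> G}\<^sup>*"

lemma conn_refl [simp]: "conn G x x"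
  by (simp add: conn_def)

lemma conn_edge: "{x, y} \<in> G \<Longrightarrow> conn G x y"
  by (auto simp: conn_def)

lemma conn_trans: "conn G x y \<Longrightarrow> conn G y z \<Longrightarrow> conn G x z"
  by (auto simp: conn_def)

lemma conn_sym: "conn G x y \<Longrightarrow> conn G y x"
proof -
  have "sym {(x, y). {x, y} \<in> G}"
    by (auto simp: sym_def insert_commute)
  then show "conn G x y \<Longrightarrow> conn G y x"
    unfolding conn_def by (meson sym_rtrancl symD)
qed

lemma conn_induct [consumes 1, case_names refl step]:
  assumes "conn G x y" "P x" "\<And>y z. conn G x y \<Longrightarrow> {y, z} \<in> G \<Longrightarrow> P y \<Longrightarrow> P z"
  shows "P y"
  using assms(1) unfolding conn_def
  by (induction rule: rtrancl_induct) (use assms(2,3) in \<open>auto simp: conn_def\<close>)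

lemma conn_map:
  assumes "conn G x y" "\<And>x y. {x, y} \<in> G \<Longrightarrow> conn G' (r x) (r y)"
  shows "conn G' (r x) (r y)"
  using assms(1)
proof (induction rule: conn_induct)
  case (step y z)
  then show ?case
    using assms(2)[of y z] conn_trans[of G' "r x" "r y" "r z"] by blast
qed simp

lemma conn_mono: "conn G x y \<Longrightarrow> (\<And>x y. {x, y} \<in> G \<Longrightarrow> conn G' x y) \<Longrightarrow> conn G' x y"
  using conn_map[of G x y G' id] by simp

lemma conn_const:
  assumes "conn G x y" "\<And>x y. {x, y} \<in> G \<Longrightarrow> f x = f y"
  shows "f x = f y"
  using assms(1)
proof (induction rule: conn_induct)
  case (step y z)
  then show ?case
    using assms(2)[of y z] by simp
qed simp

definition cls :: "'p set set \<Rightarrow> 'p \<Rightarrow> 'p set" where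
  "cls G x = Collect (conn G x)"

lemma cls_eq_iff: "cls G x = cls G y \<longleftrightarrow> conn G x y"
proof
  assume "cls G x = cls G y"
  then have "y \<in> cls G x"
    by (simp add: cls_def)
  then show "conn G x y"
    by (simp add: cls_def)
qed (auto simp: cls_def intro: conn_trans conn_sym)

lemma components_cls: "components P G = cls G ` P"
  by (auto simp: components_def quotient_def cls_def conn_def)

lemma finite_components [simp]: "finite P \<Longrightarrow> finite (components P G)"
  by (simp add: components_cls)

text \<open>A function that is constant along edges induces a map from the components onto its
  image. Later, lower bounds for numbers of cycles and faces are obtained by naming such an
  invariant.\<close>

lemma card_components_ge:
  assumes "finite P" "\<And>x y. {x, y} \<in> G \<Longrightarrow> f x = f y"
  shows "card (f ` P) \<le> card (components P G)"
proof -
  have eq: "f x = the_elem (f ` cls G x)" for x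
  proof -
    have "f ` cls G x = {f x}"
      using conn_const[of G x _ f, OF _ assms(2)] by (auto simp: cls_def intro: conn_refl)
    then show ?thesis by simp
  qed
  have "f ` P = (\<lambda>C. the_elem (f ` C)) ` components P G"
    unfolding components_cls image_image by (rule image_cong[OF refl eq])
  then show ?thesis
    using card_image_le[OF finite_components[OF assms(1)], of "\<lambda>C. the_elem (f ` C)" G] by argo
qed

lemma card_components_le:
  assumes "finite P" "\<And>x y. x \<in> P \<Longrightarrow> y \<in> P \<Longrightarrow> f x = f y \<Longrightarrow> conn G x y"
  shows "card (components P G) \<le> card (f ` P)"
proof -
  have "cls G x = cls G (SOME y. y \<in> P \<and> f y = f x)" if "x \<in> P" for x
  proof -
    have "(SOME y. y \<in> P \<and> f y = f x) \<in> P \<and> f (SOME y. y \<in> P \<and> f y = f x) = f x"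
      by (rule someI[of _ x]) (use that in simp)
    then show ?thesis
      using assms(2) that by (metis cls_eq_iff)
  qed
  then have "components P G \<subseteq> (\<lambda>v. cls G (SOME y. y \<in> P \<and> f y = v)) ` f ` P"
    by (auto simp: components_cls)
  then show ?thesis
    using assms(1) by (meson card_image_le card_mono finite_imageI le_trans)
qed

lemma card_components_eq:
  assumes "finite P" "\<And>x y. {x, y} \<in> G \<Longrightarrow> f x = f y"
    "\<And>x y. x \<in> P \<Longrightarrow> y \<in> P \<Longrightarrow> f x = f y \<Longrightarrow> conn G x y"
  shows "card (components P G) = card (f ` P)"
  using card_components_ge[of P G f] card_components_le[of P f G] assms by force

lemma conn_retract:
  assumes "\<And>x y. {x, y} \<in> G \<Longrightarrow> conn G' (r x) (r y)" "\<And>x. x \<in> P \<Longrightarrow> conn G x (r x)"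
    "\<And>x y. {x, y} \<in> G' \<Longrightarrow> conn G x y" "x \<in> P" "y \<in> P"
  shows "conn G' (r x) (r y) \<longleftrightarrow> conn G x y"
proof
  assume "conn G' (r x) (r y)"
  then have "conn G (r x) (r y)"
    by (rule conn_mono) (use assms(3) in auto)
  then show "conn G x y"
    using assms(2)[of x] assms(2)[of y] assms(4,5) by (meson conn_trans conn_sym)
qed (use conn_map assms(1) in metis)

text \<open>The map \<open>r\<close> sends edges to paths and moves every point within its
  component, so it induces a bijection of components. Most contractions of diagrams below are
  instances, in which only \<open>r\<close> has to be named.\<close>

lemma card_components_retract:
  assumes "finite P" "r ` P = P'" "\<And>x y. {x, y} \<in> G \<Longrightarrow> conn G' (r x) (r y)"
    "\<And>x. x \<in> P \<Longrightarrow> conn G x (r x)" "\<And>x y. {x, y} \<in> G' \<Longrightarrow> conn G x y"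
  shows "card (components P G) = card (components P' G')"
proof -
  have "card (components P G) = card ((\<lambda>x. cls G' (r x)) ` P)"
  proof (rule card_components_eq[OF assms(1)])
    show "cls G' (r x) = cls G' (r y)" if "{x, y} \<in> G" for x y
      using that by (simp add: cls_eq_iff assms(3))
    show "conn G x y" if "x \<in> P" "y \<in> P" "cls G' (r x) = cls G' (r y)" for x y
      using that conn_retract[of G G' r P, OF assms(3-5)] by (simp add: cls_eq_iff)
  qed
  also have "(\<lambda>x. cls G' (r x)) ` P = components P' G'"
    using assms(2) by (auto simp: components_cls)
  finally show ?thesis .
qed

lemma card_components_disjoint:
  assumes "finite A" "finite B" "A \<inter> B = {}" "\<And>x y. {x, y} \<in> G \<Longrightarrow> x \<in> A \<longleftrightarrow> y \<in> A"
  shows "card (components (A \<union> B) G) = card (components A G) + card (components B G)"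
proof -
  have "components A G \<inter> components B G = {}"
    using conn_const[of G _ _ "\<lambda>x. x \<in> A"] assms(3,4) by (auto simp: components_cls cls_eq_iff)
  then show ?thesis
    using assms(1,2) by (simp add: components_cls image_Un card_Un_disjoint)
qed

lemma card_components_cong:
  assumes "finite P" "\<And>x y. {x, y} \<in> G \<Longrightarrow> conn G' x y" "\<And>x y. {x, y} \<in> G' \<Longrightarrow> conn G x y"
  shows "card (components P G) = card (components P G')"
  using card_components_retract[of P id P G G'] assms by simp

text \<open>A fixed point contributes the loop \<open>{p}\<close>, which does not affect
  connectivity. So the same graph serves for matchings and for permutations with fixed
  points.\<close>

definition gr :: "'p set \<Rightarrow> ('p \<Rightarrow> 'p) \<Rightarrow> 'p set set" where
  "gr P f = {{p, f p} | p. p \<in> P}"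

lemma gr_iff: "{u, v} \<in> gr P f \<longleftrightarrow> u \<in> P \<and> v = f u \<or> v \<in> P \<and> u = f v"
  by (auto simp: gr_def doubleton_eq_iff)

lemma conn_gr: "p \<in> P \<Longrightarrow> gr P f \<subseteq> G \<Longrightarrow> conn G p (f p)"
  by (rule conn_edge) (auto simp: gr_def)


section \<open>Matchings and hooks\<close>

definition matching :: "'p set \<Rightarrow> ('p \<Rightarrow> 'p) \<Rightarrow> bool" where
  "matching P f \<longleftrightarrow> (\<forall>x. f (f x) = x \<and> (f x \<noteq> x \<longleftrightarrow> x \<in> P))"

lemma matchingD:
  assumes "matching P f"
  shows "f (f x) = x" "x \<in> P \<Longrightarrow> f x \<noteq> x" "x \<notin> P \<Longrightarrow> f x = x" "f x = f y \<longleftrightarrow> x = y" "f x \<in> P \<longleftrightarrow> x \<in> P"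
  using assms unfolding matching_def by metis+

text \<open>The cup-cap generator applied at the ends \<open>x\<close> and \<open>y\<close>: they
  become joined, and so do their former partners. If \<open>x\<close> and \<open>y\<close> were
  already joined, the last two updates restore \<open>f\<close>; the circle that splits off in this
  case is accounted for by \<open>hook_op\<close>.\<close>

definition hook :: "'p \<Rightarrow> 'p \<Rightarrow> ('p \<Rightarrow> 'p) \<Rightarrow> 'p \<Rightarrow> 'p" where
  "hook x y f = f(x := y, y := x, f x := f y, f y := f x)"

text \<open>What is left of the diagram when \<open>x\<close> and \<open>y\<close> are closed off by
  an outer arc: the two points disappear and their partners are joined.\<close>

definition del :: "'p \<Rightarrow> 'p \<Rightarrow> ('p \<Rightarrow> 'p) \<Rightarrow> 'p \<Rightarrow> 'p" where
  "del x y f = (hook x y f)(x := x, y := y)"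

lemma hook_apply:
  assumes "matching P f" "x \<in> P" "y \<in> P" "x \<noteq> y"
  shows "hook x y f p =
    (if p = x then y else if p = y then x else if p = f x then f y else if p = f y then f x else f p)"
  using matchingD[OF assms(1)] assms(2-4) unfolding hook_def by auto metis+

lemma del_apply:
  assumes "matching P f" "x \<in> P" "y \<in> P" "x \<noteq> y"
  shows "del x y f p =
    (if p = x then x else if p = y then y else if p = f x then f y else if p = f y then f x else f p)"
  unfolding del_def using hook_apply[OF assms] by simp

lemma matching_hook:
  assumes "matching P f" "x \<in> P" "y \<in> P" "x \<noteq> y"
  shows "matching P (hook x y f)"
proof -
  note m = matchingD[OF assms(1)]
  have m': "f a = b \<longleftrightarrow> a = f b" for a b
    by (metis m(1))
  have m'': "p = f p \<Longrightarrow> p \<notin> P" for p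
    using m(2) by metis
  show ?thesis
    unfolding matching_def hook_apply[OF assms] using m(2)[of x] m(2)[of y] m(3) assms(2-4)
    by (auto simp: m(1,4,5) m' dest: m'')
qed

lemma matching_del:
  assumes "matching P f" "x \<in> P" "y \<in> P" "x \<noteq> y"
  shows "matching (P - {x, y}) (del x y f)"
proof -
  note m = matchingD[OF assms(1)]
  have m': "f a = b \<longleftrightarrow> a = f b" for a b
    by (metis m(1))
  have m'': "p = f p \<Longrightarrow> p \<notin> P" for p
    using m(2) by metis
  show ?thesis
    unfolding matching_def del_apply[OF assms] using m(2)[of x] m(2)[of y] m(3) assms(2-4)
    by (auto simp: m(1,4,5) m' dest: m'')
qed

lemma hook_commute: "x \<noteq> y \<Longrightarrow> hook x y f = hook y x f"
  by (auto simp: hook_def fun_eq_iff)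

lemma hook_id: "matching P f \<Longrightarrow> x \<in> P \<Longrightarrow> f x = y \<Longrightarrow> hook x y f = f"
  using hook_apply[of P f x y] matchingD[of P f] by (auto simp: fun_eq_iff; metis)

text \<open>The relation \<open>e_i e_(i+1) e_i = e_i\<close> for one diagram: the inner hook
  replaces the arc between \<open>x\<close> and \<open>y\<close> by an arc from \<open>x\<close> to
  the partner of \<open>z\<close>, and the outer one undoes this without closing a circle.\<close>

lemma hook_hook:
  assumes f: "matching P f" and P: "x \<in> P" "y \<in> P" "z \<in> P" "distinct [x, y, z]" and xy: "f x = y"
  shows "hook x y (hook y z f) = f" "hook y z f x \<noteq> y"
proof -
  note m = matchingD[OF f]
  have g: "matching P (hook y z f)"
    using matching_hook[OF f] P by auto
  have "hook y z f p = (if p = y then z else if p = z then y else if p = x then f z else if p = f z then x else f p)" for p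
    using hook_apply[OF f, of y z p] P xy m by auto
  then show "hook y z f x \<noteq> y" "hook x y (hook y z f) = f"
    using hook_apply[OF g, of x y] P m xy by (auto simp: fun_eq_iff; metis)+
qed

lemma hook_hook_commute:
  assumes f: "matching P f" and P: "x \<in> P" "y \<in> P" "z \<in> P" "w \<in> P" "distinct [x, y, z, w]"
  shows "hook x y (hook z w f) = hook z w (hook x y f)"
proof -
  note m = matchingD[OF f]
  have "matching P (hook z w f)" "matching P (hook x y f)"
    using matching_hook[OF f] P by auto
  then have *: "hook x y (hook z w f) p = (if p = x then y else if p = y then x
        else if p = hook z w f x then hook z w f y else if p = hook z w f y then hook z w f x else hook z w f p)"
      "hook z w (hook x y f) p = (if p = z then w else if p = w then z
        else if p = hook x y f z then hook x y f w else if p = hook x y f w then hook x y f z else hook x y f p)" for p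
    using hook_apply[of P "hook z w f" x y] hook_apply[of P "hook x y f" z w] P by auto
  have m': "f a = b \<longleftrightarrow> a = f b" for a b
    by (metis m(1))
  have ne: "f x \<noteq> x" "f y \<noteq> y" "f z \<noteq> z" "f w \<noteq> w"
    using m(2) P by auto
  have h: "hook x y f p = (if p = x then y else if p = y then x else if p = f x then f y else if p = f y then f x else f p)"
    "hook z w f p = (if p = z then w else if p = w then z else if p = f z then f w else if p = f w then f z else f p)" for p
    using hook_apply[OF f, of x y] hook_apply[OF f, of z w] P by auto
  show ?thesis
  proof
    fix p
    show "hook x y (hook z w f) p = hook z w (hook x y f) p"
      unfolding * h using ne P(5) m(1)[of p] m(1)[of x] m(1)[of y] m(1)[of z] m(1)[of w]
      unfolding distinct.simps list.set by (smt (verit) insert_iff empty_iff)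
  qed
qed

section \<open>Circles formed by two matchings with the same end points\<close>

definition circles :: "'p set \<Rightarrow> ('p \<Rightarrow> 'p) \<Rightarrow> ('p \<Rightarrow> 'p) \<Rightarrow> nat" where
  "circles P f g = card (components P (gr P f \<union> gr P g))"

lemma circles_commute: "circles P f g = circles P g f"
  by (simp add: circles_def Un_commute)

text \<open>A path that reaches \<open>x\<close> or \<open>y\<close> along \<open>h\<close> passes
  through the arc between them and leaves along \<open>h\<close> again, and \<open>del\<close>
  records this passage as one arc. If \<open>h x = y\<close>, the pair is a circle of its own. The
  arcs in \<open>K\<close> are arbitrary, so that contractions can be iterated.\<close>

lemma contract:
  assumes P: "finite P" and h: "matching P h" and x: "x \<in> P" "y \<in> P" "x \<noteq> y"
    and K: "\<And>u v. {u, v} \<in> K \<Longrightarrow> u \<in> P - {x, y} \<and> v \<in> P - {x, y}"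
  defines "G \<equiv> gr P h \<union> {{x, y}} \<union> K" and "H \<equiv> gr (P - {x, y}) (del x y h) \<union> K"
  shows "card (components P G) = (if h x = y then 1 else 0) + card (components (P - {x, y}) H)"
    and "u \<in> P - {x, y} \<Longrightarrow> v \<in> P - {x, y} \<Longrightarrow> conn G u v \<longleftrightarrow> conn H u v"
proof -
  note m = matchingD[OF h] and dl = del_apply[OF h x]
  have gG: "conn G p (h p)" if "p \<in> P" for p
    by (rule conn_gr[OF that]) (auto simp: G_def)
  have KG: "conn G p q" if "{p, q} \<in> K" for p q
    by (rule conn_edge) (simp add: G_def that)
  have KH: "conn H p q" if "{p, q} \<in> K" for p q
    by (rule conn_edge) (simp add: H_def that)
  have xy: "conn G x y"
    by (rule conn_edge) (simp add: G_def)
  have dH: "conn H p (del x y h p)" if "p \<in> P - {x, y}" for p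
    by (rule conn_gr[OF that]) (auto simp: H_def)
  have HG: "conn G p q" if "{p, q} \<in> H" for p q
  proof -
    have step: "conn G p (del x y h p)" if "p \<in> P - {x, y}" for p
    proof -
      consider "p = h x" | "p = h y" | "p \<noteq> h x" "p \<noteq> h y" by blast
      then show ?thesis
      proof cases
        case 1
        then have "conn G p (h y)"
          using gG[of x] gG[of y] xy x by (meson conn_sym conn_trans)
        then show ?thesis using 1 dl[of p] that by auto
      next
        case 2
        then have "conn G p (h x)"
          using gG[of x] gG[of y] xy x by (meson conn_sym conn_trans)
        then show ?thesis using 2 dl[of p] that m by auto
      next
        case 3
        then show ?thesis using dl[of p] that gG[of p] by auto
      qed
    qed
    show ?thesis
      using that step KG conn_sym unfolding H_def gr_iff Un_iff by metis
  qed
  show "card (components P G) = (if h x = y then 1 else 0) + card (components (P - {x, y}) H)"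
    "u \<in> P - {x, y} \<Longrightarrow> v \<in> P - {x, y} \<Longrightarrow> conn G u v \<longleftrightarrow> conn H u v"
  proof -
    \<comment> \<open>Both points move to \<open>h x\<close>, since they lie in one component with
      it. If they form a circle there is no such point outside, and both go to
      \<open>x\<close>.\<close>
    define r where "r p = (if p = x \<or> p = y then (if h x = y then x else h x) else p)" for p
    have Gr: "conn H (r p) (r q)" if "{p, q} \<in> G" for p q
    proof -
      have step: "conn H (r p) (r (h p))" if "p \<in> P" for p
      proof (cases "h x = y")
        case True
        then show ?thesis
          using that dH[of p] dl[of p] m unfolding r_def by (smt (verit) Diff_iff conn_refl empty_iff insert_iff)
      next
        case False
        consider "p = x" | "p = y" | "p = h x" | "p = h y" | "p \<noteq> x" "p \<noteq> y" "p \<noteq> h x" "p \<noteq> h y" by blast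
        then show ?thesis
        proof cases
          case 1
          then show ?thesis using False m by (simp add: r_def)
        next
          case 2
          then show ?thesis using False m dH[of "h x"] dl[of "h x"] x by (auto simp: r_def)
        next
          case 3
          then show ?thesis using False m by (simp add: r_def)
        next
          case 4
          then have "h y \<in> P - {x, y}"
            using False m x by (metis Diff_iff empty_iff insert_iff)
          then show ?thesis using False m dH[of "h x"] dl[of "h x"] x 4 conn_sym[of H "h x" "h y"] by (auto simp: r_def)
        next
          case 5
          moreover have "h p \<noteq> x" "h p \<noteq> y"
            using 5 m(1)[of p] by auto
          ultimately show ?thesis using dH[of p] dl[of p] that by (auto simp: r_def)
        qed
      qed
      have "conn H (r p) (r q)" if "{p, q} \<in> K"
        using K[OF that] KH[OF that] by (auto simp: r_def)
      moreover have "r x = r y" by (simp add: r_def)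
      ultimately show ?thesis
        using that step conn_sym unfolding G_def gr_iff Un_iff
        by (metis conn_refl doubleton_eq_iff singletonD)
    qed
    have rG: "conn G p (r p)" if "p \<in> P" for p
      using gG[OF x(1)] conn_sym[OF xy] conn_trans[OF conn_sym[OF xy] gG[OF x(1)]] by (auto simp: r_def)
    show "conn G u v \<longleftrightarrow> conn H u v" if "u \<in> P - {x, y}" "v \<in> P - {x, y}"
    proof -
      have "r u = u" "r v = v"
        using that by (auto simp: r_def)
      then show ?thesis
        using conn_retract[of G H r P u v] Gr rG HG that by auto
    qed
    show "card (components P G) = (if h x = y then 1 else 0) + card (components (P - {x, y}) H)"
    proof (cases "h x = y")
      case False
      have "r ` P = P - {x, y}"
      proof
        show "r ` P \<subseteq> P - {x, y}"
          using False m x by (auto simp: r_def)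
        show "P - {x, y} \<subseteq> r ` P"
          by (auto simp: r_def image_iff)
      qed
      then show ?thesis
        using card_components_retract[of P r "P - {x, y}" G H] P Gr rG HG False by simp
    next
      case True
      have side: "p \<in> {x, y} \<longleftrightarrow> q \<in> {x, y}" if "{p, q} \<in> G" for p q
        using that True K m x unfolding G_def gr_iff Un_iff
        by (metis Diff_iff doubleton_eq_iff insert_iff singletonD)
      have "card (components ({x, y} \<union> (P - {x, y})) G) =
          card (components {x, y} G) + card (components (P - {x, y}) G)"
        by (rule card_components_disjoint) (use P side in auto)
      moreover have "{x, y} \<union> (P - {x, y}) = P" using x by auto
      moreover have "components {x, y} G = {cls G x}"
        using xy by (auto simp: components_cls cls_eq_iff intro: conn_sym)
      moreover have "card (components (P - {x, y}) G) = card (components (P - {x, y}) H)"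
      proof (rule card_components_retract)
        show "r ` (P - {x, y}) = P - {x, y}"
          by (auto simp: r_def image_iff)
      qed (use P Gr rG HG in auto)
      ultimately show ?thesis using True by simp
    qed
  qed
qed

lemma circles_arc:
  assumes P: "finite P" and h: "matching P h" and g: "matching P g" and x: "x \<in> P" "g x = y"
  shows "circles P h g = (if h x = y then 1 else 0) + circles (P - {x, y}) (del x y h) (del x y g)"
proof -
  note m = matchingD[OF g]
  have y: "y \<in> P" "x \<noteq> y" "g y = x" using m(1)[of x] m(2)[of x] m(5)[of x] x by auto
  have "gr P g = {{x, y}} \<union> gr (P - {x, y}) (del x y g)"
  proof -
    have "P = {x, y} \<union> (P - {x, y})" using x y by auto
    then have "gr P g = (\<lambda>p. {p, g p}) ` {x, y} \<union> (\<lambda>p. {p, g p}) ` (P - {x, y})"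
      unfolding gr_def by blast
    also have "(\<lambda>p. {p, g p}) ` {x, y} = {{x, y}}" using x y by auto
    also have "(\<lambda>p. {p, g p}) ` (P - {x, y}) = (\<lambda>p. {p, del x y g p}) ` (P - {x, y})"
      by (rule image_cong) (use x y del_apply[OF g x(1) y(1,2)] in auto)
    finally show ?thesis by (auto simp: gr_def)
  qed
  moreover have "matching (P - {x, y}) (del x y g)"
    using matching_del[OF g] x y by auto
  moreover have "card (components P (gr P h \<union> {{x, y}} \<union> gr (P - {x, y}) (del x y g))) = (if h x = y then 1 else 0) +
      card (components (P - {x, y}) (gr (P - {x, y}) (del x y h) \<union> gr (P - {x, y}) (del x y g)))"
  proof (rule contract(1)[OF P h x(1) y(1,2)])
    fix u v assume "{u, v} \<in> gr (P - {x, y}) (del x y g)"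
    then show "u \<in> P - {x, y} \<and> v \<in> P - {x, y}"
      using matchingD(5)[OF calculation(2)] unfolding gr_iff by metis
  qed
  ultimately show ?thesis
    unfolding circles_def by (simp only: Un_assoc)
qed

lemma del_hook: 
  assumes "matching P f" "x \<in> P" "y \<in> P" "x \<noteq> y"
  shows "del x y (hook x y f) = del x y f"
  using hook_id[OF matching_hook[OF assms], of x y] hook_apply[OF assms, of x] assms
  by (simp add: del_def)

text \<open>Contracting the arc that the hook creates between \<open>x\<close> and \<open>y\<close>
  turns either count into that of \<open>del x y h\<close> against \<open>del x y g\<close>. This is
  the self-adjointness of the generators, with the circle that a hook splits off on its own side
  taken into account.\<close>

lemma circles_hook:
  assumes P: "finite P" and h: "matching P h" and g: "matching P g" and x: "x \<in> P" "y \<in> P" "x \<noteq> y"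
  shows "(if h x = y then 1 else 0) + circles P (hook x y h) g = (if g x = y then 1 else 0) + circles P h (hook x y g)"
proof -
  have "hook x y h x = y" "hook x y g x = y"
    using hook_apply[OF h x] hook_apply[OF g x] by auto
  then show ?thesis
    using circles_arc[OF P h matching_hook[OF g x], of x y] circles_arc[OF P g matching_hook[OF h x], of x y] x
    by (simp add: circles_commute del_hook[OF h x] del_hook[OF g x])
qed

section \<open>Operators on functions of diagrams\<close>

text \<open>Finite support makes a functional linear and lets two functionals be interchanged,
  although the functions live on an infinite type of maps.\<close>

definition fcomb :: "(('f \<Rightarrow> ratfun) \<Rightarrow> ratfun) \<Rightarrow> bool" where
  "fcomb L \<longleftrightarrow> (\<exists>A c. finite A \<and> (\<forall>\<Phi>. L \<Phi> = (\<Sum>h\<in>A. c h * \<Phi> h)))"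

lemma fcomb_eval: "fcomb (\<lambda>\<Phi>. \<Phi> f)"
  unfolding fcomb_def by (rule exI[of _ "{f}"], rule exI[of _ "\<lambda>_. 1"]) simp

lemma fcomb_zero: "fcomb (\<lambda>\<Phi>. 0)"
  unfolding fcomb_def by (rule exI[of _ "{}"]) simp

lemma fcomb_mult:
  assumes "fcomb L"
  shows "fcomb (\<lambda>\<Phi>. a * L \<Phi>)"
proof -
  obtain A c where "finite A" "\<And>\<Phi>. L \<Phi> = (\<Sum>h\<in>A. c h * \<Phi> h)"
    using assms unfolding fcomb_def by blast
  then show ?thesis
    unfolding fcomb_def
    by (intro exI[of _ A] exI[of _ "\<lambda>h. a * c h"]) (simp add: sum_distrib_left mult.assoc)
qed

lemma fcomb_add:
  assumes "fcomb L" "fcomb M"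
  shows "fcomb (\<lambda>\<Phi>. L \<Phi> + M \<Phi>)"
proof -
  obtain A c where A: "finite A" "\<And>\<Phi>. L \<Phi> = (\<Sum>h\<in>A. c h * \<Phi> h)"
    using assms(1) unfolding fcomb_def by blast
  obtain B b where B: "finite B" "\<And>\<Phi>. M \<Phi> = (\<Sum>h\<in>B. b h * \<Phi> h)"
    using assms(2) unfolding fcomb_def by blast
  have "L \<Phi> + M \<Phi> = (\<Sum>h\<in>A \<union> B. ((if h \<in> A then c h else 0) + (if h \<in> B then b h else 0)) * \<Phi> h)" for \<Phi>
  proof -
    have "(\<Sum>h\<in>A. c h * \<Phi> h) = (\<Sum>h\<in>A \<union> B. (if h \<in> A then c h else 0) * \<Phi> h)"
      by (rule sum.mono_neutral_cong_left) (use A B in auto)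
    moreover have "(\<Sum>h\<in>B. b h * \<Phi> h) = (\<Sum>h\<in>A \<union> B. (if h \<in> B then b h else 0) * \<Phi> h)"
      by (rule sum.mono_neutral_cong_left) (use A B in auto)
    ultimately show ?thesis
      by (simp add: A B sum.distrib distrib_right)
  qed
  then show ?thesis
    unfolding fcomb_def using A(1) B(1)
    by (intro exI[of _ "A \<union> B"] exI[of _ "\<lambda>h. (if h \<in> A then c h else 0) + (if h \<in> B then b h else 0)"]) auto
qed

lemma fcomb_sum:
  assumes "\<And>i. i \<in> I \<Longrightarrow> fcomb (L i)"
  shows "fcomb (\<lambda>\<Phi>. \<Sum>i\<in>I. L i \<Phi>)"
proof (cases "finite I")
  case True
  then show ?thesis
    using assms by (induction I) (simp_all add: fcomb_zero fcomb_add)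
qed (simp add: fcomb_zero)

lemma fcomb_comp:
  assumes "fcomb L" "\<And>h. fcomb (\<lambda>\<Phi>. T \<Phi> h)"
  shows "fcomb (\<lambda>\<Phi>. L (T \<Phi>))"
proof -
  obtain A c where A: "finite A" "\<And>\<Phi>. L \<Phi> = (\<Sum>h\<in>A. c h * \<Phi> h)"
    using assms(1) unfolding fcomb_def by blast
  show ?thesis
    unfolding A(2) by (intro fcomb_sum fcomb_mult assms(2))
qed

lemma fcomb_linear:
  assumes "fcomb L"
  shows "L (\<lambda>h. \<Phi> h + \<Psi> h) = L \<Phi> + L \<Psi>" "L (\<lambda>h. a * \<Phi> h) = a * L \<Phi>"
    "L (\<lambda>h. \<Phi> h - a * \<Psi> h) = L \<Phi> - a * L \<Psi>" "L (\<lambda>h. 0) = 0"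
proof -
  obtain A c where "finite A" "\<And>\<Phi>. L \<Phi> = (\<Sum>h\<in>A. c h * \<Phi> h)"
    using assms unfolding fcomb_def by blast
  then show "L (\<lambda>h. \<Phi> h + \<Psi> h) = L \<Phi> + L \<Psi>" "L (\<lambda>h. a * \<Phi> h) = a * L \<Phi>"
    "L (\<lambda>h. \<Phi> h - a * \<Psi> h) = L \<Phi> - a * L \<Psi>" "L (\<lambda>h. 0) = 0"
    by (simp_all add: algebra_simps sum.distrib sum_distrib_left sum_subtractf)
qed

lemma fcomb_sum_arg:
  assumes "fcomb L"
  shows "L (\<lambda>h. \<Sum>i\<in>I. a i * \<Phi> i h) = (\<Sum>i\<in>I. a i * L (\<Phi> i))"
proof (cases "finite I")
  case True
  then show ?thesis
    by (induction I) (simp_all add: fcomb_linear[OF assms])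
qed (simp add: fcomb_linear[OF assms])

lemma fcomb_swap:
  assumes "fcomb L" "fcomb M"
  shows "L (\<lambda>f. M (\<lambda>g. K f g)) = M (\<lambda>g. L (\<lambda>f. K f g))"
proof -
  obtain A c where A: "finite A" "\<And>\<Phi>. L \<Phi> = (\<Sum>h\<in>A. c h * \<Phi> h)"
    using assms(1) unfolding fcomb_def by blast
  show ?thesis
    unfolding A(2) using fcomb_sum_arg[OF assms(2), of c "\<lambda>f. K f" A] by simp
qed

type_synonym 'f operator = "('f \<Rightarrow> ratfun) \<Rightarrow> 'f \<Rightarrow> ratfun"

definition linear_op :: "'f operator \<Rightarrow> bool" where
  "linear_op T \<longleftrightarrow> (\<forall>f. fcomb (\<lambda>\<Phi>. T \<Phi> f))"

lemma linear_opD: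
  assumes "linear_op T"
  shows "T (\<lambda>h. \<Phi> h + \<Psi> h) = (\<lambda>f. T \<Phi> f + T \<Psi> f)" "T (\<lambda>h. a * \<Phi> h) = (\<lambda>f. a * T \<Phi> f)"
    "T (\<lambda>h. \<Phi> h - a * \<Psi> h) = (\<lambda>f. T \<Phi> f - a * T \<Psi> f)" "T (\<lambda>h. 0) = (\<lambda>f. 0)"
  using fcomb_linear[of "\<lambda>\<Phi>. T \<Phi> f" for f] assms unfolding linear_op_def by (auto simp: fun_eq_iff)

lemma fcomb_op: "linear_op T \<Longrightarrow> fcomb (\<lambda>\<Phi>. T \<Phi> f)"
  by (simp add: linear_op_def)

lemma linear_op_comp: "linear_op S \<Longrightarrow> linear_op T \<Longrightarrow> linear_op (\<lambda>\<Phi>. S (T \<Phi>))"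
  unfolding linear_op_def using fcomb_comp by blast

lemma linear_op_id: "linear_op (\<lambda>\<Phi>. \<Phi>)"
  by (simp add: linear_op_def fcomb_eval)

lemma linear_op_diff:
  assumes "linear_op S" "linear_op T"
  shows "linear_op (\<lambda>\<Phi> f. S \<Phi> f - a * T \<Phi> f)"
  using fcomb_add[OF fcomb_op[OF assms(1)] fcomb_mult[OF fcomb_op[OF assms(2)], of "- a"]]
  by (simp add: linear_op_def)


subsection \<open>Quantum integers\<close>

lemma varA_power: "varA ^ k = Fract (monom 1 k) 1"
  by (induction k) (simp_all add: varA_def One_fract_def monom_Suc monom_0 one_pCons[symmetric])

lemma varA_power_neq_1: "k > 0 \<Longrightarrow> varA ^ k \<noteq> 1"
  by (auto simp: varA_power One_fract_def eq_fract monom_eq_1_iff)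

lemma varA_nonzero [simp]: "varA \<noteq> 0"
  by (simp add: varA_def Zero_fract_def eq_fract)

lemma circle_value_eq: "circle_value = - (varA ^ 2 + inverse (varA ^ 2))"
  by (simp add: circle_value_def power_int_def power_inverse)

lemma circle_poly_eq:
  "circle_poly n = (-1) ^ n * ((varA ^ 2) ^ (n + 1) - inverse ((varA ^ 2) ^ (n + 1))) / (varA ^ 2 - inverse (varA ^ 2))"
proof -
  have "varA powi (2 * (int n + 1)) = (varA ^ 2) ^ (n + 1)"
  proof -
    have "2 * (int n + 1) = int (2 * (n + 1))" by simp
    then show ?thesis
      by (simp only: power_int_of_nat power_mult)
  qed
  moreover have "varA powi (- 2 * (int n + 1)) = inverse (varA powi (2 * (int n + 1)))"
    by (simp flip: power_int_minus)
  moreover have "varA powi 2 = varA ^ 2" "varA powi (- 2) = inverse (varA ^ 2)"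
    by (simp_all add: power_int_def power_inverse)
  ultimately show ?thesis
    unfolding circle_poly_def by metis
qed

text \<open>\<open>varA\<close> is an indeterminate and hence not a root of unity, so no quantum
  integer vanishes.\<close>

lemma varA_diff_nonzero: "(varA ^ 2) ^ (n + 1) - inverse ((varA ^ 2) ^ (n + 1)) \<noteq> 0"
proof
  assume "(varA ^ 2) ^ (n + 1) - inverse ((varA ^ 2) ^ (n + 1)) = 0"
  then have "(varA ^ 2) ^ (n + 1) * (varA ^ 2) ^ (n + 1) = 1"
    by (simp add: field_simps)
  then have "varA ^ (4 * (n + 1)) = 1"
    by (metis power_add power_mult mult_2 numeral_Bit0 distrib_right)
  then show False
    using varA_power_neq_1[of "4 * (n + 1)"] by simp
qed

lemma circle_poly_nonzero [simp]: "circle_poly n \<noteq> 0"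
  using varA_diff_nonzero[of n] varA_diff_nonzero[of 0] by (simp add: circle_poly_eq)

lemma circle_poly_0 [simp]: "circle_poly 0 = 1"
  using varA_diff_nonzero[of 0] by (simp add: circle_poly_eq)

text \<open>The Chebyshev recursion: \<open>circle_poly n\<close> is \<open>(-1) ^ n\<close> times
  the quantum integer \<open>[n + 1]\<close>.\<close>

lemma circle_poly_Suc_Suc: "circle_value * circle_poly (Suc n) = circle_poly (Suc (Suc n)) + circle_poly n"
proof -
  define a where "a = varA ^ 2"
  have a: "a \<noteq> 0" "a - inverse a \<noteq> 0"
    using varA_diff_nonzero[of 0] by (simp_all add: a_def)
  have *: "- (a + inverse a) * ((-1) ^ Suc n * (a ^ (n + 2) - inverse a ^ (n + 2))) =
      (-1) ^ Suc (Suc n) * (a ^ (n + 3) - inverse a ^ (n + 3)) + (-1) ^ n * (a ^ (n + 1) - inverse a ^ (n + 1))"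
  proof -
    have "a * inverse a ^ (n + 2) = inverse a ^ (n + 1)" "inverse a * a ^ (n + 2) = a ^ (n + 1)"
      "a * a ^ (n + 2) = a ^ (n + 3)" "inverse a * inverse a ^ (n + 2) = inverse a ^ (n + 3)"
      using a by (simp_all add: numeral_3_eq_3)
    then have "(a + inverse a) * (a ^ (n + 2) - inverse a ^ (n + 2)) =
        (a ^ (n + 3) - inverse a ^ (n + 3)) + (a ^ (n + 1) - inverse a ^ (n + 1))"
      unfolding distrib_right right_diff_distrib by (simp only: diff_conv_add_uminus minus_add_distrib minus_minus ac_simps)
    then have "(-1) ^ n * ((a + inverse a) * (a ^ (n + 2) - inverse a ^ (n + 2))) =
        (-1) ^ n * ((a ^ (n + 3) - inverse a ^ (n + 3)) + (a ^ (n + 1) - inverse a ^ (n + 1)))"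
      by (simp only:)
    then show ?thesis
      unfolding power_Suc distrib_left by (simp only: mult_minus_left mult_minus_right minus_minus mult_1_left mult.left_commute[of _ "(-1) ^ n"])
  qed
  show ?thesis
    unfolding circle_value_eq circle_poly_eq a_def[symmetric]
    using arg_cong[OF *, of "\<lambda>t. t / (a - inverse a)"]
    by (simp add: add_divide_distrib power_inverse numeral_3_eq_3 del: power_Suc)
qed

lemma circle_poly_1: "circle_poly (Suc 0) = circle_value"
proof -
  define a where "a = varA ^ 2"
  have a: "a \<noteq> 0" "a - inverse a \<noteq> 0"
    using varA_diff_nonzero[of 0] by (simp_all add: a_def)
  have "a ^ 2 - inverse (a ^ 2) = (a + inverse a) * (a - inverse a)"
    by (simp add: algebra_simps power2_eq_square)
  then show ?thesis
    using a unfolding circle_value_eq circle_poly_eq a_def[symmetric] by (simp add: numeral_2_eq_2)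
qed

lemma circle_value_nonzero [simp]: "circle_value \<noteq> 0"
  using circle_poly_nonzero[of 1] by (simp add: circle_poly_1)


subsection \<open>Jones--Wenzl operators\<close>

definition wenzl :: "nat \<Rightarrow> ratfun" where
  "wenzl m = circle_poly m / circle_poly (Suc m)"

lemma wenzl_nonzero [simp]: "wenzl m \<noteq> 0"
  by (simp add: wenzl_def)

lemma wenzl_0: "inverse (wenzl 0) = circle_value"
  by (simp add: wenzl_def circle_poly_1)

lemma wenzl_Suc: "circle_value - wenzl m = inverse (wenzl (Suc m))"
  using circle_poly_Suc_Suc[of m] by (simp add: wenzl_def field_simps)

text \<open>Wenzl's recursion with abstract generators in place of diagrams. One recursion then
  serves for the given idempotents, for the strands of an edge and for the ends at a vertex, and its
  properties follow from the relations alone.\<close>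

fun jw :: "(nat \<Rightarrow> 'f operator) \<Rightarrow> nat \<Rightarrow> 'f operator" where
  "jw e 0 \<Phi> = \<Phi>"
| "jw e (Suc 0) \<Phi> = \<Phi>"
| "jw e (Suc (Suc m)) \<Phi> =
     (\<lambda>f. jw e (Suc m) \<Phi> f - wenzl m * jw e (Suc m) (e m (jw e (Suc m) \<Phi>)) f)"

lemma linear_op_jw: "(\<And>i. Suc i < m \<Longrightarrow> linear_op (e i)) \<Longrightarrow> linear_op (jw e m)"
proof (induction m rule: less_induct)
  case (less m)
  show ?case
  proof (cases "m \<le> 1")
    case True
    then consider "m = 0" | "m = Suc 0" by linarith
    then show ?thesis by cases (auto simp: linear_op_def fcomb_eval)
  next
    case False
    then obtain m' where m: "m = Suc (Suc m')" by (metis One_nat_def not_less_eq_eq old.nat.exhaust zero_le)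
    have l: "linear_op (jw e (Suc m'))" "linear_op (e m')"
      using less m by auto
    have "linear_op (\<lambda>\<Phi> f. jw e (Suc m') \<Phi> f - wenzl m' * jw e (Suc m') (e m' (jw e (Suc m') \<Phi>)) f)"
      by (intro linear_op_diff l linear_op_comp[OF l(1), of "\<lambda>\<Phi>. e m' (jw e (Suc m') \<Phi>)"] linear_op_comp[OF l(2) l(1)])
    then show ?thesis by (simp add: m linear_op_def)
  qed
qed

lemma jw_commute:
  assumes "linear_op T" "\<And>i \<Phi>. Suc i < m \<Longrightarrow> T (e i \<Phi>) = e i (T \<Phi>)"
  shows "T (jw e m \<Phi>) = jw e m (T \<Phi>)"
  using assms(2)
proof (induction e m \<Phi> rule: jw.induct)
  case (3 e m \<Phi>)
  then show ?case
    by (simp add: linear_opD[OF assms(1)])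
qed simp_all

text \<open>Up to terms containing a generator the box is the identity. In the recursion the
  outermost factor of such a term is a smaller box, which the induction hypothesis removes, so that
  the functional meets the generator.\<close>

lemma jw_absorb:
  assumes "fcomb L" "\<And>i \<Phi>. Suc i < m \<Longrightarrow> L (e i \<Phi>) = 0"
  shows "L (jw e m \<Phi>) = L \<Phi>"
  using assms(2)
proof (induction e m \<Phi> rule: jw.induct)
  case (3 e m \<Phi>)
  then show ?case
    by (simp add: fcomb_linear[OF assms(1)])
qed simp_all

lemma jw_fixed:
  assumes "\<And>i. Suc i < m \<Longrightarrow> linear_op (e i)" "\<And>i. Suc i < m \<Longrightarrow> e i \<Phi> = (\<lambda>_. 0)"
  shows "jw e m \<Phi> = \<Phi>"
  using assms
proof (induction e m \<Phi> rule: jw.induct)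
  case (3 e m \<Phi>)
  have "linear_op (jw e (Suc m))"
    by (rule linear_op_jw) (use 3 in auto)
  then show ?case
    using 3 by (simp add: linear_opD)
qed simp_all

lemma jw_cong:
  fixes e e' :: "nat \<Rightarrow> 'f operator"
  shows "(\<And>i. Suc i < m \<Longrightarrow> e i = e' i) \<Longrightarrow> jw e m = jw e' m"
proof (induction m rule: less_induct)
  case (less m)
  show ?case
  proof (cases "m \<le> 1")
    case True
    then consider "m = 0" | "m = Suc 0" by linarith
    then show ?thesis by cases (auto simp: fun_eq_iff)
  next
    case False
    then obtain m' where m: "m = Suc (Suc m')" by (metis One_nat_def not_less_eq_eq old.nat.exhaust zero_le)
    have "jw e (Suc m') = jw e' (Suc m')" "e m' = e' m'"
      using less m by auto
    then show ?thesis by (intro ext) (simp add: m)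
  qed
qed

lemma jw_intertwine:
  assumes "\<And>i \<Phi>. Suc i < m \<Longrightarrow> T (e i \<Phi>) = e' i (T \<Phi>)"
    "\<And>\<Phi> \<Psi> a. T (\<lambda>f. \<Phi> f - a * \<Psi> f) = (\<lambda>f. T \<Phi> f - a * T \<Psi> f)"
  shows "T (jw e m \<Phi>) = jw e' m (T \<Phi>)"
  using assms(1)
proof (induction e m \<Phi> rule: jw.induct)
  case (3 e m \<Phi>)
  then show ?case
    by (simp add: assms(2))
qed simp_all

text \<open>\<open>e i\<close> acts on the strands \<open>i\<close> and \<open>i + 1\<close> of \<open>k\<close> strands.\<close>

locale temperley_lieb =
  fixes e :: "nat \<Rightarrow> 'f operator" and k :: nat
  assumes linear: "Suc i < k \<Longrightarrow> linear_op (e i)"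
    and square: "Suc i < k \<Longrightarrow> e i (e i \<Phi>) = (\<lambda>f. circle_value * e i \<Phi> f)"
    and braid: "Suc (Suc i) < k \<Longrightarrow> e i (e (Suc i) (e i \<Phi>)) = e i \<Phi>"
      "Suc (Suc i) < k \<Longrightarrow> e (Suc i) (e i (e (Suc i) \<Phi>)) = e (Suc i) \<Phi>"
    and far: "Suc i < j \<Longrightarrow> Suc j < k \<Longrightarrow> e i (e j \<Phi>) = e j (e i \<Phi>)"
begin

lemma lin_jw: "m \<le> k \<Longrightarrow> linear_op (jw e m)"
  by (rule linear_op_jw) (auto intro: linear)

lemma jw_far: "m \<le> j \<Longrightarrow> Suc j < k \<Longrightarrow> e j (jw e m \<Phi>) = jw e m (e j \<Phi>)"
  by (rule jw_commute) (auto intro: linear far[symmetric])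

text \<open>Both claims need each other. On \<open>m + 2\<close> strands \<open>e m\<close> is
  killed because the partial trace on \<open>m + 1\<close> strands produces exactly the inverse of
  the Wenzl coefficient; the partial trace on \<open>m + 2\<close> strands uses idempotence on
  \<open>m + 1\<close> strands, which follows from killing.\<close>

lemma jw_kills_aux:
  "Suc m \<le> k \<Longrightarrow> (\<forall>i<m. \<forall>\<Phi>. e i (jw e (Suc m) \<Phi>) = (\<lambda>_. 0) \<and> jw e (Suc m) (e i \<Phi>) = (\<lambda>_. 0)) \<and>
     (Suc m < k \<longrightarrow> (\<forall>\<Phi>. e m (jw e (Suc m) (e m \<Phi>)) =
        (\<lambda>f. inverse (wenzl m) * jw e m (e m \<Phi>) f)))"
proof (induction m)
  case 0
  then show ?case
    by (simp add: square wenzl_0)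
next
  case (Suc m)
  let ?J = "jw e (Suc m)"
  let ?mu = "wenzl m"
  have kill: "e i (?J \<Phi>) = (\<lambda>_. 0)" "?J (e i \<Phi>) = (\<lambda>_. 0)" if "i < m" for i \<Phi>
    using Suc that by auto
  have tr: "e m (?J (e m \<Phi>)) = (\<lambda>f. inverse (wenzl m) * jw e m (e m \<Phi>) f)" for \<Phi>
    using Suc by auto
  have lJ: "linear_op ?J" "linear_op (jw e m)" using Suc.prems by (auto intro: lin_jw)
  have le: "linear_op (e i)" if "i \<le> m" for i using Suc.prems that by (auto intro: linear)
  have JJ: "?J (?J \<Phi>) = ?J \<Phi>" for \<Phi>
    by (rule jw_fixed) (use kill Suc.prems in \<open>auto intro: linear\<close>)
  have jJ: "jw e m (?J \<Phi>) = ?J \<Phi>" for \<Phi>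
    by (rule jw_fixed) (use kill Suc.prems in \<open>auto intro: linear\<close>)
  have Jj: "?J (jw e m \<Phi>) = ?J \<Phi>" for \<Phi>
  proof
    fix f
    show "?J (jw e m \<Phi>) f = ?J \<Phi> f"
      by (rule jw_absorb[of "\<lambda>\<Phi>. ?J \<Phi> f"]) (use lJ kill in \<open>auto simp: linear_op_def\<close>)
  qed
  have "e i (jw e (Suc (Suc m)) \<Phi>) = (\<lambda>_. 0) \<and> jw e (Suc (Suc m)) (e i \<Phi>) = (\<lambda>_. 0)"
    if "i < Suc m" for i \<Phi>
  proof (cases "i = m")
    case True
    have "e m (jw e m (?J \<Phi>)) = jw e m (e m (?J \<Phi>))"
      using Suc.prems by (intro jw_far) auto
    then have 1: "jw e m (e m (?J \<Phi>)) = e m (?J \<Phi>)"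
      by (simp add: jJ)
    show ?thesis
      unfolding True jw.simps linear_opD(3)[OF le[OF order_refl]] tr 1
      by (simp add: linear_opD[OF lJ(1)] Jj flip: mult.assoc)
  next
    case False
    then have "i < m" using that by simp
    then show ?thesis
      using le[of i] by (simp add: linear_opD kill linear_opD[OF lJ(1)] linear_opD[OF le[of m]])
  qed
  moreover have "e (Suc m) (jw e (Suc (Suc m)) (e (Suc m) \<Phi>)) =
      (\<lambda>f. inverse (wenzl (Suc m)) * ?J (e (Suc m) \<Phi>) f)"
    if k: "Suc (Suc m) < k" for \<Phi>
  proof -
    let ?e = "e (Suc m)"
    have l: "linear_op ?e" using k by (auto intro: linear)
    have c: "?e (?J \<Psi>) = ?J (?e \<Psi>)" for \<Psi>
      using k by (intro jw_far) auto
    \<comment> \<open>\<open>?e\<close> commutes with both boxes, so the braid relation applies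
      between them, and a product of two equal boxes is left.\<close>
    have 2: "?e (?J (e m (?J (?e \<Phi>)))) = ?J (?e \<Phi>)"
    proof -
      have "?e (?J (e m (?J (?e \<Phi>)))) = ?J (?e (e m (?e (?J \<Phi>))))"
        by (simp add: c)
      also have "\<dots> = ?J (?J (?e \<Phi>))"
        using braid(2)[OF k, of "?J \<Phi>"] by (simp add: c)
      finally show ?thesis by (simp add: JJ)
    qed
    \<comment> \<open>The closed strand contributes \<open>circle_value\<close> and the correction
      term \<open>?mu\<close>; by the Chebyshev recursion the difference is the next ratio.\<close>
    have "circle_value - ?mu = inverse (wenzl (Suc m))"
      by (rule wenzl_Suc)
    then have 3: "circle_value * x - ?mu * x = inverse (wenzl (Suc m)) * x" for x
      by (metis left_diff_distrib)
    have 4: "?e (?J (?e \<Phi>)) = (\<lambda>f. circle_value * ?J (?e \<Phi>) f)"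
      unfolding c square[OF k] linear_opD(2)[OF lJ(1)] ..
    show ?thesis
      unfolding jw.simps linear_opD(3)[OF l] 2 4 3 ..
  qed
  ultimately show ?case by blast
qed

lemma jw_kills:
  assumes "Suc i < m" "m \<le> k"
  shows "e i (jw e m \<Phi>) = (\<lambda>_. 0)" "jw e m (e i \<Phi>) = (\<lambda>_. 0)"
proof -
  obtain m' where "m = Suc m'" using assms by (cases m) auto
  then show "e i (jw e m \<Phi>) = (\<lambda>_. 0)" "jw e m (e i \<Phi>) = (\<lambda>_. 0)"
    using jw_kills_aux[of m'] assms by auto
qed

lemma jw_trace:
  "Suc m < k \<Longrightarrow> e m (jw e (Suc m) (e m \<Phi>)) = (\<lambda>f. inverse (wenzl m) * jw e m (e m \<Phi>) f)"
  using jw_kills_aux[of m] by auto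

lemma jw_jw_right: "j \<le> m \<Longrightarrow> m \<le> k \<Longrightarrow> jw e j (jw e m \<Phi>) = jw e m \<Phi>"
  by (rule jw_fixed) (auto intro: linear jw_kills)

end


subsection \<open>Hook operators\<close>

text \<open>The value 0 outside the matchings makes the Temperley-Lieb relations equations between
  functions, without a side condition on the argument.\<close>

definition hook_op :: "'p set \<Rightarrow> 'p \<Rightarrow> 'p \<Rightarrow> ('p \<Rightarrow> 'p) operator" where
  "hook_op P x y \<Phi> f =
     (if matching P f then (if f x = y then circle_value else 1) * \<Phi> (hook x y f) else 0)"

lemma linear_op_hook_op: "linear_op (hook_op P x y)"
  unfolding linear_op_def
proof
  fix f
  show "fcomb (\<lambda>\<Phi>. hook_op P x y \<Phi> f)"
    unfolding hook_op_def
    by (cases "matching P f") (simp_all only: if_True if_False fcomb_mult fcomb_eval fcomb_zero)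
qed

lemma hook_op_commute: "x \<noteq> y \<Longrightarrow> hook_op P x y = hook_op P y x"
proof (intro ext)
  fix \<Phi> f
  assume "x \<noteq> y"
  show "hook_op P x y \<Phi> f = hook_op P y x \<Phi> f"
  proof (cases "matching P f")
    case True
    then have "f x = y \<longleftrightarrow> f y = x"
      by (metis matchingD(1))
    then show ?thesis
      using hook_commute[OF \<open>x \<noteq> y\<close>] by (simp add: hook_op_def)
  qed (simp add: hook_op_def)
qed

lemma hook_op_square:
  assumes "x \<in> P" "y \<in> P" "x \<noteq> y"
  shows "hook_op P x y (hook_op P x y \<Phi>) = (\<lambda>f. circle_value * hook_op P x y \<Phi> f)"
proof
  fix f
  show "hook_op P x y (hook_op P x y \<Phi>) f = circle_value * hook_op P x y \<Phi> f"
  proof (cases "matching P f")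
    case True
    then show ?thesis
      using matching_hook[OF True assms] hook_id[OF matching_hook[OF True assms] assms(1), of y]
        hook_apply[OF True assms, of x] by (simp add: hook_op_def)
  qed (simp add: hook_op_def)
qed

lemma hook_op_braid:
  assumes "x \<in> P" "y \<in> P" "z \<in> P" "distinct [x, y, z]"
  shows "hook_op P x y (hook_op P y z (hook_op P x y \<Phi>)) = hook_op P x y \<Phi>"
proof
  fix f
  show "hook_op P x y (hook_op P y z (hook_op P x y \<Phi>)) f = hook_op P x y \<Phi> f"
  proof (cases "matching P f")
    case True
    have g: "matching P (hook x y f)" "hook x y f x = y" "hook x y f y = x"
      using matching_hook[OF True] hook_apply[OF True, of x y] assms by auto
    have "matching P (hook y z (hook x y f))"
      using matching_hook[OF g(1)] assms by auto
    then show ?thesis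
      using True g hook_hook[OF g(1) assms g(2)] assms(4) by (simp add: hook_op_def)
  qed (simp add: hook_op_def)
qed

lemma hook_op_far:
  assumes "x \<in> P" "y \<in> P" "z \<in> P" "w \<in> P" "distinct [x, y, z, w]"
  shows "hook_op P x y (hook_op P z w \<Phi>) = hook_op P z w (hook_op P x y \<Phi>)"
proof
  fix f
  show "hook_op P x y (hook_op P z w \<Phi>) f = hook_op P z w (hook_op P x y \<Phi>) f"
  proof (cases "matching P f")
    case True
    note m = matchingD[OF True]
    have "matching P (hook x y f)" "matching P (hook z w f)"
      using matching_hook[OF True] assms by auto
    moreover have "hook x y f z = w \<longleftrightarrow> f z = w \<or> f x = z \<and> f y = w \<or> f x = w \<and> f y = z"
      "hook z w f x = y \<longleftrightarrow> f x = y \<or> f x = z \<and> f y = w \<or> f x = w \<and> f y = z"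
    proof -
      have d: "x \<noteq> y" "x \<noteq> z" "x \<noteq> w" "y \<noteq> z" "y \<noteq> w" "z \<noteq> w"
        using assms(5) by auto
      note h = hook_apply[OF True assms(1,2) d(1), of z] hook_apply[OF True assms(3,4) d(6), of x]
      show "hook x y f z = w \<longleftrightarrow> f z = w \<or> f x = z \<and> f y = w \<or> f x = w \<and> f y = z"
        unfolding h using d m(1)[of x] m(1)[of y] m(1)[of z] m(1)[of w] by (smt (verit))
      show "hook z w f x = y \<longleftrightarrow> f x = y \<or> f x = z \<and> f y = w \<or> f x = w \<and> f y = z"
        unfolding h using d m(1)[of x] m(1)[of y] m(1)[of z] m(1)[of w] by (smt (verit))
    qed
    \<comment> \<open>When \<open>f\<close> joins \<open>x\<close> and \<open>y\<close> to
      \<open>z\<close> and \<open>w\<close>, neither pair is joined by \<open>f\<close> itself. Then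
      the hook performed first splits off no circle and the second one does, in either
      order.\<close>
    moreover have "\<not> (f z = w \<and> (f x = z \<and> f y = w \<or> f x = w \<and> f y = z))"
      "\<not> (f x = y \<and> (f x = z \<and> f y = w \<or> f x = w \<and> f y = z))"
      using assms(5) m(1)[of x] m(1)[of y] m(1)[of z] by auto
    ultimately have "(if f x = y then circle_value else 1) * (if hook x y f z = w then circle_value else 1) =
        (if f z = w then circle_value else 1) * (if hook z w f x = y then circle_value else 1)"
      by (smt (verit) mult.commute)
    then show ?thesis
      using hook_hook_commute[OF True assms] True \<open>matching P (hook x y f)\<close> \<open>matching P (hook z w f)\<close>
      by (simp only: hook_op_def if_True flip: mult.assoc)
  qed (simp add: hook_op_def)
qed

definition strand_op :: "'p set \<Rightarrow> (nat \<Rightarrow> 'p) \<Rightarrow> nat \<Rightarrow> ('p \<Rightarrow> 'p) operator" where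
  "strand_op P s i = hook_op P (s i) (s (Suc i))"

lemma temperley_lieb_strand_op:
  assumes "inj_on s {..<k}" "s ` {..<k} \<subseteq> P"
  shows "temperley_lieb (strand_op P s) k"
proof
  have s: "s i \<in> P" if "i < k" for i using assms(2) that by auto
  have ne: "s i \<noteq> s j" if "i < k" "j < k" "i \<noteq> j" for i j
    using assms(1) that by (auto simp: inj_on_def)
  fix i j \<Phi>
  show "linear_op (strand_op P s i)"
    by (simp add: strand_op_def linear_op_hook_op)
  show "strand_op P s i (strand_op P s i \<Phi>) = (\<lambda>f. circle_value * strand_op P s i \<Phi> f)" if "Suc i < k"
    unfolding strand_op_def by (rule hook_op_square) (use that s ne in auto)
  show "strand_op P s i (strand_op P s (Suc i) (strand_op P s i \<Phi>)) = strand_op P s i \<Phi>" if "Suc (Suc i) < k"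
    unfolding strand_op_def by (rule hook_op_braid) (use that s ne in auto)
  show "strand_op P s (Suc i) (strand_op P s i (strand_op P s (Suc i) \<Phi>)) = strand_op P s (Suc i) \<Phi>"
    if "Suc (Suc i) < k"
  proof -
    have "s i \<noteq> s (Suc i)" "s (Suc i) \<noteq> s (Suc (Suc i))" using ne that by auto
    then show ?thesis
      unfolding strand_op_def hook_op_commute[OF \<open>s i \<noteq> s (Suc i)\<close>]
        hook_op_commute[OF \<open>s (Suc i) \<noteq> s (Suc (Suc i))\<close>]
      by (intro hook_op_braid) (use that s ne in auto)
  qed
  show "strand_op P s i (strand_op P s j \<Phi>) = strand_op P s j (strand_op P s i \<Phi>)" if "Suc i < j" "Suc j < k"
    unfolding strand_op_def by (rule hook_op_far) (use that s ne in auto)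
qed

abbreviation jwp :: "'p set \<Rightarrow> (nat \<Rightarrow> 'p) \<Rightarrow> nat \<Rightarrow> ('p \<Rightarrow> 'p) operator" where
  "jwp P s \<equiv> jw (strand_op P s)"

section \<open>The pairing of two matchings\<close>

definition pairing :: "'p set \<Rightarrow> ('p \<Rightarrow> 'p) \<Rightarrow> ('p \<Rightarrow> 'p) \<Rightarrow> ratfun" where
  "pairing P g f = (if matching P f \<and> matching P g then circle_value ^ circles P f g else 0)"

lemma pairing_commute: "pairing P g f = pairing P f g"
  by (simp add: pairing_def circles_commute)

text \<open>Transposition with respect to \<open>pairing\<close>: an operator moves from one of the
  two glued diagrams to the other.\<close>

definition adjoint :: "'p set \<Rightarrow> ('p \<Rightarrow> 'p) operator \<Rightarrow> ('p \<Rightarrow> 'p) operator \<Rightarrow> bool" where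
  "adjoint P S S' \<longleftrightarrow> (\<forall>f g. S (pairing P g) f = S' (pairing P f) g)"

lemma adjoint_comp:
  assumes "adjoint P S S'" "adjoint P T T'" "linear_op S" "linear_op T'"
  shows "adjoint P (\<lambda>\<Phi>. S (T \<Phi>)) (\<lambda>\<Phi>. T' (S' \<Phi>))"
  unfolding adjoint_def
proof (intro allI)
  fix f g
  have "T (pairing P g) = (\<lambda>h. T' (\<lambda>k. pairing P h k) g)"
    using assms(2) by (auto simp: adjoint_def)
  then have "S (T (pairing P g)) f = S (\<lambda>h. T' (\<lambda>k. pairing P h k) g) f"
    by simp
  also have "\<dots> = T' (\<lambda>k. S (\<lambda>h. pairing P h k) f) g"
    using fcomb_swap[of "\<lambda>\<Phi>. S \<Phi> f" "\<lambda>\<Phi>. T' \<Phi> g" "pairing P"] assms by (simp add: linear_op_def)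
  also have "\<dots> = T' (\<lambda>k. S (pairing P k) f) g"
    by (subst pairing_commute) (rule refl)
  also have "\<dots> = T' (S' (pairing P f)) g"
    using assms(1) by (simp add: adjoint_def)
  finally show "S (T (pairing P g)) f = T' (S' (pairing P f)) g" .
qed

lemma adjoint_hook_op:
  assumes "finite P" "x \<in> P" "y \<in> P" "x \<noteq> y"
  shows "adjoint P (hook_op P x y) (hook_op P x y)"
  unfolding adjoint_def
proof (intro allI)
  fix f g
  show "hook_op P x y (pairing P g) f = hook_op P x y (pairing P f) g"
  proof (cases "matching P f \<and> matching P g")
    case True
    then have m: "matching P (hook x y f)" "matching P (hook x y g)"
      using matching_hook assms by auto
    have "circle_value ^ ((if f x = y then 1 else 0) + circles P (hook x y f) g) =
        circle_value ^ ((if g x = y then 1 else 0) + circles P f (hook x y g))"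
      using circles_hook[of P f g x y] True assms by simp
    then have "(if f x = y then circle_value else 1) * circle_value ^ circles P (hook x y f) g =
        (if g x = y then circle_value else 1) * circle_value ^ circles P (hook x y g) f"
      by (auto simp: circles_commute[of P f] split: if_splits)
    then show ?thesis
      using True m by (simp add: hook_op_def pairing_def)
  qed (auto simp: hook_op_def pairing_def)
qed

text \<open>The generators are self-adjoint and Wenzl's recursion is a palindrome.\<close>

lemma adjoint_jw:
  assumes "\<And>i. Suc i < m \<Longrightarrow> adjoint P (e i) (e i)" "\<And>i. Suc i < m \<Longrightarrow> linear_op (e i)"
  shows "adjoint P (jw e m) (jw e m)"
  using assms
proof (induction m rule: less_induct)
  case (less m)
  show ?case
  proof (cases "m \<le> 1")
    case True
    then consider "m = 0" | "m = Suc 0" by linarith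
    then show ?thesis by cases (auto simp: adjoint_def pairing_commute)
  next
    case False
    then obtain m' where m: "m = Suc (Suc m')" by (metis One_nat_def not_less_eq_eq old.nat.exhaust zero_le)
    let ?J = "jw e (Suc m')"
    have J: "adjoint P ?J ?J" "linear_op ?J" "adjoint P (e m') (e m')" "linear_op (e m')"
      using less m by (auto intro: linear_op_jw)
    have "adjoint P (\<lambda>\<Phi>. ?J (e m' (?J \<Phi>))) (\<lambda>\<Phi>. ?J (e m' (?J \<Phi>)))"
      using adjoint_comp[OF J(1) adjoint_comp[OF J(3) J(1) J(4) J(2)] J(2) linear_op_comp[OF J(2,4)]] .
    then show ?thesis
      using J(1) by (simp add: m adjoint_def)
  qed
qed

lemma hook_op_arc: "matching P f \<Longrightarrow> x \<in> P \<Longrightarrow> f x = y \<Longrightarrow> hook_op P x y \<Phi> f = circle_value * \<Phi> f"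
  by (simp add: hook_op_def hook_id)

lemma hook_op_pairing_arc:
  assumes "finite P" "matching P g" "x \<in> P" "g x = y"
  shows "hook_op P x y (pairing P g) = (\<lambda>f. circle_value * pairing P g f)"
proof
  fix f
  have "y \<in> P" "x \<noteq> y"
    using matchingD(2)[OF assms(2), of x] matchingD(5)[OF assms(2), of x] assms(3,4) by auto
  then have "hook_op P x y (pairing P g) f = hook_op P x y (pairing P f) g"
    using adjoint_hook_op[of P x y] assms by (auto simp: adjoint_def)
  then show "hook_op P x y (pairing P g) f = circle_value * pairing P g f"
    using hook_op_arc[OF assms(2,3,4)] by (simp add: pairing_commute)
qed

text \<open>Both hooks join \<open>x\<close> with \<open>y\<close> and \<open>f x\<close> with
  \<open>f y\<close>, and neither closes a circle. This move transports generators along strands: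
  through an identity diagram, and from one box into another.\<close>

lemma hook_op_slide:
  assumes "matching P f" "x \<in> P" "y \<in> P" "x \<noteq> y" "f x \<noteq> y"
  shows "hook_op P x y \<Phi> f = hook_op P (f x) (f y) \<Phi> f"
proof -
  note m = matchingD[OF assms(1)]
  have n: "f y \<noteq> x" "f x \<in> P" "f y \<in> P" "f x \<noteq> f y" "f x \<noteq> x" "f y \<noteq> y"
    using assms m by metis+
  have "hook x y f = hook (f x) (f y) f"
    using n assms hook_apply[OF assms(1) assms(2-4)] hook_apply[OF assms(1) n(2,3,4)] m(1)
    by (auto simp: fun_eq_iff)
  then show ?thesis
    using assms m(1) n by (simp add: hook_op_def)
qed

lemma circles_self: "finite P \<Longrightarrow> matching P f \<Longrightarrow> 2 * circles P f f = card P"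
proof (induction "card P" arbitrary: P f rule: less_induct)
  case less
  note m = matchingD[OF less.prems(2)]
  show ?case
  proof (cases "P = {}")
    case False
    then obtain x where x: "x \<in> P" by auto
    have fx: "f x \<in> P" "x \<noteq> f x" using m(2)[of x] m(5)[of x] x by auto
    have "card (P - {x, f x}) + 2 = card P"
      using x fx less.prems(1) card_Diff_subset[of "{x, f x}" P] card_mono[of P "{x, f x}"] by auto
    moreover have "2 * circles (P - {x, f x}) (del x (f x) f) (del x (f x) f) = card (P - {x, f x})"
      by (rule less.hyps) (use calculation less.prems matching_del[OF less.prems(2) x fx] in auto)
    ultimately show ?thesis
      using circles_arc[OF less.prems(1,2,2) x, of "f x"] by simp
  qed (simp add: circles_def components_def)
qed

lemma strand_op_apply: "strand_op P s i \<Phi> = hook_op P (s i) (s (Suc i)) \<Phi>"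
  by (simp add: strand_op_def)

lemma inj_on_Suc: "inj_on s {..<m} \<Longrightarrow> Suc i < m \<Longrightarrow> s i \<noteq> s (Suc i)"
  using inj_onD[of s "{..<m}" i "Suc i"] by auto

lemma strand_op_cong: "(\<And>i. i < m \<Longrightarrow> s i = t i) \<Longrightarrow> jwp P s m = jwp P t m"
  by (rule jw_cong) (simp add: strand_op_def)

lemma linear_op_jwp: "linear_op (jwp P s m)"
  by (rule linear_op_jw) (simp add: strand_op_def linear_op_hook_op)

lemma adjoint_jwp:
  assumes "finite P" "inj_on s {..<m}" "s ` {..<m} \<subseteq> P"
  shows "adjoint P (jwp P s m) (jwp P s m)"
proof (rule adjoint_jw)
  fix i assume "Suc i < m"
  then have "s i \<in> P" "s (Suc i) \<in> P" "s i \<noteq> s (Suc i)"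
    using assms inj_on_Suc[of s m i] by auto
  then show "adjoint P (strand_op P s i) (strand_op P s i)"
    unfolding strand_op_def using adjoint_hook_op assms(1) by metis
qed (simp add: strand_op_def linear_op_hook_op)

lemma jwp_hook_op_commute:
  assumes "inj_on s {..<m}" "s ` {..<m} \<subseteq> P" "u \<in> P" "v \<in> P" "u \<noteq> v" "u \<notin> s ` {..<m}" "v \<notin> s ` {..<m}"
  shows "hook_op P u v (jwp P s m \<Phi>) = jwp P s m (hook_op P u v \<Phi>)"
proof (rule jw_commute)
  fix i \<Phi> assume i: "Suc i < m"
  then have "s i \<noteq> s (Suc i)" "s i \<in> P" "s (Suc i) \<in> P" "s i \<in> s ` {..<m}" "s (Suc i) \<in> s ` {..<m}"
    using assms(1,2) inj_on_Suc[of s m i] by auto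
  then show "hook_op P u v (strand_op P s i \<Phi>) = strand_op P s i (hook_op P u v \<Phi>)"
    unfolding strand_op_apply using assms by (intro hook_op_far) auto
qed (rule linear_op_hook_op)

lemma jwp_jwp_commute:
  assumes "inj_on s {..<m}" "s ` {..<m} \<subseteq> P" "inj_on t {..<n}" "t ` {..<n} \<subseteq> P"
    "s ` {..<m} \<inter> t ` {..<n} = {}"
  shows "jwp P s m (jwp P t n \<Phi>) = jwp P t n (jwp P s m \<Phi>)"
proof (rule jw_commute)
  fix i \<Phi> assume i: "Suc i < n"
  then have "t i \<noteq> t (Suc i)" "t i \<in> t ` {..<n}" "t (Suc i) \<in> t ` {..<n}"
    using assms(3) inj_on_Suc[of t n i] by auto
  then show "jwp P s m (strand_op P t i \<Phi>) = strand_op P t i (jwp P s m \<Phi>)"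
    using assms unfolding strand_op_apply[of P t i] by (intro jwp_hook_op_commute[symmetric]) auto
qed (rule linear_op_jwp)

text \<open>The last strand of the box is closed up through the arc of \<open>T\<close> at
  \<open>s m\<close>. A generator at the two ends of this arc can be inserted on both sides of the
  box, each time for a factor \<open>circle_value\<close>. With \<open>s\<close> continued by
  \<open>T (s m)\<close> the relation \<open>jw_trace\<close> applies and leaves one generator. Two
  factors against one give the division by \<open>circle_value\<close>. \<open>S\<close> stands for
  the other boxes.\<close>

lemma jwp_partial_trace:
  assumes "finite P" "matching P T" "inj_on s {..<Suc m}" "s ` {..<Suc m} \<subseteq> P"
    "T (s m) \<notin> s ` {..<Suc m}" "linear_op S"
    "\<And>\<Phi>. hook_op P (s m) (T (s m)) (S \<Phi>) = S (hook_op P (s m) (T (s m)) \<Phi>)"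
  shows "S (jwp P s (Suc m) (pairing P T)) T =
    inverse (wenzl m) / circle_value * S (jwp P s m (pairing P T)) T"
proof -
  let ?E = "hook_op P (s m) (T (s m))"
  let ?s = "s(Suc m := T (s m))"
  have q: "s m \<in> P" "T (s m) \<in> P"
    using assms(4) matchingD(5)[OF assms(2)] by auto
  have "inj_on ?s {..<Suc (Suc m)}"
  proof -
    have "s i \<noteq> T (s m) \<and> T (s m) \<noteq> s i \<and> s m \<noteq> T (s m) \<and> T (s m) \<noteq> s m" if "i < m" for i
      using assms(5) that by (metis image_eqI lessI lessThan_iff less_SucI)
    moreover have "s m \<noteq> T (s m) \<and> T (s m) \<noteq> s m"
      using assms(5) by (metis image_eqI lessI lessThan_iff)
    ultimately have "s i \<noteq> T (s m) \<and> T (s m) \<noteq> s i" if "i < Suc m" for i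
      using that by (auto simp: less_Suc_eq)
    then show ?thesis
      using assms(3) unfolding inj_on_def by (auto simp: less_Suc_eq) metis+
  qed
  moreover have "?s ` {..<Suc (Suc m)} \<subseteq> P"
    using assms(4) q by (auto simp: less_Suc_eq)
  ultimately interpret temperley_lieb "strand_op P ?s" "Suc (Suc m)"
    by (rule temperley_lieb_strand_op)
  have e: "strand_op P ?s m = ?E"
    by (simp add: strand_op_def)
  have j: "jwp P ?s (Suc m) = jwp P s (Suc m)" "jwp P ?s m = jwp P s m"
    by (rule strand_op_cong; simp)+
  have tr: "?E (jwp P s (Suc m) (?E \<Phi>)) = (\<lambda>f. inverse (wenzl m) * jwp P s m (?E \<Phi>) f)" for \<Phi>
    using jw_trace[of m \<Phi>] by (simp add: e j)
  have pE: "?E (pairing P T) = (\<lambda>f. circle_value * pairing P T f)"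
    using hook_op_pairing_arc[OF assms(1,2) q(1)] by simp
  have lS: "S (\<lambda>f. x * \<Phi> f) = (\<lambda>f. x * S \<Phi> f)" "jwp P s n (\<lambda>f. x * \<Phi> f) = (\<lambda>f. x * jwp P s n \<Phi> f)" for x \<Phi> n
    using linear_opD(2)[OF assms(6)] linear_opD(2)[OF linear_op_jwp] by auto
  have "?E (S (jwp P s (Suc m) (?E (pairing P T)))) T = circle_value * (circle_value * S (jwp P s (Suc m) (pairing P T)) T)"
    unfolding hook_op_arc[OF assms(2) q(1) refl] unfolding pE lS ..
  moreover have "?E (S (jwp P s (Suc m) (?E (pairing P T)))) T = inverse (wenzl m) * (circle_value * S (jwp P s m (pairing P T)) T)"
    unfolding assms(7) tr unfolding pE lS ..
  ultimately show ?thesis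
    by (simp add: field_simps)
qed


section \<open>The theta graph\<close>

text \<open>In quantum integers, \<open>[y+z+2] [x+z+2] - [x+1] [y+1] = [x+y+z+3] [z+1]\<close>: the
  arithmetic core of the theta formula. In terms of \<open>b = - varA ^ 2\<close> the signs
  disappear.\<close>

lemma circle_poly_split:
  "circle_poly (y + z + 1) * circle_poly (x + z + 1) - circle_poly x * circle_poly y =
   circle_poly (x + y + z + 2) * circle_poly z"
proof -
  define b where "b = - (varA ^ 2)"
  have b: "b \<noteq> 0" by (simp add: b_def)
  have c: "circle_poly n = (b ^ (n + 1) - inverse b ^ (n + 1)) / (b - inverse b)" for n
  proof -
    have "b ^ (n + 1) = - ((-1) ^ n * (varA ^ 2) ^ (n + 1))"
      "inverse b ^ (n + 1) = - ((-1) ^ n * inverse ((varA ^ 2) ^ (n + 1)))"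
      by (simp_all add: b_def power_minus[of "varA ^ 2"] power_minus[of "inverse (varA ^ 2)"] power_inverse)
    moreover have "b - inverse b = - (varA ^ 2 - inverse (varA ^ 2))"
      by (simp add: b_def)
    ultimately have "(b ^ (n + 1) - inverse b ^ (n + 1)) / (b - inverse b) =
        - ((-1) ^ n * ((varA ^ 2) ^ (n + 1) - inverse ((varA ^ 2) ^ (n + 1)))) / - (varA ^ 2 - inverse (varA ^ 2))"
      by (simp only: right_diff_distrib) simp
    then show ?thesis
      unfolding circle_poly_eq by (simp only: minus_divide_divide)
  qed
  define u v w where "u = b ^ x" "v = b ^ y" "w = b ^ z"
  have nz: "u \<noteq> 0" "v \<noteq> 0" "w \<noteq> 0" using b by (auto simp: u_v_w_def)
  have "(v * w * b ^ 2 - inverse (v * w * b ^ 2)) * (u * w * b ^ 2 - inverse (u * w * b ^ 2)) -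
      (u * b - inverse (u * b)) * (v * b - inverse (v * b)) =
      (u * v * w * b ^ 3 - inverse (u * v * w * b ^ 3)) * (w * b - inverse (w * b))"
    using nz b by (simp add: field_simps power2_eq_square power3_eq_cube)
  then show ?thesis
    unfolding c times_divide_times_eq diff_divide_distrib[symmetric]
    by (simp add: u_v_w_def power_add power_inverse power2_eq_square power3_eq_cube ac_simps)
qed

text \<open>Shifted by one against the usual factorial: since \<open>circle_poly 0 = 1\<close>,
  \<open>circle_fact (m + 1)\<close> is the product of \<open>circle_poly 1\<close> up to
  \<open>circle_poly m\<close>.\<close>

definition circle_fact :: "nat \<Rightarrow> ratfun" where
  "circle_fact n = (\<Prod>i<n. circle_poly i)"

lemma circle_fact_Suc [simp]: "circle_fact (Suc n) = circle_fact n * circle_poly n"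
  by (simp add: circle_fact_def)

lemma circle_fact_0 [simp]: "circle_fact 0 = 1"
  by (simp add: circle_fact_def)

lemma circle_fact_nonzero [simp]: "circle_fact n \<noteq> 0"
  by (simp add: circle_fact_def)

text \<open>The classical product formula for the theta net with edge colors \<open>x + y\<close>,
  \<open>x + z\<close> and \<open>y + z\<close>, where \<open>x\<close>, \<open>y\<close>,
  \<open>z\<close> are the numbers of strands joining two edges. That the net has this value is
  proved in \<open>theta_net_eq\<close>.\<close>

definition theta :: "nat \<Rightarrow> nat \<Rightarrow> nat \<Rightarrow> ratfun" where
  "theta x y z = circle_fact (Suc (x + y + z)) * circle_fact x * circle_fact y * circle_fact z /
     (circle_fact (x + y) * circle_fact (x + z) * circle_fact (y + z))"

lemma theta_0: "theta x y 0 = circle_poly (x + y)"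
  by (simp add: theta_def)

lemma theta_0_Suc: "theta 0 y (Suc z) = inverse (wenzl (y + z)) * theta 0 y z"
  by (simp add: theta_def wenzl_def field_simps)

text \<open>The recursion that \<open>theta_net_Suc\<close> finds for the nets, up to powers of
  \<open>circle_value\<close>. After taking out the common factor \<open>F\<close> it is
  \<open>circle_poly_split\<close>.\<close>

lemma theta_Suc_Suc:
  "theta (Suc x) y (Suc z) = inverse (wenzl (y + z)) * theta (Suc x) y z -
     wenzl (x + z) * (circle_poly x / circle_poly (x + z)) ^ 2 * theta x (Suc y) z"
proof -
  define F where "F = circle_fact (Suc (Suc (x + y + z))) * circle_fact x * circle_fact y * circle_fact z /
     (circle_fact (Suc (x + y)) * circle_fact (x + z) * circle_fact (y + z))"
  have 1: "theta (Suc x) y z = F * (circle_poly x / circle_poly (x + z))"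
    by (simp add: theta_def F_def field_simps)
  have 2: "theta x (Suc y) z = F * (circle_poly y / circle_poly (y + z))"
    by (simp add: theta_def F_def field_simps)
  have 3: "theta (Suc x) y (Suc z) = F * (circle_poly x * circle_poly z * circle_poly (x + y + z + 2) /
      (circle_poly (x + z) * circle_poly (Suc (x + z)) * circle_poly (y + z)))"
    by (simp add: theta_def F_def field_simps)
  have 4: "circle_poly (x + y + z + 2) * circle_poly z =
      circle_poly (Suc (y + z)) * circle_poly (Suc (x + z)) - circle_poly x * circle_poly y"
    using circle_poly_split[of y z x] by simp
  have "circle_poly x * circle_poly z * circle_poly (x + y + z + 2) =
      circle_poly x * (circle_poly (Suc (y + z)) * circle_poly (Suc (x + z)) - circle_poly x * circle_poly y)"
    using 4 by (simp add: mult.commute mult.left_commute)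
  then have 5: "circle_poly x * circle_poly z * circle_poly (x + y + z + 2) /
      (circle_poly (x + z) * circle_poly (Suc (x + z)) * circle_poly (y + z)) =
      inverse (wenzl (y + z)) * (circle_poly x / circle_poly (x + z)) -
      wenzl (x + z) * (circle_poly x / circle_poly (x + z)) ^ 2 * (circle_poly y / circle_poly (y + z))"
    by (simp add: wenzl_def field_simps power2_eq_square)
  show ?thesis
    unfolding 1 2 3 5 by (simp add: algebra_simps)
qed

section \<open>Theta nets on three groups of points of a matching\<close>

locale three_groups =
  fixes P :: "'p set" and s t u :: "nat \<Rightarrow> 'p" and a b c :: nat
  assumes fin: "finite P"
    and mem: "i < a \<Longrightarrow> s i \<in> P" "i < b \<Longrightarrow> t i \<in> P" "i < c \<Longrightarrow> u i \<in> P"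
    and inj: "i < a \<Longrightarrow> j < a \<Longrightarrow> s i = s j \<longleftrightarrow> i = j" "i < b \<Longrightarrow> j < b \<Longrightarrow> t i = t j \<longleftrightarrow> i = j"
      "i < c \<Longrightarrow> j < c \<Longrightarrow> u i = u j \<longleftrightarrow> i = j"
    and disj: "i < a \<Longrightarrow> j < b \<Longrightarrow> s i \<noteq> t j" "i < a \<Longrightarrow> j < c \<Longrightarrow> s i \<noteq> u j" "i < b \<Longrightarrow> j < c \<Longrightarrow> t i \<noteq> u j"
begin

lemmas ne = disj disj[symmetric]

lemma groups:
  "m \<le> a \<Longrightarrow> inj_on s {..<m}" "m \<le> a \<Longrightarrow> s ` {..<m} \<subseteq> P"
  "m \<le> b \<Longrightarrow> inj_on t {..<m}" "m \<le> b \<Longrightarrow> t ` {..<m} \<subseteq> P"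
  "m \<le> c \<Longrightarrow> inj_on u {..<m}" "m \<le> c \<Longrightarrow> u ` {..<m} \<subseteq> P"
  using mem inj by (auto simp: inj_on_def)

lemma groups_disjoint:
  "l \<le> a \<Longrightarrow> m \<le> b \<Longrightarrow> s ` {..<l} \<inter> t ` {..<m} = {}"
  "l \<le> a \<Longrightarrow> n \<le> c \<Longrightarrow> s ` {..<l} \<inter> u ` {..<n} = {}"
  "m \<le> b \<Longrightarrow> n \<le> c \<Longrightarrow> t ` {..<m} \<inter> u ` {..<n} = {}"
  using disj by fastforce+

lemma jw_st: "l \<le> a \<Longrightarrow> m \<le> b \<Longrightarrow> jwp P s l (jwp P t m \<Phi>) = jwp P t m (jwp P s l \<Phi>)"
  and jw_su: "l \<le> a \<Longrightarrow> n \<le> c \<Longrightarrow> jwp P s l (jwp P u n \<Phi>) = jwp P u n (jwp P s l \<Phi>)"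
  and jw_tu: "m \<le> b \<Longrightarrow> n \<le> c \<Longrightarrow> jwp P t m (jwp P u n \<Phi>) = jwp P u n (jwp P t m \<Phi>)"
  by (rule jwp_jwp_commute; simp add: groups groups_disjoint)+

lemma tl: "temperley_lieb (strand_op P s) a" "temperley_lieb (strand_op P t) b" "temperley_lieb (strand_op P u) c"
  by (rule temperley_lieb_strand_op; simp add: groups)+

lemma strand_t:
  "l \<le> a \<Longrightarrow> Suc i < b \<Longrightarrow> strand_op P t i (jwp P s l \<Phi>) = jwp P s l (strand_op P t i \<Phi>)"
  "n \<le> c \<Longrightarrow> Suc i < b \<Longrightarrow> strand_op P t i (jwp P u n \<Phi>) = jwp P u n (strand_op P t i \<Phi>)"
proof -
  assume i: "Suc i < b"
  have d: "t i \<notin> s ` {..<l} \<and> t (Suc i) \<notin> s ` {..<l}" if "l \<le> a"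
    using that i by (auto simp: ne)
  have d': "t i \<notin> u ` {..<n} \<and> t (Suc i) \<notin> u ` {..<n}" if "n \<le> c"
    using that i by (auto simp: ne)
  show "strand_op P t i (jwp P s l \<Phi>) = jwp P s l (strand_op P t i \<Phi>)" if "l \<le> a"
    by (simp only: strand_op_apply, rule jwp_hook_op_commute; (rule groups)?; use d that i in \<open>simp add: mem inj\<close>)
  show "strand_op P t i (jwp P u n \<Phi>) = jwp P u n (strand_op P t i \<Phi>)" if "n \<le> c"
    by (simp only: strand_op_apply, rule jwp_hook_op_commute; (rule groups)?; use d' that i in \<open>simp add: mem inj\<close>)
qed

text \<open>The numbering makes the last strand of the box on \<open>t\<close> lead to the last
  strand of the box on \<open>u\<close> when \<open>z > 0\<close>; there the recursion in
  \<open>z\<close> takes off one strand. Elsewhere the arcs of \<open>T\<close> are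
  unrestricted.\<close>

definition config :: "nat \<Rightarrow> nat \<Rightarrow> nat \<Rightarrow> ('p \<Rightarrow> 'p) \<Rightarrow> bool" where
  "config x y z T \<longleftrightarrow> matching P T \<and> (\<forall>i<x. T (s i) = t i) \<and> (\<forall>j<y. T (s (x + j)) = u (y - 1 - j)) \<and>
     (\<forall>k<z. T (t (x + k)) = u (y + k))"

text \<open>\<open>T\<close> stands on both sides of the boxes, one copy for each of the two
  vertices of the theta graph.\<close>

definition theta_net :: "nat \<Rightarrow> nat \<Rightarrow> nat \<Rightarrow> ('p \<Rightarrow> 'p) \<Rightarrow> ratfun" where
  "theta_net x y z T = jwp P s (x + y) (jwp P t (x + z) (jwp P u (y + z) (pairing P T))) T"

text \<open>A generator in the box on \<open>t\<close> slides along the arcs of \<open>f\<close> to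
  the box on \<open>s\<close>, which kills it.\<close>

lemma absorb_t:
  assumes "matching P f" "\<forall>i<m. f (s i) = t i" "m \<le> l" "l \<le> a" "m \<le> b" "n \<le> c"
  shows "jwp P s l (jwp P u n (jwp P t m \<Phi>)) f = jwp P s l (jwp P u n \<Phi>) f"
proof (rule jw_absorb[of "\<lambda>\<Phi>. jwp P s l (jwp P u n \<Phi>) f"])
  show "fcomb (\<lambda>\<Phi>. jwp P s l (jwp P u n \<Phi>) f)"
    using linear_op_comp[OF linear_op_jwp linear_op_jwp, of P s l P u n] by (simp add: linear_op_def)
  fix i \<Phi> assume i: "Suc i < m"
  interpret S: temperley_lieb "strand_op P s" a by (rule tl)
  have f: "f (s i) = t i" "f (s (Suc i)) = t (Suc i)" using assms(2) i by auto
  have "jwp P s l (jwp P u n (strand_op P t i \<Phi>)) f = strand_op P t i (jwp P s l (jwp P u n \<Phi>)) f"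
    using strand_t i assms by simp
  also have "\<dots> = strand_op P s i (jwp P s l (jwp P u n \<Phi>)) f"
    unfolding strand_op_apply f[symmetric]
    by (rule hook_op_slide[symmetric]) (use f assms i mem inj ne(1)[of "Suc i" i] in auto)
  also have "\<dots> = 0"
    using S.jw_kills(1)[of i l "jwp P u n \<Phi>"] i assms by simp
  finally show "jwp P s l (jwp P u n (strand_op P t i \<Phi>)) f = 0" .
qed

text \<open>Partial traces take off one strand after the other, and their ratios telescope to
  \<open>circle_poly m\<close>. The arc of a removed strand stays behind as a free circle, which the
  power of \<open>circle_value\<close> balances.\<close>

lemma closure_s:
  assumes "matching P T" "m \<le> a" "\<forall>i<m. \<forall>j<a. T (s i) \<noteq> s j"
  shows "jwp P s m (pairing P T) T * circle_value ^ m = circle_poly m * pairing P T T"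
  using assms(2,3)
proof (induction m)
  case (Suc m)
  have "jwp P s (Suc m) (pairing P T) T = inverse (wenzl m) / circle_value * jwp P s m (pairing P T) T"
    by (rule jwp_partial_trace[of P T s m "\<lambda>\<Phi>. \<Phi>"])
      (use assms(1) Suc.prems groups[of "Suc m"] fin in \<open>auto simp: linear_op_id\<close>)
  then have "jwp P s (Suc m) (pairing P T) T * circle_value ^ Suc m =
      inverse (wenzl m) * (jwp P s m (pairing P T) T * circle_value ^ m)"
    by simp
  also have "\<dots> = inverse (wenzl m) * (circle_poly m * pairing P T T)"
    using Suc by simp
  finally show ?case
    by (simp add: wenzl_def)
qed simp

text \<open>Without strands between \<open>t\<close> and \<open>u\<close>, both of their boxes face
  the box on \<open>s\<close> and are absorbed by it; what remains is the closure of that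
  box.\<close>

lemma theta_net_0:
  assumes T: "config x y 0 T" and le: "x + y \<le> a" "x \<le> b" "y \<le> c"
  shows "theta_net x y 0 T * circle_value ^ (x + y) = theta x y 0 * pairing P T T"
proof -
  have m: "matching P T" and Tx: "\<forall>i<x. T (s i) = t i" and Ty: "\<forall>j<y. T (s (x + j)) = u (y - 1 - j)"
    using T by (auto simp: config_def)
  interpret S: temperley_lieb "strand_op P s" a by (rule tl)
  have u: "jwp P s (x + y) (jwp P u y \<Phi>) T = jwp P s (x + y) \<Phi> T" for \<Phi>
  proof (rule jw_absorb[of "\<lambda>\<Phi>. jwp P s (x + y) \<Phi> T"])
    show "fcomb (\<lambda>\<Phi>. jwp P s (x + y) \<Phi> T)"
      by (rule fcomb_op[OF linear_op_jwp])
    fix i \<Phi> assume i: "Suc i < y"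
    \<comment> \<open>The arcs from \<open>s\<close> to \<open>u\<close> reverse the order, so the
      generator at \<open>u i\<close> arrives on \<open>s\<close> with its two points
      exchanged.\<close>
    define j where "j = x + (y - 2 - i)"
    have jb: "Suc j < x + y" using i by (simp add: j_def)
    have Tj: "T (s (Suc j)) = u i" "T (s j) = u (Suc i)"
      using Ty[rule_format, of "y - 1 - i"] Ty[rule_format, of "y - 2 - i"] i
      by (auto simp: j_def Suc_diff_le numeral_2_eq_2 Suc_diff_Suc)
    have "jwp P s (x + y) (strand_op P u i \<Phi>) T = strand_op P u i (jwp P s (x + y) \<Phi>) T"
      by (simp only: strand_op_apply, subst jwp_hook_op_commute; (rule groups)?; use i le in \<open>auto simp: ne mem inj\<close>)
    also have "\<dots> = hook_op P (s (Suc j)) (s j) (jwp P s (x + y) \<Phi>) T"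
      by (simp only: strand_op_apply Tj[symmetric], rule hook_op_slide[symmetric]) (use m i jb le in \<open>auto simp: Tj ne mem inj\<close>)
    also have "\<dots> = strand_op P s j (jwp P s (x + y) \<Phi>) T"
      using hook_op_commute[of "s (Suc j)" "s j" P] inj(1)[of "Suc j" j] jb le by (simp add: strand_op_def)
    also have "\<dots> = 0"
      using S.jw_kills(1)[of j "x + y"] jb le by simp
    finally show "jwp P s (x + y) (strand_op P u i \<Phi>) T = 0" .
  qed
  have "theta_net x y 0 T = jwp P s (x + y) (jwp P u y (jwp P t x (pairing P T))) T"
    using jw_tu[of x y] le by (simp add: theta_net_def)
  also have "\<dots> = jwp P s (x + y) (jwp P u y (pairing P T)) T"
    using absorb_t[OF m Tx, of "x + y" y] le by simp
  also have "\<dots> = jwp P s (x + y) (pairing P T) T"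
    by (rule u)
  finally have 1: "theta_net x y 0 T = jwp P s (x + y) (pairing P T) T" .
  have "\<forall>i<x + y. \<forall>j<a. T (s i) \<noteq> s j"
  proof (intro allI impI)
    fix i j assume i: "i < x + y" "j < a"
    show "T (s i) \<noteq> s j"
    proof (cases "i < x")
      case True
      then show ?thesis using Tx disj(1)[of j i] i le by auto
    next
      case False
      then have "T (s i) = u (y - 1 - (i - x))" "y - 1 - (i - x) < c"
        using Ty[rule_format, of "i - x"] i le by auto
      then show ?thesis using disj(2)[of j "y - 1 - (i - x)"] i le by auto
    qed
  qed
  then show ?thesis
    unfolding 1 theta_0 using closure_s[OF m] le by simp
qed

text \<open>The box on \<open>t\<close> is unfolded from its last strand. In each step the term
  without a further box generator dies: its hook sits on two strands leading to \<open>u\<close> and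
  slides into that box. The other term carries a factor \<open>- wenzl i\<close> and one more hook,
  and these factors telescope to the stated quotient. For \<open>x = 0\<close> the chain never meets
  a strand leading to \<open>s\<close>, and it vanishes. Otherwise it ends at the last such strand,
  number \<open>x' = x - 1\<close>, and the accumulated hooks form \<open>T'\<close>, which turns
  back at \<open>t i\<close> and has a new arc from \<open>s x'\<close> to
  \<open>u y\<close>.\<close>

lemma hook_chain:
  assumes T: "config x y (Suc z) T" and le: "x + y \<le> a" "Suc (x + z) \<le> b" "Suc (y + z) \<le> c" and i: "x \<le> Suc i" "i < x + z"
  defines "A \<equiv> \<lambda>i \<Psi>. jwp P s (x + y) (jwp P u (Suc (y + z)) (jwp P t (Suc i) (strand_op P t i \<Psi>))) T"
  shows "x = 0 \<Longrightarrow> A i \<Psi> = 0"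
    and "x = Suc x' \<Longrightarrow> \<exists>T'. matching P T' \<and> T' (t i) = t (Suc i) \<and> T' (s x') = u y \<and>
      (\<forall>k<i - x'. T' (t (x' + k)) = u (Suc (y + k))) \<and> (\<forall>k>i - x'. k \<le> z \<longrightarrow> T' (t (Suc (x' + k))) = u (y + k)) \<and>
      (\<forall>j<x'. T' (s j) = t j) \<and> (\<forall>j<y. T' (s (Suc (x' + j))) = u (y - 1 - j)) \<and>
      (\<forall>\<Psi>. A i \<Psi> = (-1) ^ (i - x') * (circle_poly x' / circle_poly i) *
        jwp P s (x + y) (jwp P u (Suc (y + z)) (jwp P t i \<Psi>)) T')"
proof -
  have m: "matching P T" and Tx: "\<forall>i<x. T (s i) = t i" and Ty: "\<forall>j<y. T (s (x + j)) = u (y - 1 - j)"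
    and Tz: "\<forall>k<Suc z. T (t (x + k)) = u (y + k)"
    using T by (auto simp: config_def)
  interpret S: temperley_lieb "strand_op P s" a by (rule tl)
  interpret T: temperley_lieb "strand_op P t" b by (rule tl)
  interpret U: temperley_lieb "strand_op P u" c by (rule tl)
  let ?J = "\<lambda>\<Psi>. jwp P s (x + y) (jwp P u (Suc (y + z)) \<Psi>)"
  have lJ: "linear_op ?J"
    by (rule linear_op_comp[OF linear_op_jwp linear_op_jwp])
  have Jt: "?J (strand_op P t i \<Psi>) = strand_op P t i (?J \<Psi>)" if "Suc i < b" for i \<Psi>
    using strand_t that le by simp
  have dead: "?J (strand_op P t i \<Psi>) T = 0" if "x \<le> i" "i < x + z" for i \<Psi>
  proof -
    define k where "k = i - x"
    have k: "i = x + k" "k < z" using that by (auto simp: k_def)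
    have Tk: "T (t (x + k)) = u (y + k)" "T (t (Suc (x + k))) = u (Suc (y + k))"
      using Tz[rule_format, of k] Tz[rule_format, of "Suc k"] k by auto
    have "?J (strand_op P t i \<Psi>) T = strand_op P t i (?J \<Psi>) T"
      using Jt that le by simp
    also have "\<dots> = strand_op P u (y + k) (?J \<Psi>) T"
      by (simp only: strand_op_apply, subst hook_op_slide) (use m k le in \<open>simp_all add: Tk ne mem inj\<close>)
    also have "\<dots> = strand_op P u (y + k) (jwp P u (Suc (y + z)) (jwp P s (x + y) \<Psi>)) T"
      using jw_su[of "x + y" "Suc (y + z)"] le by simp
    also have "\<dots> = 0"
      using U.jw_kills(1)[of "y + k" "Suc (y + z)"] k le by simp
    finally show ?thesis .
  qed
  have step: "A (Suc i) \<Psi> = - wenzl i * A i (strand_op P t (Suc i) (jwp P t (Suc i) \<Psi>))"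
    if "x \<le> Suc i" "Suc i < x + z" for i \<Psi>
  proof -
    let ?e = "strand_op P t (Suc i)"
    have far: "jwp P t (Suc i) (?e \<Psi>) = ?e (jwp P t (Suc i) \<Psi>)"
      using T.jw_far[of "Suc i" "Suc i" \<Psi>] that le by simp
    have "jwp P t (Suc (Suc i)) (?e \<Psi>) =
        (\<lambda>f. ?e (jwp P t (Suc i) \<Psi>) f - wenzl i * jwp P t (Suc i) (strand_op P t i (?e (jwp P t (Suc i) \<Psi>))) f)"
      by (simp add: far)
    then have "?J (jwp P t (Suc (Suc i)) (?e \<Psi>)) =
        (\<lambda>f. ?J (?e (jwp P t (Suc i) \<Psi>)) f - wenzl i * ?J (jwp P t (Suc i) (strand_op P t i (?e (jwp P t (Suc i) \<Psi>)))) f)"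
      using linear_opD(3)[OF lJ] by simp
    then show ?thesis
      using dead[of "Suc i" "jwp P t (Suc i) \<Psi>"] that by (simp add: A_def)
  qed
  show "A i \<Psi> = 0" if x: "x = 0"
    using i(2)
  proof (induction i arbitrary: \<Psi>)
    case 0
    then show ?case using dead[of 0] x by (simp add: A_def)
  next
    case (Suc i)
    then show ?case using step[of i] x by simp
  qed
  show "\<exists>T'. matching P T' \<and> T' (t i) = t (Suc i) \<and> T' (s x') = u y \<and>
      (\<forall>k<i - x'. T' (t (x' + k)) = u (Suc (y + k))) \<and> (\<forall>k>i - x'. k \<le> z \<longrightarrow> T' (t (Suc (x' + k))) = u (y + k)) \<and>
      (\<forall>j<x'. T' (s j) = t j) \<and> (\<forall>j<y. T' (s (Suc (x' + j))) = u (y - 1 - j)) \<and>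
      (\<forall>\<Psi>. A i \<Psi> = (-1) ^ (i - x') * (circle_poly x' / circle_poly i) *
        jwp P s (x + y) (jwp P u (Suc (y + z)) (jwp P t i \<Psi>)) T')" if x: "x = Suc x'"
  proof -
    define n where "n = i - x'"
    have "i = x' + n" using i x by (simp add: n_def)
    show ?thesis
      using i(2) unfolding \<open>i = x' + n\<close> add_diff_cancel_left'
    proof (induction n)
      case 0
      let ?T = "hook (t x') (t (Suc x')) T"
      have Tt: "T (t x') = s x'" "T (t (Suc x')) = u y"
        using Tx[rule_format, of x'] matchingD(1)[OF m, of "s x'"] Tz[rule_format, of 0] x by auto
      have mT: "matching P ?T"
        by (rule matching_hook[OF m]) (use mem inj le x in auto)
      have h: "?T p = (if p = t x' then t (Suc x') else if p = t (Suc x') then t x' else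
          if p = s x' then u y else if p = u y then s x' else T p)" for p
        using hook_apply[OF m, of "t x'" "t (Suc x')" p] Tt mem inj le x by auto
      \<comment> \<open>The box on the first \<open>x' + 1\<close> strands of \<open>t\<close> is
        absorbed by the box on \<open>s\<close>. After the hook only the first \<open>x'\<close> of
        them still lead to \<open>s\<close>, and the box on these is put back, as the claim
        demands.\<close>
      have AJ: "A x' \<Psi> = ?J (jwp P t x' \<Psi>) ?T" for \<Psi>
      proof -
        have "A x' \<Psi> = ?J (strand_op P t x' \<Psi>) T"
          unfolding A_def using absorb_t[OF m Tx, of "x + y"] le x by simp
        also have "\<dots> = ?J \<Psi> ?T"
          using Jt[of x'] m Tt disj(1)[of x' "Suc x'"] le x by (simp add: strand_op_apply hook_op_def)
        also have "\<dots> = ?J (jwp P t x' \<Psi>) ?T"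
          by (rule absorb_t[OF mT, symmetric]) (use le x Tx in \<open>auto simp: h ne inj\<close>)
        finally show ?thesis .
      qed
      show ?case
      proof (rule exI[of _ ?T], intro conjI)
        show "matching P ?T" by (rule mT)
        show "\<forall>\<Psi>. A (x' + 0) \<Psi> = (-1) ^ 0 * (circle_poly x' / circle_poly (x' + 0)) * ?J (jwp P t (x' + 0) \<Psi>) ?T"
          using AJ by simp
      qed (use Tz Tx Ty le x in \<open>auto simp: h ne inj\<close>)
    next
      case (Suc n)
      then obtain T' where T': "matching P T'" "T' (t (x' + n)) = t (Suc (x' + n))" "T' (s x') = u y"
        "\<forall>k<n. T' (t (x' + k)) = u (Suc (y + k))" "\<forall>k>n. k \<le> z \<longrightarrow> T' (t (Suc (x' + k))) = u (y + k)"
        "\<forall>j<x'. T' (s j) = t j" "\<forall>j<y. T' (s (Suc (x' + j))) = u (y - 1 - j)"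
        and A: "\<forall>\<Psi>. A (x' + n) \<Psi> = (-1) ^ n * (circle_poly x' / circle_poly (x' + n)) * ?J (jwp P t (x' + n) \<Psi>) T'"
        by auto
      have n: "Suc n \<le> z" using Suc.prems x by simp
      let ?p = "t (Suc (x' + n))" and ?q = "t (Suc (Suc (x' + n)))"
      let ?T = "hook ?p ?q T'"
      have Tt: "T' ?p = t (x' + n)" "T' ?q = u (Suc (y + n))"
        using matchingD(1)[OF T'(1), of "t (x' + n)"] T'(2) T'(5)[rule_format, of "Suc n"] n by auto
      have mT: "matching P ?T"
        by (rule matching_hook[OF T'(1)]) (use mem inj le x n in auto)
      have h: "?T r = (if r = ?p then ?q else if r = ?q then ?p else
          if r = t (x' + n) then u (Suc (y + n)) else if r = u (Suc (y + n)) then t (x' + n) else T' r)" for r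
        using hook_apply[OF T'(1), of ?p ?q r] Tt mem inj le x n by auto
      have AJ: "A (x' + Suc n) \<Psi> = (-1) ^ Suc n * (circle_poly x' / circle_poly (x' + Suc n)) * ?J (jwp P t (x' + Suc n) \<Psi>) ?T" for \<Psi>
      proof -
        let ?e = "strand_op P t (Suc (x' + n))"
        let ?t = "jwp P t (Suc (x' + n))"
        have "jwp P t (x' + n) (?e (?t \<Psi>)) = ?e (jwp P t (x' + n) (?t \<Psi>))"
          using T.jw_far[of "x' + n" "Suc (x' + n)" "?t \<Psi>"] n le x by simp
        also have "\<dots> = ?e (?t \<Psi>)"
          using T.jw_jw_right[of "x' + n" "Suc (x' + n)"] n le x by simp
        finally have "?J (jwp P t (x' + n) (?e (?t \<Psi>))) T' = ?e (?J (?t \<Psi>)) T'"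
          using Jt[of "Suc (x' + n)"] n le x by simp
        also have "\<dots> = ?J (?t \<Psi>) ?T"
          using T'(1) Tt inj(2)[of "x' + n" "Suc (Suc (x' + n))"] n le x by (simp add: strand_op_apply hook_op_def)
        finally have "A (Suc (x' + n)) \<Psi> = - wenzl (x' + n) * ((-1) ^ n * (circle_poly x' / circle_poly (x' + n)) * ?J (?t \<Psi>) ?T)"
          using step[of "x' + n"] A n x by simp
        then show ?thesis
          by (simp add: wenzl_def)
      qed
      show ?case
      proof (rule exI[of _ ?T], intro conjI)
        show "\<forall>k<Suc n. ?T (t (x' + k)) = u (Suc (y + k))"
          using T'(4) n le x by (auto simp: less_Suc_eq h ne inj)
        show "\<forall>\<Psi>. A (x' + Suc n) \<Psi> = (-1) ^ Suc n * (circle_poly x' / circle_poly (x' + Suc n)) * ?J (jwp P t (x' + Suc n) \<Psi>) ?T"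
          using AJ by blast
        show "matching P ?T" by (rule mT)
      qed (use T' n le x in \<open>auto simp: h ne inj\<close>)
    qed
  qed
qed

text \<open>Wenzl's recursion for the box on \<open>t\<close>. In its first term the last strand
  runs freely from \<open>t\<close> to the box on \<open>u\<close>, whose partial trace removes it.
  In its second term \<open>hook_chain\<close> is used on both sides of the generator, with the
  boxes transposed in between, which is the origin of the square.\<close>

lemma theta_net_Suc:
  assumes T: "config x y (Suc z) T" and le: "x + y \<le> a" "Suc (x + z) \<le> b" "Suc (y + z) \<le> c"
  shows "x = 0 \<Longrightarrow> theta_net x y (Suc z) T = inverse (wenzl (y + z)) / circle_value * theta_net x y z T"
    and "x = Suc x' \<Longrightarrow> \<exists>T'. config x' (Suc y) z T' \<and> theta_net x y (Suc z) T = inverse (wenzl (y + z)) / circle_value * theta_net x y z T -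
       wenzl (x' + z) * (circle_poly x' / circle_poly (x' + z)) ^ 2 / circle_value * theta_net x' (Suc y) z T'"
proof -
  have m: "matching P T" and Tx: "\<forall>i<x. T (s i) = t i" and Ty: "\<forall>j<y. T (s (x + j)) = u (y - 1 - j)"
    and Tz: "\<forall>k<Suc z. T (t (x + k)) = u (y + k)"
    using T by (auto simp: config_def)
  interpret T: temperley_lieb "strand_op P t" b by (rule tl)
  let ?a = "jwp P s (x + y)" and ?c = "jwp P u (Suc (y + z))" and ?b = "jwp P t (x + z)"
  have lJ: "linear_op (\<lambda>\<Phi>. ?a (?b \<Phi>))"
    by (rule linear_op_comp[OF linear_op_jwp linear_op_jwp])
  have Tu: "T (u (y + z)) = t (x + z)"
    using Tz[rule_format, of z] matchingD(1)[OF m, of "t (x + z)"] by simp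
  have term1: "?a (?b (?c (pairing P T))) T = inverse (wenzl (y + z)) / circle_value * theta_net x y z T"
    unfolding theta_net_def
  proof (rule jwp_partial_trace[of P T u "y + z" "\<lambda>\<Phi>. ?a (?b \<Phi>)", OF fin m _ _ _ lJ])
    show "T (u (y + z)) \<notin> u ` {..<Suc (y + z)}"
      unfolding Tu using le by (auto simp: ne)
    fix \<Phi>
    have "hook_op P (u (y + z)) (t (x + z)) (?b \<Phi>) = ?b (hook_op P (u (y + z)) (t (x + z)) \<Phi>)" for \<Phi>
      by (rule jwp_hook_op_commute; (rule groups)?; use le in \<open>auto simp: ne mem inj\<close>)
    moreover have "hook_op P (u (y + z)) (t (x + z)) (?a \<Phi>) = ?a (hook_op P (u (y + z)) (t (x + z)) \<Phi>)" for \<Phi>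
      by (rule jwp_hook_op_commute; (rule groups)?; use le in \<open>auto simp: ne mem inj\<close>)
    ultimately show "hook_op P (u (y + z)) (T (u (y + z))) (?a (?b \<Phi>)) = ?a (?b (hook_op P (u (y + z)) (T (u (y + z))) \<Phi>))"
      by (simp add: Tu)
  qed (rule groups; use le in simp)+
  show "theta_net x y (Suc z) T = inverse (wenzl (y + z)) / circle_value * theta_net x y z T" if x: "x = 0"
  proof (cases z)
    case 0
    then show ?thesis using term1 x by (simp add: theta_net_def)
  next
    case (Suc z')
    let ?e = "strand_op P t z'"
    have "jwp P t (Suc z) \<Phi> = (\<lambda>f. jwp P t z \<Phi> f - wenzl z' * jwp P t z (?e (jwp P t z \<Phi>)) f)" for \<Phi>
      by (simp add: Suc)
    then have "theta_net x y (Suc z) T = ?a (?b (?c (pairing P T))) T - wenzl z' * ?a (?b (?e (?b (?c (pairing P T))))) T"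
      using linear_opD(3)[OF linear_op_jwp, of P s "x + y"] x by (simp add: theta_net_def)
    also have "?a (?b (?e (?b (?c (pairing P T))))) T = ?a (?c (?b (?e (?b (pairing P T))))) T"
      using jw_tu[of "x + z" "Suc (y + z)"] strand_t(2)[of "Suc (y + z)" z'] le x Suc by simp
    also have "\<dots> = 0"
      using hook_chain(1)[OF T le, of z'] x Suc by simp
    finally show ?thesis using term1 by simp
  qed
  assume x: "x = Suc x'"
  let ?n = "x' + z"
  let ?e = "strand_op P t ?n"
  define A where "A \<Psi> = ?a (?c (?b (?e \<Psi>))) T" for \<Psi>
  define kap where "kap = (-1) ^ z * (circle_poly x' / circle_poly ?n)"
  have kap2: "kap * kap = (circle_poly x' / circle_poly ?n) ^ 2"
    by (simp add: kap_def power2_eq_square flip: power_add)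
  obtain T' where T': "matching P T'" "T' (t ?n) = t (Suc ?n)" "T' (s x') = u y"
      "\<forall>k<z. T' (t (x' + k)) = u (Suc (y + k))"
      "\<forall>j<x'. T' (s j) = t j" "\<forall>j<y. T' (s (Suc (x' + j))) = u (y - 1 - j)"
    and A: "A \<Psi> = kap * ?a (?c (jwp P t ?n \<Psi>)) T'" for \<Psi>
    using hook_chain(2)[OF T le, of ?n x'] x unfolding A_def kap_def by auto
  have cfg: "config x' (Suc y) z T'"
    unfolding config_def
  proof (intro conjI allI impI)
    fix j assume "j < Suc y"
    then show "T' (s (x' + j)) = u (Suc y - 1 - j)"
      using T'(3,6) by (cases j) auto
  qed (use T' in auto)
  have "jwp P t (Suc (x + z)) \<Phi> = (\<lambda>f. ?b \<Phi> f - wenzl ?n * ?b (?e (?b \<Phi>)) f)" for \<Phi>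
    by (simp add: x)
  then have "theta_net x y (Suc z) T = ?a (?b (?c (pairing P T))) T - wenzl ?n * ?a (?b (?e (?b (?c (pairing P T))))) T"
    using linear_opD(3)[OF linear_op_jwp, of P s "x + y"] by (simp add: theta_net_def)
  also have "?a (?b (?e (?b (?c (pairing P T))))) T = A (?b (pairing P T))"
    using jw_tu[of "x + z" "Suc (y + z)"] strand_t(2)[of "Suc (y + z)" ?n] le x by (simp add: A_def)
  also have "\<dots> = kap * ?a (?c (?b (pairing P T))) T'"
    using T.jw_jw_right[of ?n "x + z"] le x by (simp add: A)
  also have "?a (?c (?b (pairing P T))) T' = ?a (?c (?b (pairing P T'))) T"
  proof -
    have ad: "adjoint P ?a ?a" "adjoint P ?b ?b" "adjoint P ?c ?c"
      by (rule adjoint_jwp[OF fin]; rule groups; use le in simp)+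
    have "adjoint P (\<lambda>\<Phi>. ?a (?c (?b \<Phi>))) (\<lambda>\<Phi>. ?b (?c (?a \<Phi>)))"
      using adjoint_comp[OF ad(1) adjoint_comp[OF ad(3,2) linear_op_jwp linear_op_jwp] linear_op_jwp
          linear_op_comp[OF linear_op_jwp linear_op_jwp]] .
    then show ?thesis
      using jw_tu[of "x + z" "Suc (y + z)"] jw_st[of "x + y" "x + z"] jw_su[of "x + y" "Suc (y + z)"] le
      by (simp add: adjoint_def)
  qed
  \<comment> \<open>\<open>T'\<close> already joins the two points of \<open>?e\<close>, so the
    generator can be inserted at the price of one circle. This makes \<open>hook_chain\<close>
    applicable a second time.\<close>
  also have "\<dots> = A (pairing P T') / circle_value"
  proof -
    have "?e (pairing P T') = (\<lambda>f. circle_value * pairing P T' f)"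
      unfolding strand_op_apply by (rule hook_op_pairing_arc[OF fin T'(1)]) (use T' mem le x in auto)
    then show ?thesis
      by (simp add: A_def linear_opD(2)[OF linear_op_jwp])
  qed
  also have "A (pairing P T') = kap * theta_net x' (Suc y) z T'"
    using A jw_tu[of ?n "Suc (y + z)"] le x by (simp add: theta_net_def)
  finally have "theta_net x y (Suc z) T = inverse (wenzl (y + z)) / circle_value * theta_net x y z T -
      wenzl ?n * (kap * kap) / circle_value * theta_net x' (Suc y) z T'"
    using term1 by simp
  then show "\<exists>T'. config x' (Suc y) z T' \<and> theta_net x y (Suc z) T = inverse (wenzl (y + z)) / circle_value * theta_net x y z T -
       wenzl (x' + z) * (circle_poly x' / circle_poly (x' + z)) ^ 2 / circle_value * theta_net x' (Suc y) z T'"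
    using cfg unfolding kap2 by blast
qed

text \<open>Induction on \<open>z\<close>. The recursion takes strands out of the boxes but leaves
  their arcs in \<open>T\<close>, where they become free circles. The two powers of
  \<open>circle_value\<close> compare the \<open>x + y + z\<close> arcs of the net with all arcs of
  \<open>T\<close>.\<close>

theorem theta_net_eq:
  assumes "config x y z T" "x + y \<le> a" "x + z \<le> b" "y + z \<le> c"
  shows "theta_net x y z T * circle_value ^ (x + y + z) = theta x y z * circle_value ^ (card P div 2)"
  using assms
proof (induction z arbitrary: x y T)
  case 0
  have "pairing P T T = circle_value ^ (card P div 2)"
  proof -
    have "circles P T T = card P div 2"
      using 0 circles_self[OF fin, of T] unfolding config_def by linarith
    then show ?thesis
      using 0 by (simp add: pairing_def config_def)
  qed
  then show ?case
    using theta_net_0[OF 0(1)] 0 by simp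
next
  case (Suc z)
  let ?D = "circle_value ^ (card P div 2)"
  have cfg: "config x y z T"
    using Suc.prems(1) by (simp add: config_def)
  have IH: "theta_net x y z T * circle_value ^ (x + y + z) = theta x y z * ?D"
    using Suc.IH[OF cfg] Suc.prems by simp
  show ?case
  proof (cases x)
    case 0
    then have "theta_net x y (Suc z) T = inverse (wenzl (y + z)) / circle_value * theta_net x y z T"
      using theta_net_Suc(1)[OF Suc.prems(1)] Suc.prems by simp
    then have "theta_net x y (Suc z) T * circle_value ^ (x + y + Suc z) =
        inverse (wenzl (y + z)) * (theta_net x y z T * circle_value ^ (x + y + z))"
      by simp
    then show ?thesis
      unfolding IH using 0 theta_0_Suc[of y z] by simp
  next
    case (Suc x')
    then obtain T' where T': "config x' (Suc y) z T'" and
      e: "theta_net x y (Suc z) T = inverse (wenzl (y + z)) / circle_value * theta_net x y z T -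
       wenzl (x' + z) * (circle_poly x' / circle_poly (x' + z)) ^ 2 / circle_value * theta_net x' (Suc y) z T'"
      using theta_net_Suc(2)[OF Suc.prems(1)] Suc.prems by auto
    have "theta_net x' (Suc y) z T' * circle_value ^ (x + y + z) = theta x' (Suc y) z * ?D"
      using Suc.IH[OF T'] Suc.prems Suc by simp
    then have "theta_net x y (Suc z) T * circle_value ^ (x + y + Suc z) =
        inverse (wenzl (y + z)) * (theta x y z * ?D) -
        wenzl (x' + z) * (circle_poly x' / circle_poly (x' + z)) ^ 2 * (theta x' (Suc y) z * ?D)"
      unfolding IH[symmetric] e by (simp add: field_simps)
    then show ?thesis
      unfolding Suc theta_Suc_Suc by (simp add: algebra_simps)
  qed
qed

end

section \<open>Capping off a matching along a list of arcs\<close>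

fun caps :: "('p \<times> 'p) list \<Rightarrow> ('p \<Rightarrow> 'p) \<Rightarrow> 'p \<Rightarrow> 'p" where
  "caps [] h = h"
| "caps ((x, y) # L) h = caps L (del x y h)"

fun cap_circles :: "('p \<times> 'p) list \<Rightarrow> ('p \<Rightarrow> 'p) \<Rightarrow> nat" where
  "cap_circles [] h = 0"
| "cap_circles ((x, y) # L) h = (if h x = y then 1 else 0) + cap_circles L (del x y h)"

fun list_points :: "('p \<times> 'p) list \<Rightarrow> 'p list" where
  "list_points [] = []"
| "list_points ((x, y) # L) = x # y # list_points L"

definition list_arcs :: "('p \<times> 'p) list \<Rightarrow> 'p set set" where
  "list_arcs L = (\<lambda>(x, y). {x, y}) ` set L"

lemma list_points_arc: "(x, y) \<in> set L \<Longrightarrow> x \<in> set (list_points L) \<and> y \<in> set (list_points L)"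
  by (induction L rule: list_points.induct) auto

text \<open>Iterated \<open>contract\<close>. The second claim counts the circles closed on the way;
  the third one characterizes the remaining matching by connectivity, which is how it is compared
  with the components in the definitions.\<close>

lemma caps_spec:
  assumes "finite P" "matching P h" "distinct (list_points L)" "set (list_points L) \<subseteq> P"
  defines "R \<equiv> P - set (list_points L)" and "G \<equiv> gr P h \<union> list_arcs L"
  shows "matching R (caps L h)"
    and "card (components P G) = cap_circles L h + card (components R (gr R (caps L h)))"
    and "u \<in> R \<Longrightarrow> v \<in> R \<Longrightarrow> conn G u v \<longleftrightarrow> conn (gr R (caps L h)) u v"
  using assms(1-4) unfolding R_def G_def
proof (induction L h arbitrary: P rule: caps.induct)
  case (1 h)
  {
    case 1 then show ?case by simp
  next
    case 2 then show ?case by (simp add: list_arcs_def)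
  next
    case 3 then show ?case by (simp add: list_arcs_def)
  }
next
  case (2 x y L h)

  have xy: "x \<in> P" "y \<in> P" "x \<noteq> y" "x \<notin> set (list_points L)" "y \<notin> set (list_points L)"
    if "distinct (list_points ((x, y) # L))" "set (list_points ((x, y) # L)) \<subseteq> P" for P
    using that by auto
  have K: "u \<in> P - {x, y} \<and> v \<in> P - {x, y}"
    if "distinct (list_points ((x, y) # L))" "set (list_points ((x, y) # L)) \<subseteq> P" "{u, v} \<in> list_arcs L" for u v P
  proof -
    have "u \<in> set (list_points L) \<and> v \<in> set (list_points L)"
      using that(3) list_points_arc[of _ _ L] by (auto simp: list_arcs_def doubleton_eq_iff)
    then show ?thesis
      using that(1,2) by auto
  qed
  have arcs: "gr P h \<union> list_arcs ((x, y) # L) = gr P h \<union> {{x, y}} \<union> list_arcs L" for P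
    by (auto simp: list_arcs_def)
  have D: "P - set (list_points ((x, y) # L)) = P - {x, y} - set (list_points L)" for P
    by auto
  have prem: "finite (P - {x, y})" "matching (P - {x, y}) (del x y h)" "distinct (list_points L)"
    "set (list_points L) \<subseteq> P - {x, y}"
    if "finite P" "matching P h" "distinct (list_points ((x, y) # L))" "set (list_points ((x, y) # L)) \<subseteq> P" for P
    using that matching_del[of P h x y] by auto
  {
    case 1
    then show ?case
      unfolding D caps.simps by (intro "2.IH"(1) prem)
  next
    case 2
    note p = xy[OF 2(3,4)]
    have "card (components P (gr P h \<union> {{x, y}} \<union> list_arcs L)) = (if h x = y then 1 else 0) +
        card (components (P - {x, y}) (gr (P - {x, y}) (del x y h) \<union> list_arcs L))"
      by (rule contract(1)[OF 2(1,2) p(1-3)], rule K[OF 2(3,4)])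
    moreover note "2.IH"(2)[OF prem[OF 2]]
    ultimately show ?case
      unfolding D caps.simps cap_circles.simps arcs by linarith
  next
    case 3
    note p = xy[OF 3(5,6)]
    have uv: "u \<in> P - {x, y}" "v \<in> P - {x, y}" using 3 by auto
    have "conn (gr P h \<union> {{x, y}} \<union> list_arcs L) u v \<longleftrightarrow>
        conn (gr (P - {x, y}) (del x y h) \<union> list_arcs L) u v"
      by (rule contract(2)[OF 3(3,4) p(1-3) _ uv], rule K[OF 3(5,6)])
    also have "\<dots> \<longleftrightarrow> conn (gr (P - {x, y} - set (list_points L)) (caps L (del x y h))) u v"
      by (rule "2.IH"(3)[OF _ _ prem[OF 3(3-6)]]) (use 3 in auto)
    finally show ?case
      unfolding D caps.simps arcs .
  }
qed

definition cap_op :: "'p set \<Rightarrow> ('p \<times> 'p) list \<Rightarrow> ('p \<Rightarrow> 'p) operator" where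
  "cap_op P L \<Phi> h = (if matching P h then circle_value ^ cap_circles L h * \<Phi> (caps L h) else 0)"

lemma cap_op_Cons:
  assumes "x \<in> P" "y \<in> P" "x \<noteq> y"
  shows "cap_op P ((x, y) # L) \<Phi> = cap_op P [(x, y)] (cap_op (P - {x, y}) L \<Phi>)"
  using matching_del[OF _ assms] by (auto simp: cap_op_def fun_eq_iff power_add)

lemma linear_op_cap_op: "linear_op (cap_op P L)"
  unfolding linear_op_def
proof
  fix f
  show "fcomb (\<lambda>\<Phi>. cap_op P L \<Phi> f)"
    unfolding cap_op_def
    by (cases "matching P f") (simp_all only: if_True if_False fcomb_mult fcomb_eval fcomb_zero)
qed

lemma cap_op_hook_op_1:
  assumes "x \<in> P" "y \<in> P" "u \<in> P" "v \<in> P" "distinct [x, y, u, v]"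
  shows "cap_op P [(x, y)] (hook_op (P - {x, y}) u v \<Phi>) = hook_op P u v (cap_op P [(x, y)] \<Phi>)"
proof
  fix h
  show "cap_op P [(x, y)] (hook_op (P - {x, y}) u v \<Phi>) h = hook_op P u v (cap_op P [(x, y)] \<Phi>) h"
  proof (cases "matching P h")
    case True
    have d: "x \<noteq> y" "u \<noteq> v" "u \<noteq> x" "u \<noteq> y" "v \<noteq> x" "v \<noteq> y" using assms(5) by auto
    note hx = matching_hook[OF True assms(1,2) d(1)] and hu = matching_hook[OF True assms(3,4) d(2)]
    note dx = matching_del[OF True assms(1,2) d(1)]
    have hxx: "hook x y h x = y" "hook x y h y = x"
      using hook_apply[OF True assms(1,2) d(1)] by auto
    have du: "del x y h u = hook x y h u" "del x y h v = hook x y h v"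
      using d by (auto simp: del_def)
    have nx: "hook x y h u \<notin> {x, y}" "hook x y h v \<notin> {x, y}"
      using hxx matchingD(1)[OF hx] d by (metis insert_iff singletonD)+
    have "hook u v (del x y h) = (hook u v (hook x y h))(x := x, y := y)"
    proof
      fix p
      have "del x y h p = (if p = x then x else if p = y then y else hook x y h p)"
        by (auto simp: del_def)
      then show "hook u v (del x y h) p = ((hook u v (hook x y h))(x := x, y := y)) p"
        using d nx by (auto simp: hook_def[of u v] du)
    qed
    also have "hook u v (hook x y h) = hook x y (hook u v h)"
      by (rule hook_hook_commute[OF True]) (use assms in auto)
    finally have e: "hook u v (del x y h) = del x y (hook u v h)"
      unfolding del_def[of x y "hook u v h"] .
    \<comment> \<open>Capping is a hook followed by erasing \<open>x\<close> and \<open>y\<close>.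
      The circle factors are therefore those of two far hooks and can be read off from the constant
      function.\<close>
    have "hook_op P x y (hook_op P u v (\<lambda>_. 1)) h = hook_op P u v (hook_op P x y (\<lambda>_. 1)) h"
      by (subst hook_op_far) (use assms in auto)
    then have "(if h x = y then circle_value else 1) * (if del x y h u = v then circle_value else 1) =
        (if h u = v then circle_value else 1) * (if hook u v h x = y then circle_value else 1)"
      using True hx hu by (simp add: hook_op_def du)
    then have "(if h x = y then circle_value else 1) * (if del x y h u = v then circle_value else 1) * \<Phi> (hook u v (del x y h)) =
        (if h u = v then circle_value else 1) * (if hook u v h x = y then circle_value else 1) * \<Phi> (del x y (hook u v h))"
      by (simp only: e)
    moreover have "circle_value ^ cap_circles [(x, y)] g = (if g x = y then circle_value else 1)" for g
      by simp
    ultimately show ?thesis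
      using True hu dx by (simp only: cap_op_def hook_op_def if_True caps.simps mult.assoc)
  qed (simp add: cap_op_def hook_op_def)
qed

text \<open>Generators at ends that stay open do not interfere with closing up the others. This is
  what moves a generator from the ends at a vertex into the diagrams on the edges.\<close>

lemma cap_op_hook_op:
  assumes "distinct (list_points L)" "set (list_points L) \<subseteq> P" "u \<in> P" "v \<in> P" "u \<noteq> v"
    "u \<notin> set (list_points L)" "v \<notin> set (list_points L)"
  shows "cap_op P L (hook_op (P - set (list_points L)) u v \<Phi>) = hook_op P u v (cap_op P L \<Phi>)"
  using assms
proof (induction L arbitrary: P rule: list_points.induct)
  case 1
  then have "matching P h \<Longrightarrow> matching P (hook u v h)" for h
    using matching_hook[of P h u v] by auto
  then show ?case by (auto simp: cap_op_def hook_op_def fun_eq_iff)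
next
  case (2 x y L)
  have "P - set (list_points ((x, y) # L)) = P - {x, y} - set (list_points L)"
    by auto
  then have "cap_op P ((x, y) # L) (hook_op (P - set (list_points ((x, y) # L))) u v \<Phi>) =
      cap_op P [(x, y)] (cap_op (P - {x, y}) L (hook_op (P - {x, y} - set (list_points L)) u v \<Phi>))"
    using 2 by (subst cap_op_Cons) auto
  also have "cap_op (P - {x, y}) L (hook_op (P - {x, y} - set (list_points L)) u v \<Phi>) =
      hook_op (P - {x, y}) u v (cap_op (P - {x, y}) L \<Phi>)"
    by (rule "2.IH") (use 2 in auto)
  also have "cap_op P [(x, y)] \<dots> = hook_op P u v (cap_op P [(x, y)] (cap_op (P - {x, y}) L \<Phi>))"
    by (rule cap_op_hook_op_1) (use 2 in auto)
  also have "cap_op P [(x, y)] (cap_op (P - {x, y}) L \<Phi>) = cap_op P ((x, y) # L) \<Phi>"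
    using 2 by (subst (2) cap_op_Cons) auto
  finally show ?case .
qed

lemma conn_gr_matching:
  assumes "matching R c" "u \<in> R"
  shows "conn (gr R c) u v \<longleftrightarrow> v = u \<or> v = c u"
proof
  assume "conn (gr R c) u v"
  then show "v = u \<or> v = c u"
  proof (induction rule: conn_induct)
    case (step v w)
    then show ?case
      using matchingD(1)[OF assms(1)] unfolding gr_iff by metis
  qed simp
next
  assume "v = u \<or> v = c u"
  then show "conn (gr R c) u v"
    using conn_gr[OF assms(2) order_refl] by auto
qed

lemma card_image_kernel:
  assumes "\<And>u v. u \<in> R \<Longrightarrow> v \<in> R \<Longrightarrow> f u = f v \<longleftrightarrow> g u = g v"
  shows "card (f ` R) = card (g ` R)"
proof (rule bij_betw_same_card)
  have *: "inv_into R f (f u) \<in> R \<and> g (inv_into R f (f u)) = g u" if "u \<in> R" for u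
    using assms[of "inv_into R f (f u)" u] that by (simp add: inv_into_into f_inv_into_f)
  show "bij_betw (\<lambda>y. g (inv_into R f y)) (f ` R) (g ` R)"
    unfolding bij_betw_def inj_on_def using * assms by (force simp: image_image)
qed


section \<open>Placing a matching inside another one\<close>

text \<open>One construction for several situations: the diagram of one edge inside a network, the
  lower diagram of a stack, a diagram next to a further strand and, with nothing around it, the
  transport of a matching along a bijection.\<close>

definition place :: "'q set \<Rightarrow> ('q \<Rightarrow> 'p) \<Rightarrow> ('p \<Rightarrow> 'p) \<Rightarrow> ('q \<Rightarrow> 'q) \<Rightarrow> 'p \<Rightarrow> 'p" where
  "place A \<phi> g f p = (if p \<in> \<phi> ` A then \<phi> (f (inv_into A \<phi> p)) else g p)"

context
  fixes A :: "'q set" and \<phi> :: "'q \<Rightarrow> 'p" and B :: "'p set" and g :: "'p \<Rightarrow> 'p"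
  assumes inj: "inj_on \<phi> A" and B: "matching B g" "B \<inter> \<phi> ` A = {}"
begin

lemma place_image: "i \<in> A \<Longrightarrow> place A \<phi> g f (\<phi> i) = \<phi> (f i)"
  using inj by (simp add: place_def)

lemma place_outside: "p \<notin> \<phi> ` A \<Longrightarrow> place A \<phi> g f p = g p"
  by (simp add: place_def)

lemma matching_place:
  assumes "matching A f"
  shows "matching (\<phi> ` A \<union> B) (place A \<phi> g f)"
proof -
  have "place A \<phi> g f (place A \<phi> g f p) = p \<and> (place A \<phi> g f p \<noteq> p \<longleftrightarrow> p \<in> \<phi> ` A \<union> B)" for p
  proof (cases "p \<in> \<phi> ` A")
    case True
    then obtain i where i: "i \<in> A" "p = \<phi> i" by auto
    then show ?thesis
      using matchingD[OF assms] inj by (simp add: place_image inj_on_eq_iff)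
  next
    case False
    then have "g p \<notin> \<phi> ` A"
      using matchingD[OF B(1)] B(2) by (metis disjoint_iff)
    then show ?thesis
      using False matchingD[OF B(1)] by (auto simp: place_outside)
  qed
  then show ?thesis by (simp add: matching_def)
qed

lemma hook_place:
  assumes "matching A f" "i \<in> A" "j \<in> A" "i \<noteq> j"
  shows "hook (\<phi> i) (\<phi> j) (place A \<phi> g f) = place A \<phi> g (hook i j f)"
proof
  fix p
  have ne: "\<phi> i \<noteq> \<phi> j" using assms inj by (simp add: inj_on_eq_iff)
  have h: "hook (\<phi> i) (\<phi> j) (place A \<phi> g f) p = (if p = \<phi> i then \<phi> j else if p = \<phi> j then \<phi> i else
      if p = \<phi> (f i) then \<phi> (f j) else if p = \<phi> (f j) then \<phi> (f i) else place A \<phi> g f p)"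
    using hook_apply[OF matching_place[OF assms(1)] _ _ ne, of p] assms by (auto simp: place_image)
  show "hook (\<phi> i) (\<phi> j) (place A \<phi> g f) p = place A \<phi> g (hook i j f) p"
  proof (cases "p \<in> \<phi> ` A")
    case True
    then obtain k where k: "k \<in> A" "p = \<phi> k" by auto
    have "f i \<in> A" "f j \<in> A" using matchingD(5)[OF assms(1)] assms by auto
    then show ?thesis
      unfolding h unfolding k(2) using k assms inj hook_apply[OF assms] by (simp add: place_image inj_on_eq_iff)
  next
    case False
    moreover have "p \<noteq> \<phi> i" "p \<noteq> \<phi> j" "p \<noteq> \<phi> (f i)" "p \<noteq> \<phi> (f j)"
      using False assms matchingD(5)[OF assms(1)] by auto
    ultimately show ?thesis
      unfolding h by (simp add: place_outside)
  qed
qed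

lemma hook_op_place:
  assumes "i \<in> A" "j \<in> A" "i \<noteq> j"
  shows "(\<lambda>f. if matching A f then hook_op (\<phi> ` A \<union> B) (\<phi> i) (\<phi> j) \<Psi> (place A \<phi> g f) else 0) =
    hook_op A i j (\<lambda>f. if matching A f then \<Psi> (place A \<phi> g f) else 0)"
proof
  fix f
  show "(if matching A f then hook_op (\<phi> ` A \<union> B) (\<phi> i) (\<phi> j) \<Psi> (place A \<phi> g f) else 0) =
    hook_op A i j (\<lambda>f. if matching A f then \<Psi> (place A \<phi> g f) else 0) f"
  proof (cases "matching A f")
    case True
    have "\<phi> (f i) = \<phi> j \<longleftrightarrow> f i = j"
      using True assms inj matchingD(5)[OF True, of i] by (simp add: inj_on_eq_iff)
    then show ?thesis
      using True assms matching_hook[OF True assms] matching_place[OF True]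
      by (simp add: hook_op_def hook_place place_image)
  qed (simp add: hook_op_def)
qed

lemma jwp_place:
  assumes "inj_on s {..<m}" "s ` {..<m} \<subseteq> A" "matching A f"
  shows "jwp (\<phi> ` A \<union> B) (\<lambda>i. \<phi> (s i)) m \<Psi> (place A \<phi> g f) =
    jwp A s m (\<lambda>f. if matching A f then \<Psi> (place A \<phi> g f) else 0) f"
proof -
  define T :: "(('p \<Rightarrow> 'p) \<Rightarrow> ratfun) \<Rightarrow> ('q \<Rightarrow> 'q) \<Rightarrow> ratfun"
    where "T \<Psi> = (\<lambda>f. if matching A f then \<Psi> (place A \<phi> g f) else 0)" for \<Psi>
  have "T (jwp (\<phi> ` A \<union> B) (\<lambda>i. \<phi> (s i)) m \<Psi>) = jwp A s m (T \<Psi>)"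
  proof (rule jw_intertwine)
    fix i \<Psi> assume i: "Suc i < m"
    have "s i \<in> A" "s (Suc i) \<in> A" "s i \<noteq> s (Suc i)"
      using assms(1,2) i inj_on_Suc[of s m i] by auto
    then show "T (strand_op (\<phi> ` A \<union> B) (\<lambda>i. \<phi> (s i)) i \<Psi>) = strand_op A s i (T \<Psi>)"
      unfolding T_def strand_op_def by (rule hook_op_place)
  qed (auto simp: T_def)
  then show ?thesis
    using assms(3) fun_cong[of _ _ f] by (fastforce simp: T_def)
qed

end

section \<open>Crossingless matchings\<close>

text \<open>Only ends with \<open>p < f p\<close> are tested here;
  \<open>noncrossing_between\<close> gives the form that is symmetric in the two ends of an
  arc.\<close>

definition noncrossing :: "(nat \<Rightarrow> nat) \<Rightarrow> bool" where
  "noncrossing f \<longleftrightarrow> (\<forall>p x. p < x \<and> x < f p \<longrightarrow> p < f x \<and> f x < f p)"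

definition between :: "nat \<Rightarrow> nat \<Rightarrow> nat \<Rightarrow> bool" where
  "between p q x \<longleftrightarrow> p < x \<and> x < q \<or> q < x \<and> x < p"

lemma noncrossing_between:
  assumes "matching P f"
  shows "noncrossing f \<longleftrightarrow> (\<forall>p x. x \<noteq> p \<longrightarrow> x \<noteq> f p \<longrightarrow> between p (f p) x = between p (f p) (f x))"
proof
  assume nc: "noncrossing f"
  show "\<forall>p x. x \<noteq> p \<longrightarrow> x \<noteq> f p \<longrightarrow> between p (f p) x = between p (f p) (f x)"
  proof (intro allI impI)
    fix p x
    note m = matchingD(1)[OF assms]
    have "p < x \<and> x < f p \<longleftrightarrow> p < f x \<and> f x < f p"
      using nc[unfolded noncrossing_def, rule_format, of p x] nc[unfolded noncrossing_def, rule_format, of p "f x"]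
      unfolding m by blast
    moreover have "f p < x \<and> x < p \<longleftrightarrow> f p < f x \<and> f x < p"
      using nc[unfolded noncrossing_def, rule_format, of "f p" x] nc[unfolded noncrossing_def, rule_format, of "f p" "f x"]
      unfolding m by blast
    ultimately show "between p (f p) x = between p (f p) (f x)"
      unfolding between_def by blast
  qed
next
  assume *: "\<forall>p x. x \<noteq> p \<longrightarrow> x \<noteq> f p \<longrightarrow> between p (f p) x = between p (f p) (f x)"
  show "noncrossing f"
    unfolding noncrossing_def
  proof (intro allI impI)
    fix p x assume "p < x \<and> x < f p"
    then show "p < f x \<and> f x < f p"
      using *[rule_format, of x p] unfolding between_def by auto
  qed
qed

lemma between_swap:
  "distinct [a, b, c, d] \<Longrightarrow> between a b c = between a b d \<longleftrightarrow> between c d a = between c d b"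
  unfolding between_def by (smt (verit) distinct_length_2_or_more linorder_neqE_nat less_trans order_less_asym)

text \<open>Another arc cannot separate the neighbours \<open>i\<close> and \<open>Suc i\<close>,
  hence it does not separate their partners either, and so does not cross the new arc between the
  partners. The new arc between the neighbours encloses nothing.\<close>

lemma noncrossing_hook:
  assumes f: "matching P f" and i: "i \<in> P" "Suc i \<in> P" and nc: "noncrossing f"
  shows "noncrossing (hook i (Suc i) f)"
proof -
  let ?g = "hook i (Suc i) f"
  let ?u = "f i" and ?v = "f (Suc i)"
  note m = matchingD[OF f]
  have g: "?g p = (if p = i then Suc i else if p = Suc i then i else if p = ?u then ?v else if p = ?v then ?u else f p)" for p
    using hook_apply[OF f i] by simp
  have B: "x \<noteq> p \<Longrightarrow> x \<noteq> f p \<Longrightarrow> between p (f p) x = between p (f p) (f x)" for p x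
    using nc noncrossing_between[OF f] by blast
  have adj: "between p q i = between p q (Suc i)" if "p \<noteq> i" "p \<noteq> Suc i" "q \<noteq> i" "q \<noteq> Suc i" for p q
    using that unfolding between_def by linarith
  have adj': "\<not> between i (Suc i) x" "\<not> between (Suc i) i x" for x
    unfolding between_def by auto
  have iu: "f x = i \<longleftrightarrow> x = ?u" "f x = Suc i \<longleftrightarrow> x = ?v" for x using m(1,4) by metis+
  have uv: "between p (f p) ?u = between p (f p) ?v"
    if "p \<noteq> i" "p \<noteq> Suc i" "p \<noteq> ?u" "p \<noteq> ?v" for p
  proof -
    have "f p \<noteq> i" "f p \<noteq> Suc i" using iu that by auto
    then show ?thesis
      using B[of i p] B[of "Suc i" p] adj[of p "f p"] that by simp
  qed
  have new: "between ?u ?v x = between ?u ?v (f x)"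
    if "x \<noteq> i" "x \<noteq> Suc i" "x \<noteq> ?u" "x \<noteq> ?v" "?u \<noteq> Suc i" for x
  proof -
    have "f x \<noteq> ?u" "f x \<noteq> ?v" "?u \<noteq> ?v" using that m(4) by auto
    show ?thesis
    proof (cases "x = f x")
      case False
      then have "distinct [?u, ?v, x, f x]"
        using that \<open>f x \<noteq> ?u\<close> \<open>f x \<noteq> ?v\<close> \<open>?u \<noteq> ?v\<close> by auto
      then show ?thesis
        using between_swap[of ?u ?v x "f x"] uv[of x] that by simp
    qed simp
  qed
  have bs: "between p q x = between q p x" for p q x by (auto simp: between_def)
  have "between p (?g p) x = between p (?g p) (?g x)" if x: "x \<noteq> p" "x \<noteq> ?g p" for p x
  proof (cases "p = i \<or> p = Suc i")
    case True
    then have "p = i \<and> ?g p = Suc i \<or> p = Suc i \<and> ?g p = i" using g[of p] by auto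
    then show ?thesis by (elim disjE conjE) (simp_all only: adj')
  next
    case False
    then have p: "p \<noteq> i" "p \<noteq> Suc i" by auto
    show ?thesis
    proof (cases "p = ?u \<or> p = ?v")
      case True
      have vi: "?u \<noteq> Suc i" "?v \<noteq> i" using True p iu by auto
      have pq: "p = ?u \<and> ?g p = ?v \<or> p = ?v \<and> ?g p = ?u"
        using True g p vi by auto
      have "between ?u ?v x = between ?u ?v (?g x)"
      proof (cases "x = i \<or> x = Suc i")
        case True
        have "?u \<noteq> i" "?v \<noteq> Suc i" using m(2) i by auto
        then have "between ?u ?v i = between ?u ?v (Suc i)"
          using vi by (intro adj) auto
        then show ?thesis using True g by auto
      next
        case False
        then show ?thesis using new[of x] vi x pq g by auto
      qed
      then show ?thesis using pq bs by metis
    next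
      case False
      then have gp: "?g p = f p" using g p by auto
      have fp: "f p \<noteq> i" "f p \<noteq> Suc i" using iu False by auto
      consider "x = i \<or> x = Suc i" | "x \<noteq> i" "x \<noteq> Suc i" "x = ?u \<or> x = ?v" | "x \<noteq> i" "x \<noteq> Suc i" "x \<noteq> ?u" "x \<noteq> ?v"
        by blast
      then show ?thesis
      proof cases
        case 1
        then show ?thesis
          using adj[OF p fp] g gp by auto
      next
        case 2
        then show ?thesis
          using uv[OF p] False g gp by auto
      next
        case 3
        then show ?thesis
          using B x g gp by auto
      qed
    qed
  qed
  then show ?thesis
    using noncrossing_between[OF matching_hook[OF f i]] by simp
qed

section \<open>Diagrams as sets of pairs and as involutions\<close>

definition nc_matchings :: "nat \<Rightarrow> (nat \<Rightarrow> nat) set" where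
  "nc_matchings k = {f. matching {..<k} f \<and> noncrossing f}"

text \<open>The inverse of \<open>gr\<close> on matchings; the default \<open>p\<close> follows the
  convention that a matching is the identity elsewhere.\<close>

definition mate :: "'p set set \<Rightarrow> 'p \<Rightarrow> 'p" where
  "mate D p = (if \<exists>q. q \<noteq> p \<and> {p, q} \<in> D then THE q. q \<noteq> p \<and> {p, q} \<in> D else p)"

lemma mate_gr:
  assumes "matching P f"
  shows "mate (gr P f) = f"
proof
  fix p
  have "q \<noteq> p \<and> {p, q} \<in> gr P f \<longleftrightarrow> p \<in> P \<and> q = f p" for q
    using matchingD[OF assms] unfolding gr_iff by metis
  then show "mate (gr P f) p = f p"
    using matchingD(3)[OF assms] by (simp add: mate_def)
qed

lemma gr_inj: "matching P f \<Longrightarrow> matching P g \<Longrightarrow> gr P f = gr P g \<longleftrightarrow> f = g"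
  by (metis mate_gr)

lemma gr_partition:
  assumes f: "matching P f"
  shows "partition_on P (gr P f)"
proof (rule partition_onI)
  show "\<Union> (gr P f) = P"
    using matchingD(5)[OF f] by (auto simp: gr_def)
  show "{} \<notin> gr P f"
    by (auto simp: gr_def)
  show "disjnt p q" if "p \<in> gr P f" "q \<in> gr P f" "p \<noteq> q" for p q
  proof -
    have "r = {z, f z}" if "r \<in> gr P f" "z \<in> r" for r z
      using that matchingD(1)[OF f] by (auto simp: gr_def)
    then show ?thesis
      using that unfolding disjnt_def by blast
  qed
qed

lemma crossingless_gr: "crossingless_matchings k = gr {..<k} ` nc_matchings k"
proof
  show "gr {..<k} ` nc_matchings k \<subseteq> crossingless_matchings k"
  proof
    fix M assume "M \<in> gr {..<k} ` nc_matchings k"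
    then obtain f where M: "M = gr {..<k} f" and f: "matching {..<k} f" "noncrossing f"
      by (auto simp: nc_matchings_def)
    note m = matchingD[OF f(1)]
    have "card p = 2" if "p \<in> M" for p
      using that m(2) unfolding M gr_def by (auto simp: card_2_iff)
    moreover have "\<not> ({a, c} \<in> M \<and> {b, d} \<in> M)" if "a < b" "b < c" "c < d" for a b c d
    proof
      assume "{a, c} \<in> M \<and> {b, d} \<in> M"
      then have "c = f a" "d = f b"
        using m(1) unfolding M gr_iff by metis+
      then show False
        using f(2)[unfolded noncrossing_def, rule_format, of a b] that by auto
    qed
    ultimately show "M \<in> crossingless_matchings k"
      unfolding crossingless_matchings_def using gr_partition[OF f(1)] M by blast
  qed
  show "crossingless_matchings k \<subseteq> gr {..<k} ` nc_matchings k"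
  proof
    fix M assume "M \<in> crossingless_matchings k"
    then have part: "partition_on {..<k} M" and card: "\<And>p. p \<in> M \<Longrightarrow> card p = 2"
      and nc: "\<And>a b c d. a < b \<Longrightarrow> b < c \<Longrightarrow> c < d \<Longrightarrow> \<not> ({a, c} \<in> M \<and> {b, d} \<in> M)"
      unfolding crossingless_matchings_def by blast+
    have uniq: "q = r" if "{p, q} \<in> M" "{p, r} \<in> M" for p q r
    proof -
      have "{p, q} = {p, r}"
        using disjointD[OF partition_onD2[OF part] that] by auto
      then show ?thesis by (metis doubleton_eq_iff)
    qed
    have ne: "p \<noteq> q" if "{p, q} \<in> M" for p q
      using card[OF that] by auto
    have ex: "\<exists>q. {p, q} \<in> M" if p: "p < k" for p
    proof -
      obtain C where C: "C \<in> M" "p \<in> C"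
        using p partition_onD1[OF part] by auto
      obtain a b where "C = {a, b}" using card[OF C(1)] by (auto simp: card_2_iff)
      then show ?thesis using C by (auto simp: insert_commute)
    qed
    have sub: "p < k" if "{p, q} \<in> M" for p q
      using that partition_onD1[OF part] by auto
    define f where "f = mate M"
    have f1: "{p, f p} \<in> M" if p: "p < k" for p
    proof -
      obtain q where q: "{p, q} \<in> M" using ex[OF p] by blast
      have "q' \<noteq> p \<and> {p, q'} \<in> M \<longleftrightarrow> q' = q" for q'
        using q ne uniq by metis
      then have "f p = q"
        unfolding f_def mate_def by simp
      then show ?thesis using q by simp
    qed
    have f2: "f p = p" if "\<not> p < k" for p
      using sub that unfolding f_def mate_def by auto
    have mf: "matching {..<k} f"
      unfolding matching_def using f1 f2 ne uniq sub by (metis insert_commute lessThan_iff)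
    have gf: "gr {..<k} f = M"
    proof
      show "gr {..<k} f \<subseteq> M" using f1 by (auto simp: gr_def)
      show "M \<subseteq> gr {..<k} f"
      proof
        fix C assume C: "C \<in> M"
        obtain a b where ab: "C = {a, b}" using card[OF C] by (auto simp: card_2_iff)
        then show "C \<in> gr {..<k} f"
          using C f1[of a] sub[of a b] uniq[of a b "f a"] by (auto simp: gr_def)
      qed
    qed
    have "noncrossing f"
      unfolding noncrossing_def
    proof (intro allI impI)
      fix p x assume px: "p < x \<and> x < f p"
      have p: "p < k" using f2[of p] px by (cases "p < k") auto
      have fp: "f p < k" using matchingD(5)[OF mf, of p] p by auto
      have x: "x < k" using px fp by simp
      have a: "{p, f p} \<in> M" "{x, f x} \<in> M" "{f x, x} \<in> M" using f1 p x by (auto simp: insert_commute)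
      have n: "f x \<noteq> p" "f x \<noteq> f p"
        using matchingD(1,4)[OF mf] px by (metis less_irrefl)+
      show "p < f x \<and> f x < f p"
        using nc[of p x "f p" "f x"] nc[of "f x" p x "f p"] a px n by (meson nat_neq_iff)
    qed
    then show "M \<in> gr {..<k} ` nc_matchings k"
      using mf gf by (auto simp: nc_matchings_def)
  qed
qed

lemma finite_nc_matchings: "finite (nc_matchings k)"
proof (rule finite_imageD)
  have "crossingless_matchings k \<subseteq> Pow (Pow {..<k})"
    by (auto simp: crossingless_matchings_def partition_on_def)
  then show "finite (gr {..<k} ` nc_matchings k)"
    unfolding crossingless_gr[symmetric] by (rule finite_subset) simp
  show "inj_on (gr {..<k}) (nc_matchings k)"
    by (auto simp: inj_on_def nc_matchings_def gr_inj)
qed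

lemma sum_crossingless: "(\<Sum>D\<in>crossingless_matchings k. F D) = (\<Sum>f\<in>nc_matchings k. F (gr {..<k} f))"
  unfolding crossingless_gr by (rule sum.reindex_cong[OF _ refl refl]) (auto simp: inj_on_def nc_matchings_def gr_inj)


section \<open>Stacking diagrams\<close>

definition stack_list :: "nat \<Rightarrow> ((bool \<times> nat) \<times> bool \<times> nat) list" where
  "stack_list m = map (\<lambda>j. ((False, 2 * m - 1 - j), (True, j))) [0..<m]"

lemma set_list_points: "set (list_points L) = fst ` set L \<union> snd ` set L"
  by (induction L rule: list_points.induct) auto

lemma distinct_list_points:
  "distinct (map fst L) \<Longrightarrow> distinct (map snd L) \<Longrightarrow> fst ` set L \<inter> snd ` set L = {} \<Longrightarrow> distinct (list_points L)"
  by (induction L rule: list_points.induct) (auto simp: set_list_points)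

lemma stack_list_points:
  "set (list_points (stack_list m)) = {False} \<times> {m..<2 * m} \<union> {True} \<times> {..<m}"
proof -
  have "(\<lambda>j. 2 * m - 1 - j) ` {..<m} = {m..<2 * m}"
  proof
    show "{m..<2 * m} \<subseteq> (\<lambda>j. 2 * m - 1 - j) ` {..<m}"
    proof
      fix i assume "i \<in> {m..<2 * m}"
      then show "i \<in> (\<lambda>j. 2 * m - 1 - j) ` {..<m}"
        by (intro image_eqI[of _ _ "2 * m - 1 - i"]) auto
    qed
  qed auto
  then have "Pair False ` (\<lambda>j. 2 * m - 1 - j) ` {..<m} = {False} \<times> {m..<2 * m}"
    by auto
  then show ?thesis
    by (auto simp: set_list_points stack_list_def image_image atLeast0LessThan)
qed

lemma stack_list_distinct: "distinct (list_points (stack_list m))"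
  by (rule distinct_list_points) (auto simp: stack_list_def o_def distinct_map inj_on_def)

lemma stack_outer_eq: "stack_points m - set (list_points (stack_list m)) = stack_outer m"
  unfolding stack_list_points by (auto simp: stack_points_def stack_outer_def)

lemma stack_list_subset: "set (list_points (stack_list m)) \<subseteq> stack_points m"
  unfolding stack_list_points by (auto simp: stack_points_def)

lemma finite_stack_points: "finite (stack_points m)"
  by (simp add: stack_points_def)

definition stacked :: "(nat \<Rightarrow> nat) \<Rightarrow> (nat \<Rightarrow> nat) \<Rightarrow> bool \<times> nat \<Rightarrow> bool \<times> nat" where
  "stacked f g p = (fst p, if fst p then g (snd p) else f (snd p))"

definition outer_point :: "nat \<Rightarrow> nat \<Rightarrow> bool \<times> nat" where
  "outer_point m i = (m \<le> i, i)"

definition outer_matching :: "nat \<Rightarrow> (bool \<times> nat \<Rightarrow> bool \<times> nat) \<Rightarrow> nat \<Rightarrow> nat" where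
  "outer_matching m c i = (if i < 2 * m then snd (c (outer_point m i)) else i)"

lemma outer_point_snd: "p \<in> stack_outer m \<Longrightarrow> outer_point m (snd p) = p \<and> snd p < 2 * m"
  by (auto simp: outer_point_def stack_outer_def)

lemma outer_point_image: "outer_point m ` {..<2 * m} = stack_outer m"
proof
  show "outer_point m ` {..<2 * m} \<subseteq> stack_outer m"
    by (auto simp: outer_point_def stack_outer_def)
  show "stack_outer m \<subseteq> outer_point m ` {..<2 * m}"
    by (metis outer_point_snd image_eqI lessThan_iff subsetI)
qed

lemma outer_point_eq: "outer_point m i = outer_point m j \<longleftrightarrow> i = j"
  by (auto simp: outer_point_def)

lemma outer_point_mem: "i < 2 * m \<Longrightarrow> outer_point m i \<in> stack_outer m"
  by (auto simp: outer_point_def stack_outer_def)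

lemma matching_stacked:
  assumes "matching {..<2 * m} f" "matching {..<2 * m} g"
  shows "matching (stack_points m) (stacked f g)"
  unfolding matching_def
proof
  fix p :: "bool \<times> nat"
  obtain b i where p: "p = (b, i)" by (cases p)
  show "stacked f g (stacked f g p) = p \<and> (stacked f g p \<noteq> p \<longleftrightarrow> p \<in> stack_points m)"
    using assms(1)[unfolded matching_def, rule_format, of i] assms(2)[unfolded matching_def, rule_format, of i]
    unfolding p by (cases b) (simp_all add: stacked_def stack_points_def)
qed

lemma stack_list_arcs: "list_arcs (stack_list m) = {{(False, 2 * m - 1 - j), (True, j)} | j. j < m}"
  unfolding list_arcs_def stack_list_def set_map image_image case_prod_conv setcompr_eq_image
  by (simp add: atLeast0LessThan lessThan_def)

lemma stack_arcs_gr: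
  "stack_arcs m (gr {..<2 * m} f) (gr {..<2 * m} g) = gr (stack_points m) (stacked f g) \<union> list_arcs (stack_list m)"
proof -
  have 1: "(\<lambda>p. Pair b ` p) ` gr {..<2 * m} h = {{p, stacked f g p} | p. p \<in> {b} \<times> {..<2 * m}}"
    if "h = (if b then g else f)" for b h
    using that unfolding gr_def stacked_def by (auto simp: image_iff) blast+
  have 2: "gr (stack_points m) (stacked f g) =
      {{p, stacked f g p} | p. p \<in> {False} \<times> {..<2 * m}} \<union> {{p, stacked f g p} | p. p \<in> {True} \<times> {..<2 * m}}"
    unfolding gr_def stack_points_def UNIV_bool by blast
  show ?thesis
    unfolding stack_arcs_def 2 stack_list_arcs using 1[of f False] 1[of g True] by simp
qed

context
  fixes m :: nat and c :: "bool \<times> nat \<Rightarrow> bool \<times> nat"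
  assumes c: "matching (stack_outer m) c"
begin

lemma outer_matching_point: "i < 2 * m \<Longrightarrow> c (outer_point m i) = outer_point m (outer_matching m c i)"
  using outer_point_snd[of "c (outer_point m i)" m] matchingD(5)[OF c, of "outer_point m i"] outer_point_mem[of i m]
  by (simp add: outer_matching_def)

lemma matching_outer_matching: "matching {..<2 * m} (outer_matching m c)"
  unfolding matching_def
proof (intro allI conjI)
  fix i
  show "outer_matching m c (outer_matching m c i) = i"
  proof (cases "i < 2 * m")
    case True
    have "c (outer_point m i) \<in> stack_outer m"
      using matchingD(5)[OF c] outer_point_mem[OF True] by simp
    then have i': "outer_matching m c i < 2 * m"
      using outer_point_snd True by (simp add: outer_matching_def)
    have "outer_point m (outer_matching m c (outer_matching m c i)) = c (c (outer_point m i))"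
      using outer_matching_point[OF True] outer_matching_point[OF i'] by simp
    then show ?thesis
      using matchingD(1)[OF c] by (simp add: outer_point_eq)
  qed (simp add: outer_matching_def)
  show "outer_matching m c i \<noteq> i \<longleftrightarrow> i \<in> {..<2 * m}"
  proof (cases "i < 2 * m")
    case True
    then show ?thesis
      using matchingD(2)[OF c outer_point_mem[OF True]] outer_matching_point[OF True] by auto
  qed (simp add: outer_matching_def)
qed

lemma outer_matching_eq: "i < 2 * m \<Longrightarrow> c (outer_point m i) = outer_point m j \<longleftrightarrow> outer_matching m c i = j"
  by (simp add: outer_matching_point outer_point_eq)

lemma hook_outer_matching:
  assumes "i < 2 * m" "j < 2 * m" "i \<noteq> j"
  shows "outer_matching m (hook (outer_point m i) (outer_point m j) c) = hook i j (outer_matching m c)"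
proof
  fix k
  note h = hook_apply[OF matching_outer_matching, of i j k]
  have lt: "outer_matching m c i < 2 * m" "outer_matching m c j < 2 * m"
    using matchingD(5)[OF matching_outer_matching] assms by auto
  show "outer_matching m (hook (outer_point m i) (outer_point m j) c) k = hook i j (outer_matching m c) k"
  proof (cases "k < 2 * m")
    case True
    have "hook (outer_point m i) (outer_point m j) c (outer_point m k) = outer_point m (hook i j (outer_matching m c) k)"
      using hook_apply[OF c, of "outer_point m i" "outer_point m j" "outer_point m k"] h assms True
        outer_point_mem[of _ m] by (simp add: outer_point_eq outer_matching_point)
    then show ?thesis
      using True by (simp add: outer_matching_def[of m "hook _ _ _"]) (simp add: outer_point_def)
  next
    case False
    then show ?thesis
      using h assms lt by (auto simp: outer_matching_def)
  qed
qed

end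

text \<open>Stacking is capping: the disjoint union of the two diagrams is closed up along the
  \<open>m\<close> arcs in the middle. A component that meets the outer points meets them in exactly
  one pair, an arc of the result, and the remaining components are the circles.\<close>

lemma stack_diagram_caps:
  assumes f: "matching {..<2 * m} f" and g: "matching {..<2 * m} g"
  defines "c \<equiv> caps (stack_list m) (stacked f g)"
  shows "matching (stack_outer m) c"
    and "stack_diagram m (gr {..<2 * m} f) (gr {..<2 * m} g) = gr {..<2 * m} (outer_matching m c)"
    and "stack_circles m (gr {..<2 * m} f) (gr {..<2 * m} g) = cap_circles (stack_list m) (stacked f g)"
proof -
  let ?P = "stack_points m" and ?R = "stack_outer m"
  let ?G = "gr ?P (stacked f g) \<union> list_arcs (stack_list m)"
  note sp = caps_spec[OF finite_stack_points matching_stacked[OF f g] stack_list_distinct stack_list_subset,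
      unfolded stack_outer_eq, folded c_def]
  have c: "matching ?R c" by (rule sp)
  then show "matching ?R c" .
  have sub: "?R \<subseteq> ?P" using stack_outer_eq[of m] by auto
  have conn: "conn ?G u v \<longleftrightarrow> v = u \<or> v = c u" if "u \<in> ?R" "v \<in> ?R" for u v
    using sp(3)[OF that] conn_gr_matching[OF c that(1)] by simp
  have inter: "cls ?G u \<inter> ?R = {u, c u}" if "u \<in> ?R" for u
  proof (intro set_eqI)
    fix v
    show "v \<in> cls ?G u \<inter> ?R \<longleftrightarrow> v \<in> {u, c u}"
      using conn[OF that, of v] that matchingD(5)[OF c, of u] by (cases "v \<in> ?R") (auto simp: cls_def)
  qed
  have meet: "{C \<in> components ?P ?G. C \<inter> ?R \<noteq> {}} = cls ?G ` ?R"
  proof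
    show "{C \<in> components ?P ?G. C \<inter> ?R \<noteq> {}} \<subseteq> cls ?G ` ?R"
    proof
      fix C assume "C \<in> {C \<in> components ?P ?G. C \<inter> ?R \<noteq> {}}"
      then obtain p u where "C = cls ?G p" "u \<in> C" "u \<in> ?R" by (auto simp: components_cls)
      then have "C = cls ?G u" by (simp add: cls_eq_iff) (simp add: cls_def)
      then show "C \<in> cls ?G ` ?R" using \<open>u \<in> ?R\<close> by auto
    qed
    show "cls ?G ` ?R \<subseteq> {C \<in> components ?P ?G. C \<inter> ?R \<noteq> {}}"
      using sub inter by (auto simp: components_cls)
  qed
  have "stack_diagram m (gr {..<2 * m} f) (gr {..<2 * m} g) = (\<lambda>C. snd ` (C \<inter> ?R)) ` {C \<in> components ?P ?G. C \<inter> ?R \<noteq> {}}"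
    unfolding stack_diagram_def stack_arcs_gr by auto
  also have "\<dots> = (\<lambda>u. snd ` {u, c u}) ` ?R"
    unfolding meet image_image using inter by (intro image_cong) auto
  also have "\<dots> = gr {..<2 * m} (outer_matching m c)"
  proof -
    have "snd ` {outer_point m i, c (outer_point m i)} = {i, outer_matching m c i}" if "i < 2 * m" for i
      using that outer_matching_point[OF c that] by (auto simp: outer_point_def)
    then show ?thesis
      unfolding outer_point_image[symmetric] image_image gr_def by auto
  qed
  finally show "stack_diagram m (gr {..<2 * m} f) (gr {..<2 * m} g) = gr {..<2 * m} (outer_matching m c)" .
  have "card (cls ?G ` ?R) = card (components ?R (gr ?R c))"
    unfolding components_cls by (rule card_image_kernel) (use sp(3) in \<open>simp add: cls_eq_iff\<close>)
  moreover have "card (components ?P ?G) = card {C \<in> components ?P ?G. C \<inter> ?R = {}} + card (cls ?G ` ?R)"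
    unfolding meet[symmetric] using finite_components[OF finite_stack_points, of m ?G]
    by (subst card_Un_disjoint[symmetric]) (auto intro!: arg_cong[of _ _ card])
  ultimately show "stack_circles m (gr {..<2 * m} f) (gr {..<2 * m} g) = cap_circles (stack_list m) (stacked f g)"
    using sp(2) by (simp add: stack_circles_def stack_arcs_gr)
qed

text \<open>The upper diagram \<open>g\<close> is fixed and the lower one varies, so that operators
  at the bottom can be moved past the stacking.\<close>

definition stack_op :: "nat \<Rightarrow> (nat \<Rightarrow> nat) \<Rightarrow> (nat \<Rightarrow> nat) operator" where
  "stack_op m g \<Phi> f = (if matching {..<2 * m} f
     then cap_op (stack_points m) (stack_list m) (\<lambda>c. \<Phi> (outer_matching m c)) (stacked f g) else 0)"

lemma stack_op_eq:
  assumes "matching {..<2 * m} f" "matching {..<2 * m} g"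
  shows "stack_op m g \<Phi> f = circle_value ^ stack_circles m (gr {..<2 * m} f) (gr {..<2 * m} g) *
    \<Phi> (outer_matching m (caps (stack_list m) (stacked f g)))"
  using assms matching_stacked[OF assms] by (simp add: stack_op_def cap_op_def stack_diagram_caps(3))

text \<open>The generator touches only bottom points of the lower diagram, which stay open while the
  middle is closed. To apply it there, \<open>stacked f g\<close> is seen as \<open>f\<close> placed
  into the upper diagram \<open>g0\<close>.\<close>

lemma stack_op_hook_op:
  assumes g: "matching {..<2 * m} g" and ij: "i < m" "j < m" "i \<noteq> j"
  shows "stack_op m g (hook_op {..<2 * m} i j \<Phi>) = hook_op {..<2 * m} i j (stack_op m g \<Phi>)"
proof -
  let ?P = "stack_points m" and ?R = "stack_outer m" and ?A = "{..<2 * m}"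
  let ?L = "stack_list m"
  define g0 where "g0 p = (fst p, if fst p then g (snd p) else snd p)" for p :: "bool \<times> nat"
  have B: "matching ({True} \<times> ?A) g0" "({True} \<times> ?A) \<inter> Pair False ` ?A = {}"
    using matchingD[OF g] unfolding matching_def g0_def by (auto simp: prod_eq_iff)
  have inj: "inj_on (Pair False) ?A" by (simp add: inj_on_def)
  have P: "Pair False ` ?A \<union> {True} \<times> ?A = ?P"
    unfolding stack_points_def UNIV_bool by auto
  have pl: "place ?A (Pair False) g0 f = stacked f g" if f: "matching ?A f" for f
  proof
    fix p
    show "place ?A (Pair False) g0 f p = stacked f g p"
    proof (cases "p \<in> Pair False ` ?A")
      case True
      then obtain k where k: "k < 2 * m" "p = (False, k)" by auto
      then show ?thesis using place_image[OF inj B, where i = k and f = f] by (simp add: stacked_def)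
    next
      case False
      then show ?thesis
        using matchingD(3)[OF f, of "snd p"] by (cases p) (auto simp: place_def stacked_def g0_def image_iff)
    qed
  qed
  have o: "outer_point m i = (False, i)" "outer_point m j = (False, j)"
    using ij by (auto simp: outer_point_def)
  have ext: "hook_op ?A i j \<Phi> (outer_matching m c) = hook_op ?R (False, i) (False, j) (\<lambda>c. \<Phi> (outer_matching m c)) c"
    if c: "matching ?R c" for c
    using c matching_outer_matching[OF c] outer_matching_eq[OF c, of i j] hook_outer_matching[OF c, of i j] ij
    by (simp add: hook_op_def o)
  have "cap_op ?P ?L (\<lambda>c. hook_op ?A i j \<Phi> (outer_matching m c)) h =
      cap_op ?P ?L (hook_op ?R (False, i) (False, j) (\<lambda>c. \<Phi> (outer_matching m c))) h" for h
    using ext caps_spec(1)[OF finite_stack_points _ stack_list_distinct stack_list_subset, of m h]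
    by (auto simp: cap_op_def stack_outer_eq)
  then have "cap_op ?P ?L (\<lambda>c. hook_op ?A i j \<Phi> (outer_matching m c)) =
      cap_op ?P ?L (hook_op ?R (False, i) (False, j) (\<lambda>c. \<Phi> (outer_matching m c)))"
    by blast
  also have "\<dots> = hook_op ?P (False, i) (False, j) (cap_op ?P ?L (\<lambda>c. \<Phi> (outer_matching m c)))"
    unfolding stack_outer_eq[symmetric]
    by (rule cap_op_hook_op[OF stack_list_distinct stack_list_subset])
      (use ij in \<open>auto simp: stack_list_points stack_points_def\<close>)
  finally have cap: "cap_op ?P ?L (\<lambda>c. hook_op ?A i j \<Phi> (outer_matching m c)) =
      hook_op ?P (False, i) (False, j) (cap_op ?P ?L (\<lambda>c. \<Phi> (outer_matching m c)))" .
  have "stack_op m g (hook_op ?A i j \<Phi>) = (\<lambda>f. if matching ?A f then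
      hook_op (Pair False ` ?A \<union> {True} \<times> ?A) (False, i) (False, j) (cap_op ?P ?L (\<lambda>c. \<Phi> (outer_matching m c)))
        (place ?A (Pair False) g0 f) else 0)"
    unfolding P stack_op_def cap using pl by auto
  also have "\<dots> = hook_op ?A i j (\<lambda>f. if matching ?A f then cap_op ?P ?L (\<lambda>c. \<Phi> (outer_matching m c)) (place ?A (Pair False) g0 f) else 0)"
    by (rule hook_op_place[OF inj B]) (use ij in auto)
  also have "(\<lambda>f. if matching ?A f then cap_op ?P ?L (\<lambda>c. \<Phi> (outer_matching m c)) (place ?A (Pair False) g0 f) else 0) = stack_op m g \<Phi>"
    unfolding stack_op_def using pl by auto
  finally show ?thesis .
qed

definition identity_matching :: "nat \<Rightarrow> nat \<Rightarrow> nat" where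
  "identity_matching m i = (if i < 2 * m then 2 * m - 1 - i else i)"

lemma matching_identity: "matching {..<2 * m} (identity_matching m)"
  unfolding matching_def identity_matching_def by auto presburger

lemma identity_nc: "identity_matching m \<in> nc_matchings (2 * m)"
  using matching_identity by (auto simp: nc_matchings_def noncrossing_def identity_matching_def split: if_splits)

lemma card_components_matching:
  assumes "finite P" "matching P f"
  shows "2 * card (components P (gr P f)) = card P"
  using circles_self[OF assms] by (simp add: circles_def)

text \<open>The strands of the identity only prolong those of \<open>g\<close>. Retracting the lower
  diagram onto the points of \<open>g\<close> preserves connectivity, and no circle can occur: there
  are \<open>m\<close> components altogether and already \<open>m\<close> through the outer
  points.\<close>

lemma stack_op_identity:
  assumes g: "matching {..<2 * m} g"
  shows "stack_op m g \<Phi> (identity_matching m) = \<Phi> g"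
proof -
  let ?P = "stack_points m" and ?R = "stack_outer m" and ?A = "{..<2 * m}"
  let ?I = "identity_matching m"
  let ?h = "stacked ?I g"
  let ?G = "gr ?P ?h \<union> list_arcs (stack_list m)" and ?T = "{True} \<times> ?A"
  let ?c = "caps (stack_list m) ?h"
  \<comment> \<open>A lower point goes to the upper point at which its strand arrives: the bottom
    point \<open>i\<close> and the point \<open>2 * m - 1 - i\<close> above it both go to
    \<open>(True, i)\<close>.\<close>
  define r :: "bool \<times> nat \<Rightarrow> bool \<times> nat"
    where "r p = (True, if \<not> fst p \<and> m \<le> snd p then 2 * m - 1 - snd p else snd p)" for p
  note sp = caps_spec[OF finite_stack_points matching_stacked[OF matching_identity g] stack_list_distinct stack_list_subset,
      unfolded stack_outer_eq]
  have mT: "matching ?T (\<lambda>p. if p \<in> ?T then ?h p else p)"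
    unfolding matching_def
  proof
    fix p :: "bool \<times> nat"
    obtain b i where p: "p = (b, i)" by (cases p)
    let ?k = "\<lambda>p. if p \<in> ?T then ?h p else p"
    show "?k (?k p) = p \<and> (?k p \<noteq> p \<longleftrightarrow> p \<in> ?T)"
      using g[unfolded matching_def, rule_format, of i] matchingD(5)[OF g, of i]
      unfolding p by (cases b) (simp_all add: stacked_def)
  qed
  have grT: "gr ?T (\<lambda>p. if p \<in> ?T then ?h p else p) = gr ?T ?h"
    unfolding gr_def setcompr_eq_image by (rule image_cong) simp_all
  have arc: "{p, q} \<in> list_arcs (stack_list m) \<longleftrightarrow> (\<exists>j. (p = (False, 2 * m - 1 - j) \<and> q = (True, j) \<or> p = (True, j) \<and> q = (False, 2 * m - 1 - j)) \<and> j < m)" for p q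
    unfolding stack_list_arcs by (simp only: doubleton_eq_iff mem_Collect_eq)
  have G1: "conn (gr ?T ?h) (r p) (r q)" if "{p, q} \<in> ?G" for p q
  proof -
    have step: "conn (gr ?T ?h) (r p) (r (?h p))" if "p \<in> ?P" for p
    proof (cases "fst p")
      case True
      then have "p \<in> ?T" "r p = p" "r (?h p) = ?h p"
        using that by (cases p; auto simp: stack_points_def r_def stacked_def)+
      then show ?thesis using conn_gr[of p ?T] by auto
    next
      case False
      then have "r p = r (?h p)"
        using that by (cases p) (auto simp: stack_points_def r_def stacked_def identity_matching_def)
      then show ?thesis by simp
    qed
    show ?thesis
      using that
    proof
      assume "{p, q} \<in> gr ?P ?h"
      then show ?thesis
        using step conn_sym unfolding gr_iff by metis
    next
      assume "{p, q} \<in> list_arcs (stack_list m)"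
      then obtain j where j: "j < m" "p = (False, 2 * m - 1 - j) \<and> q = (True, j) \<or> p = (True, j) \<and> q = (False, 2 * m - 1 - j)"
        unfolding arc by (elim exE conjE)
      have "r (False, 2 * m - 1 - j) = (True, j)" "r (True, j) = (True, j)"
        using j(1) by (simp_all add: r_def)
      then have "r p = r q"
        using j(2) by metis
      then show ?thesis by simp
    qed
  qed
  have G2: "conn ?G p (r p)" if pP: "p \<in> ?P" for p
  proof (cases "fst p")
    case True
    then have "r p = p" by (cases p) (auto simp: r_def)
    then show ?thesis by simp
  next
    case False
    then obtain i where i: "p = (False, i)" "i < 2 * m" using pP by (cases p) (auto simp: stack_points_def)
    have top: "conn ?G (False, 2 * m - 1 - j) (True, j)" if "j < m" for j
      by (rule conn_edge) (use arc that in blast)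
    show ?thesis
    proof (cases "i < m")
      case True
      have "conn ?G p (?h p)" by (rule conn_gr[OF pP]) auto
      moreover have "?h p = (False, 2 * m - 1 - i)"
        using i by (simp add: stacked_def identity_matching_def)
      ultimately have "conn ?G p (True, i)"
        using conn_trans[OF _ top[OF True], of p] by simp
      moreover have "r p = (True, i)"
        using True i by (simp add: r_def)
      ultimately show ?thesis by simp
    next
      case False
      then show ?thesis using top[of "2 * m - 1 - i"] i by (auto simp: r_def)
    qed
  qed
  have G3: "conn ?G p q" if "{p, q} \<in> gr ?T ?h" for p q
  proof (rule conn_edge)
    show "{p, q} \<in> ?G"
      using that unfolding gr_iff Un_iff stack_points_def by auto
  qed
  have "card (components ?P ?G) = card (components ?T (gr ?T ?h))"
  proof (rule card_components_retract[OF finite_stack_points _ G1 G2 G3])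
    show "r ` ?P = ?T"
    proof
      show "r ` ?P \<subseteq> ?T" by (auto simp: r_def stack_points_def)
      show "?T \<subseteq> r ` ?P"
      proof
        fix p assume "p \<in> ?T"
        then have "r p = p" "p \<in> ?P" by (auto simp: r_def stack_points_def)
        then show "p \<in> r ` ?P" by (metis imageI)
      qed
    qed
  qed auto
  moreover have "2 * card (components ?T (gr ?T ?h)) = 2 * m"
    using card_components_matching[OF _ mT] unfolding grT by simp
  moreover have "card ?R = 2 * m"
    unfolding outer_point_image[symmetric] by (subst card_image) (auto simp: inj_on_def outer_point_eq)
  then have "2 * card (components ?R (gr ?R ?c)) = 2 * m"
    using card_components_matching[OF _ sp(1)] outer_point_image[of m] by (metis finite_imageI finite_lessThan)
  ultimately have 0: "cap_circles (stack_list m) ?h = 0"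
    using sp(2) by linarith
  have "outer_matching m ?c i = g i" for i
  proof (cases "i < 2 * m")
    case True
    let ?j = "outer_matching m ?c i"
    note mo = matching_outer_matching[OF sp(1)]
    have j: "?j < 2 * m" "?j \<noteq> i" using matchingD(5)[OF mo, of i] matchingD(2)[OF mo, of i] True by auto
    have rP: "r (outer_point m k) = (True, k)" "outer_point m k \<in> ?P" if "k < 2 * m" for k
      using that by (auto simp: outer_point_def r_def stack_points_def)
    have "conn (gr ?R ?c) (outer_point m i) (outer_point m ?j)"
      using outer_matching_point[OF sp(1) True] conn_gr_matching[OF sp(1) outer_point_mem[OF True]] by simp
    then have "conn ?G (outer_point m i) (outer_point m ?j)"
      using sp(3)[OF outer_point_mem[OF True] outer_point_mem[OF j(1)]] by simp
    then have "conn (gr ?T ?h) (True, i) (True, ?j)"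
      using conn_map[of ?G _ _ "gr ?T ?h" r, OF _ G1] rP[OF True] rP[OF j(1)] by metis
    then have "(True, ?j) = (True, i) \<or> (True, ?j) = ?h (True, i)"
      unfolding grT[symmetric] using conn_gr_matching[OF mT, of "(True, i)" "(True, ?j)"] True by auto
    then show ?thesis using j by (simp add: stacked_def)
  next
    case False
    then show ?thesis using matchingD(3)[OF g, of i] by (simp add: outer_matching_def)
  qed
  then have "outer_matching m ?c = g" by auto
  then show ?thesis
    using matching_identity matching_stacked[OF matching_identity g] by (simp add: stack_op_def cap_op_def 0)
qed

section \<open>The Jones--Wenzl idempotents as operators\<close>

definition tl_sum :: "nat \<Rightarrow> tl \<Rightarrow> ((nat \<Rightarrow> nat) \<Rightarrow> ratfun) \<Rightarrow> ratfun" where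
  "tl_sum m x \<Phi> = (\<Sum>f\<in>nc_matchings (2 * m). x (gr {..<2 * m} f) * \<Phi> f)"

text \<open>\<open>x\<close> is obtained from the identity by \<open>T\<close>, which acts at the bottom and therefore commutes
  with stacking further diagrams on top.\<close>

definition represents :: "nat \<Rightarrow> (nat \<Rightarrow> nat) operator \<Rightarrow> tl \<Rightarrow> bool" where
  "represents m T x \<longleftrightarrow> (\<forall>\<Phi>. tl_sum m x \<Phi> = T \<Phi> (identity_matching m)) \<and>
     (\<forall>g \<Phi>. matching {..<2 * m} g \<longrightarrow> stack_op m g (T \<Phi>) = T (stack_op m g \<Phi>)) \<and>
     (\<forall>\<Phi> \<Psi>. (\<forall>f\<in>nc_matchings (2 * m). \<Phi> f = \<Psi> f) \<longrightarrow> (\<forall>f\<in>nc_matchings (2 * m). T \<Phi> f = T \<Psi> f))"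

lemma nc_matching: "f \<in> nc_matchings k \<Longrightarrow> matching {..<k} f"
  by (simp add: nc_matchings_def)

text \<open>For a fixed upper diagram \<open>g\<close>, summing over the lower ones gives
  \<open>T\<close> applied to \<open>stack_op m g \<Phi>\<close>, at the identity. \<open>T\<close>
  moves past the stacking, and stacking on the identity returns \<open>g\<close>. Products of
  diagrams thus become compositions of operators.\<close>

lemma tl_sum_mult:
  assumes T: "represents m T x"
  shows "tl_sum m (tl_mult m x y) \<Phi> = tl_sum m y (T \<Phi>)"
proof -
  let ?A = "{..<2 * m}" and ?N = "nc_matchings (2 * m)"
  \<comment> \<open>The product collects only noncrossing results of stacking, and the cutoff in
    \<open>\<Phi>'\<close> mirrors this.\<close>
  define \<Phi>' where "\<Phi>' f = (if f \<in> ?N then \<Phi> f else 0)" for f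
  let ?o = "\<lambda>f g. outer_matching m (caps (stack_list m) (stacked f g))"
  have diag: "stack_diagram m (gr ?A f) (gr ?A g) = gr ?A b \<longleftrightarrow> ?o f g = b"
    if "f \<in> ?N" "g \<in> ?N" "b \<in> ?N" for f g b
  proof -
    note s = stack_diagram_caps[OF nc_matching[OF that(1)] nc_matching[OF that(2)]]
    show ?thesis
      unfolding s(2) by (rule gr_inj[OF matching_outer_matching[OF s(1)] nc_matching[OF that(3)]])
  qed
  have "tl_sum m (tl_mult m x y) \<Phi> = (\<Sum>b\<in>?N. \<Sum>f\<in>?N. \<Sum>g\<in>?N.
      (if ?o f g = b then x (gr ?A f) * y (gr ?A g) * circle_value ^ stack_circles m (gr ?A f) (gr ?A g) * \<Phi> b else 0))"
    unfolding tl_sum_def tl_mult_def sum_crossingless sum_distrib_right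
    by (intro sum.cong refl) (simp add: diag)
  also have "\<dots> = (\<Sum>f\<in>?N. \<Sum>g\<in>?N. \<Sum>b\<in>?N.
      (if ?o f g = b then x (gr ?A f) * y (gr ?A g) * circle_value ^ stack_circles m (gr ?A f) (gr ?A g) * \<Phi> b else 0))"
    by (subst sum.swap) (intro sum.cong refl sum.swap)
  also have "\<dots> = (\<Sum>f\<in>?N. \<Sum>g\<in>?N. x (gr ?A f) * y (gr ?A g) * stack_op m g \<Phi>' f)"
    by (intro sum.cong refl) (simp add: stack_op_eq nc_matching \<Phi>'_def finite_nc_matchings)
  also have "\<dots> = (\<Sum>g\<in>?N. y (gr ?A g) * tl_sum m x (stack_op m g \<Phi>'))"
    unfolding tl_sum_def sum_distrib_left
    by (subst sum.swap) (intro sum.cong refl, simp add: mult.assoc mult.left_commute)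
  also have "\<dots> = (\<Sum>g\<in>?N. y (gr ?A g) * T \<Phi>' g)"
  proof (intro sum.cong refl)
    fix g assume "g \<in> ?N"
    then have g: "matching ?A g" by (rule nc_matching)
    have "tl_sum m x (stack_op m g \<Phi>') = T (stack_op m g \<Phi>') (identity_matching m)"
      using T unfolding represents_def by blast
    also have "T (stack_op m g \<Phi>') = stack_op m g (T \<Phi>')"
      using T g unfolding represents_def by metis
    finally show "y (gr ?A g) * tl_sum m x (stack_op m g \<Phi>') = y (gr ?A g) * T \<Phi>' g"
      by (simp only: stack_op_identity[OF g])
  qed
  also have "\<dots> = tl_sum m y (T \<Phi>)"
  proof -
    have "T \<Phi>' g = T \<Phi> g" if "g \<in> ?N" for g
      using T that unfolding represents_def by (metis \<Phi>'_def)
    then show ?thesis by (simp add: tl_sum_def)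
  qed
  finally show ?thesis .
qed

lemma tl_sum_basis:
  assumes "f \<in> nc_matchings (2 * m)"
  shows "tl_sum m (tl_basis (gr {..<2 * m} f)) \<Phi> = \<Phi> f"
proof -
  have "tl_sum m (tl_basis (gr {..<2 * m} f)) \<Phi> = (\<Sum>g\<in>nc_matchings (2 * m). if f = g then \<Phi> g else 0)"
    unfolding tl_sum_def tl_basis_def
    by (intro sum.cong refl) (use assms in \<open>auto simp: gr_inj nc_matching\<close>)
  then show ?thesis using assms by (simp add: finite_nc_matchings)
qed

lemma gr_identity: "gr {..<2 * m} (identity_matching m) = {{i, 2 * m - 1 - i} | i. i < m}"
proof
  show "gr {..<2 * m} (identity_matching m) \<subseteq> {{i, 2 * m - 1 - i} | i. i < m}"
  proof
    fix C assume "C \<in> gr {..<2 * m} (identity_matching m)"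
    then obtain i where i: "i < 2 * m" "C = {i, 2 * m - 1 - i}"
      by (auto simp: gr_def identity_matching_def)
    show "C \<in> {{i, 2 * m - 1 - i} | i. i < m}"
    proof (cases "i < m")
      case False
      then have "C = {2 * m - 1 - i, 2 * m - 1 - (2 * m - 1 - i)}" "2 * m - 1 - i < m"
        using i by auto
      then show ?thesis by blast
    qed (use i in auto)
  qed
  show "{{i, 2 * m - 1 - i} | i. i < m} \<subseteq> gr {..<2 * m} (identity_matching m)"
  proof
    fix C assume "C \<in> {{i, 2 * m - 1 - i} | i. i < m}"
    then obtain i where i: "i < m" "C = {i, 2 * m - 1 - i}" by blast
    then have "C = {i, identity_matching m i}" "i \<in> {..<2 * m}"
      by (auto simp: identity_matching_def)
    then show "C \<in> gr {..<2 * m} (identity_matching m)"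
      unfolding gr_def by blast
  qed
qed

lemma gr_image: "gr P f = (\<lambda>p. {p, f p}) ` P"
  by (simp only: gr_def setcompr_eq_image Collect_mem_eq)

lemma represents_one: "represents m (\<lambda>\<Phi>. \<Phi>) (tl_one m)"
  using tl_sum_basis[OF identity_nc[of m]] by (simp add: represents_def tl_one_def gr_identity)

lemma hook_op_agree:
  assumes "Suc i < k" "\<forall>f\<in>nc_matchings k. \<Phi> f = \<Psi> f"
  shows "\<forall>f\<in>nc_matchings k. hook_op {..<k} i (Suc i) \<Phi> f = hook_op {..<k} i (Suc i) \<Psi> f"
proof
  fix f assume f: "f \<in> nc_matchings k"
  then have "hook i (Suc i) f \<in> nc_matchings k"
    using assms(1) matching_hook[of "{..<k}" f i "Suc i"] noncrossing_hook[of "{..<k}" f i]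
    by (simp add: nc_matchings_def)
  then show "hook_op {..<k} i (Suc i) \<Phi> f = hook_op {..<k} i (Suc i) \<Psi> f"
    using assms(2) by (simp add: hook_op_def)
qed

lemma jw_agree:
  assumes "\<And>i \<Phi> \<Psi>. Suc i < m \<Longrightarrow> \<forall>f\<in>S. \<Phi> f = \<Psi> f \<Longrightarrow> \<forall>f\<in>S. e i \<Phi> f = e i \<Psi> f" "\<forall>f\<in>S. \<Phi> f = \<Psi> f"
  shows "\<forall>f\<in>S. jw e m \<Phi> f = jw e m \<Psi> f"
  using assms
proof (induction e m \<Phi> arbitrary: \<Psi> rule: jw.induct)
  case (3 e m \<Phi>)
  have e: "\<forall>f\<in>S. e i \<Phi> f = e i \<Psi> f" if "Suc i < Suc (Suc m)" "\<forall>f\<in>S. \<Phi> f = \<Psi> f" for i \<Phi> \<Psi>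
    by (rule "3.prems"(1)[OF that])
  have 1: "\<forall>f\<in>S. jw e (Suc m) \<Phi> f = jw e (Suc m) \<Psi> f"
    by (rule "3.IH"(1)) (use e "3.prems"(2) in auto)
  have "\<forall>f\<in>S. e m (jw e (Suc m) \<Phi>) f = e m (jw e (Suc m) \<Psi>) f"
    by (rule e) (use 1 in auto)
  then have "\<forall>f\<in>S. jw e (Suc m) (e m (jw e (Suc m) \<Phi>)) f = jw e (Suc m) (e m (jw e (Suc m) \<Psi>)) f"
    by (intro "3.IH"(3)) (use e in auto)
  then show ?case using 1 by simp
qed auto

abbreviation jwn :: "nat \<Rightarrow> nat \<Rightarrow> (nat \<Rightarrow> nat) operator" where
  "jwn m \<equiv> jwp {..<2 * m} (\<lambda>i. i)"

lemma linear_op_stack_op: "linear_op (stack_op m g)"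
  unfolding linear_op_def
proof
  fix f
  have "fcomb (\<lambda>\<Phi>. cap_op (stack_points m) (stack_list m) (\<lambda>c. \<Phi> (outer_matching m c)) (stacked f g))"
    unfolding cap_op_def
    by (cases "matching (stack_points m) (stacked f g)") (simp_all only: if_True if_False fcomb_mult fcomb_eval fcomb_zero)
  then show "fcomb (\<lambda>\<Phi>. stack_op m g \<Phi> f)"
    unfolding stack_op_def by (cases "matching {..<2 * m} f") (simp_all only: if_True if_False fcomb_zero)
qed

lemma represents_jwn:
  assumes "n \<le> m" "\<And>\<Phi>. tl_sum m x \<Phi> = jwn m n \<Phi> (identity_matching m)"
  shows "represents m (jwn m n) x"
  unfolding represents_def
proof (intro conjI allI impI)
  show "tl_sum m x \<Phi> = jwn m n \<Phi> (identity_matching m)" for \<Phi>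
    by (rule assms(2))
  show "stack_op m g (jwn m n \<Phi>) = jwn m n (stack_op m g \<Phi>)" if "matching {..<2 * m} g" for g \<Phi>
    by (rule jw_commute[OF linear_op_stack_op]) (use stack_op_hook_op[OF that] assms in \<open>simp add: strand_op_def\<close>)
  show "\<forall>f\<in>nc_matchings (2 * m). jwn m n \<Phi> f = jwn m n \<Psi> f" if "\<forall>f\<in>nc_matchings (2 * m). \<Phi> f = \<Psi> f" for \<Phi> \<Psi>
    by (rule jw_agree[OF _ that]) (use hook_op_agree assms in \<open>auto simp: strand_op_def\<close>)
qed

lemma gr_hook_identity:
  "gr {..<2 * (m + 2)} (hook m (m + 1) (identity_matching (m + 2))) =
    {{i, 2 * (m + 2) - 1 - i} | i. i < m} \<union> {{m, m + 1}, {m + 2, m + 3}}"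
proof -
  let ?g = "hook m (m + 1) (identity_matching (m + 2))"
  have g: "?g i = (if i = m then m + 1 else if i = m + 1 then m else if i = m + 3 then m + 2
      else if i = m + 2 then m + 3 else identity_matching (m + 2) i)" for i
    using hook_apply[OF matching_identity, of m "m + 2" "m + 1" i] by (simp add: identity_matching_def)
  have gi: "?g i = 2 * (m + 2) - 1 - i" if "i < m \<or> m + 4 \<le> i \<and> i < 2 * (m + 2)" for i
    by (subst g) (use that in \<open>auto simp: identity_matching_def\<close>)
  have "{..<2 * (m + 2)} = {..<m} \<union> {m + 4..<2 * (m + 2)} \<union> {m, m + 1, m + 2, m + 3}"
    by auto
  then have "gr {..<2 * (m + 2)} ?g = (\<lambda>i. {i, ?g i}) ` {..<m} \<union> (\<lambda>i. {i, ?g i}) ` {m + 4..<2 * (m + 2)} \<union>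
      (\<lambda>i. {i, ?g i}) ` {m, m + 1, m + 2, m + 3}"
    unfolding gr_image by (simp only: image_Un)
  also have "(\<lambda>i. {i, ?g i}) ` {..<m} = {{i, 2 * (m + 2) - 1 - i} | i. i < m}"
    unfolding setcompr_eq_image lessThan_def[symmetric]
  proof (intro image_cong refl)
    fix i assume "i \<in> {..<m}"
    then show "{i, ?g i} = {i, 2 * (m + 2) - 1 - i}"
      using gi[of i] by simp
  qed
  also have "(\<lambda>i. {i, ?g i}) ` {m + 4..<2 * (m + 2)} = {{i, 2 * (m + 2) - 1 - i} | i. i < m}"
  proof
    show "(\<lambda>i. {i, ?g i}) ` {m + 4..<2 * (m + 2)} \<subseteq> {{i, 2 * (m + 2) - 1 - i} | i. i < m}"
    proof
      fix C assume "C \<in> (\<lambda>i. {i, ?g i}) ` {m + 4..<2 * (m + 2)}"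
      then obtain i where i: "i \<in> {m + 4..<2 * (m + 2)}" "C = {i, ?g i}" by blast
      then have "C = {i, 2 * (m + 2) - 1 - i}"
        using gi[of i] by simp
      moreover have "2 * (m + 2) - 1 - (2 * (m + 2) - 1 - i) = i" "2 * (m + 2) - 1 - i < m"
        using i(1) by auto
      ultimately have "C = {2 * (m + 2) - 1 - i, 2 * (m + 2) - 1 - (2 * (m + 2) - 1 - i)}"
        by (metis insert_commute)
      then show "C \<in> {{i, 2 * (m + 2) - 1 - i} | i. i < m}"
        using \<open>2 * (m + 2) - 1 - i < m\<close> by blast
    qed
    show "{{i, 2 * (m + 2) - 1 - i} | i. i < m} \<subseteq> (\<lambda>i. {i, ?g i}) ` {m + 4..<2 * (m + 2)}"
    proof
      fix C assume "C \<in> {{i, 2 * (m + 2) - 1 - i} | i. i < m}"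
      then obtain i where i: "i < m" "C = {i, 2 * (m + 2) - 1 - i}" by blast
      define k where "k = 2 * (m + 2) - 1 - i"
      have k: "m + 4 \<le> k \<and> k < 2 * (m + 2)" "2 * (m + 2) - 1 - k = i"
        using i(1) by (auto simp: k_def)
      have "?g k = i" using gi[of k] k by simp
      moreover have "C = {i, k}" using i(2) unfolding k_def .
      ultimately have "C = {k, ?g k}"
        by (metis insert_commute)
      then show "C \<in> (\<lambda>i. {i, ?g i}) ` {m + 4..<2 * (m + 2)}"
        using k(1) by (intro image_eqI[of _ _ k]) auto
    qed
  qed
  also have "(\<lambda>i. {i, ?g i}) ` {m, m + 1, m + 2, m + 3} = {{m, m + 1}, {m + 2, m + 3}}"
  proof -
    have "?g m = m + 1" "?g (m + 1) = m" "?g (m + 2) = m + 3" "?g (m + 3) = m + 2"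
      by (subst g, simp)+
    then show ?thesis
      unfolding image_insert image_empty by (simp only: insert_commute insert_absorb2)
  qed
  finally show ?thesis by simp
qed

lemma represents_hook: "represents (m + 2) (hook_op {..<2 * (m + 2)} m (m + 1)) (tl_hook m)"
  unfolding represents_def
proof (intro conjI allI impI)
  let ?I = "identity_matching (m + 2)"
  have mh: "matching {..<2 * (m + 2)} (hook m (Suc m) ?I)"
    by (rule matching_hook[OF matching_identity]) auto
  have nh: "noncrossing (hook m (Suc m) ?I)"
    by (rule noncrossing_hook[OF matching_identity]) (use identity_nc[of "m + 2"] in \<open>auto simp: nc_matchings_def\<close>)
  have nc: "hook m (m + 1) ?I \<in> nc_matchings (2 * (m + 2))"
    using mh nh by (simp only: nc_matchings_def mem_Collect_eq Suc_eq_plus1)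
  have "?I m \<noteq> m + 1" by (simp add: identity_matching_def)
  then show "tl_sum (m + 2) (tl_hook m) \<Phi> = hook_op {..<2 * (m + 2)} m (m + 1) \<Phi> ?I" for \<Phi>
    unfolding tl_hook_def gr_hook_identity[symmetric] tl_sum_basis[OF nc]
    by (simp only: hook_op_def matching_identity if_True if_False mult_1_left)
  show "stack_op (m + 2) g (hook_op {..<2 * (m + 2)} m (m + 1) \<Phi>) = hook_op {..<2 * (m + 2)} m (m + 1) (stack_op (m + 2) g \<Phi>)"
    if "matching {..<2 * (m + 2)} g" for g \<Phi>
    by (rule stack_op_hook_op[OF that]) auto
  show "\<forall>f\<in>nc_matchings (2 * (m + 2)). hook_op {..<2 * (m + 2)} m (m + 1) \<Phi> f = hook_op {..<2 * (m + 2)} m (m + 1) \<Psi> f"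
    if "\<forall>f\<in>nc_matchings (2 * (m + 2)). \<Phi> f = \<Psi> f" for \<Phi> \<Psi>
    using hook_op_agree[OF _ that, of m] by simp
qed

section \<open>A further strand at the right of a diagram\<close>

definition shift_point :: "nat \<Rightarrow> nat \<Rightarrow> nat" where
  "shift_point m i = (if i < m then i else i + 2)"

definition extend_matching :: "nat \<Rightarrow> (nat \<Rightarrow> nat) \<Rightarrow> nat \<Rightarrow> nat" where
  "extend_matching m = place {..<2 * m} (shift_point m) (id(m := Suc m, Suc m := m))"

lemma shift_point_props:
  "inj_on (shift_point m) {..<2 * m}" "matching {m, Suc m} (id(m := Suc m, Suc m := m))"
  "{m, Suc m} \<inter> shift_point m ` {..<2 * m} = {}" "shift_point m ` {..<2 * m} \<union> {m, Suc m} = {..<2 * (Suc m)}"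
proof -
  show "inj_on (shift_point m) {..<2 * m}"
    by (auto simp: inj_on_def shift_point_def split: if_splits)
  show "matching {m, Suc m} (id(m := Suc m, Suc m := m))"
    by (auto simp: matching_def)
  show "{m, Suc m} \<inter> shift_point m ` {..<2 * m} = {}"
    by (auto simp: shift_point_def split: if_splits)
  show "shift_point m ` {..<2 * m} \<union> {m, Suc m} = {..<2 * (Suc m)}"
  proof
    show "{..<2 * (Suc m)} \<subseteq> shift_point m ` {..<2 * m} \<union> {m, Suc m}"
    proof
      fix i assume "i \<in> {..<2 * (Suc m)}"
      then have i: "i < 2 * m + 2" by simp
      consider "i < m" | "i = m \<or> i = Suc m" | "m + 2 \<le> i"
        by linarith
      then show "i \<in> shift_point m ` {..<2 * m} \<union> {m, Suc m}"
      proof cases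
        case 1
        then have "i = shift_point m i" "i < 2 * m" by (auto simp: shift_point_def)
        then show ?thesis by blast
      next
        case 3
        then have "i = shift_point m (i - 2)" "i - 2 < 2 * m" using i by (auto simp: shift_point_def)
        then show ?thesis by blast
      qed auto
    qed
  qed (auto simp: shift_point_def split: if_splits)
qed

lemma extend_matching_simps:
  "i < 2 * m \<Longrightarrow> extend_matching m f (shift_point m i) = shift_point m (f i)"
  "extend_matching m f m = Suc m" "extend_matching m f (Suc m) = m"
proof -
  note sp = shift_point_props[of m]
  show "i < 2 * m \<Longrightarrow> extend_matching m f (shift_point m i) = shift_point m (f i)"
    unfolding extend_matching_def by (rule place_image[OF sp(1-3)]) simp
  have "m \<notin> shift_point m ` {..<2 * m}" "Suc m \<notin> shift_point m ` {..<2 * m}"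
    using sp(3) by auto
  then show "extend_matching m f m = Suc m" "extend_matching m f (Suc m) = m"
    unfolding extend_matching_def using place_outside[OF sp(1-3)] by auto
qed

lemma matching_extend: "matching {..<2 * m} f \<Longrightarrow> matching {..<2 * (Suc m)} (extend_matching m f)"
  using matching_place[OF shift_point_props(1-3)] unfolding extend_matching_def shift_point_props(4) .

lemma gr_extend: "gr {..<2 * (Suc m)} (extend_matching m f) = add_strand m (gr {..<2 * m} f)"
proof -
  let ?g = "extend_matching m f"
  have "gr {..<2 * (Suc m)} ?g = (\<lambda>i. {i, ?g i}) ` (shift_point m ` {..<2 * m} \<union> {m, Suc m})"
    unfolding gr_image shift_point_props(4) ..
  also have "\<dots> = (\<lambda>i. {shift_point m i, ?g (shift_point m i)}) ` {..<2 * m} \<union> {{m, Suc m}}"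
    by (simp add: image_Un image_image extend_matching_simps insert_commute)
  also have "(\<lambda>i. {shift_point m i, ?g (shift_point m i)}) ` {..<2 * m} = (\<lambda>i. shift_point m ` {i, f i}) ` {..<2 * m}"
    by (intro image_cong) (auto simp: extend_matching_simps)
  finally show ?thesis
    unfolding add_strand_def gr_image image_image shift_point_def[abs_def] Suc_eq_plus1 .
qed

lemma extend_nc:
  assumes "f \<in> nc_matchings (2 * m)"
  shows "extend_matching m f \<in> nc_matchings (2 * (Suc m))"
proof -
  have f: "matching {..<2 * m} f" "noncrossing f" using assms by (auto simp: nc_matchings_def)
  let ?g = "extend_matching m f"
  note mg = matching_extend[OF f(1)]
  have mono: "shift_point m i < shift_point m j \<longleftrightarrow> i < j" for i j
    by (auto simp: shift_point_def)
  have cases: "(\<exists>i<2 * m. p = shift_point m i) \<or> p = m \<or> p = Suc m" if "p < 2 * (Suc m)" for p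
    using that shift_point_props(4)[of m] by auto
  have "noncrossing ?g"
    unfolding noncrossing_def
  proof (intro allI impI)
    fix p x assume px: "p < x \<and> x < ?g p"
    have p: "p < 2 * (Suc m)"
      using px matchingD(3)[OF mg, of p] by (cases "p < 2 * (Suc m)") auto
    have gp: "?g p < 2 * (Suc m)"
      using matchingD(5)[OF mg, of p] p by auto
    have x: "x < 2 * (Suc m)" using px gp by simp
    show "p < ?g x \<and> ?g x < ?g p"
      using cases[OF p]
    proof (elim disjE exE conjE)
      fix i assume i: "i < 2 * m" "p = shift_point m i"
      then have gp: "?g p = shift_point m (f i)" by (simp add: extend_matching_simps)
      show ?thesis
        using cases[OF x]
      proof (elim disjE exE conjE)
        fix k assume k: "k < 2 * m" "x = shift_point m k"
        then have "i < k" "k < f i" using px i gp mono by auto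
        then have "i < f k" "f k < f i" using f(2) unfolding noncrossing_def by blast+
        then show ?thesis using k i gp mono by (simp add: extend_matching_simps)
      next
        assume "x = m"
        then show ?thesis using px gp i by (auto simp: extend_matching_simps shift_point_def split: if_splits)
      next
        assume x: "x = Suc m"
        then have "?g x = m" using extend_matching_simps(3) by simp
        then show ?thesis using px gp i x by (auto simp: shift_point_def split: if_splits)
      qed
    next
      assume "p = m"
      then show ?thesis using px extend_matching_simps(2)[of m f] by auto
    next
      assume "p = Suc m"
      then show ?thesis using px extend_matching_simps(3)[of m f] by auto
    qed
  qed
  then show ?thesis using mg by (simp add: nc_matchings_def)
qed

lemma extend_identity: "extend_matching m (identity_matching m) = identity_matching (Suc m)"
proof
  fix p
  show "extend_matching m (identity_matching m) p = identity_matching (Suc m) p"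
  proof (cases "p < 2 * (Suc m)")
    case True
    then have "(\<exists>i<2 * m. p = shift_point m i) \<or> p = m \<or> p = Suc m"
      using shift_point_props(4)[of m] by auto
    then show ?thesis
    proof (elim disjE exE conjE)
      fix i assume i: "i < 2 * m" "p = shift_point m i"
      then have "extend_matching m (identity_matching m) p = shift_point m (identity_matching m i)"
        by (simp add: extend_matching_simps)
      then show ?thesis
        using i by (auto simp: identity_matching_def shift_point_def)
    qed (simp_all add: extend_matching_simps identity_matching_def)
  next
    case False
    then show ?thesis
      using matchingD(3)[OF matching_extend[OF matching_identity]] by (simp add: identity_matching_def)
  qed
qed

lemma tl_sum_add_strand: "tl_sum (Suc m) (tl_add_strand m x) \<Phi> = tl_sum m x (\<lambda>f. \<Phi> (extend_matching m f))"
proof -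
  let ?N = "nc_matchings (2 * m)" and ?N' = "nc_matchings (2 * (Suc m))"
  have "tl_sum (Suc m) (tl_add_strand m x) \<Phi> =
      (\<Sum>b\<in>?N'. \<Sum>f\<in>?N. if extend_matching m f = b then x (gr {..<2 * m} f) * \<Phi> b else 0)"
    unfolding tl_sum_def tl_add_strand_def sum_crossingless sum_distrib_right gr_extend[symmetric]
  proof (intro sum.cong refl)
    fix b f assume "b \<in> ?N'" "f \<in> ?N"
    then have "gr {..<2 * Suc m} (extend_matching m f) = gr {..<2 * Suc m} b \<longleftrightarrow> extend_matching m f = b"
      by (intro gr_inj nc_matching extend_nc)
    then show "(if gr {..<2 * Suc m} (extend_matching m f) = gr {..<2 * Suc m} b then x (gr {..<2 * m} f) else 0) * \<Phi> b =
        (if extend_matching m f = b then x (gr {..<2 * m} f) * \<Phi> b else 0)"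
      by (cases "extend_matching m f = b") (simp_all only: if_True if_False mult_zero_left simp_thms)
  qed
  also have "\<dots> = (\<Sum>f\<in>?N. \<Sum>b\<in>?N'. if extend_matching m f = b then x (gr {..<2 * m} f) * \<Phi> b else 0)"
    by (rule sum.swap)
  also have "\<dots> = tl_sum m x (\<lambda>f. \<Phi> (extend_matching m f))"
    unfolding tl_sum_def
  proof (intro sum.cong refl)
    fix f assume "f \<in> ?N"
    then show "(\<Sum>b\<in>?N'. if extend_matching m f = b then x (gr {..<2 * m} f) * \<Phi> b else 0) =
        x (gr {..<2 * m} f) * \<Phi> (extend_matching m f)"
      using extend_nc[of f m] by (simp only: sum.delta'[OF finite_nc_matchings] if_True)
  qed
  finally show ?thesis .
qed

text \<open>The box on the old strands becomes \<open>jwp\<close> at the shifted points, and the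
  shift does not move the points below \<open>m\<close>, on which this box sits.\<close>

lemma represents_add_strand:
  assumes "represents m (jwn m m) x"
  shows "represents (Suc m) (jwn (Suc m) m) (tl_add_strand m x)"
proof (rule represents_jwn)
  fix \<Phi>
  note sp = shift_point_props[of m]
  have "tl_sum (Suc m) (tl_add_strand m x) \<Phi> =
      tl_sum m x (\<lambda>f. if matching {..<2 * m} f then \<Phi> (extend_matching m f) else 0)"
    unfolding tl_sum_add_strand unfolding tl_sum_def by (intro sum.cong refl) (simp add: nc_matching)
  also have "\<dots> = jwn m m (\<lambda>f. if matching {..<2 * m} f then \<Phi> (extend_matching m f) else 0) (identity_matching m)"
    using assms by (simp add: represents_def)
  also have "\<dots> = jwp {..<2 * (Suc m)} (shift_point m) m \<Phi> (identity_matching (Suc m))"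
    using jwp_place[OF sp(1-3), of "\<lambda>i. i" m "identity_matching m" \<Phi>] matching_identity[of m]
    unfolding sp(4) by (simp only: extend_identity[symmetric] extend_matching_def) (auto simp: inj_on_def)
  also have "jwp {..<2 * (Suc m)} (shift_point m) m = jwn (Suc m) m"
    by (rule strand_op_cong) (simp add: shift_point_def)
  finally show "tl_sum (Suc m) (tl_add_strand m x) \<Phi> = jwn (Suc m) m \<Phi> (identity_matching (Suc m))" .
qed simp

text \<open>Induction along Wenzl's recursion: by \<open>tl_sum_mult\<close> the triple product of
  diagrams turns into the composition of operators in the recursion of \<open>jw\<close>.\<close>

lemma represents_jones_wenzl: "represents m (jwn m m) (jones_wenzl m)"
proof (induction m rule: jones_wenzl.induct)
  case 1
  show ?case
    by (rule represents_jwn) (use represents_one[of 0] in \<open>simp_all add: represents_def\<close>)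
next
  case 2
  show ?case
    by (rule represents_jwn) (use represents_one[of 1] in \<open>simp_all add: represents_def\<close>)
next
  case (3 m)
  let ?f = "tl_add_strand (m + 1) (jones_wenzl (Suc m))"
  let ?J = "jwn (m + 2) (Suc m)"
  have f: "represents (m + 2) ?J ?f"
    using represents_add_strand[of "m + 1" "jones_wenzl (Suc m)"] 3 by (simp add: add.commute)
  show ?case
  proof (rule represents_jwn)
    fix \<Phi>
    have "tl_sum (m + 2) (jones_wenzl (Suc (Suc m))) \<Phi> =
        tl_sum (m + 2) ?f \<Phi> - wenzl m * tl_sum (m + 2) (tl_mult (m + 2) ?f (tl_mult (m + 2) (tl_hook m) ?f)) \<Phi>"
      unfolding tl_sum_def sum_distrib_left
      by (simp add: Let_def wenzl_def left_diff_distrib sum_subtractf mult.assoc)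
    also have "\<dots> = ?J \<Phi> (identity_matching (m + 2)) -
        wenzl m * ?J (hook_op {..<2 * (m + 2)} m (m + 1) (?J \<Phi>)) (identity_matching (m + 2))"
      unfolding tl_sum_mult[OF f] tl_sum_mult[OF represents_hook] using f by (simp only: represents_def)
    finally show "tl_sum (Suc (Suc m)) (jones_wenzl (Suc (Suc m))) \<Phi> =
        jwn (Suc (Suc m)) (Suc (Suc m)) \<Phi> (identity_matching (Suc (Suc m)))"
      by (simp add: strand_op_def)
  qed simp
qed

lemma tl_jwn: "temperley_lieb (strand_op {..<2 * m} (\<lambda>i. i)) m"
  by (rule temperley_lieb_strand_op) auto

lemma represents_end_box: "represents (dcolor N d) (if trivalent_at N d then jwn (dcolor N d) (dcolor N d) else (\<lambda>\<Phi>. \<Phi>)) (end_box N d)"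
  using represents_jones_wenzl represents_one by (simp add: end_box_def)

text \<open>The boxes at the two ends are identities or equal to the box of the edge, so idempotence
  absorbs them.\<close>

lemma tl_sum_edge_box: "tl_sum (color N e) (edge_box N e) \<Phi> = jwn (color N e) (color N e) \<Phi> (identity_matching (color N e))"
proof -
  let ?m = "color N e"
  let ?J = "jwn ?m ?m"
  have JJ: "?J (?J \<Psi>) = ?J \<Psi>" for \<Psi>
    using temperley_lieb.jw_jw_right[OF tl_jwn, of ?m ?m] by simp
  have e: "represents ?m (if trivalent_at N (e, s) then ?J else (\<lambda>\<Phi>. \<Phi>)) (end_box N (e, s))" for s
    using represents_end_box[of N "(e, s)"] unfolding dcolor_def fst_conv .
  have "tl_sum ?m (end_box N (e, s)) \<Psi> = (if trivalent_at N (e, s) then ?J else (\<lambda>\<Phi>. \<Phi>)) \<Psi> (identity_matching ?m)" for s \<Psi>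
    using e unfolding represents_def by blast
  then show ?thesis
    unfolding edge_box_def tl_sum_mult[OF e] tl_sum_mult[OF represents_jones_wenzl] by (simp add: JJ)
qed

text \<open>A generator at the bottom is killed by the box itself. A generator at the top commutes
  with the box, slides along the identity to the bottom, and meets the box there from the other
  side.\<close>

lemma tl_sum_edge_box_kill:
  assumes "Suc i < color N e \<or> color N e \<le> i \<and> Suc i < 2 * color N e"
  shows "tl_sum (color N e) (edge_box N e) (hook_op {..<2 * color N e} i (Suc i) \<Phi>) = 0"
proof -
  let ?m = "color N e"
  let ?I = "identity_matching ?m"
  interpret temperley_lieb "strand_op {..<2 * ?m} (\<lambda>i. i)" ?m by (rule tl_jwn)
  have bottom: "jwn ?m ?m (hook_op {..<2 * ?m} j (Suc j) \<Psi>) = (\<lambda>_. 0)" "hook_op {..<2 * ?m} j (Suc j) (jwn ?m ?m \<Psi>) = (\<lambda>_. 0)"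
    if "Suc j < ?m" for j \<Psi>
    using jw_kills[OF that order_refl] by (simp_all add: strand_op_def)
  show ?thesis
  proof (cases "Suc i < ?m")
    case True
    then show ?thesis unfolding tl_sum_edge_box by (simp add: bottom)
  next
    case False
    then have i: "?m \<le> i" "Suc i < 2 * ?m" using assms by auto
    \<comment> \<open>Top points are numbered from right to left, so \<open>i\<close> and
      \<open>Suc i\<close> lie above \<open>Suc ?j\<close> and \<open>?j\<close>.\<close>
    let ?j = "2 * ?m - 2 - i"
    have j: "Suc ?j < ?m" using i by linarith
    have "jwn ?m ?m (hook_op {..<2 * ?m} i (Suc i) \<Phi>) = hook_op {..<2 * ?m} i (Suc i) (jwn ?m ?m \<Phi>)"
      by (rule jwp_hook_op_commute[symmetric]) (use i in auto)
    then have "tl_sum ?m (edge_box N e) (hook_op {..<2 * ?m} i (Suc i) \<Phi>) = hook_op {..<2 * ?m} i (Suc i) (jwn ?m ?m \<Phi>) ?I"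
      unfolding tl_sum_edge_box by simp
    also have "\<dots> = hook_op {..<2 * ?m} (?I i) (?I (Suc i)) (jwn ?m ?m \<Phi>) ?I"
      by (rule hook_op_slide[OF matching_identity]) (use i in \<open>auto simp: identity_matching_def\<close>)
    also have "\<dots> = 0"
    proof -
      have "?I i = Suc ?j" "?I (Suc i) = ?j"
        using i by (auto simp: identity_matching_def)
      then show ?thesis
        using bottom(2)[OF j, of \<Phi>] hook_op_commute[of "Suc ?j" ?j "{..<2 * ?m}"] by simp
    qed
    finally show ?thesis .
  qed
qed

section \<open>Planar pairs of permutations\<close>

definition perm :: "'p set \<Rightarrow> ('p \<Rightarrow> 'p) \<Rightarrow> bool" where
  "perm P s \<longleftrightarrow> finite P \<and> inj_on s P \<and> s ` P \<subseteq> P"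

definition cycles :: "'p set \<Rightarrow> ('p \<Rightarrow> 'p) \<Rightarrow> nat" where
  "cycles P s = card (components P (gr P s))"

text \<open>Genus zero for the hypermap with vertices \<open>s\<close>, edges \<open>t\<close> and faces \<open>s \<circ> t\<close>. The converse
  inequality holds for all permutations.\<close>

definition planar_pair :: "'p set \<Rightarrow> ('p \<Rightarrow> 'p) \<Rightarrow> ('p \<Rightarrow> 'p) \<Rightarrow> bool" where
  "planar_pair P s t \<longleftrightarrow> cycles P s + cycles P t + cycles P (s \<circ> t) \<ge> card P + 2 * card (components P (gr P s \<union> gr P t))"

lemma permD:
  assumes "perm P s"
  shows "finite P" "x \<in> P \<Longrightarrow> s x \<in> P" "x \<in> P \<Longrightarrow> y \<in> P \<Longrightarrow> s x = s y \<longleftrightarrow> x = y" "s ` P = P"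
proof -
  show "finite P" "x \<in> P \<Longrightarrow> s x \<in> P"
    using assms unfolding perm_def by blast+
  show "x \<in> P \<Longrightarrow> y \<in> P \<Longrightarrow> s x = s y \<longleftrightarrow> x = y"
    using assms unfolding perm_def by (meson inj_on_eq_iff)
  show "s ` P = P"
    using assms unfolding perm_def by (simp add: endo_inj_surj)
qed

lemma perm_comp:
  assumes "perm P s" "perm P t"
  shows "perm P (s \<circ> t)"
  unfolding perm_def inj_on_def
  using permD(1)[OF assms(1)] permD(2,3)[OF assms(1)] permD(2,3)[OF assms(2)] by auto

lemma conn_gr_le: "(\<And>p. p \<in> P \<Longrightarrow> conn H p (s p)) \<Longrightarrow> {u, v} \<in> gr P s \<Longrightarrow> conn H u v"
  unfolding gr_iff using conn_sym by metis
lemma gr_cong: "(\<And>p. p \<in> P \<Longrightarrow> s p = s' p) \<Longrightarrow> gr P s = gr P s'"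
  unfolding gr_image by (rule image_cong) auto

lemma planar_pair_cong:
  assumes "\<And>p. p \<in> P \<Longrightarrow> s p = s' p" "\<And>p. p \<in> P \<Longrightarrow> t p = t' p" "\<And>p. p \<in> P \<Longrightarrow> t p \<in> P"
  shows "planar_pair P s t \<longleftrightarrow> planar_pair P s' t'"
proof -
  have "gr P s = gr P s'" "gr P t = gr P t'" "gr P (s \<circ> t) = gr P (s' \<circ> t')"
    by (rule gr_cong; use assms in force)+
  then show ?thesis by (simp add: planar_pair_def cycles_def)
qed

lemma perm_cong: "(\<And>p. p \<in> P \<Longrightarrow> s p = s' p) \<Longrightarrow> perm P s \<longleftrightarrow> perm P s'"
  unfolding perm_def by (auto simp: inj_on_def)

text \<open>Composition with the transposition of \<open>x\<close> and \<open>y\<close> on the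
  right. For a permutation this joins two cycles or splits one.\<close>

definition swap_at :: "'p \<Rightarrow> 'p \<Rightarrow> ('p \<Rightarrow> 'q) \<Rightarrow> 'p \<Rightarrow> 'q" where
  "swap_at x y s = s(x := s y, y := s x)"

lemma swap_at_simps:
  "swap_at x y s x = s y" "swap_at x y s y = s x" "p \<noteq> x \<Longrightarrow> p \<noteq> y \<Longrightarrow> swap_at x y s p = s p"
  "swap_at x y (swap_at x y s) = s"
  by (auto simp: swap_at_def fun_eq_iff)

lemma perm_swap_at:
  assumes "perm P s" "x \<in> P" "y \<in> P"
  shows "perm P (swap_at x y s)"
  using permD[OF assms(1)] assms(2,3) unfolding perm_def swap_at_def inj_on_def by auto

lemma card_components_mono:
  assumes "finite P" "\<And>x y. {x, y} \<in> G \<Longrightarrow> conn H x y"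
  shows "card (components P H) \<le> card (components P G)"
  unfolding components_cls[of P G]
  by (rule card_components_le[OF assms(1)]) (use assms(2) in \<open>auto simp: cls_eq_iff intro: conn_mono\<close>)

lemma card_components_insert:
  assumes P: "finite P" "x \<in> P" "y \<in> P" and nc: "\<not> conn G x y"
  shows "card (components P G) = Suc (card (components P (insert {x, y} G)))"
proof -
  define f where "f v = (if conn G v y then cls G x else cls G v)" for v
  have "card (components P (insert {x, y} G)) = card (f ` P)"
  proof (rule card_components_eq[OF P(1)])
    fix u v assume "{u, v} \<in> insert {x, y} G"
    then consider "u = x" "v = y" | "u = y" "v = x" | "{u, v} \<in> G"
      by (auto simp: doubleton_eq_iff)
    then show "f u = f v"
    proof cases
      case 3
      then have uv: "conn G u v" by (rule conn_edge)
      then have "conn G u y \<longleftrightarrow> conn G v y" by (meson conn_sym conn_trans)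
      then show ?thesis using uv by (simp add: f_def cls_eq_iff)
    qed (use nc in \<open>auto simp: f_def\<close>)
  next
    let ?H = "insert {x, y} G"
    have GH: "conn ?H u v" if "conn G u v" for u v
      using that by (rule conn_mono) (simp add: conn_edge)
    have xy: "conn ?H x y" by (rule conn_edge) simp
    have r: "\<exists>r. f u = cls G r \<and> conn ?H u r" for u
    proof (cases "conn G u y")
      case True
      then show ?thesis using conn_trans[OF GH[OF True] conn_sym[OF xy]] by (auto simp: f_def)
    qed (auto simp: f_def)
    fix u v assume "f u = f v"
    then show "conn ?H u v"
      using r[of u] r[of v] by (metis GH cls_eq_iff conn_sym conn_trans)
  qed
  moreover have "components P G = insert (cls G y) (f ` P)"
  proof
    show "components P G \<subseteq> insert (cls G y) (f ` P)"
    proof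
      fix C assume "C \<in> components P G"
      then obtain v where v: "v \<in> P" "C = cls G v" by (auto simp: components_cls)
      show "C \<in> insert (cls G y) (f ` P)"
      proof (cases "conn G v y")
        case True
        then show ?thesis using v by (simp add: cls_eq_iff)
      next
        case False
        then have "C = f v" using v by (simp add: f_def)
        then show ?thesis using v by blast
      qed
    qed
    have "f v \<in> components P G" if "v \<in> P" for v
      using that P(2) by (simp add: f_def components_cls)
    then show "insert (cls G y) (f ` P) \<subseteq> components P G"
      using P(3) by (auto simp: components_cls)
  qed
  moreover have "cls G y \<notin> f ` P"
    using nc by (auto simp: f_def cls_eq_iff conn_sym split: if_splits)
  ultimately show ?thesis
    using P(1) by simp
qed

lemma card_components_insert_le:
  assumes "finite P" "x \<in> P" "y \<in> P"
  shows "card (components P G) \<le> Suc (card (components P (insert {x, y} G)))"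
proof (cases "conn G x y")
  case True
  have "card (components P G) \<le> card (components P (insert {x, y} G))"
    by (rule card_components_mono[OF assms(1)])
      (use True in \<open>auto simp: doubleton_eq_iff intro: conn_edge conn_sym\<close>)
  then show ?thesis by simp
qed (simp add: card_components_insert[OF assms])

text \<open>Otherwise the points reached from \<open>s y\<close> without stepping off from
  \<open>x\<close> or \<open>y\<close> form a finite set that \<open>s\<close> maps into itself,
  hence onto itself. It contains \<open>s y\<close>, and therefore \<open>y\<close>.\<close>

lemma cycle_return:
  assumes s: "perm P s" and xy: "x \<in> P" "y \<in> P" and nc: "\<not> conn (gr P s) x y"
  shows "conn (gr (P - {x, y}) s) (s y) y"
proof (rule ccontr)
  let ?G = "gr (P - {x, y}) s"
  assume no: "\<not> conn ?G (s y) y"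
  define C where "C = {v \<in> P. conn ?G (s y) v}"
  have sub: "conn (gr P s) u v" if "conn ?G u v" for u v
    using that by (rule conn_mono) (auto simp: gr_iff intro!: conn_edge)
  have y: "conn (gr P s) y (s y)" by (rule conn_gr[OF xy(2) order_refl])
  have C: "v \<noteq> y \<and> v \<noteq> x" if "v \<in> C" for v
  proof -
    have v: "conn ?G (s y) v" using that by (simp add: C_def)
    have "conn (gr P s) y v" by (rule conn_trans[OF y sub[OF v]])
    then show ?thesis
      using v no nc conn_sym[of "gr P s" y v] by auto
  qed
  have "s ` C \<subseteq> C"
  proof
    fix w assume "w \<in> s ` C"
    then obtain v where v: "v \<in> C" "w = s v" by blast
    then have "v \<in> P - {x, y}" using C unfolding C_def by blast
    then have "conn ?G v (s v)" by (rule conn_gr) simp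
    moreover have "conn ?G (s y) v" "v \<in> P"
      using v(1) by (auto simp: C_def)
    ultimately show "w \<in> C"
      using conn_trans[of ?G "s y" v "s v"] permD(2)[OF s] v(2) by (simp add: C_def)
  qed
  moreover have "inj_on s C" "finite C"
    using s unfolding perm_def C_def by (auto simp: inj_on_def)
  ultimately have "s ` C = C"
    using endo_inj_surj by blast
  moreover have "s y \<in> C" using permD(2)[OF s] xy by (simp add: C_def)
  ultimately obtain v where "v \<in> C" "s v = s y" by (metis imageE)
  then have "v = y" using permD(3)[OF s] xy unfolding C_def by blast
  then show False using C \<open>v \<in> C\<close> by blast
qed

text \<open>With the two images exchanged, the arrows run through one cycle and then through the
  other; \<open>cycle_return\<close> shows that each is traversed completely.\<close>

lemma cycles_merge:
  assumes s: "perm P s" and xy: "x \<in> P" "y \<in> P" and nc: "\<not> conn (gr P s) x y"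
  shows "cycles P s = Suc (cycles P (swap_at x y s))"
proof -
  let ?G = "gr P (swap_at x y s)" and ?H = "insert {x, y} (gr P s)"
  have ne: "x \<noteq> y" using nc by auto
  have fin: "finite P" using s by (rule permD)
  have sub: "conn ?G u v" if "conn (gr (P - {x, y}) s) u v" for u v
    using that by (rule conn_mono) (auto simp: gr_iff swap_at_simps intro!: conn_edge)
  have nc': "\<not> conn (gr P s) y x" using nc conn_sym by metis
  have xs: "conn ?G x (s y)" "conn ?G y (s x)"
    using conn_gr[of x P "swap_at x y s"] conn_gr[of y P "swap_at x y s"] xy by (auto simp: swap_at_simps)
  have "conn ?G (s y) y" using sub[OF cycle_return[OF s xy nc]] .
  have "conn ?G (s x) x"
    using sub cycle_return[OF s xy(2,1) nc'] by (metis insert_commute)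
  then have xsx: "conn ?G x y" "conn ?G x (s x)" "conn ?G y (s y)"
    using xs \<open>conn ?G (s y) y\<close> by (meson conn_sym conn_trans)+
  have "conn ?G u (s u)" if "u \<in> P" for u
    using conn_gr[OF that, of "swap_at x y s" ?G] xsx by (cases "u = x"; cases "u = y") (auto simp: swap_at_simps)
  then have "conn ?G u v" if "{u, v} \<in> gr P s" for u v
    using conn_gr_le that by metis
  then have HG: "conn ?G u v" if "{u, v} \<in> ?H" for u v
    using that xsx(1) conn_sym[OF xsx(1)] by (auto simp: doubleton_eq_iff)
  have "conn ?H u (swap_at x y s u)" if "u \<in> P" for u
  proof -
    have e: "conn ?H v (s v)" if "v \<in> P" for v
      by (rule conn_gr[OF that]) auto
    have xy': "conn ?H x y" by (rule conn_edge) simp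
    show ?thesis
      using e[OF that] conn_trans[OF xy' e[OF xy(2)]] conn_trans[OF conn_sym[OF xy'] e[OF xy(1)]]
      by (cases "u = y"; cases "u = x") (auto simp: swap_at_simps)
  qed
  then have GH: "conn ?H u v" if "{u, v} \<in> ?G" for u v
    using conn_gr_le that by metis
  have "card (components P ?H) = card (components P ?G)"
    by (rule card_components_cong[OF fin HG GH])
  then show ?thesis
    using card_components_insert[OF fin xy nc] by (simp add: cycles_def)
qed

lemma cycles_swap_ge:
  assumes s: "perm P s" and xy: "x \<in> P" "y \<in> P"
  shows "cycles P s \<le> Suc (cycles P (swap_at x y s))"
proof -
  let ?H = "insert {x, y} (gr P s)"
  have fin: "finite P" using s by (rule permD)
  have "conn ?H u (swap_at x y s u)" if "u \<in> P" for u
  proof -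
    have e: "conn ?H v (s v)" if "v \<in> P" for v
      by (rule conn_gr[OF that]) auto
    have xy': "conn ?H x y" by (rule conn_edge) simp
    show ?thesis
      using e[OF that] conn_trans[OF xy' e[OF xy(2)]] conn_trans[OF conn_sym[OF xy'] e[OF xy(1)]]
      by (cases "u = y"; cases "u = x") (auto simp: swap_at_simps)
  qed
  then have "card (components P ?H) \<le> card (components P (gr P (swap_at x y s)))"
    by (intro card_components_mono[OF fin]) (metis conn_gr_le)
  then show ?thesis
    using card_components_insert_le[OF fin xy, of "gr P s"] by (simp add: cycles_def)
qed

text \<open>\<open>s\<close> gains one cycle. If \<open>x\<close> and \<open>y\<close> stay
  connected, \<open>s \<circ> t\<close> loses at most one cycle and no component is added. If they
  get disconnected, \<open>s \<circ> t\<close> gains a cycle too, and the two gains pay for the new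
  component, which counts twice.\<close>

lemma planar_pair_split:
  assumes st: "planar_pair P s t" "perm P s" "perm P t" and xy: "x \<in> P" "y \<in> P"
    and nc: "\<not> conn (gr P (swap_at x y s)) x y"
  shows "planar_pair P (swap_at x y s) t"
proof -
  let ?s = "swap_at x y s"
  let ?G = "gr P s \<union> gr P t" and ?G' = "gr P ?s \<union> gr P t"
  have s': "perm P ?s" by (rule perm_swap_at[OF st(2) xy])
  have fin: "finite P" using s' by (rule permD)
  have z: "cycles P ?s = Suc (cycles P s)"
    using cycles_merge[OF s' xy nc] by (simp add: swap_at_simps)
  \<comment> \<open>Swapping \<open>s\<close> at \<open>x\<close> and \<open>y\<close> amounts to
    swapping \<open>s \<circ> t\<close> at their preimages under \<open>t\<close>.\<close>
  obtain x0 y0 where x0: "x0 \<in> P" "t x0 = x" and y0: "y0 \<in> P" "t y0 = y"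
    using permD(4)[OF st(3)] xy by (metis imageE)
  have comp: "perm P (s \<circ> t)" "perm P (?s \<circ> t)"
    using perm_comp st s' by blast+
  have sw: "\<forall>p\<in>P. (?s \<circ> t) p = swap_at x0 y0 (s \<circ> t) p"
    using x0 y0 permD(3)[OF st(3)] by (auto simp: swap_at_def)
  have zsw: "cycles P (?s \<circ> t) = cycles P (swap_at x0 y0 (s \<circ> t))"
    unfolding cycles_def using gr_cong[of P "?s \<circ> t" "swap_at x0 y0 (s \<circ> t)"] sw by simp
  have eG': "conn ?G' p (?s p)" "conn ?G' p (t p)" if "p \<in> P" for p
    by (rule conn_gr[OF that]; auto)+
  show ?thesis
  proof (cases "conn ?G' x y")
    case True
    have sG: "conn ?G' p (s p)" if "p \<in> P" for p
      using eG'(1)[OF that] conn_trans[OF True eG'(1)[OF xy(2)]] conn_trans[OF conn_sym[OF True] eG'(1)[OF xy(1)]]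
      by (cases "p = x"; cases "p = y") (auto simp: swap_at_simps)
    have "card (components P ?G') \<le> card (components P ?G)"
      by (rule card_components_mono[OF fin]) (metis conn_gr_le sG eG'(2) Un_iff)
    moreover have "cycles P (s \<circ> t) \<le> Suc (cycles P (?s \<circ> t))"
      using cycles_swap_ge[OF comp(1) x0(1) y0(1)] zsw by simp
    ultimately show ?thesis
      using st(1) z unfolding planar_pair_def by linarith
  next
    case False
    let ?H = "insert {x, y} ?G'"
    have xyH: "conn ?H x y" by (rule conn_edge) simp
    have eH: "conn ?H p (?s p)" "conn ?H p (t p)" if "p \<in> P" for p
      by (rule conn_gr[OF that]; auto)+
    have sH: "conn ?H p (s p)" if "p \<in> P" for p
      using eH(1)[OF that] conn_trans[OF xyH eH(1)[OF xy(2)]] conn_trans[OF conn_sym[OF xyH] eH(1)[OF xy(1)]]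
      by (cases "p = x"; cases "p = y") (auto simp: swap_at_simps)
    have "card (components P ?H) \<le> card (components P ?G)"
      by (rule card_components_mono[OF fin]) (metis conn_gr_le sH eH(2) Un_iff)
    then have C: "card (components P ?G') \<le> Suc (card (components P ?G))"
      using card_components_insert[OF fin xy False] by simp
    have stG: "conn ?G' p ((?s \<circ> t) p)" if "p \<in> P" for p
      using conn_trans[OF eG'(2)[OF that] eG'(1)[of "t p"]] permD(2)[OF st(3) that] by simp
    have "\<not> conn (gr P (?s \<circ> t)) x0 y0"
    proof
      assume "conn (gr P (?s \<circ> t)) x0 y0"
      then have "conn ?G' x0 y0"
        by (rule conn_mono) (metis conn_gr_le stG)
      moreover have "conn ?G' x0 x" "conn ?G' y0 y"
        using eG'(2)[OF x0(1)] eG'(2)[OF y0(1)] x0 y0 by auto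
      ultimately show False
        using False by (meson conn_sym conn_trans)
    qed
    then have "cycles P (?s \<circ> t) = Suc (cycles P (swap_at x0 y0 (?s \<circ> t)))"
      by (rule cycles_merge[OF comp(2) x0(1) y0(1)])
    moreover have "cycles P (swap_at x0 y0 (?s \<circ> t)) = cycles P (s \<circ> t)"
      unfolding cycles_def
      using gr_cong[of P "swap_at x0 y0 (?s \<circ> t)" "s \<circ> t"] x0 y0 permD(3)[OF st(3)] by (auto simp: swap_at_def)
    ultimately show ?thesis
      using st(1) z C unfolding planar_pair_def by linarith
  qed
qed

text \<open>\<open>t\<close> carries the cycles of \<open>s \<circ> t\<close> to those of
  \<open>t \<circ> s\<close>, and the other terms are symmetric. So the surgery on the first
  permutation is available for the second one too.\<close>

lemma planar_pair_sym:
  assumes "planar_pair P s t" "perm P s" "perm P t"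
  shows "planar_pair P t s"
proof -
  have eq: "cycles P (s \<circ> t) = card ((\<lambda>p. cls (gr P (t \<circ> s)) (t p)) ` P)"
    unfolding cycles_def
  proof (rule card_components_eq)
    show "finite P" using assms(2) by (rule permD)
    have step: "conn (gr P (t \<circ> s)) (t p) (t (s (t p)))" if "p \<in> P" for p
      using conn_gr[of "t p" P "t \<circ> s"] permD(2)[OF assms(3) that] by simp
    show "cls (gr P (t \<circ> s)) (t x) = cls (gr P (t \<circ> s)) (t y)" if "{x, y} \<in> gr P (s \<circ> t)" for x y
      using that step conn_sym unfolding cls_eq_iff gr_iff by (metis comp_apply)
    fix x y assume xy: "x \<in> P" "y \<in> P" "cls (gr P (t \<circ> s)) (t x) = cls (gr P (t \<circ> s)) (t y)"
    have step': "conn (gr P (s \<circ> t)) (s p) (s (t (s p)))" if "p \<in> P" for p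
      using conn_gr[of "s p" P "s \<circ> t"] permD(2)[OF assms(2) that] by simp
    have "conn (gr P (s \<circ> t)) (s (t x)) (s (t y))"
      using xy(3) unfolding cls_eq_iff
    proof (rule conn_map)
      fix u v assume "{u, v} \<in> gr P (t \<circ> s)"
      then show "conn (gr P (s \<circ> t)) (s u) (s v)"
        unfolding gr_iff using step' conn_sym by (metis comp_apply)
    qed
    moreover have "conn (gr P (s \<circ> t)) p (s (t p))" if "p \<in> P" for p
      using conn_gr[OF that, of "s \<circ> t"] by simp
    ultimately show "conn (gr P (s \<circ> t)) x y"
      using xy by (meson conn_sym conn_trans)
  qed
  have "(\<lambda>p. cls (gr P (t \<circ> s)) (t p)) ` P = components P (gr P (t \<circ> s))"
    unfolding components_cls using permD(4)[OF assms(3)] by (metis image_image)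
  then have "cycles P (s \<circ> t) = cycles P (t \<circ> s)"
    unfolding eq cycles_def[of P "t \<circ> s"] by (rule arg_cong)
  then show ?thesis
    using assms(1) unfolding planar_pair_def Un_commute[of "gr P t"] by linarith
qed

text \<open>Two points disappear, and \<open>s\<close> and \<open>t\<close> lose one cycle each. If
  \<open>t x = y\<close>, two cycles of the composition and one component disappear in addition. In
  both cases the two sides of the inequality change by the same amount.\<close>

lemma planar_pair_delete:
  assumes st: "planar_pair P s t" "perm P s" "matching P t" and xy: "x \<in> P" "y \<in> P" "x \<noteq> y" "s x = y" "s y = x"
  shows "planar_pair (P - {x, y}) s (del x y t)" "perm (P - {x, y}) s"
proof -
  let ?P = "P - {x, y}" and ?t = "del x y t"
  have fin: "finite P" using st(2) by (rule permD)
  note ps = permD[OF st(2)] and m = matchingD[OF st(3)]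
  have s': "s p \<in> ?P" if "p \<in> ?P" for p
  proof -
    have p: "p \<in> P" "p \<noteq> x" "p \<noteq> y" using that by auto
    have "s p \<noteq> y" "s p \<noteq> x"
      using ps(3)[OF p(1) xy(1)] ps(3)[OF p(1) xy(2)] p(2,3) unfolding xy(4,5) by simp_all
    then show ?thesis using ps(2)[OF p(1)] by simp
  qed
  then show p': "perm ?P s"
  proof -
    have "inj_on s ?P" "finite ?P"
      using st(2) unfolding perm_def by (auto intro: inj_on_subset)
    then show ?thesis
      using s' unfolding perm_def by blast
  qed
  have mt: "matching ?P ?t" by (rule matching_del[OF st(3) xy(1-3)])
  have tp: "?t p = (if p = x then x else if p = y then y else if p = t x then t y else if p = t y then t x else t p)" for p
    by (rule del_apply[OF st(3) xy(1-3)])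
  have grs: "gr P s = {{x, y}} \<union> gr ?P s"
  proof -
    have "P = {x, y} \<union> ?P" using xy by auto
    then have "gr P s = (\<lambda>p. {p, s p}) ` {x, y} \<union> gr ?P s"
      unfolding gr_image by (metis image_Un)
    then show ?thesis using xy by auto
  qed
  have C: "card (components P (gr P s \<union> gr P t)) = (if t x = y then 1 else 0) + card (components ?P (gr ?P s \<union> gr ?P ?t))"
  proof -
    have "card (components P (gr P t \<union> {{x, y}} \<union> gr ?P s)) = (if t x = y then 1 else 0) + card (components ?P (gr ?P ?t \<union> gr ?P s))"
      by (rule contract(1)[OF fin st(3) xy(1-3)]) (use s' in \<open>auto simp: gr_iff\<close>)
    then show ?thesis unfolding grs by (simp add: Un_ac)
  qed
  have cP: "card P = card ?P + 2"
    using xy fin card_Diff_subset[of "{x, y}" P] card_mono[of P "{x, y}"] by auto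
  have zt: "cycles P t = Suc (cycles ?P ?t)"
    using card_components_matching[OF fin st(3)] card_components_matching[OF _ mt] fin cP
    unfolding cycles_def by simp
  have split: "card (components P G) = card (components {x, y} G) + card (components ?P G)"
    if "\<And>u v. {u, v} \<in> G \<Longrightarrow> u \<in> {x, y} \<longleftrightarrow> v \<in> {x, y}" for G
  proof -
    have "P = {x, y} \<union> ?P" using xy by auto
    then show ?thesis
      using card_components_disjoint[of "{x, y}" ?P G] that fin by auto
  qed
  have restrict: "card (components ?P (gr P r)) = card (components ?P (gr ?P r))"
    if "\<And>p. p \<in> ?P \<Longrightarrow> r p \<in> ?P" "r x \<in> {x, y}" "r y \<in> {x, y}" for r
  proof (rule card_components_retract[where r = "\<lambda>p. if p = y then x else p"])
    show "conn (gr ?P r) (if u = y then x else u) (if v = y then x else v)" if "{u, v} \<in> gr P r" for u v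
    proof -
      have "conn (gr ?P r) (if p = y then x else p) (if r p = y then x else r p)" if "p \<in> P" for p
        using conn_gr[of p ?P r "gr ?P r"] \<open>p \<in> P\<close> \<open>\<And>p. p \<in> ?P \<Longrightarrow> r p \<in> ?P\<close>[of p] \<open>r x \<in> {x, y}\<close> \<open>r y \<in> {x, y}\<close>
        by (cases "p = x"; cases "p = y") auto
      then show ?thesis
        using that conn_sym unfolding gr_iff by metis
    qed
  qed (use fin in \<open>auto simp: gr_iff intro: conn_edge\<close>)
  have zs: "cycles P s = Suc (cycles ?P s)"
  proof -
    have "card (components P (gr P s)) = card (components {x, y} (gr P s)) + card (components ?P (gr P s))"
      by (rule split) (use s' xy in \<open>auto simp: gr_iff\<close>)
    moreover have "components {x, y} (gr P s) = {cls (gr P s) x}"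
      using conn_gr[OF xy(1) order_refl, of s] xy by (auto simp: components_cls cls_eq_iff intro: conn_sym)
    ultimately show ?thesis
      using restrict[of s] s' xy by (simp add: cycles_def)
  qed
  have zst: "cycles P (s \<circ> t) = (if t x = y then 2 else 0) + cycles ?P (s \<circ> ?t)"
  proof (cases "t x = y")
    case True
    then have ty: "t y = x" using m(1) by auto
    have tt: "t p \<in> ?P \<and> ?t p = t p" if "p \<in> ?P" for p
      using that True ty m(1,5) tp by (metis Diff_iff insert_iff singletonD)
    have "card (components P (gr P (s \<circ> t))) = card (components {x, y} (gr P (s \<circ> t))) + card (components ?P (gr P (s \<circ> t)))"
      by (rule split) (use s' tt xy True ty in \<open>auto simp: gr_iff\<close>)
    moreover have "card (components {x, y} (gr P (s \<circ> t))) = card ((\<lambda>p. p = x) ` {x, y})"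
    proof (rule card_components_eq)
      have "(s (t p) = x) = (p = x)" if "p \<in> P" for p
        using s'[of "t p"] tt[of p] xy True ty that by (cases "p = x"; cases "p = y") auto
      then show "(u = x) = (v = x)" if "{u, v} \<in> gr P (s \<circ> t)" for u v
        using that unfolding gr_iff comp_apply by metis
    qed (use xy in auto)
    moreover have "card ((\<lambda>p. p = x) ` {x, y}) = 2" using xy by (auto simp: card_insert_if)
    moreover have "gr ?P (s \<circ> t) = gr ?P (s \<circ> ?t)"
      by (rule gr_cong) (use tt in auto)
    ultimately show ?thesis
      using restrict[of "s \<circ> t"] s' tt xy True ty by (simp add: cycles_def)
  next
    case False
    let ?x = "t x" and ?y = "t y"
    have ne: "?x \<in> ?P" "?y \<in> ?P" "?x \<noteq> ?y"
      using False m xy by (metis Diff_iff insert_iff singletonD)+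
    \<comment> \<open>\<open>s \<circ> t\<close> sends \<open>t x\<close> to \<open>y\<close> and
      \<open>t y\<close> to \<open>x\<close>, so each deleted point is merged with its
      predecessor.\<close>
    define r where "r p = (if p = y then ?x else if p = x then ?y else p)" for p
    let ?G = "gr P (s \<circ> t)" and ?H = "gr ?P (s \<circ> ?t)"
    have eH: "conn ?H p (s (?t p))" if "p \<in> ?P" for p
      using conn_gr[OF that order_refl, of "s \<circ> ?t"] by simp
    have eG: "conn ?G p (s (t p))" if "p \<in> P" for p
      using conn_gr[OF that order_refl, of "s \<circ> t"] by simp
    have tv: "?t ?x = ?y" "?t ?y = ?x" using tp ne by auto
    have G1: "conn ?H (r p) (r (s (t p)))" if pP: "p \<in> P" for p
    proof -
      consider "p = x" | "p = y" | "p = ?x" | "p = ?y" | "p \<in> ?P" "p \<noteq> ?x" "p \<noteq> ?y" using pP by blast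
      then show ?thesis
      proof cases
        case 1
        then show ?thesis using eH[OF ne(2)] tv s'[OF ne(1)] xy by (auto simp: r_def)
      next
        case 2
        then show ?thesis using eH[OF ne(1)] tv s'[OF ne(2)] xy by (auto simp: r_def)
      next
        case 3
        then show ?thesis using ne m(1) xy by (auto simp: r_def)
      next
        case 4
        then show ?thesis using ne m(1) xy by (auto simp: r_def)
      next
        case 5
        then have "t p \<in> ?P" "?t p = t p"
          using m(1,5) tp by (metis Diff_iff insert_iff singletonD)+
        then show ?thesis using eH[OF 5(1)] s'[of "t p"] 5 by (auto simp: r_def)
      qed
    qed
    have e1: "conn ?G ?x y" "conn ?G ?y x"
      using eG[of ?x] eG[of ?y] ne m(1) xy by auto
    have H1: "conn ?G p (s (?t p))" if "p \<in> ?P" for p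
    proof -
      consider "p = ?x" | "p = ?y" | "p \<noteq> ?x" "p \<noteq> ?y" by blast
      then show ?thesis
      proof cases
        case 1
        then show ?thesis using conn_trans[OF e1(1) eG[OF xy(2)]] tv by simp
      next
        case 2
        then show ?thesis using conn_trans[OF e1(2) eG[OF xy(1)]] tv by simp
      next
        case 3
        then show ?thesis using eG[of p] tp[of p] that by auto
      qed
    qed
    have "card (components P ?G) = card (components ?P ?H)"
    proof (rule card_components_retract[OF fin, of r])
      show "r ` P = ?P"
      proof
        show "r ` P \<subseteq> ?P" using ne by (auto simp: r_def)
        show "?P \<subseteq> r ` P" by (auto simp: r_def image_iff)
      qed
      show "conn ?H (r u) (r v)" if "{u, v} \<in> ?G" for u v
        using that G1 conn_sym unfolding gr_iff by (metis comp_apply)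
      show "conn ?G u (r u)" if "u \<in> P" for u
        using e1 conn_sym by (auto simp: r_def)
      show "conn ?G u v" if "{u, v} \<in> ?H" for u v
        using that H1 conn_sym unfolding gr_iff by (metis comp_apply)
    qed
    then show ?thesis using False by (simp add: cycles_def)
  qed
  show "planar_pair ?P s ?t"
    using st(1) unfolding planar_pair_def C zs zt zst cP by (auto split: if_splits)
qed

lemma planar_pair_caps:
  assumes "planar_pair P s t" "perm P s" "matching P t" "distinct (list_points L)" "set (list_points L) \<subseteq> P"
    "\<And>x y. (x, y) \<in> set L \<Longrightarrow> s x = y \<and> s y = x"
  shows "planar_pair (P - set (list_points L)) s (caps L t) \<and> perm (P - set (list_points L)) s"
  using assms
proof (induction L t arbitrary: P rule: caps.induct)
  case (2 x y L t)
  have "planar_pair (P - {x, y}) s (del x y t)" "perm (P - {x, y}) s"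
    by (rule planar_pair_delete[of P s t x y]; use 2 in auto)+
  moreover have "matching (P - {x, y}) (del x y t)"
    by (rule matching_del) (use 2 in auto)
  ultimately have "planar_pair (P - {x, y} - set (list_points L)) s (caps L (del x y t)) \<and> perm (P - {x, y} - set (list_points L)) s"
    by (intro "2.IH") (use 2 in auto)
  moreover have "P - {x, y} - set (list_points L) = P - set (list_points ((x, y) # L))"
    by auto
  ultimately show ?case by simp
qed simp

section \<open>Noncrossing matchings of a cyclic list\<close>

definition cyclic :: "('p \<Rightarrow> 'p) \<Rightarrow> 'p list \<Rightarrow> bool" where
  "cyclic s L \<longleftrightarrow> map s L = rotate1 L"

text \<open>A nonempty noncrossing matching has an arc between neighbours, and removing it leaves a
  noncrossing matching. This form refers to the arrangement of the points in the list and to no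
  order on them.\<close>

inductive nc_list :: "('p \<Rightarrow> 'p) \<Rightarrow> 'p list \<Rightarrow> bool" for f where
  nc_Nil: "nc_list f []"
| nc_insert: "nc_list f (A @ B) \<Longrightarrow> f x = y \<Longrightarrow> f y = x \<Longrightarrow> nc_list f (A @ x # y # B)"

lemma cyclic_rotate1: "cyclic s L \<Longrightarrow> cyclic s (rotate1 L)"
  by (metis cyclic_def rotate1_map)

text \<open>Bypassing \<open>x\<close> and \<open>y\<close>: with \<open>p\<close> the predecessor
  of \<open>x\<close>, exchanging the images of \<open>p\<close> and \<open>y\<close> sends
  \<open>p\<close> to the former successor of \<open>y\<close> and closes \<open>x\<close> and
  \<open>y\<close> up to a 2-cycle.\<close>

lemma cyclic_split:
  assumes "cyclic s (A @ x # y # B)" "A @ B \<noteq> []"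
  obtains p where "p \<in> set (A @ B)" "s p = x" "s x = y" "s y \<in> set (A @ B)"
    "distinct (A @ x # y # B) \<Longrightarrow> cyclic (swap_at p y s) (A @ B)"
proof (cases A)
  case Nil
  then have B: "B \<noteq> []" using assms by simp
  then obtain B0 p where B0: "B = B0 @ [p]" by (metis rev_exhaust)
  have *: "s x = y" "s y # map s B = B @ [x]"
    using assms(1) Nil by (simp_all add: cyclic_def)
  then have **: "s p = x" "s y # map s B0 = B0 @ [p]"
    using B0 by simp_all
  show ?thesis
  proof (rule that[of p])
    show "s y \<in> set (A @ B)" using ** B0 Nil by (metis list.set_intros(1) self_append_conv2)
    show "cyclic (swap_at p y s) (A @ B)" if "distinct (A @ x # y # B)"
    proof -
      have "map (swap_at p y s) B0 = map s B0"
        using that Nil B0 by (intro map_cong) (auto simp: swap_at_def)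
      then have "map (swap_at p y s) B = map s B0 @ [s y]"
        using B0 by (simp add: swap_at_def)
      also have "\<dots> = rotate1 (s y # map s B0)" by simp
      also have "\<dots> = rotate1 B" using ** B0 by simp
      finally show ?thesis using Nil by (simp add: cyclic_def)
    qed
  qed (use ** * B0 in auto)
next
  case (Cons a A')
  then obtain A0 p where A0: "A = A0 @ [p]" by (metis rev_exhaust list.distinct(1))
  have m: "map s A0 @ s p # s x # s y # map s B = A' @ x # y # B @ [a]"
    using assms(1) A0 Cons by (simp add: cyclic_def) (metis append_Cons append_assoc append_self_conv2 rotate1.simps(2) self_append_conv2)
  have len: "length (map s A0) = length A'" using A0 Cons by (metis length_append_singleton length_Cons length_map nat.inject)
  then have *: "map s A0 = A'" "s p = x" "s x = y" "s y # map s B = B @ [a]"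
    using m by auto
  show ?thesis
  proof (rule that[of p])
    show "s y \<in> set (A @ B)"
    proof -
      have "s y \<in> set (B @ [a])" using *(4) by (metis list.set_intros(1))
      then show ?thesis using Cons by auto
    qed
    show "cyclic (swap_at p y s) (A @ B)" if "distinct (A @ x # y # B)"
    proof -
      have "map (swap_at p y s) A0 = map s A0" "map (swap_at p y s) B = map s B"
        using that A0 by (auto simp: swap_at_def)
      moreover have "swap_at p y s p = s y" by (simp add: swap_at_def)
      ultimately have "map (swap_at p y s) (A @ B) = A' @ s y # map s B"
        using A0 * by (simp cong: map_cong)
      also have "\<dots> = rotate1 (A @ B)" using * Cons by simp
      finally show ?thesis by (simp add: cyclic_def)
    qed
  qed (use * A0 in auto)
qed

lemma cyclic_pair: "cyclic s [x, y] \<longleftrightarrow> s x = y \<and> s y = x"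
  by (auto simp: cyclic_def)


lemma planar_pair_cut:
  assumes st: "planar_pair P s t" "perm P s" "perm P t" and c: "cyclic s (A @ x # y # B)"
    and L: "distinct (A @ x # y # B)" "set (A @ x # y # B) \<subseteq> P"
  obtains s' where "planar_pair P s' t" "perm P s'" "cyclic s' (A @ B)" "s' x = y" "s' y = x"
    "\<And>p. p \<notin> set (A @ x # y # B) \<Longrightarrow> s' p = s p"
proof (cases "A @ B = []")
  case True
  then show ?thesis using that[of s] st c by (simp add: cyclic_pair) (simp add: cyclic_def)
next
  case False
  obtain p where p: "p \<in> set (A @ B)" "s p = x" "s x = y" "cyclic (swap_at p y s) (A @ B)"
    using cyclic_split[OF c False] L(1) by metis
  let ?s = "swap_at p y s"
  have ne: "p \<noteq> x" "p \<noteq> y" "x \<noteq> y" using p(1) L(1) by auto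
  have mem: "p \<in> P" "y \<in> P" "x \<in> P" using p(1) L(2) by auto
  have sx: "?s x = y" "?s y = x" using ne p by (auto simp: swap_at_def)
  have ps: "perm P ?s" by (rule perm_swap_at[OF st(2) mem(1,2)])
  have "\<not> conn (gr P ?s) p y"
  proof
    assume "conn (gr P ?s) p y"
    then have "(p \<in> {x, y}) = (y \<in> {x, y})"
    proof (rule conn_const)
      fix u v assume "{u, v} \<in> gr P ?s"
      moreover have "(?s w \<in> {x, y}) = (w \<in> {x, y})" if "w \<in> P" for w
        using permD(3)[OF ps that mem(2)] permD(3)[OF ps that mem(3)] sx by auto
      ultimately show "(u \<in> {x, y}) = (v \<in> {x, y})"
        unfolding gr_iff by metis
    qed
    then show False using ne by simp
  qed
  then have "planar_pair P ?s t"
    by (rule planar_pair_split[OF st mem(1,2)])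
  moreover have "?s q = s q" if "q \<notin> set (A @ x # y # B)" for q
    using p(1) that by (auto simp: swap_at_def)
  ultimately show ?thesis
    using that[OF _ ps p(4) sx] by blast
qed

text \<open>The arcs of the matching are cut off one after the other, from neighbours to neighbours,
  and each cut splits a cycle. In this way the diagrams on the edges and the strands at the vertices
  are inserted into the cyclic orders.\<close>

lemma planar_pair_refine:
  assumes "nc_list f L" "distinct L" "set L \<subseteq> P" "planar_pair P s t" "perm P s" "perm P t" "cyclic s L"
  shows "planar_pair P (\<lambda>p. if p \<in> set L then f p else s p) t \<and> perm P (\<lambda>p. if p \<in> set L then f p else s p)"
  using assms
proof (induction L arbitrary: s rule: nc_list.induct)
  case (nc_insert A B x y)
  obtain s' where s': "planar_pair P s' t" "perm P s'" "cyclic s' (A @ B)" "s' x = y" "s' y = x"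
    "\<And>p. p \<notin> set (A @ x # y # B) \<Longrightarrow> s' p = s p"
    using planar_pair_cut[OF nc_insert.prems(3-6) nc_insert.prems(1,2)] by metis
  let ?r = "\<lambda>p. if p \<in> set (A @ B) then f p else s' p" and ?r' = "\<lambda>p. if p \<in> set (A @ x # y # B) then f p else s p"
  have "planar_pair P ?r t \<and> perm P ?r"
    by (rule nc_insert.IH) (use nc_insert.prems s' in auto)
  moreover have "?r = ?r'"
  proof
    fix p
    consider "p \<in> set (A @ B)" | "p = x" "p \<notin> set (A @ B)" | "p = y" "p \<notin> set (A @ B)" | "p \<notin> set (A @ x # y # B)"
      by auto
    then show "?r p = ?r' p"
      using s'(4,5) s'(6)[of p] nc_insert.hyps by cases auto
  qed
  ultimately show ?case by simp
qed simp

text \<open>The enclosing pair is inserted first and the rest inside it. It is needed because the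
  first and the last point of the list are neighbours on the circle.\<close>

lemma nc_list_enclose:
  assumes "nc_list f L" "f x = y" "f y = x"
  shows "nc_list f (x # L @ [y])"
  using assms(1)
proof (induction rule: nc_list.induct)
  case nc_Nil
  show ?case using nc_list.nc_insert[of f "[]" "[]" x y] assms(2,3) by (simp add: nc_list.nc_Nil)
next
  case (nc_insert A B a b)
  then have "nc_list f ((x # A) @ (B @ [y]))" by simp
  from nc_list.nc_insert[OF this nc_insert.hyps(2,3)] show ?case by simp
qed

lemma cyclic_succ:
  assumes "cyclic s L" "y \<in> set L" "distinct L"
  shows "(\<exists>A B. L = A @ y # s y # B) \<or> (\<exists>M. L = s y # M @ [y]) \<or> L = [y]"
proof -
  obtain A B where L: "L = A @ y # B" using assms(2) by (metis split_list)
  show ?thesis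
  proof (cases A)
    case Nil
    show ?thesis
    proof (cases B)
      case (Cons b B')
      then have "s y = b" using assms(1) L Nil by (simp add: cyclic_def)
      then show ?thesis using L Cons by blast
    qed (use L Nil in simp)
  next
    case (Cons a A')
    have m: "map s A @ s y # map s B = A' @ y # B @ [a]"
      using assms(1) L Cons by (simp add: cyclic_def)
    show ?thesis
    proof (cases B)
      case Nil
      then have "map s A @ [s y] = (A' @ [y]) @ [a]" using m by simp
      then have "s y = a" by simp
      then show ?thesis using L Cons Nil by auto
    next
      case B: (Cons b B')
      have "map s A @ s y # map s B = (A' @ [y]) @ b # B' @ [a]" using m B by simp
      moreover have "length (map s A) = length (A' @ [y])" using Cons by simp
      ultimately have "s y = b" by (metis append_eq_append_conv list.inject)
      then show ?thesis using L B by blast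
    qed
  qed
qed

lemma cyclic_conn:
  assumes "cyclic s L" "set L \<subseteq> P" "v \<in> set L"
  shows "conn (gr P s) (hd L) v"
proof -
  have "conn (gr P s) (hd L) v" if "L = A @ v # B" for A v B
    using that
  proof (induction A arbitrary: v B rule: rev_induct)
    case (snoc a A)
    have "s a = v"
    proof (cases A)
      case Nil
      then show ?thesis using snoc.prems assms(1) by (simp add: cyclic_def)
    next
      case (Cons c A')
      then have "map s A @ s a # s v # map s B = (A' @ [a]) @ v # B @ [c]"
        using snoc.prems assms(1) by (simp add: cyclic_def)
      moreover have "length (map s A) = length (A' @ [a])" using Cons by simp
      ultimately show ?thesis by (metis append_eq_append_conv list.inject)
    qed
    moreover have "a \<in> P" using snoc.prems assms(2) by auto
    moreover have "conn (gr P s) (hd L) a" using snoc.IH[of a "v # B"] snoc.prems by simp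
    ultimately show ?case using conn_trans conn_gr[of a P s "gr P s"] by auto
  qed simp
  then show ?thesis using assms(3) by (metis split_list)
qed

text \<open>Without fixed points every cycle has at least two points.\<close>

lemma two_cycles_le:
  assumes "perm P s" "\<And>p. p \<in> P \<Longrightarrow> s p \<noteq> p"
  shows "2 * cycles P s \<le> card P"
proof -
  let ?G = "gr P s"
  have fin: "finite P" using assms(1) by (rule permD)
  have "card P = (\<Sum>C\<in>cls ?G ` P. card {p \<in> P. cls ?G p = C})"
    using sum.image_gen[OF fin, of "\<lambda>_. 1 :: nat" "cls ?G"] by simp
  moreover have "2 \<le> card {p \<in> P. cls ?G p = C}" if "C \<in> cls ?G ` P" for C
  proof -
    obtain p where p: "p \<in> P" "C = cls ?G p" using \<open>C \<in> cls ?G ` P\<close> by blast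
    have "cls ?G (s p) = C"
      unfolding p(2) cls_eq_iff using conn_gr[OF p(1) order_refl] by (rule conn_sym)
    then have "{p, s p} \<subseteq> {p \<in> P. cls ?G p = C}"
      using p permD(2)[OF assms(1)] by auto
    then have "card {p, s p} \<le> card {p \<in> P. cls ?G p = C}"
      using fin by (intro card_mono) auto
    then show ?thesis using assms(2)[OF p(1)] by (simp add: card_insert_if split: if_splits)
  qed
  then have "(\<Sum>C\<in>cls ?G ` P. 2) \<le> (\<Sum>C\<in>cls ?G ` P. card {p \<in> P. cls ?G p = C})"
    by (intro sum_mono) auto
  ultimately show ?thesis
    by (simp add: cycles_def components_cls)
qed

lemma perm_matching: "finite P \<Longrightarrow> matching P f \<Longrightarrow> perm P f"
  unfolding perm_def by (auto simp: inj_on_def matchingD)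

text \<open>With one cycle of \<open>s\<close>, genus zero forces more cycles of
  \<open>s \<circ> f\<close> than a permutation without fixed points can have. A fixed point of
  \<open>s \<circ> f\<close> is an arc of \<open>f\<close> between neighbours; it is cut off and
  deleted, and induction applies to the rest.\<close>

lemma planar_pair_nc_list:
  assumes "planar_pair (set L) s f" "perm (set L) s" "matching (set L) f" "cyclic s L" "distinct L"
  shows "nc_list f L"
  using assms
proof (induction "length L" arbitrary: L s f rule: less_induct)
  case less
  let ?P = "set L"
  note m = matchingD[OF less.prems(3)]
  have pf: "perm ?P f" by (rule perm_matching[OF _ less.prems(3)]) simp
  have smaller: "nc_list f (A @ B)" if c: "cyclic s (A @ x # y # B)" and fx: "f x = y" "f y = x"
    and L: "set L = set (A @ x # y # B)" "distinct (A @ x # y # B)" "length L = length (A @ x # y # B)" for A B x y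
  proof -
    obtain s' where s': "planar_pair ?P s' f" "perm ?P s'" "cyclic s' (A @ B)" "s' x = y" "s' y = x"
      using planar_pair_cut[OF less.prems(1,2) pf c L(2)] L(1) by (metis order_refl)
    have xy: "x \<in> ?P" "y \<in> ?P" "x \<noteq> y" using L by auto
    have P: "?P - {x, y} = set (A @ B)" using L by auto
    note d = planar_pair_delete[OF s'(1,2) less.prems(3) xy s'(4,5), unfolded P]
    have md: "matching (set (A @ B)) (del x y f)"
      using matching_del[OF less.prems(3) xy] unfolding P .
    have "nc_list (del x y f) (A @ B)"
      by (rule less.hyps[OF _ d md s'(3)]) (use L in auto)
    moreover have df: "del x y f p = f p" if "p \<in> set (A @ B)" for p
      using del_apply[OF less.prems(3) xy, of p] that L(2) fx by auto
    have "nc_list f M" if "nc_list (del x y f) M" "set M \<subseteq> set (A @ B)" for M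
      using that
    proof (induction rule: nc_list.induct)
      case (nc_insert C D u v)
      then show ?case
        using df[of u] df[of v] by (intro nc_list.nc_insert) auto
    qed (rule nc_list.nc_Nil)
    ultimately show ?thesis by blast
  qed
  show ?case
  proof (cases "L = []")
    case False
    have z: "cycles ?P s \<le> 1"
    proof -
      have "cycles ?P s \<le> card ((\<lambda>_. ()) ` ?P)"
        unfolding cycles_def
      proof (rule card_components_le)
        show "conn (gr ?P s) x y" if "x \<in> ?P" "y \<in> ?P" for x y
          using conn_trans[OF conn_sym[OF cyclic_conn[OF less.prems(4) order_refl that(1)]] cyclic_conn[OF less.prems(4) order_refl that(2)]] .
      qed simp
      also have "\<dots> \<le> 1" by (metis card_mono finite.emptyI finite_insert is_singletonI is_singleton_altdef subset_UNIV UNIV_unit)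
      finally show ?thesis .
    qed
    have zf: "2 * cycles ?P f = card ?P"
      using card_components_matching[OF _ less.prems(3)] by (simp add: cycles_def)
    have "card (components ?P (gr ?P s \<union> gr ?P f)) \<ge> 1"
      using False by (simp add: components_cls card_gt_0_iff Suc_leI)
    then have "2 * cycles ?P (s \<circ> f) \<ge> card ?P + 2"
      using less.prems(1) z zf unfolding planar_pair_def by linarith
    then have "\<not> (\<forall>p\<in>?P. (s \<circ> f) p \<noteq> p)"
      using two_cycles_le[OF perm_comp[OF less.prems(2) pf]] by force
    then obtain q where q: "q \<in> ?P" "s (f q) = q" by auto
    \<comment> \<open>Since \<open>s y = q\<close>, this arc joins consecutive points, possibly the
      last and the first one of \<open>L\<close>.\<close>
    define y where "y = f q"
    have y: "y \<in> ?P" "f y = q" "f q = y" "s y = q" "y \<noteq> q"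
      using q m(1)[of q] m(2)[of q] m(5)[of q] by (auto simp: y_def)
    consider A B where "L = A @ y # q # B" | M where "L = q # M @ [y]"
      using cyclic_succ[OF less.prems(4) y(1) less.prems(5)] y q(1) by auto
    then show ?thesis
    proof cases
      case 1
      have "nc_list f (A @ B)"
        by (rule smaller[of A y q B]) (use less.prems y 1 in auto)
      then show ?thesis unfolding 1 using y by (intro nc_list.nc_insert)
    next
      case 2
      have "cyclic s (M @ y # q # [])"
        using cyclic_rotate1[OF less.prems(4)] 2 by simp
      then have "nc_list f (M @ [])"
        by (rule smaller) (use less.prems y 2 in auto)
      then show ?thesis unfolding 2 using nc_list_enclose[of f M q y] y by simp
    qed
  qed (simp add: nc_list.nc_Nil)
qed

section \<open>Noncrossing matchings of three groups of points\<close>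

lemma nc_list_nested:
  assumes "nc_list f (U @ V)" "\<And>w. w \<in> set W \<Longrightarrow> f (f w) = w"
  shows "nc_list f (U @ W @ rev (map f W) @ V)"
  using assms
proof (induction W arbitrary: U V)
  case (Cons w W)
  have "nc_list f (U @ w # f w # V)"
    by (rule nc_list.nc_insert) (use Cons.prems in auto)
  then have "nc_list f ((U @ [w]) @ (f w # V))" by simp
  from Cons.IH[OF this] Cons.prems(2) show ?case by simp
qed simp

lemma nc_list_three:
  assumes "\<And>w. f (f w) = w"
  shows "nc_list f (A1 @ A2 @ rev (map f A2) @ B2 @ rev (map f B2) @ rev (map f A1))"
proof -
  have "nc_list f (A1 @ rev (map f A1))"
    using nc_list_nested[of f "[]" "[]" A1] assms by (simp add: nc_list.nc_Nil)
  then have "nc_list f (A1 @ A2 @ rev (map f A2) @ rev (map f A1))"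
    by (rule nc_list_nested) (rule assms)
  then have "nc_list f ((A1 @ A2 @ rev (map f A2)) @ rev (map f A1))" by simp
  then have "nc_list f ((A1 @ A2 @ rev (map f A2)) @ B2 @ rev (map f B2) @ rev (map f A1))"
    by (rule nc_list_nested) (rule assms)
  then show ?thesis by simp
qed

definition no_adjacent :: "('p \<Rightarrow> 'p) \<Rightarrow> 'p list \<Rightarrow> bool" where
  "no_adjacent f L \<longleftrightarrow> (\<forall>A x y B. L = A @ x # y # B \<longrightarrow> f x \<noteq> y)"

lemma no_adjacent_appendD: "no_adjacent f (A @ B) \<Longrightarrow> no_adjacent f A \<and> no_adjacent f B"
  unfolding no_adjacent_def by (metis append.assoc append_Cons)

lemma append_eq_split:
  assumes "A @ R = U @ x # y # V"
  shows "(\<exists>V'. A = U @ x # y # V' \<and> V = V' @ R) \<or> (A = U @ [x] \<and> R = y # V) \<or> (\<exists>U'. U = A @ U' \<and> R = U' @ x # y # V)"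
proof -
  obtain us where us: "A = U @ us \<and> us @ R = x # y # V \<or> A @ us = U \<and> R = us @ x # y # V"
    using assms unfolding append_eq_append_conv2 by blast
  then show ?thesis
  proof
    assume *: "A = U @ us \<and> us @ R = x # y # V"
    show ?thesis
    proof (cases us)
      case Nil
      then show ?thesis using * by auto
    next
      case (Cons a us')
      then show ?thesis using * by (cases us') auto
    qed
  qed auto
qed

text \<open>In the absence of arcs inside a group, a noncrossing matching of three groups is the diagram
  of a trivalent vertex.\<close>

lemma nc_list_groups:
  assumes "nc_list f (A @ B @ C)" "no_adjacent f A" "no_adjacent f B" "no_adjacent f C"
  shows "\<exists>A1 A2 B1 B2 C1 C2. A = A1 @ A2 \<and> B = B1 @ B2 \<and> C = C1 @ C2 \<and>
    B1 = rev (map f A2) \<and> C1 = rev (map f B2) \<and> C2 = rev (map f A1)"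
  using assms
proof (induction "A @ B @ C" arbitrary: A B C rule: nc_list.induct)
  case nc_Nil
  then show ?case by simp
next
  case (nc_insert U V x y)
  note no = nc_insert.prems
  \<comment> \<open>The inserted pair lies inside one group, which is excluded, or straddles a
    boundary. In the latter case it becomes the innermost arc between the two groups; these are
    \<open>A\<close> and \<open>C\<close> if \<open>B\<close> is empty.\<close>
  from append_eq_split[OF nc_insert.hyps(5)[symmetric]]
  consider (a) V' where "A = U @ x # y # V'" | (ab) "A = U @ [x]" "B @ C = y # V"
    | (r) U' where "U = A @ U'" "B @ C = U' @ x # y # V" by blast
  then show ?case
  proof cases
    case a
    then show ?thesis using no(1) nc_insert.hyps(3) unfolding no_adjacent_def by blast
  next
    case ab
    have nU: "no_adjacent f U" using no_adjacent_appendD no(1) ab(1) by metis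
    show ?thesis
    proof (cases B)
      case Nil
      then have C: "C = y # V" using ab by simp
      have nV: "no_adjacent f V" using no_adjacent_appendD[of f "[y]" V] no(3) C by simp
      obtain A1 A2 C1 C2 where "U = A1 @ A2" "V = C1 @ C2" "[] = rev (map f A2)" "C1 = []" "C2 = rev (map f A1)"
        using nc_insert.hyps(2)[of U "[]" V] nU nV no(2) Nil by auto
      then show ?thesis
        using ab(1) C Nil nc_insert.hyps(3)
        by (intro exI[of _ "U @ [x]"] exI[of _ "[]"] exI[of _ "[]"] exI[of _ "[]"] exI[of _ "[]"] exI[of _ "y # V"]) simp
    next
      case (Cons b B')
      then have B: "B = y # B'" "V = B' @ C" using ab by auto
      have nB: "no_adjacent f B'" using no_adjacent_appendD[of f "[y]" B'] no(2) B by simp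
      obtain A1 A2 B1 B2 C1 C2 where *: "U = A1 @ A2" "B' = B1 @ B2" "C = C1 @ C2"
        "B1 = rev (map f A2)" "C1 = rev (map f B2)" "C2 = rev (map f A1)"
        using nc_insert.hyps(2)[of U B' C] nU nB no(3) B by auto
      show ?thesis
        using ab(1) B * nc_insert.hyps(3)
        by (intro exI[of _ A1] exI[of _ "A2 @ [x]"] exI[of _ "y # B1"] exI[of _ B2] exI[of _ C1] exI[of _ C2]) simp
    qed
  next
    case r
    from append_eq_split[OF r(2)]
    consider (b) V' where "B = U' @ x # y # V'" | (bc) "B = U' @ [x]" "C = y # V"
      | (c) U'' where "C = U'' @ x # y # V" by blast
    then show ?thesis
    proof cases
      case b
      then show ?thesis using no(2) nc_insert.hyps(3) unfolding no_adjacent_def by blast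
    next
      case c
      then show ?thesis using no(3) nc_insert.hyps(3) unfolding no_adjacent_def by blast
    next
      case bc
      have nB: "no_adjacent f U'" using no_adjacent_appendD no(2) bc(1) by metis
      have nV: "no_adjacent f V" using no_adjacent_appendD[of f "[y]" V] no(3) bc by simp
      obtain A1 A2 B1 B2 C1 C2 where *: "A = A1 @ A2" "U' = B1 @ B2" "V = C1 @ C2"
        "B1 = rev (map f A2)" "C1 = rev (map f B2)" "C2 = rev (map f A1)"
        using nc_insert.hyps(2)[of A U' V] nB nV no(1) r by auto
      show ?thesis
        using bc * nc_insert.hyps(3)
        by (intro exI[of _ A1] exI[of _ A2] exI[of _ B1] exI[of _ "B2 @ [x]"] exI[of _ "y # C1"] exI[of _ C2]) simp
    qed
  qed
qed

text \<open>A shortest arc encloses no point, since the arc at such a point would be shorter; its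
  ends are therefore neighbours in the list.\<close>

lemma noncrossing_nc_list:
  assumes "sorted_wrt (<) L" "\<And>p. p \<in> set L \<Longrightarrow> f p \<in> set L \<and> f p \<noteq> p \<and> f (f p) = p" "noncrossing f"
  shows "nc_list f L"
  using assms(1,2)
proof (induction "length L" arbitrary: L rule: less_induct)
  case less
  show ?case
  proof (cases "L = []")
    case False
    let ?S = "{p \<in> set L. p < f p}"
    obtain p0 where "p0 \<in> set L" using False by (metis list.set_sel(1))
    then have "p0 \<in> ?S \<or> f p0 \<in> ?S"
      using less.prems(2)[of p0] less.prems(2)[of "f p0"] by auto
    then have "\<exists>p. p \<in> ?S" by blast
    then obtain p where p: "p \<in> ?S" and min: "\<And>q. q \<in> ?S \<Longrightarrow> f p - p \<le> f q - q"
      using ex_has_least_nat[of "\<lambda>p. p \<in> ?S" _ "\<lambda>p. f p - p"] by blast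
    have gap: "\<not> (p < x \<and> x < f p)" if "x \<in> set L" for x
    proof
      assume x: "p < x \<and> x < f p"
      then have fx: "p < f x \<and> f x < f p" using assms(3) unfolding noncrossing_def by blast
      have "x \<in> ?S \<or> f x \<in> ?S"
        using less.prems(2)[OF that] less.prems(2)[of "f x"] that by auto
      then show False
        using min[of x] min[of "f x"] x fx less.prems(2)[OF that] by auto
    qed
    obtain A R where L: "L = A @ p # R" using p by (metis (no_types, lifting) mem_Collect_eq split_list)
    have "f p \<in> set L" "p < f p" using p less.prems(2) by auto
    then have "f p \<in> set R" using less.prems(1) unfolding L by (auto simp: sorted_wrt_append)
    then obtain q B where R: "R = q # B" by (cases R) auto
    have "q \<le> f p" using \<open>f p \<in> set R\<close> less.prems(1) unfolding L R by (auto simp: sorted_wrt_append)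
    moreover have "p < q" using less.prems(1) unfolding L R by (auto simp: sorted_wrt_append)
    ultimately have q: "f p = q" using gap[of q] unfolding L R by auto
    have fq: "f q = p" using less.prems(2)[of p] p q by auto
    have "nc_list f (A @ B)"
    proof (rule less.hyps)
      show "length (A @ B) < length L" unfolding L R by simp
      show "sorted_wrt (<) (A @ B)" using less.prems(1) unfolding L R by (auto simp: sorted_wrt_append)
      fix r assume r: "r \<in> set (A @ B)"
      have d: "distinct L" using less.prems(1) by (simp add: strict_sorted_iff)
      then have "r \<noteq> p" "r \<noteq> q" using r unfolding L R by auto
      then have "f r \<noteq> q" "f r \<noteq> p" using less.prems(2)[of r] r q fq unfolding L R by auto
      then show "f r \<in> set (A @ B) \<and> f r \<noteq> r \<and> f (f r) = r"
        using less.prems(2)[of r] r unfolding L R by auto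
    qed
    then show ?thesis unfolding L R using q fq by (intro nc_list.nc_insert)
  qed (simp add: nc_list.nc_Nil)
qed

section \<open>Matchings of the strands of a network\<close>

text \<open>The leftmost strands turn to the next dart and the others to the previous one, which at
  a trivalent vertex is \<open>rot N (rot N (fst p))\<close>. At a joint all strands fall under the
  first case.\<close>

definition vertex_matching :: "'e spin_network \<Rightarrow> 'e dart \<times> nat \<Rightarrow> 'e dart \<times> nat" where
  "vertex_matching N p = (if p \<in> strand_points N then
     (if snd p < corner_strands N (fst p)
      then (rot N (fst p), dcolor N (rot N (fst p)) - 1 - snd p)
      else (rot N (rot N (fst p)), dcolor N (fst p) - 1 - snd p)) else p)"

definition edge_index :: "'e spin_network \<Rightarrow> 'e dart \<times> nat \<Rightarrow> nat" where
  "edge_index N p = (if snd (fst p) then color N (fst (fst p)) + snd p else snd p)"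

definition edge_matching :: "'e spin_network \<Rightarrow> ('e \<Rightarrow> nat \<Rightarrow> nat) \<Rightarrow> 'e dart \<times> nat \<Rightarrow> 'e dart \<times> nat" where
  "edge_matching N F p = (if p \<in> strand_points N
     then edge_point N (fst (fst p)) (F (fst (fst p)) (edge_index N p)) else p)"

definition edge_states :: "'e spin_network \<Rightarrow> ('e \<Rightarrow> nat \<Rightarrow> nat) set" where
  "edge_states N = (\<Pi>\<^sub>E e\<in>edges N. nc_matchings (2 * color N e))"

text \<open>The boxes at the ends of the edges are already absorbed here, as justified by
  \<open>edge_box_eq\<close>.\<close>

definition weight :: "'e spin_network \<Rightarrow> ('e \<Rightarrow> nat \<Rightarrow> nat) \<Rightarrow> ratfun" where
  "weight N F = (\<Prod>e\<in>edges N. jones_wenzl (color N e) (gr {..<2 * color N e} (F e)))"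

definition net_sum :: "'e spin_network \<Rightarrow> (('e dart \<times> nat \<Rightarrow> 'e dart \<times> nat) \<Rightarrow> ratfun) \<Rightarrow> ratfun" where
  "net_sum N \<Phi> = (\<Sum>F\<in>edge_states N. weight N F * \<Phi> (edge_matching N F))"

text \<open>\<open>tl_sum\<close> against the indicator function of \<open>f\<close> reads off a
  single coefficient, so the absorption of the end boxes holds coefficient by coefficient.\<close>

lemma edge_box_eq:
  assumes "f \<in> nc_matchings (2 * color N e)"
  shows "edge_box N e (gr {..<2 * color N e} f) = jones_wenzl (color N e) (gr {..<2 * color N e} f)"
proof -
  let ?\<Phi> = "\<lambda>g. if g = f then 1 else 0 :: ratfun"
  have *: "tl_sum (color N e) x ?\<Phi> = x (gr {..<2 * color N e} f)" for x
    unfolding tl_sum_def using assms by (simp add: finite_nc_matchings if_distrib cong: if_cong)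
  have "tl_sum (color N e) (edge_box N e) ?\<Phi> = tl_sum (color N e) (jones_wenzl (color N e)) ?\<Phi>"
    using represents_jones_wenzl[of "color N e"] unfolding tl_sum_edge_box represents_def by simp
  then show ?thesis unfolding * .
qed

lemma strand_points_dart: "(d, i) \<in> strand_points N \<longleftrightarrow> d \<in> darts N \<and> i < dcolor N d"
  by (simp add: strand_points_def)

lemma finite_strand_points: "finite (edges N) \<Longrightarrow> finite (strand_points N)"
proof -
  assume "finite (edges N)"
  then have "finite (darts N)" by (simp add: darts_def)
  then have "finite (SIGMA d:darts N. {..<dcolor N d})" by simp
  moreover have "strand_points N = (SIGMA d:darts N. {..<dcolor N d})"
    by (auto simp: strand_points_def)
  ultimately show ?thesis by simp
qed

lemma edge_point_mem: "e \<in> edges N \<Longrightarrow> j < 2 * color N e \<Longrightarrow> edge_point N e j \<in> strand_points N"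
  by (auto simp: edge_point_def strand_points_def darts_def dcolor_def)

lemma edge_index_point: "j < 2 * color N e \<Longrightarrow> edge_index N (edge_point N e j) = j"
  by (auto simp: edge_point_def edge_index_def)

lemma fst_edge_point: "fst (fst (edge_point N e j)) = e"
  by (simp add: edge_point_def)

lemma edge_point_index:
  assumes "p \<in> strand_points N"
  shows "fst (fst p) \<in> edges N" "edge_index N p < 2 * color N (fst (fst p))"
    "edge_point N (fst (fst p)) (edge_index N p) = p"
  using assms by (cases p; auto simp: edge_point_def edge_index_def strand_points_def darts_def dcolor_def split: if_splits)+

lemma edge_states_nc: "F \<in> edge_states N \<Longrightarrow> e \<in> edges N \<Longrightarrow> F e \<in> nc_matchings (2 * color N e)"
  by (auto simp: edge_states_def)

lemma edge_matching_point:
  assumes "F \<in> edge_states N" "e \<in> edges N" "j < 2 * color N e"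
  shows "edge_matching N F (edge_point N e j) = edge_point N e (F e j)"
  using edge_point_mem[OF assms(2,3)] edge_index_point[OF assms(3)] by (simp add: edge_matching_def fst_edge_point)

lemma matching_edge_matching:
  assumes "F \<in> edge_states N"
  shows "matching (strand_points N) (edge_matching N F)"
  unfolding matching_def
proof
  fix p
  show "edge_matching N F (edge_matching N F p) = p \<and> (edge_matching N F p \<noteq> p \<longleftrightarrow> p \<in> strand_points N)"
  proof (cases "p \<in> strand_points N")
    case True
    note ep = edge_point_index[OF True]
    have m: "matching {..<2 * color N (fst (fst p))} (F (fst (fst p)))"
      by (rule nc_matching[OF edge_states_nc[OF assms ep(1)]])
    have lt: "F (fst (fst p)) (edge_index N p) < 2 * color N (fst (fst p))"
      using matchingD(5)[OF m, of "edge_index N p"] ep(2) by simp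
    have e: "edge_matching N F p = edge_point N (fst (fst p)) (F (fst (fst p)) (edge_index N p))"
      using True by (simp add: edge_matching_def)
    have "edge_matching N F p \<noteq> p"
      using e matchingD(2)[OF m, of "edge_index N p"] ep edge_index_point[OF lt] by auto
    then show ?thesis
      using True e edge_matching_point[OF assms ep(1) lt] matchingD(1)[OF m] ep(3) by simp
  qed (simp add: edge_matching_def)
qed

lemma edge_arcs_gr:
  assumes "F \<in> edge_states N"
  shows "edge_arcs N (\<lambda>e\<in>edges N. gr {..<2 * color N e} (F e)) = gr (strand_points N) (edge_matching N F)"
proof -
  have P: "strand_points N = (\<Union>e\<in>edges N. edge_point N e ` {..<2 * color N e})"
  proof
    show "strand_points N \<subseteq> (\<Union>e\<in>edges N. edge_point N e ` {..<2 * color N e})"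
    proof
      fix p assume "p \<in> strand_points N"
      note ep = edge_point_index[OF this]
      show "p \<in> (\<Union>e\<in>edges N. edge_point N e ` {..<2 * color N e})"
        by (rule UN_I[OF ep(1)], rule image_eqI[of _ _ "edge_index N p"]) (simp_all add: ep(2,3))
    qed
    show "(\<Union>e\<in>edges N. edge_point N e ` {..<2 * color N e}) \<subseteq> strand_points N"
      by (rule UN_least, rule image_subsetI) (simp add: edge_point_mem)
  qed
  have "(\<lambda>p. edge_point N e ` p) ` gr {..<2 * color N e} (F e) =
      (\<lambda>p. {p, edge_matching N F p}) ` edge_point N e ` {..<2 * color N e}" if "e \<in> edges N" for e
    unfolding gr_image image_image
    by (rule image_cong) (use edge_matching_point[OF assms that] in auto)
  then have eq: "(\<Union>e\<in>edges N. (\<lambda>p. edge_point N e ` p) ` (\<lambda>e\<in>edges N. gr {..<2 * color N e} (F e)) e) =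
      (\<Union>e\<in>edges N. (\<lambda>p. {p, edge_matching N F p}) ` edge_point N e ` {..<2 * color N e})"
    by (intro SUP_cong refl) (simp only: restrict_apply' )
  show ?thesis
    unfolding edge_arcs_def eq unfolding P gr_image image_UN ..
qed

text \<open>The combinatorial part of a spin network. The glued graph is made an instance too;
  planarity is assumed separately, where the genus argument uses it.\<close>

locale network =
  fixes N :: "'e spin_network"
  assumes fin: "finite (edges N)" and closed: "rot N ` darts N \<subseteq> darts N"
    and loc: "d \<in> darts N \<Longrightarrow> trivalent_at N d \<or> joint_at N d" and adm: "admissible N"
begin

abbreviation "r \<equiv> rot N"
abbreviation "c \<equiv> dcolor N"
abbreviation "P \<equiv> strand_points N"

lemma rot_in: "d \<in> darts N \<Longrightarrow> r d \<in> darts N"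
  using closed by auto

text \<open>Six is a common multiple of the two possible orbit lengths, so one identity serves for
  joints and for trivalent vertices.\<close>

lemma rot6: "d \<in> darts N \<Longrightarrow> r (r (r (r (r (r d))))) = d"
  using loc[of d] by (auto simp: trivalent_at_def joint_at_def)

lemma rot_inj: "d \<in> darts N \<Longrightarrow> d' \<in> darts N \<Longrightarrow> r d = r d' \<longleftrightarrow> d = d'"
  using rot6 by metis

lemma trivalent_rot: "d \<in> darts N \<Longrightarrow> trivalent_at N d \<Longrightarrow> trivalent_at N (r d)"
  using rot_inj[of d "r d"] rot_in[of d] by (auto simp: trivalent_at_def)

lemma joint_rot: "d \<in> darts N \<Longrightarrow> joint_at N d \<Longrightarrow> joint_at N (r d)"
  by (auto simp: joint_at_def)

lemma joint_not_trivalent: "joint_at N d \<Longrightarrow> \<not> trivalent_at N d"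
  by (auto simp: joint_at_def trivalent_at_def)

lemma trivalent_distinct:
  "d \<in> darts N \<Longrightarrow> trivalent_at N d \<Longrightarrow> distinct [d, r d, r (r d)] \<and> r (r (r d)) = d"
  using rot_inj[of d "r d"] rot_in[of d] unfolding trivalent_at_def by auto

text \<open>Parity makes the halving exact, and the inequalities of admissibility make the truncated
  differences genuine.\<close>

lemma half_sum:
  fixes a b e :: nat
  assumes "even (a + b + e)" "e \<le> a + b" "b \<le> a + e"
  shows "a = (a + b - e) div 2 + (e + a - b) div 2"
proof -
  have "even (a + b - e)" using assms(1,2) by auto
  then obtain k where "a + b - e = 2 * k" by (metis evenE)
  then have "a + b - e = 2 * k" "e + a - b = 2 * (a - k)" "k \<le> a" using assms(2,3) by auto
  then show ?thesis by simp
qed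

lemma corner_sum: "d \<in> darts N \<Longrightarrow> trivalent_at N d \<Longrightarrow> c d = corner_strands N d + corner_strands N (r (r d))"
proof -
  assume d: "d \<in> darts N" "trivalent_at N d"
  have t: "trivalent_at N (r (r d))" using trivalent_rot rot_in d by metis
  have r3: "r (r (r d)) = d" using trivalent_distinct[OF d] by simp
  have "admissible_triple (c d) (c (r d)) (c (r (r d)))"
    using adm d unfolding admissible_def by metis
  then have "even (c d + c (r d) + c (r (r d)))" "c (r (r d)) \<le> c d + c (r d)" "c (r d) \<le> c d + c (r (r d))"
    unfolding admissible_triple_def by linarith+
  from half_sum[OF this] show ?thesis
    using d(2) t r3 unfolding corner_strands_def by simp
qed

lemma corner_joint: "joint_at N d \<Longrightarrow> corner_strands N d = c d \<and> c (r d) = c d"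
  using joint_not_trivalent[of d] by (auto simp: corner_strands_def joint_at_def)

lemma vertex_matching_corner:
  assumes d: "d \<in> darts N" and i: "i < corner_strands N d"
  shows "(d, i) \<in> P" "(r d, c (r d) - 1 - i) \<in> P" "vertex_matching N (d, i) = (r d, c (r d) - 1 - i)"
    "vertex_matching N (r d, c (r d) - 1 - i) = (d, i)"
proof -
  have "(d, i) \<in> P \<and> (r d, c (r d) - 1 - i) \<in> P \<and> vertex_matching N (d, i) = (r d, c (r d) - 1 - i) \<and>
    vertex_matching N (r d, c (r d) - 1 - i) = (d, i)"
  proof (cases "trivalent_at N d")
    case True
    note t = trivalent_distinct[OF d True]
    have "c d = corner_strands N d + corner_strands N (r (r d))" "c (r d) = corner_strands N (r d) + corner_strands N d"
      using corner_sum[OF d True] corner_sum[OF rot_in[OF d] trivalent_rot[OF d True]] t by auto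
    then show ?thesis
      using i t d rot_in[OF d] by (auto simp: vertex_matching_def strand_points_dart)
  next
    case False
    then have j: "joint_at N d" using loc[OF d] by simp
    note cj = corner_joint[OF j] corner_joint[OF joint_rot[OF d j]]
    have "r (r d) = d" using j by (simp add: joint_at_def)
    then show ?thesis
      using i cj d rot_in[OF d] by (auto simp: vertex_matching_def strand_points_dart)
  qed
  then show "(d, i) \<in> P" "(r d, c (r d) - 1 - i) \<in> P" "vertex_matching N (d, i) = (r d, c (r d) - 1 - i)"
    "vertex_matching N (r d, c (r d) - 1 - i) = (d, i)" by blast+
qed

lemma strand_cases:
  assumes "p \<in> P"
  obtains d i where "d \<in> darts N" "i < corner_strands N d" "p = (d, i) \<or> p = (r d, c (r d) - 1 - i)"
proof -
  obtain d i where p: "p = (d, i)" "d \<in> darts N" "i < c d"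
    using assms by (cases p) (auto simp: strand_points_dart)
  show ?thesis
  proof (cases "i < corner_strands N d")
    case True
    then show ?thesis using that p by blast
  next
    case False
    then have t: "trivalent_at N d" using loc[OF p(2)] corner_joint[of d] p(3) by auto
    let ?d = "r (r d)"
    have d': "?d \<in> darts N" "r ?d = d" using p(2) rot_in trivalent_distinct[OF p(2) t] by auto
    have "c d - 1 - i < corner_strands N ?d" "i = c (r ?d) - 1 - (c d - 1 - i)"
      using False p(3) corner_sum[OF p(2) t] d'(2) by auto
    then show ?thesis using that[of ?d "c d - 1 - i"] d' p(1) by simp
  qed
qed

lemma matching_vertex_matching: "matching P (vertex_matching N)"
  unfolding matching_def
proof
  fix p
  show "vertex_matching N (vertex_matching N p) = p \<and> (vertex_matching N p \<noteq> p \<longleftrightarrow> p \<in> P)"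
  proof (cases "p \<in> P")
    case True
    then obtain d i where d: "d \<in> darts N" "i < corner_strands N d" "p = (d, i) \<or> p = (r d, c (r d) - 1 - i)"
      by (rule strand_cases)
    have "r d \<noteq> d" using loc[OF d(1)] by (auto simp: trivalent_at_def joint_at_def)
    then show ?thesis
      using True d(3) vertex_matching_corner[OF d(1,2)] by auto
  qed (simp add: vertex_matching_def)
qed

lemma vertex_arcs_gr: "vertex_arcs N = gr P (vertex_matching N)"
proof
  show "vertex_arcs N \<subseteq> gr P (vertex_matching N)"
    unfolding vertex_arcs_def gr_def using vertex_matching_corner(1,3) by fastforce
  show "gr P (vertex_matching N) \<subseteq> vertex_arcs N"
  proof
    fix C assume "C \<in> gr P (vertex_matching N)"
    then obtain p where p: "p \<in> P" "C = {p, vertex_matching N p}" by (auto simp: gr_def)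
    obtain d i where d: "d \<in> darts N" "i < corner_strands N d" "p = (d, i) \<or> p = (r d, c (r d) - 1 - i)"
      using strand_cases[OF p(1)] .
    have "C = {(d, i), (r d, c (r d) - 1 - i)}"
      using d(3) vertex_matching_corner(3,4)[OF d(1,2)] unfolding p(2) by (auto simp: insert_commute)
    then show "C \<in> vertex_arcs N"
      unfolding vertex_arcs_def using d(1,2) by blast
  qed
qed

lemma finite_P: "finite P"
  using finite_strand_points[OF fin] .

lemma evaluation_net_sum: "evaluation N = net_sum N (pairing P (vertex_matching N))"
proof -
  let ?g = "\<lambda>F. \<lambda>e\<in>edges N. gr {..<2 * color N e} (F e)"
  have bij: "bij_betw ?g (edge_states N) (\<Pi>\<^sub>E e\<in>edges N. crossingless_matchings (2 * color N e))"
    unfolding bij_betw_def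
  proof
    show "inj_on ?g (edge_states N)"
    proof
      fix F G assume FG: "F \<in> edge_states N" "G \<in> edge_states N" "?g F = ?g G"
      show "F = G"
      proof
        fix e
        show "F e = G e"
        proof (cases "e \<in> edges N")
          case True
          then have "gr {..<2 * color N e} (F e) = gr {..<2 * color N e} (G e)"
            using fun_cong[OF FG(3), of e] by simp
          then show ?thesis
            using gr_inj nc_matching edge_states_nc FG(1,2) True by metis
        next
          case False
          then show ?thesis using FG(1,2) by (auto simp: edge_states_def PiE_def extensional_def)
        qed
      qed
    qed
    show "?g ` edge_states N = (\<Pi>\<^sub>E e\<in>edges N. crossingless_matchings (2 * color N e))"
    proof
      show "?g ` edge_states N \<subseteq> (\<Pi>\<^sub>E e\<in>edges N. crossingless_matchings (2 * color N e))"
        unfolding crossingless_gr by (auto dest: edge_states_nc)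
      show "(\<Pi>\<^sub>E e\<in>edges N. crossingless_matchings (2 * color N e)) \<subseteq> ?g ` edge_states N"
      proof
        fix S assume S: "S \<in> (\<Pi>\<^sub>E e\<in>edges N. crossingless_matchings (2 * color N e))"
        let ?F = "\<lambda>e\<in>edges N. mate (S e)"
        have Se: "mate (S e) \<in> nc_matchings (2 * color N e) \<and> gr {..<2 * color N e} (mate (S e)) = S e" if e: "e \<in> edges N" for e
        proof -
          have "S e \<in> gr {..<2 * color N e} ` nc_matchings (2 * color N e)"
            using PiE_mem[OF S e] unfolding crossingless_gr .
          then show ?thesis using mate_gr[OF nc_matching] by auto
        qed
        then have FE: "?F \<in> edge_states N" unfolding edge_states_def by auto
        have gS: "?g ?F = S"
        proof
          fix e
          show "?g ?F e = S e"
            using Se[of e] PiE_arb[OF S, of e] by (cases "e \<in> edges N") simp_all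
        qed
        show "S \<in> ?g ` edge_states N" by (rule image_eqI[of S _ ?F]) (rule gS[symmetric], rule FE)
      qed
    qed
  qed
  have "evaluation N = (\<Sum>F\<in>edge_states N. (\<Prod>e\<in>edges N. edge_box N e (?g F e)) *
      circle_value ^ card (components P (vertex_arcs N \<union> edge_arcs N (?g F))))"
    unfolding evaluation_def
    by (rule sum.reindex_bij_betw[OF bij, symmetric, of "\<lambda>S. (\<Prod>e\<in>edges N. edge_box N e (S e)) *
      circle_value ^ card (components P (vertex_arcs N \<union> edge_arcs N S))"])
  also have "\<dots> = net_sum N (pairing P (vertex_matching N))"
    unfolding net_sum_def
  proof (intro sum.cong refl)
    fix F assume F: "F \<in> edge_states N"
    have "(\<Prod>e\<in>edges N. edge_box N e (?g F e)) = weight N F"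
      unfolding weight_def by (intro prod.cong refl) (simp add: edge_box_eq edge_states_nc[OF F])
    moreover have "components P (vertex_arcs N \<union> edge_arcs N (?g F)) =
        components P (gr P (edge_matching N F) \<union> gr P (vertex_matching N))"
      unfolding vertex_arcs_gr edge_arcs_gr[OF F] by (simp add: Un_commute)
    ultimately show "(\<Prod>e\<in>edges N. edge_box N e (?g F e)) *
        circle_value ^ card (components P (vertex_arcs N \<union> edge_arcs N (?g F))) =
      weight N F * pairing P (vertex_matching N) (edge_matching N F)"
      using matching_vertex_matching matching_edge_matching[OF F] by (simp add: pairing_def circles_def)
  qed
  finally show ?thesis .
qed

lemma fcomb_net_sum: "fcomb (net_sum N)"
  unfolding net_sum_def by (intro fcomb_sum fcomb_mult fcomb_eval)

lemma net_sum_cong: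
  "(\<And>F. F \<in> edge_states N \<Longrightarrow> \<Phi> (edge_matching N F) = \<Psi> (edge_matching N F)) \<Longrightarrow> net_sum N \<Phi> = net_sum N \<Psi>"
  by (simp add: net_sum_def)

text \<open>With the diagrams on all other edges frozen, what remains is the sum over the diagrams
  of a single box with a generator at two neighbouring ends, which the box kills.\<close>

lemma net_sum_kill:
  assumes d: "d \<in> darts N" and i: "Suc i < c d"
  shows "net_sum N (hook_op P (d, i) (d, Suc i) \<Phi>) = 0"
proof -
  define e where "e = fst d"
  define k where "k = color N e"
  \<comment> \<open>The number of the point \<open>(d, i)\<close> on the boundary of the diagram on
    \<open>e\<close>: the end \<open>(e, True)\<close> carries the points from \<open>k\<close>
    on.\<close>
  define j where "j = (if snd d then k + i else i)"
  have e: "e \<in> edges N" using d by (auto simp: e_def darts_def)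
  have j: "Suc j < k \<or> k \<le> j \<and> Suc j < 2 * k" "Suc j < 2 * k"
    using i by (auto simp: j_def k_def e_def dcolor_def)
  have pt: "edge_point N e j = (d, i)" "edge_point N e (Suc j) = (d, Suc i)"
    using i by (cases d; auto simp: edge_point_def j_def k_def e_def dcolor_def)+
  define E where "E = edges N - {e}"
  let ?A = "{..<2 * k}" and ?N = "nc_matchings (2 * k)"
  have E: "edges N = insert e E" "e \<notin> E" "finite E" using e fin by (auto simp: E_def)
  let ?T = "\<Pi>\<^sub>E x\<in>E. nc_matchings (2 * color N x)"
  have bij: "bij_betw (\<lambda>(f, T). T(e := f)) (?N \<times> ?T) (edge_states N)"
    unfolding bij_betw_def
  proof
    show "inj_on (\<lambda>(f, T). T(e := f)) (?N \<times> ?T)"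
      using inj_combinator[OF E(2), of "\<lambda>x. nc_matchings (2 * color N x)"] by (simp add: k_def)
    show "(\<lambda>(f, T). T(e := f)) ` (?N \<times> ?T) = edge_states N"
      unfolding edge_states_def E(1) PiE_insert_eq by (simp add: k_def)
  qed
  let ?H = "hook_op P (d, i) (d, Suc i) \<Phi>"
  have "net_sum N ?H = (\<Sum>(f, T)\<in>?N \<times> ?T. weight N (T(e := f)) * ?H (edge_matching N (T(e := f))))"
    unfolding net_sum_def using sum.reindex_bij_betw[OF bij, of "\<lambda>F. weight N F * ?H (edge_matching N F)"]
    by (simp add: case_prod_unfold)
  also have "\<dots> = (\<Sum>T\<in>?T. \<Sum>f\<in>?N. weight N (T(e := f)) * ?H (edge_matching N (T(e := f))))"
    unfolding sum.cartesian_product[symmetric] by (rule sum.swap)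
  also have "\<dots> = (\<Sum>T\<in>?T. 0)"
  proof (intro sum.cong refl)
    fix T assume T: "T \<in> ?T"
    define w where "w = (\<Prod>x\<in>E. jones_wenzl (color N x) (gr {..<2 * color N x} (T x)))"
    have wt: "weight N (T(e := f)) = w * jones_wenzl k (gr ?A f)" for f
    proof -
      have "weight N (T(e := f)) = jones_wenzl k (gr ?A f) * (\<Prod>x\<in>E. jones_wenzl (color N x) (gr {..<2 * color N x} ((T(e := f)) x)))"
        unfolding weight_def E(1) using E(2,3) by (simp add: k_def)
      also have "(\<Prod>x\<in>E. jones_wenzl (color N x) (gr {..<2 * color N x} ((T(e := f)) x))) = w"
        unfolding w_def by (intro prod.cong refl) (use E(2) in auto)
      finally show ?thesis by (simp only: mult.commute)
    qed
    define g where "g p = (if p \<in> edge_point N e ` ?A then p else edge_matching N T p)" for p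
    define B where "B = P - edge_point N e ` ?A"
    have st: "T(e := f) \<in> edge_states N" if "f \<in> ?N" for f
      using bij that T unfolding bij_betw_def by force
    have inj: "inj_on (edge_point N e) ?A"
      using edge_index_point by (metis inj_onI k_def lessThan_iff)
    have PB: "edge_point N e ` ?A \<union> B = P"
      unfolding B_def using edge_point_mem[OF e] by (auto simp: k_def)
    have img: "p \<in> edge_point N e ` ?A \<longleftrightarrow> fst (fst p) = e" if "p \<in> P" for p
      using edge_point_index[OF that] fst_edge_point[of N e] by (auto simp: k_def) (metis imageI lessThan_iff)
    have same: "edge_matching N T p = edge_matching N (T(e := f)) p" if "p \<notin> edge_point N e ` ?A" for p f
      using that img[of p] by (cases "p \<in> P") (auto simp: edge_matching_def)
    have gB: "matching B g" if f: "f \<in> ?N" for f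
    proof -
      note me = matchingD[OF matching_edge_matching[OF st[OF f]]]
      have out: "edge_matching N (T(e := f)) p \<notin> edge_point N e ` ?A" if p: "p \<notin> edge_point N e ` ?A" for p
      proof (cases "p \<in> P")
        case True
        have "fst (fst (edge_matching N (T(e := f)) p)) = fst (fst p)"
          using True by (simp add: edge_matching_def fst_edge_point)
        then show ?thesis using img[of "edge_matching N (T(e := f)) p"] img[of p] True p me(5) by auto
      qed (use p me(3) in simp)
      show ?thesis
        unfolding matching_def
      proof
        fix p
        show "g (g p) = p \<and> (g p \<noteq> p \<longleftrightarrow> p \<in> B)"
          using out[of p] me(1,2,3)[of p] same[of p f] same[of "edge_matching N (T(e := f)) p" f]
          by (cases "p \<in> edge_point N e ` ?A"; cases "p \<in> P") (auto simp: g_def B_def)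
      qed
    qed
    have Bd: "B \<inter> edge_point N e ` ?A = {}" by (auto simp: B_def)
    have pl: "edge_matching N (T(e := f)) = place ?A (edge_point N e) g f" if f: "f \<in> ?N" for f
    proof
      fix p
      show "edge_matching N (T(e := f)) p = place ?A (edge_point N e) g f p"
      proof (cases "p \<in> edge_point N e ` ?A")
        case True
        then obtain l where l: "l < 2 * k" "p = edge_point N e l" by auto
        then show ?thesis
          using edge_matching_point[OF st[OF f] e, of l] place_image[OF inj gB[OF f] Bd, of l f] by (simp add: k_def)
      next
        case False
        then show ?thesis
          using place_outside[OF inj gB[OF f] Bd, of p f] same[of p f] by (simp add: g_def)
      qed
    qed
    let ?\<Psi> = "\<lambda>f. if matching ?A f then \<Phi> (place ?A (edge_point N e) g f) else 0"
    have "(\<Sum>f\<in>?N. weight N (T(e := f)) * ?H (edge_matching N (T(e := f)))) =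
        (\<Sum>f\<in>?N. w * (jones_wenzl k (gr ?A f) * hook_op ?A j (Suc j) ?\<Psi> f))"
    proof (intro sum.cong refl)
      fix f assume f: "f \<in> ?N"
      have "?H (edge_matching N (T(e := f))) = hook_op ?A j (Suc j) ?\<Psi> f"
        using fun_cong[OF hook_op_place[OF inj gB[OF f] Bd, of j "Suc j" \<Phi>], of f] j(2) nc_matching[OF f]
        unfolding pl[OF f] PB pt by simp
      then show "weight N (T(e := f)) * ?H (edge_matching N (T(e := f))) = w * (jones_wenzl k (gr ?A f) * hook_op ?A j (Suc j) ?\<Psi> f)"
        unfolding wt by simp
    qed
    also have "\<dots> = w * tl_sum k (edge_box N e) (hook_op ?A j (Suc j) ?\<Psi>)"
      unfolding tl_sum_def sum_distrib_left
      by (intro sum.cong refl) (use edge_box_eq[of _ N e] in \<open>simp add: k_def\<close>)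
    also have "\<dots> = 0"
      using tl_sum_edge_box_kill[of j N e ?\<Psi>] j(1) by (simp add: k_def)
    finally show "(\<Sum>f\<in>?N. weight N (T(e := f)) * ?H (edge_matching N (T(e := f)))) = 0" .
  qed
  finally show ?thesis by simp
qed

end

section \<open>Capping a matching along arcs of another one\<close>

lemma arc_list_exists:
  assumes "finite Q" "\<And>p. p \<in> Q \<Longrightarrow> f p \<in> Q \<and> f p \<noteq> p \<and> f (f p) = p"
  shows "\<exists>L. distinct (list_points L) \<and> set (list_points L) = Q \<and> (\<forall>(x, y)\<in>set L. f x = y)"
  using assms
proof (induction "card Q" arbitrary: Q rule: less_induct)
  case less
  show ?case
  proof (cases "Q = {}")
    case True
    then show ?thesis by (intro exI[of _ "[]"]) simp
  next
    case False
    then obtain x where x: "x \<in> Q" by auto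
    let ?Q = "Q - {x, f x}"
    have "card ?Q < card Q" using x less.prems(1) by (intro psubset_card_mono) auto
    moreover have "f p \<in> ?Q \<and> f p \<noteq> p \<and> f (f p) = p" if "p \<in> ?Q" for p
      using less.prems(2)[of p] less.prems(2)[of x] that x by (metis Diff_iff insert_iff singletonD)
    ultimately obtain L where L: "distinct (list_points L)" "set (list_points L) = ?Q" "\<forall>(x, y)\<in>set L. f x = y"
      using less.hyps[of ?Q] less.prems(1) by auto
    then show ?thesis
      using less.prems(2)[OF x] x by (intro exI[of _ "(x, f x) # L"]) auto
  qed
qed

lemma caps_arcs:
  assumes "matching P g" "distinct (list_points L)" "set (list_points L) \<subseteq> P" "\<forall>(x, y)\<in>set L. g x = y"
  shows "caps L g = (\<lambda>p. if p \<in> set (list_points L) then p else g p)"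
  using assms
proof (induction L g arbitrary: P rule: caps.induct)
  case (2 x y L g)
  note m = matchingD[OF 2(2)]
  have xy: "x \<in> P" "y \<in> P" "x \<noteq> y" "g x = y" "g y = x"
    using 2(3-5) m(1)[of x] by auto
  have d: "del x y g p = (if p = x \<or> p = y then p else g p)" for p
    using del_apply[OF 2(2) xy(1-3), of p] xy by auto
  have "caps L (del x y g) = (\<lambda>p. if p \<in> set (list_points L) then p else del x y g p)"
  proof (rule "2.IH"[of "P - {x, y}"])
    show "\<forall>(u, v)\<in>set L. del x y g u = v"
      using 2(3,5) d list_points_arc[of _ _ L] by auto
  qed (use 2 matching_del[OF 2(2) xy(1-3)] in auto)
  then show ?case using d by (auto simp: fun_eq_iff)
qed simp

lemma circles_caps:
  assumes "finite P" "matching P h" "matching P g" "distinct (list_points L)" "set (list_points L) \<subseteq> P" "\<forall>(x, y)\<in>set L. g x = y"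
  shows "circles P h g = cap_circles L h + circles (P - set (list_points L)) (caps L h) (caps L g)"
  using assms
proof (induction L h arbitrary: P g rule: caps.induct)
  case (2 x y L h)
  note m = matchingD[OF 2(4)]
  have xy: "x \<in> P" "y \<in> P" "x \<noteq> y" "g x = y" "g y = x"
    using 2(5-7) m(1)[of x] by auto
  have d: "del x y g p = (if p = x \<or> p = y then p else g p)" for p
    using del_apply[OF 2(4) xy(1-3), of p] xy by auto
  have "circles (P - {x, y}) (del x y h) (del x y g) = cap_circles L (del x y h) +
      circles (P - {x, y} - set (list_points L)) (caps L (del x y h)) (caps L (del x y g))"
  proof (rule "2.IH")
    show "\<forall>(u, v)\<in>set L. del x y g u = v"
      using 2(5,7) d list_points_arc[of _ _ L] by auto
  qed (use 2 matching_del[OF 2(4) xy(1-3)] matching_del[OF 2(3) xy(1-3)] in auto)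
  moreover have "P - {x, y} - set (list_points L) = P - set (list_points ((x, y) # L))" by auto
  ultimately show ?case
    using circles_arc[OF 2(2,3,4) xy(1,4)] by simp
qed simp

section \<open>Planarity of the strands of a network\<close>

lemma nc_list_map:
  assumes "nc_list f L" "\<And>x. x \<in> set L \<Longrightarrow> g (\<phi> x) = \<phi> (f x)"
  shows "nc_list g (map \<phi> L)"
  using assms
proof (induction rule: nc_list.induct)
  case (nc_insert A B x y)
  have "nc_list g (map \<phi> A @ map \<phi> B)"
    using nc_insert.IH nc_insert.prems by simp
  then have "nc_list g (map \<phi> A @ \<phi> x # \<phi> y # map \<phi> B)"
    by (rule nc_list.nc_insert) (use nc_insert in auto)
  then show ?case by simp
qed (simp add: nc_list.nc_Nil)

lemma flip_simps [simp]: "flip (flip d) = d" "flip d = flip d' \<longleftrightarrow> d = d'" "flip d \<in> darts N \<longleftrightarrow> d \<in> darts N"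
  "dcolor N (flip d) = dcolor N d"
  by (auto simp: flip_def darts_def dcolor_def prod_eq_iff mem_Times_iff)

context network
begin

text \<open>Strands are numbered from left to right looking outwards, so the counterclockwise order around
  the vertex is that of decreasing numbers.\<close>

definition group :: "'e dart \<Rightarrow> ('e dart \<times> nat) list" where
  "group d = map (\<lambda>i. (d, c d - 1 - i)) [0..<c d]"

definition around_vertex :: "'e dart \<times> nat \<Rightarrow> 'e dart \<times> nat" where
  "around_vertex p = (if snd p > 0 then (fst p, snd p - 1) else (r (fst p), c (r (fst p)) - 1))"

text \<open>The cyclic order of the boundary points of a diagram on the edge, as numbered by
  \<open>edge_point\<close>. Followed by \<open>around_vertex\<close>, it fixes all strands but the
  last one of each dart, and the last ones run around the faces.\<close>

definition around_edge :: "'e dart \<times> nat \<Rightarrow> 'e dart \<times> nat" where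
  "around_edge p = (if Suc (snd p) < c (fst p) then (fst p, Suc (snd p)) else (flip (fst p), 0))"

definition vertex_list :: "'e dart \<Rightarrow> ('e dart \<times> nat) list" where
  "vertex_list d = (if trivalent_at N d then group d @ group (r d) @ group (r (r d)) else group d @ group (r d))"

lemma length_group [simp]: "length (group d) = c d"
  by (simp add: group_def)

lemma nth_group: "i < c d \<Longrightarrow> group d ! i = (d, c d - 1 - i)"
  by (simp add: group_def)

lemma set_group: "set (group d) = {d} \<times> {..<c d}"
proof -
  have "(\<lambda>i. c d - 1 - i) ` {0..<c d} = {..<c d}"
  proof
    show "{..<c d} \<subseteq> (\<lambda>i. c d - 1 - i) ` {0..<c d}"
    proof
      fix i assume "i \<in> {..<c d}"
      then show "i \<in> (\<lambda>i. c d - 1 - i) ` {0..<c d}"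
        by (intro image_eqI[of _ _ "c d - 1 - i"]) auto
    qed
  qed auto
  moreover have "set (group d) = Pair d ` (\<lambda>i. c d - 1 - i) ` {0..<c d}"
    unfolding group_def set_map set_upt image_image ..
  ultimately show ?thesis by auto
qed

lemma distinct_group: "distinct (group d)"
  by (auto simp: group_def distinct_map inj_on_def)

lemma vertex_list_props:
  assumes "d \<in> darts N"
  shows "distinct (vertex_list d)" "set (vertex_list d) = {p \<in> P. fst p \<in> {d, r d, r (r d)}}"
proof -
  have j: "r (r d) = d \<and> r d \<noteq> d" if "\<not> trivalent_at N d"
    using loc[OF assms] that by (auto simp: joint_at_def)
  note t = trivalent_distinct[OF assms]
  have "set (group d) \<inter> set (group d') = {}" if "d \<noteq> d'" for d d'
    using that by (auto simp: set_group)
  then show "distinct (vertex_list d)"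
    unfolding vertex_list_def using distinct_group t j by (auto simp: set_group)
  have "d \<in> darts N" "r d \<in> darts N" "r (r d) \<in> darts N"
    using assms rot_in by auto
  then show "set (vertex_list d) = {p \<in> P. fst p \<in> {d, r d, r (r d)}}"
    unfolding vertex_list_def using j by (auto simp: set_group strand_points_dart)
qed

lemma corner_le: "d \<in> darts N \<Longrightarrow> corner_strands N d \<le> c d \<and> corner_strands N d \<le> c (r d)"
proof -
  assume d: "d \<in> darts N"
  show ?thesis
  proof (cases "trivalent_at N d")
    case True
    then show ?thesis
      using corner_sum[OF d True] corner_sum[OF rot_in[OF d] trivalent_rot[OF d True]] trivalent_distinct[OF d True] by auto
  next
    case False
    then show ?thesis using loc[OF d] corner_joint[of d] by auto
  qed
qed

lemma group_corner:
  assumes d: "d \<in> darts N"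
  shows "rev (map (vertex_matching N) (drop (c d - corner_strands N d) (group d))) = take (corner_strands N d) (group (r d))"
proof (rule nth_equalityI)
  let ?q = "corner_strands N d"
  note le = corner_le[OF d]
  show "length (rev (map (vertex_matching N) (drop (c d - ?q) (group d)))) = length (take ?q (group (r d)))"
    using le by simp
  fix i assume "i < length (rev (map (vertex_matching N) (drop (c d - ?q) (group d))))"
  then have i: "i < ?q" using le by simp
  have "rev (map (vertex_matching N) (drop (c d - ?q) (group d))) ! i = vertex_matching N (group d ! (c d - ?q + (?q - 1 - i)))"
    using i le by (simp add: rev_nth)
  also have "c d - ?q + (?q - 1 - i) = c d - 1 - i" using i le by simp
  also have "group d ! (c d - 1 - i) = (d, i)"
    using i le by (simp add: nth_group)
  finally show "rev (map (vertex_matching N) (drop (c d - ?q) (group d))) ! i = take ?q (group (r d)) ! i"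
    using i le vertex_matching_corner(3)[OF d i] by (simp add: nth_group)
qed

lemma nc_list_vertex:
  assumes d: "d \<in> darts N"
  shows "nc_list (vertex_matching N) (vertex_list d)"
proof (cases "trivalent_at N d")
  case True
  let ?V = "vertex_matching N"
  note t = trivalent_distinct[OF d True]
  have d1: "r d \<in> darts N" "trivalent_at N (r d)" using rot_in d trivalent_rot True by auto
  have d2: "r (r d) \<in> darts N" "trivalent_at N (r (r d))" using rot_in d1 trivalent_rot by auto
  let ?q = "corner_strands N d" and ?w = "corner_strands N (r d)" and ?z = "corner_strands N (r (r d))"
  have cs: "c d = ?q + ?z" "c (r d) = ?w + ?q" "c (r (r d)) = ?z + ?w"
    using corner_sum[OF d True] corner_sum[OF d1] corner_sum[OF d2] t by auto
  define A1 A2 B1 B2 C1 C2 where ABC: "A1 = take ?z (group d)" "A2 = drop ?z (group d)" "B1 = take ?q (group (r d))" "B2 = drop ?q (group (r d))"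
    "C1 = take ?w (group (r (r d)))" "C2 = drop ?w (group (r (r d)))"
  have VV: "?V (?V p) = p" for p using matchingD(1)[OF matching_vertex_matching] .
  have 1: "B1 = rev (map ?V A2)" using group_corner[OF d] cs by (simp add: ABC)
  have 2: "C1 = rev (map ?V B2)" using group_corner[OF d1(1)] cs by (simp add: ABC)
  have "A1 = rev (map ?V C2)" using group_corner[OF d2(1)] cs t by (simp add: ABC)
  then have 3: "C2 = rev (map ?V A1)" using VV by (simp add: rev_map o_def)
  have "vertex_list d = A1 @ A2 @ B1 @ B2 @ C1 @ C2"
    using True by (simp add: vertex_list_def ABC)
  then show ?thesis
    unfolding 1 2 3 using nc_list_three[of ?V A1 A2 B2] VV by simp
next
  case False
  then have j: "joint_at N d" using loc[OF d] by simp
  have "rev (map (vertex_matching N) (group d)) = group (r d)"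
    using group_corner[OF d] corner_joint[OF j] by simp
  then have "vertex_list d = [] @ group d @ rev (map (vertex_matching N) (group d)) @ []"
    using False by (simp add: vertex_list_def)
  then show ?thesis
    using nc_list_nested[of "vertex_matching N" "[]" "[]" "group d"] matchingD(1)[OF matching_vertex_matching]
    by (simp add: nc_list.nc_Nil)
qed

text \<open>A dart of color 0 carries no strand end and would drop out of the cyclic orders, and the
  relation to the Euler count of the graph would be lost.\<close>

context
  assumes pos: "\<And>d. d \<in> darts N \<Longrightarrow> c d > 0"
begin

lemma around_vertex_group:
  assumes "d \<in> darts N"
  shows "map around_vertex (group d) = tl (group d) @ [hd (group (r d))]"
proof (rule nth_equalityI)
  have cp: "c d > 0" "c (r d) > 0" using pos assms rot_in by auto
  then show "length (map around_vertex (group d)) = length (tl (group d) @ [hd (group (r d))])" by simp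
  fix i assume "i < length (map around_vertex (group d))"
  then have i: "i < c d" by simp
  have "group (r d) \<noteq> []" using cp by (metis length_group length_0_conv less_irrefl)
  then have "hd (group (r d)) = (r d, c (r d) - 1)"
    using cp nth_group[of 0 "r d"] by (simp add: hd_conv_nth)
  then show "map around_vertex (group d) ! i = (tl (group d) @ [hd (group (r d))]) ! i"
    using i cp by (auto simp: nth_append nth_tl nth_group around_vertex_def)
qed

lemma cyclic_vertex:
  assumes d: "d \<in> darts N"
  shows "cyclic around_vertex (vertex_list d)"
proof -
  have ne: "group x = hd (group x) # tl (group x)" if "x \<in> darts N" for x
    using pos[OF that] by (metis length_group length_0_conv less_irrefl list.collapse)
  have in1: "r d \<in> darts N" "r (r d) \<in> darts N" using rot_in d by auto
  show ?thesis
  proof (cases "trivalent_at N d")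
    case True
    have "rotate1 (group d @ group (r d) @ group (r (r d))) = tl (group d) @ group (r d) @ group (r (r d)) @ [hd (group d)]"
      by (subst ne[OF d]) simp
    also have "\<dots> = tl (group d) @ [hd (group (r d))] @ tl (group (r d)) @ [hd (group (r (r d)))] @ tl (group (r (r d))) @ [hd (group d)]"
      by (subst ne[OF in1(1)], subst ne[OF in1(2)]) simp
    finally show ?thesis
      using True around_vertex_group d in1 trivalent_distinct[OF d True] by (simp add: cyclic_def vertex_list_def)
  next
    case False
    then have "r (r d) = d" using loc[OF d] by (auto simp: joint_at_def)
    moreover have "rotate1 (group d @ group (r d)) = tl (group d) @ group (r d) @ [hd (group d)]"
      by (subst ne[OF d]) simp
    moreover have "\<dots> = tl (group d) @ [hd (group (r d))] @ tl (group (r d)) @ [hd (group d)]"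
      by (subst ne[OF in1(1)]) simp
    ultimately show ?thesis
      using False around_vertex_group d in1 by (simp add: cyclic_def vertex_list_def)
  qed
qed

lemma perm_around_vertex: "perm P around_vertex"
  unfolding perm_def
proof (intro conjI finite_P inj_onI)
  show "around_vertex ` P \<subseteq> P"
  proof (rule image_subsetI)
    fix p assume p: "p \<in> P"
    then have "fst p \<in> darts N" "snd p < c (fst p)" by (auto simp: strand_points_def)
    then show "around_vertex p \<in> P"
      using rot_in[of "fst p"] pos[OF rot_in[of "fst p"]] by (auto simp: strand_points_dart around_vertex_def)
  qed
  fix p q assume pq: "p \<in> P" "q \<in> P" "around_vertex p = around_vertex q"
  obtain d i d' j where *: "p = (d, i)" "q = (d', j)" by (cases p; cases q)
  have m: "d \<in> darts N" "i < c d" "d' \<in> darts N" "j < c d'"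
    using pq * by (auto simp: strand_points_dart)
  show "p = q"
    using pq(3) m pos[OF m(1)] pos[OF m(3)] rot_inj[OF m(1,3)] unfolding * around_vertex_def
    by (auto split: if_splits)
qed

lemma perm_around_edge: "perm P around_edge"
  unfolding perm_def
proof (intro conjI finite_P inj_onI)
  show "around_edge ` P \<subseteq> P"
  proof (rule image_subsetI)
    fix p assume p: "p \<in> P"
    then have "fst p \<in> darts N" "snd p < c (fst p)" by (auto simp: strand_points_def)
    then show "around_edge p \<in> P"
      using pos[of "fst p"] by (auto simp: strand_points_dart around_edge_def)
  qed
  fix p q assume pq: "p \<in> P" "q \<in> P" "around_edge p = around_edge q"
  obtain d i d' j where *: "p = (d, i)" "q = (d', j)" by (cases p; cases q)
  have m: "d \<in> darts N" "i < c d" "d' \<in> darts N" "j < c d'"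
    using pq * by (auto simp: strand_points_dart)
  show "p = q"
    using pq(3) m unfolding * around_edge_def
    by (auto split: if_splits)
qed

text \<open>The Euler count passes from darts to strand ends. Vertices, edges and faces are
  separated by cycles of the two permutations and of their composition, and every strand but the
  last one of its dart is a fixed point of the composition, which pays for the additional point.
  Only inequalities are shown, each in the direction that \<open>planar_pair\<close> asks
  for.\<close>

lemma planar_pair_around:
  assumes "planar N"
  shows "planar_pair P around_vertex around_edge"
proof -
  let ?D = "darts N"
  let ?fl = "\<lambda>d. {d, flip d}"
  let ?Gv = "gr ?D r" and ?Gf = "gr ?D (r \<circ> flip)" and ?Gc = "gr ?D r \<union> gr ?D flip"
  have fD: "finite ?D" using fin by (simp add: darts_def)
  have cD: "card ?D = 2 * card (edges N)"
    by (simp add: darts_def card_cartesian_product)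
  have pl: "int (card (components ?D ?Gv)) - int (card (edges N)) + int (card (components ?D ?Gf)) = 2 * int (card (components ?D ?Gc))"
    using assms unfolding planar_def gr_def comp_def .
  have ev: "cls ?Gv d = cls ?Gv (r d)" if "d \<in> ?D" for d
    unfolding cls_eq_iff by (rule conn_gr[OF that order_refl])
  have z1: "card (components ?D ?Gv) \<le> cycles P around_vertex"
  proof -
    have "card ((\<lambda>p. cls ?Gv (fst p)) ` P) \<le> cycles P around_vertex"
      unfolding cycles_def
    proof (rule card_components_ge[OF finite_P])
      have "cls ?Gv (fst p) = cls ?Gv (fst (around_vertex p))" if "p \<in> P" for p
        using ev[of "fst p"] that by (cases p) (auto simp: around_vertex_def strand_points_dart)
      then show "cls ?Gv (fst x) = cls ?Gv (fst y)" if "{x, y} \<in> gr P around_vertex" for x y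
        using that unfolding gr_iff by metis
    qed
    moreover have "fst ` P = ?D"
      using pos by (force simp: strand_points_def)
    then have "(\<lambda>p. cls ?Gv (fst p)) ` P = components ?D ?Gv"
      unfolding components_cls by (metis image_image)
    ultimately show ?thesis by simp
  qed
  have z2: "card (edges N) \<le> cycles P around_edge"
  proof -
    have "card ((\<lambda>p. fst (fst p)) ` P) \<le> cycles P around_edge"
      unfolding cycles_def
    proof (rule card_components_ge[OF finite_P])
      have "fst (fst p) = fst (fst (around_edge p))" for p
        by (auto simp: around_edge_def flip_def)
      then show "fst (fst x) = fst (fst y)" if "{x, y} \<in> gr P around_edge" for x y
        using that unfolding gr_iff by metis
    qed
    moreover have "edges N \<subseteq> (\<lambda>p. fst (fst p)) ` P"
    proof
      fix e assume "e \<in> edges N"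
      then have "((e, False), 0) \<in> P" using pos[of "(e, False)"] by (simp add: strand_points_dart darts_def)
      then show "e \<in> (\<lambda>p. fst (fst p)) ` P" by force
    qed
    then have "card (edges N) \<le> card ((\<lambda>p. fst (fst p)) ` P)"
      using finite_P by (intro card_mono) auto
    ultimately show ?thesis by simp
  qed
  \<comment> \<open>\<open>A\<close> consists of the fixed points of the composition just described;
    the invariant \<open>g\<close> tells them apart from each other and from the faces.\<close>
  define A where "A = {p \<in> P. Suc (snd p) < c (fst p)}"
  define g where "g p = (if Suc (snd p) < c (fst p) then Inl p else Inr (cls ?Gf (fst p)))" for p
  have PA: "card P = card A + card ?D"
  proof -
    have "P = A \<union> (\<lambda>d. (d, c d - 1)) ` ?D"
    proof
      show "P \<subseteq> A \<union> (\<lambda>d. (d, c d - 1)) ` ?D"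
      proof
        fix p assume p: "p \<in> P"
        then have d: "fst p \<in> ?D" "snd p < c (fst p)" by (auto simp: strand_points_def)
        show "p \<in> A \<union> (\<lambda>d. (d, c d - 1)) ` ?D"
        proof (cases "Suc (snd p) < c (fst p)")
          case True
          then show ?thesis using p by (simp add: A_def)
        next
          case False
          then have "p = (fst p, c (fst p) - 1)" using d by (simp add: prod_eq_iff)
          then show ?thesis using d(1) by blast
        qed
      qed
      show "A \<union> (\<lambda>d. (d, c d - 1)) ` ?D \<subseteq> P"
        using pos by (auto simp: A_def strand_points_def)
    qed
    moreover have "card ((\<lambda>d. (d, c d - 1)) ` ?D) = card ?D" by (rule card_image) (auto simp: inj_on_def)
    moreover have "card (A \<union> (\<lambda>d. (d, c d - 1)) ` ?D) = card A + card ((\<lambda>d. (d, c d - 1)) ` ?D)"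
      by (rule card_Un_disjoint) (use finite_P fD in \<open>auto simp: A_def\<close>)
    ultimately show ?thesis by simp
  qed
  have z3: "card A + card (components ?D ?Gf) \<le> cycles P (around_vertex \<circ> around_edge)"
  proof -
    have "card (g ` P) \<le> cycles P (around_vertex \<circ> around_edge)"
      unfolding cycles_def
    proof (rule card_components_ge[OF finite_P])
      have "g p = g (around_vertex (around_edge p))" if "p \<in> P" for p
      proof (cases "Suc (snd p) < c (fst p)")
        case True
        then show ?thesis by (simp add: around_vertex_def around_edge_def)
      next
        case False
        have d: "fst p \<in> ?D" using that by (auto simp: strand_points_def)
        then have d': "r (flip (fst p)) \<in> ?D" using rot_in by simp
        have "around_vertex (around_edge p) = (r (flip (fst p)), c (r (flip (fst p))) - 1)"
          using False by (simp add: around_vertex_def around_edge_def)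
        moreover have "cls ?Gf (fst p) = cls ?Gf (r (flip (fst p)))"
          unfolding cls_eq_iff using conn_gr[OF d order_refl, of "r \<circ> flip"] by simp
        ultimately show ?thesis using False pos[OF d'] by (simp add: g_def)
      qed
      then show "g x = g y" if "{x, y} \<in> gr P (around_vertex \<circ> around_edge)" for x y
        using that unfolding gr_iff comp_apply by metis
    qed
    moreover have "Inl ` A \<union> Inr ` components ?D ?Gf \<subseteq> g ` P"
    proof -
      have "Inl p \<in> g ` P" if "p \<in> A" for p
        using that by (intro image_eqI[of _ _ p]) (auto simp: A_def g_def)
      moreover have "Inr (cls ?Gf d) \<in> g ` P" if "d \<in> ?D" for d
        using that pos[OF that] by (intro image_eqI[of _ _ "(d, c d - 1)"]) (auto simp: g_def strand_points_dart)
      ultimately show ?thesis by (auto simp: components_cls)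
    qed
    then have "card (Inl ` A \<union> Inr ` components ?D ?Gf :: (_ + _) set) \<le> card (g ` P)"
      using finite_P by (intro card_mono) auto
    moreover have "card (Inl ` A \<union> Inr ` components ?D ?Gf :: (_ + _) set) = card A + card (components ?D ?Gf)"
    proof -
      have "finite A" using finite_P by (simp add: A_def)
      then show ?thesis
        using fD by (subst card_Un_disjoint) (auto simp: card_image)
    qed
    ultimately show ?thesis by simp
  qed
  let ?G = "gr P around_vertex \<union> gr P around_edge"
  have zc: "card (components P ?G) \<le> card (components ?D ?Gc)"
  proof -
    have e1: "conn ?G p (around_vertex p)" "conn ?G p (around_edge p)" if "p \<in> P" for p
      by (rule conn_gr[OF that]; auto)+
    have down: "conn ?G (d, i) (d, 0)" if "d \<in> ?D" "i < c d" for d i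
      using that(2)
    proof (induction i)
      case (Suc i)
      have "conn ?G (d, Suc i) (d, i)"
        using e1(1)[of "(d, Suc i)"] Suc.prems that(1) by (simp add: strand_points_dart around_vertex_def)
      then show ?case using Suc conn_trans by fastforce
    qed simp
    have rr: "conn ?G (d, 0) (r d, 0)" if "d \<in> ?D" for d
      using e1(1)[of "(d, 0)"] down[of "r d" "c (r d) - 1"] pos[OF that] pos[OF rot_in[OF that]] rot_in[OF that] that conn_trans
      by (fastforce simp: strand_points_dart around_vertex_def)
    have ff: "conn ?G (d, 0) (flip d, 0)" if "d \<in> ?D" for d
      using e1(2)[of "(d, c d - 1)"] conn_sym[OF down[of d "c d - 1"]] pos[OF that] that conn_trans
      by (fastforce simp: strand_points_dart around_edge_def)
    have "conn ?G (d, 0) (d', 0)" if "conn ?Gc d d'" for d d'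
      using that
    proof (rule conn_map[where r = "\<lambda>d. (d, 0)"])
      fix u v assume "{u, v} \<in> ?Gc"
      then show "conn ?G (u, 0) (v, 0)"
        using rr ff conn_sym unfolding gr_iff Un_iff by metis
    qed
    then have *: "conn ?G x y" if "x \<in> P" "y \<in> P" "cls ?Gc (fst x) = cls ?Gc (fst y)" for x y
    proof -
      have a: "conn ?G x (fst x, 0)" and bb: "conn ?G y (fst y, 0)"
        using down[of "fst x" "snd x"] down[of "fst y" "snd y"] that(1,2) by (auto simp: strand_points_def)
      have m: "conn ?G (fst x, 0) (fst y, 0)"
        using that(3) \<open>\<And>d d'. conn ?Gc d d' \<Longrightarrow> conn ?G (d, 0) (d', 0)\<close> unfolding cls_eq_iff by blast
      show ?thesis
        by (rule conn_trans[OF conn_trans[OF a m] conn_sym[OF bb]])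
    qed
    have "card (components P ?G) \<le> card ((\<lambda>p. cls ?Gc (fst p)) ` P)"
      by (rule card_components_le[OF finite_P]) (rule *)
    also have "\<dots> \<le> card (components ?D ?Gc)"
      using fD by (intro card_mono) (auto simp: components_cls strand_points_def)
    finally show ?thesis .
  qed
  show ?thesis
    unfolding planar_pair_def using z1 z2 z3 zc PA cD pl by linarith
qed

lemma around_edge_point:
  assumes e: "e \<in> edges N" and j: "j < 2 * color N e"
  shows "around_edge (edge_point N e j) = edge_point N e (Suc j mod (2 * color N e))"
proof -
  have k: "color N e > 0" using pos[of "(e, False)"] e by (simp add: darts_def dcolor_def)
  show ?thesis
  proof (cases "Suc j = 2 * color N e")
    case True
    then show ?thesis using k by (simp add: around_edge_def edge_point_def dcolor_def flip_def)
  next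
    case False
    then show ?thesis using j k by (auto simp: around_edge_def edge_point_def dcolor_def flip_def)
  qed
qed

text \<open>The points of an edge form a cycle of \<open>around_edge\<close>, in the order in which
  its diagram is noncrossing, so \<open>planar_pair_refine\<close> handles one edge at a time. As
  refinement acts on the first permutation, the pair is turned around and back by
  \<open>planar_pair_sym\<close>.\<close>

lemma refine_edges:
  assumes pp: "planar_pair P s around_edge" "perm P s" and F: "F \<in> edge_states N"
  shows "planar_pair P s (edge_matching N F)"
proof -
  let ?t = "\<lambda>E p. if fst (fst p) \<in> E then edge_matching N F p else around_edge p"
  have "planar_pair P s (?t E) \<and> perm P (?t E)" if "finite E" "E \<subseteq> edges N" for E
    using that
  proof (induction E rule: finite_induct)
    case empty
    then show ?case using pp perm_around_edge by simp
  next
    case (insert e E)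
    let ?k = "2 * color N e"
    let ?L = "map (edge_point N e) [0..<?k]"
    have e: "e \<in> edges N" and IH: "planar_pair P s (?t E)" "perm P (?t E)" using insert by auto
    have inj: "inj_on (edge_point N e) {..<?k}"
      using edge_index_point by (metis inj_onI lessThan_iff)
    have L: "distinct ?L" "set ?L = edge_point N e ` {..<?k}"
      using inj by (auto simp: distinct_map atLeast0LessThan)
    have LP: "set ?L \<subseteq> P" unfolding L(2) using edge_point_mem[OF e] by auto
    have Lin: "p \<in> set ?L \<longleftrightarrow> fst (fst p) = e" if "p \<in> P" for p
      unfolding L(2) using edge_point_index[OF that] fst_edge_point[of N e] by (metis imageE imageI lessThan_iff)
    have nc: "nc_list (edge_matching N F) ?L"
    proof (rule nc_list_map)
      have f: "matching {..<?k} (F e)" "noncrossing (F e)"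
        using edge_states_nc[OF F e] by (auto simp: nc_matchings_def)
      show "nc_list (F e) [0..<?k]"
        by (rule noncrossing_nc_list) (use f matchingD[OF f(1)] in \<open>auto simp: atLeast0LessThan\<close>)
    qed (use edge_matching_point[OF F e] in auto)
    have cyc: "cyclic (?t E) ?L"
      unfolding cyclic_def
    proof (rule nth_equalityI)
      fix j assume "j < length (map (?t E) ?L)"
      then have j: "j < ?k" by simp
      then have "Suc j mod ?k < ?k" by simp
      then show "map (?t E) ?L ! j = rotate1 ?L ! j"
        using j around_edge_point[OF e j] insert.hyps(2) by (simp add: nth_rotate1 fst_edge_point)
    qed simp
    have ts: "planar_pair P (?t E) s" by (rule planar_pair_sym[OF IH(1) pp(2) IH(2)])
    let ?t' = "\<lambda>p. if p \<in> set ?L then edge_matching N F p else ?t E p"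
    have ref: "planar_pair P ?t' s \<and> perm P ?t'"
      by (rule planar_pair_refine[OF nc L(1) LP ts IH(2) pp(2) cyc])
    have eq: "?t' p = ?t (insert e E) p" if "p \<in> P" for p
      using Lin[OF that] by auto
    have "planar_pair P (?t (insert e E)) s"
      using ref planar_pair_cong[of P ?t' "?t (insert e E)" s s] eq permD(2)[OF pp(2)] by blast
    moreover have "perm P (?t (insert e E))"
      using ref perm_cong[of P ?t' "?t (insert e E)"] eq by blast
    ultimately show ?case
      using planar_pair_sym pp(2) by blast
  qed
  from this[OF fin order_refl] have *: "planar_pair P s (?t (edges N))" "perm P (?t (edges N))" by blast+
  have eq: "?t (edges N) p = edge_matching N F p" if "p \<in> P" for p
    using edge_point_index(1)[OF that] by simp
  show ?thesis
    using * planar_pair_cong[of P s s "?t (edges N)" "edge_matching N F"] eq permD(2)[OF *(2)] by blast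
qed

definition orbit :: "'e dart set \<Rightarrow> 'e dart set" where
  "orbit D = D \<union> r ` D \<union> (\<lambda>d. r (r d)) ` D"

lemma orbit_rot:
  assumes "D \<subseteq> darts N" "d \<in> orbit D"
  shows "r d \<in> orbit D"
proof -
  obtain d0 where d0: "d0 \<in> D" "d \<in> {d0, r d0, r (r d0)}" using assms(2) unfolding orbit_def by blast
  have "r (r (r d0)) \<in> {d0, r d0}"
    using loc[OF subsetD[OF assms(1) d0(1)]] unfolding trivalent_at_def joint_at_def by (elim disjE conjE) simp_all
  then have "r d \<in> {d0, r d0, r (r d0)}" using d0(2) by (elim insertE emptyE) simp_all
  then show ?thesis using d0(1) unfolding orbit_def by blast
qed

text \<open>The same surgery for the strands at the vertices. The induction runs over darts; a dart
  at a vertex treated before changes nothing.\<close>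

lemma refine_vertices:
  assumes pp: "planar_pair P around_vertex t" "perm P t" and D: "finite D" "D \<subseteq> darts N"
  shows "\<exists>s. planar_pair P s t \<and> perm P s \<and>
    (\<forall>p\<in>P. s p = (if fst p \<in> orbit D then vertex_matching N p else around_vertex p))"
  using D
proof (induction D rule: finite_induct)
  case empty
  then show ?case using pp perm_around_vertex by (auto simp: orbit_def)
next
  case (insert d D)
  then obtain s where s: "planar_pair P s t" "perm P s"
    "\<And>p. p \<in> P \<Longrightarrow> s p = (if fst p \<in> orbit D then vertex_matching N p else around_vertex p)" by auto
  have D: "D \<subseteq> darts N" and d: "d \<in> darts N" using insert.prems by auto
  have ins: "orbit (insert d D) = {d, r d, r (r d)} \<union> orbit D" by (auto simp: orbit_def)
  show ?case
  proof (cases "d \<in> orbit D")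
    case True
    then have "orbit (insert d D) = orbit D"
      unfolding ins using True orbit_rot[OF D True] orbit_rot[OF D orbit_rot[OF D True]] by blast
    then show ?thesis using s by auto
  next
    case False
    let ?L = "vertex_list d"
    note L = vertex_list_props[OF d]
    have out: "x \<notin> orbit D" if "x \<in> {d, r d, r (r d)}" for x
    proof
      assume x: "x \<in> orbit D"
      have step: "r y \<in> orbit D" if "y \<in> orbit D" for y
        by (rule orbit_rot[OF D that])
      have "r (r (r (r (r (r d))))) \<in> orbit D"
        using that x by (elim insertE emptyE) (simp_all add: step)
      then show False using False rot6[OF d] by simp
    qed
    have "map s ?L = map around_vertex ?L"
      by (rule map_cong[OF refl]) (use s(3) out L(2) in auto)
    then have cyc: "cyclic s ?L" using cyclic_vertex[OF d] unfolding cyclic_def by metis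
    have LP: "set ?L \<subseteq> P" using L(2) by auto
    let ?s = "\<lambda>p. if p \<in> set ?L then vertex_matching N p else s p"
    have "planar_pair P ?s t \<and> perm P ?s"
      by (rule planar_pair_refine[OF nc_list_vertex[OF d] L(1) LP s(1,2) pp(2) cyc])
    moreover have "?s p = (if fst p \<in> orbit (insert d D) then vertex_matching N p else around_vertex p)" if "p \<in> P" for p
      using s(3)[OF that] L(2) that unfolding ins by auto
    ultimately show ?thesis by blast
  qed
qed

text \<open>This is where planarity enters: genus zero survives the contraction of everything outside
  the vertex.\<close>

lemma nc_list_outside:
  assumes pl: "planar N" and F: "F \<in> edge_states N" and b: "b \<in> darts N"
    and L: "distinct (list_points L)" "set (list_points L) = P - set (vertex_list b)"
      "\<forall>(x, y)\<in>set L. vertex_matching N x = y"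
  shows "nc_list (caps L (edge_matching N F)) (vertex_list b)"
proof -
  let ?t = "edge_matching N F" and ?V = "vertex_matching N"
  let ?B = "{b, r b, r (r b)}"
  note X = vertex_list_props[OF b]
  note mt = matching_edge_matching[OF F]
  have pt: "perm P ?t" by (rule perm_matching[OF finite_P mt])
  have "planar_pair P around_vertex ?t"
    by (rule refine_edges[OF planar_pair_around[OF pl] perm_around_vertex F])
  \<comment> \<open>All vertices are refined except the one at \<open>b\<close>, whose strand ends
    keep their cyclic order.\<close>
  then obtain s where s: "planar_pair P s ?t" "perm P s"
    "\<And>p. p \<in> P \<Longrightarrow> s p = (if fst p \<in> orbit (darts N - ?B) then ?V p else around_vertex p)"
    using refine_vertices[OF _ pt, of "darts N - ?B"] fin by (auto simp: darts_def)
  have orb: "orbit (darts N - ?B) = darts N - ?B"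
  proof -
    have "r d \<notin> ?B" if "d \<in> darts N" "d \<notin> ?B" for d
    proof
      assume "r d \<in> ?B"
      moreover have "r x \<in> ?B" if "x \<in> ?B" for x
        using that loc[OF b] by (auto simp: trivalent_at_def joint_at_def)
      ultimately have "r (r (r (r (r (r d))))) \<in> ?B" by blast
      then show False using that rot6 by simp
    qed
    then have step: "r d \<in> darts N - ?B" if "d \<in> darts N - ?B" for d
      using rot_in that by blast
    have "r ` (darts N - ?B) \<subseteq> darts N - ?B" "(\<lambda>d. r (r d)) ` (darts N - ?B) \<subseteq> darts N - ?B"
      by (rule image_subsetI, rule step, assumption) (rule image_subsetI, rule step, rule step)
    then show ?thesis unfolding orbit_def by (simp only: Un_absorb1 Un_absorb2)
  qed
  have sX: "s p = around_vertex p" if "p \<in> set (vertex_list b)" for p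
  proof -
    have "p \<in> P" "fst p \<in> ?B" using that unfolding X(2) by blast+
    then show ?thesis using s(3)[of p] unfolding orb by simp
  qed
  have sV: "s p = ?V p" if "p \<in> P - set (vertex_list b)" for p
  proof -
    have "p \<in> P" "fst p \<notin> ?B" "fst p \<in> darts N" using that unfolding X(2) strand_points_def by auto
    then show ?thesis using s(3)[of p] unfolding orb by simp
  qed
  \<comment> \<open>Away from \<open>b\<close> the first permutation consists of 2-cycles, the arcs
    in \<open>L\<close>, and deleting them is capping.\<close>
  have "planar_pair (P - set (list_points L)) s (caps L ?t) \<and> perm (P - set (list_points L)) s"
  proof (rule planar_pair_caps[OF s(1,2) mt L(1)])
    show "set (list_points L) \<subseteq> P" using L(2) by blast
    show "s x = y \<and> s y = x" if "(x, y) \<in> set L" for x y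
      using list_points_arc[OF that] sV[of x] sV[of y] L(2,3) that matchingD(1)[OF matching_vertex_matching, of x] by auto
  qed
  moreover have PL: "P - set (list_points L) = set (vertex_list b)"
    using L(2) X(2) by auto
  moreover have "matching (set (vertex_list b)) (caps L ?t)"
    using caps_spec(1)[OF finite_P mt L(1)] L(2) unfolding PL by auto
  moreover have "cyclic s (vertex_list b)"
  proof -
    have "map s (vertex_list b) = map around_vertex (vertex_list b)"
      by (rule map_cong[OF refl]) (rule sX)
    then show ?thesis using cyclic_vertex[OF b] unfolding cyclic_def by metis
  qed
  ultimately show ?thesis
    using planar_pair_nc_list[of "vertex_list b" s "caps L ?t"] X(1) by simp
qed

end

end

section \<open>Removing a vertex\<close>

lemma no_adjacent_group:
  assumes "\<not> no_adjacent f (map (\<lambda>i. (d, k - 1 - i)) [0..<k])" "\<And>p. f (f p) = p"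
  obtains i where "Suc i < k" "f (d, i) = (d, Suc i)"
proof -
  obtain A x y B where L: "map (\<lambda>i. (d, k - 1 - i)) [0..<k] = A @ x # y # B" "f x = y"
    using assms(1) unfolding no_adjacent_def by blast
  let ?L = "map (\<lambda>i. (d, k - 1 - i)) [0..<k]"
  let ?l = "length A"
  have len: "length ?L = k" by simp
  then have l: "Suc ?l < k" using arg_cong[OF L(1), of length] by simp
  have "?L ! ?l = x" "?L ! Suc ?l = y"
    unfolding L(1) by (simp_all add: nth_append)
  then have "x = (d, k - 1 - ?l)" "y = (d, k - 1 - Suc ?l)" using l by simp_all
  then have "f (d, k - 1 - Suc ?l) = (d, Suc (k - 1 - Suc ?l))"
    using L(2) assms(2)[of x] l by (metis Suc_diff_Suc Suc_less_eq less_diff_conv diff_Suc_1 diff_diff_left plus_1_eq_Suc Suc_lessD less_imp_Suc_add add_diff_cancel_left')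
  then show ?thesis using that[of "k - 1 - Suc ?l"] l by simp
qed

locale vertex_network = network N for N :: "'e spin_network" +
  fixes b :: "'e dart" and n :: nat
  assumes b: "distinguished_vertex N (2 * n) b" and pl: "planar N"
    and pos: "n > 0 \<Longrightarrow> e \<in> edges N \<Longrightarrow> color N e > 0"
begin

definition X :: "('e dart \<times> nat) set" where
  "X = {b, r b, r (r b)} \<times> {..<2 * n}"

definition VX :: "'e dart \<times> nat \<Rightarrow> 'e dart \<times> nat" where
  "VX p = (if p \<in> X then vertex_matching N p else p)"

definition s1 :: "nat \<Rightarrow> 'e dart \<times> nat" where "s1 i = (b, i)"
text \<open>Numbered against the other two groups, to meet the order of the arcs in
  \<open>config\<close>.\<close>

definition s2 :: "nat \<Rightarrow> 'e dart \<times> nat" where "s2 i = (r b, 2 * n - 1 - i)"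
definition s3 :: "nat \<Rightarrow> 'e dart \<times> nat" where "s3 i = (r (r b), i)"

definition J :: "('e dart \<times> nat \<Rightarrow> 'e dart \<times> nat) operator" where
  "J \<Phi> = jwp X s1 (2 * n) (jwp X s2 (2 * n) (jwp X s3 (2 * n) \<Phi>))"

lemma b_facts: "b \<in> darts N" "trivalent_at N b" "r b \<in> darts N" "r (r b) \<in> darts N" "r (r (r b)) = b"
  "b \<noteq> r b" "b \<noteq> r (r b)" "r b \<noteq> r (r b)" "c b = 2 * n" "c (r b) = 2 * n" "c (r (r b)) = 2 * n"
proof -
  show 1: "b \<in> darts N" "trivalent_at N b" "c b = 2 * n" "c (r b) = 2 * n" "c (r (r b)) = 2 * n"
    using b by (auto simp: distinguished_vertex_def)
  then show "r b \<in> darts N" "r (r b) \<in> darts N" "r (r (r b)) = b"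
    "b \<noteq> r b" "b \<noteq> r (r b)" "r b \<noteq> r (r b)"
    using rot_in trivalent_distinct[OF 1(1,2)] by auto
qed

lemma corners: "d \<in> {b, r b, r (r b)} \<Longrightarrow> corner_strands N d = n \<and> d \<in> darts N \<and> c d = 2 * n"
proof -
  have "trivalent_at N (r b)" "trivalent_at N (r (r b))"
    using trivalent_rot b_facts(1-4) by blast+
  then show "d \<in> {b, r b, r (r b)} \<Longrightarrow> corner_strands N d = n \<and> d \<in> darts N \<and> c d = 2 * n"
    using b_facts by (auto simp: corner_strands_def)
qed

lemma X_eq: "X = set (vertex_list b)"
  unfolding vertex_list_props(2)[OF b_facts(1)] X_def strand_points_def using b_facts by auto

lemma X_sub: "X \<subseteq> P"
  unfolding X_eq using vertex_list_props(2)[OF b_facts(1)] by auto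

lemma finite_X: "finite X" by (simp add: X_def)

lemma three: "three_groups X s1 s2 s3 (2 * n) (2 * n) (2 * n)"
  by unfold_locales (use b_facts(6-8) in \<open>auto simp: X_def s1_def s2_def s3_def\<close>)

lemma VX_arcs:
  assumes "i < n"
  shows "VX (b, i) = (r b, 2 * n - 1 - i)" "VX (r b, i) = (r (r b), 2 * n - 1 - i)" "VX (r (r b), i) = (b, 2 * n - 1 - i)"
    "VX (r b, 2 * n - 1 - i) = (b, i)" "VX (r (r b), 2 * n - 1 - i) = (r b, i)" "VX (b, 2 * n - 1 - i) = (r (r b), i)"
  using vertex_matching_corner(3,4)[of b i] vertex_matching_corner(3,4)[of "r b" i]
    vertex_matching_corner(3,4)[of "r (r b)" i] corners[of b] corners[of "r b"] corners[of "r (r b)"] assms b_facts(5)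
  by (auto simp: VX_def X_def)

lemma X_closed: "p \<in> X \<Longrightarrow> vertex_matching N p \<in> X"
proof -
  assume p: "p \<in> X"
  then have "vertex_matching N p \<in> P"
    using X_sub matchingD(5)[OF matching_vertex_matching] by blast
  moreover have "fst (vertex_matching N p) \<in> {b, r b, r (r b)}"
  proof -
    have "p \<in> P" "fst p \<in> {b, r b, r (r b)}" using p X_sub by (auto simp: X_def)
    moreover then have "fst (vertex_matching N p) = r (fst p) \<or> fst (vertex_matching N p) = r (r (fst p))"
      by (simp add: vertex_matching_def)
    ultimately show ?thesis using b_facts(5) by auto
  qed
  ultimately show ?thesis
    unfolding X_eq vertex_list_props(2)[OF b_facts(1)] by blast
qed

lemma matching_VX: "matching X VX"
  unfolding matching_def
proof
  fix p
  show "VX (VX p) = p \<and> (VX p \<noteq> p \<longleftrightarrow> p \<in> X)"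
    using X_closed[of p] X_sub matchingD(1,2)[OF matching_vertex_matching, of p] by (auto simp: VX_def)
qed

lemma config_VX: "three_groups.config X s1 s2 s3 n n n VX"
proof -
  interpret three_groups X s1 s2 s3 "2 * n" "2 * n" "2 * n" by (rule three)
  have 1: "VX (s1 i) = s2 i" if "i < n" for i
    using VX_arcs(1)[OF that] by (simp add: s1_def s2_def)
  have 2: "VX (s1 (n + j)) = s3 (n - 1 - j)" if "j < n" for j
  proof -
    have "2 * n - 1 - (n - 1 - j) = n + j" "n - 1 - j < n" using that by auto
    then show ?thesis using VX_arcs(6)[of "n - 1 - j"] by (simp add: s1_def s3_def)
  qed
  have 3: "VX (s2 (n + k)) = s3 (n + k)" if "k < n" for k
  proof -
    have "2 * n - 1 - (n + k) = n - 1 - k" "2 * n - 1 - (n - 1 - k) = n + k" "n - 1 - k < n" using that by auto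
    then show ?thesis using VX_arcs(2)[of "n - 1 - k"] by (simp add: s2_def s3_def)
  qed
  show ?thesis
    unfolding config_def using matching_VX 1 2 3 by auto
qed

text \<open>All \<open>3 * n\<close> arcs of \<open>VX\<close> belong to the net, so the two powers
  of \<open>circle_value\<close> in \<open>theta_net_eq\<close> cancel.\<close>

lemma theta_VX: "J (pairing X VX) VX = theta n n n"
proof -
  interpret three_groups X s1 s2 s3 "2 * n" "2 * n" "2 * n" by (rule three)
  have "card X = 6 * n"
    using b_facts(6-8) by (simp add: X_def card_cartesian_product)
  moreover have "theta_net n n n VX * circle_value ^ (n + n + n) = theta n n n * circle_value ^ (card X div 2)"
    by (rule theta_net_eq[OF config_VX]) auto
  moreover have "6 * n div 2 = n + n + n" by simp
  ultimately have "theta_net n n n VX = theta n n n"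
    by (metis circle_value_nonzero mult_cancel_right power_not_zero)
  then show ?thesis
    unfolding theta_net_def J_def mult_2 .
qed

lemma J_kill:
  assumes d: "d \<in> {b, r b, r (r b)}" and i: "Suc i < 2 * n"
  shows "hook_op X (d, i) (d, Suc i) (J \<Phi>) = (\<lambda>_. 0)"
proof -
  interpret three_groups X s1 s2 s3 "2 * n" "2 * n" "2 * n" by (rule three)
  let ?m = "2 * n"
  interpret S: temperley_lieb "strand_op X s1" ?m by (rule tl(1))
  interpret T: temperley_lieb "strand_op X s2" ?m by (rule tl(2))
  interpret U: temperley_lieb "strand_op X s3" ?m by (rule tl(3))
  consider "d = b" | "d = r b" | "d = r (r b)" using d by blast
  then show ?thesis
  proof cases
    case 1
    then show ?thesis
      using S.jw_kills(1)[OF i order_refl] by (simp add: J_def strand_op_def s1_def)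
  next
    case 2
    let ?j = "?m - 2 - i"
    have j: "Suc ?j < ?m" "?m - 1 - ?j = Suc i" "?m - 1 - Suc ?j = i" using i by auto
    have "hook_op X (d, i) (d, Suc i) = strand_op X s2 ?j"
      unfolding strand_op_def s2_def j(2,3) 2 by (rule hook_op_commute) simp
    then show ?thesis
      using T.jw_kills(1)[OF j(1) order_refl] by (simp add: J_def jw_st)
  next
    case 3
    have "J \<Phi> = jwp X s3 ?m (jwp X s1 ?m (jwp X s2 ?m \<Phi>))"
      unfolding J_def by (simp add: jw_su jw_tu)
    then show ?thesis
      using U.jw_kills(1)[OF i order_refl] 3 by (simp add: strand_op_def s3_def)
  qed
qed

text \<open>If \<open>R\<close> joins neighbours within a group, a hook there multiplies the value
  by \<open>circle_value\<close>, but the box makes it 0. Without such arcs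
  \<open>nc_list_groups\<close> cuts each group into two lists, whose lengths must all be
  \<open>n\<close>, and this determines \<open>R\<close>.\<close>

lemma J_zero:
  assumes R: "matching X R" and nc: "nc_list R (vertex_list b)" and ne: "R \<noteq> VX"
  shows "J \<Phi> R = 0"
proof -
  have dead: "J \<Phi> R = 0" if na: "\<not> no_adjacent R (group d)" and d: "d \<in> {b, r b, r (r b)}" for d
  proof -
    have cd: "c d = 2 * n" "group d = map (\<lambda>i. (d, 2 * n - 1 - i)) [0..<2 * n]"
      using corners[OF d] by (auto simp: group_def)
    obtain i where i: "Suc i < 2 * n" "R (d, i) = (d, Suc i)"
      using no_adjacent_group[of R d "2 * n"] na matchingD(1)[OF R] unfolding cd by metis
    have "(d, i) \<in> X" using d i(1) by (auto simp: X_def)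
    then have "hook_op X (d, i) (d, Suc i) (J \<Phi>) R = circle_value * J \<Phi> R"
      by (rule hook_op_arc[OF R _ i(2)])
    then show ?thesis using J_kill[OF d i(1), of \<Phi>] by simp
  qed
  show ?thesis
  proof (rule ccontr)
    assume "J \<Phi> R \<noteq> 0"
    then have na: "no_adjacent R (group b)" "no_adjacent R (group (r b))" "no_adjacent R (group (r (r b)))"
      using dead by blast+
    have vl: "vertex_list b = group b @ group (r b) @ group (r (r b))"
      using b_facts(2) by (simp add: vertex_list_def)
    obtain A1 A2 B1 B2 C1 C2 where g: "group b = A1 @ A2" "group (r b) = B1 @ B2" "group (r (r b)) = C1 @ C2"
      and R3: "B1 = rev (map R A2)" "C1 = rev (map R B2)" "C2 = rev (map R A1)"
      using nc_list_groups[OF nc[unfolded vl] na] by metis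
    have len: "length A1 + length A2 = 2 * n" "length B1 + length B2 = 2 * n" "length C1 + length C2 = 2 * n"
      using arg_cong[OF g(1), of length] arg_cong[OF g(2), of length] arg_cong[OF g(3), of length] b_facts by auto
    have len': "length B1 = length A2" "length C1 = length B2" "length C2 = length A1"
      using R3 by auto
    then have ln: "length A1 = n" "length A2 = n" "length B1 = n" "length B2 = n" "length C1 = n" "length C2 = n"
      using len by linarith+
    let ?V = "vertex_matching N"
    have V: "rev (map ?V (drop n (group d))) = take n (group (r d))" if "d \<in> {b, r b, r (r b)}" for d
      using group_corner[of d] corners[OF that] by simp
    have dr: "A1 = take n (group b)" "A2 = drop n (group b)" "B1 = take n (group (r b))" "B2 = drop n (group (r b))"
      "C1 = take n (group (r (r b)))" "C2 = drop n (group (r (r b)))"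
      using g ln by simp_all
    have V3: "rev (map ?V A2) = B1" "rev (map ?V B2) = C1" "rev (map ?V C2) = A1"
      unfolding dr using V[of b] V[of "r b"] V[of "r (r b)"] b_facts(5) by simp_all
    have m: "map R A2 = map ?V A2" "map R B2 = map ?V B2" "map ?V C2 = rev A1" "C2 = rev (map R A1)"
      using V3 R3 by (metis rev_rev_ident)+
    have VV: "?V (?V p) = p" for p using matchingD(1)[OF matching_vertex_matching] .
    have "map R A1 = map ?V A1"
    proof -
      have "map ?V (map ?V C2) = map ?V (rev A1)" using m(3) by simp
      then have "C2 = rev (map ?V A1)" by (simp add: VV o_def rev_map)
      then show ?thesis using m(4) by simp
    qed
    then have eq: "R p = ?V p" if "p \<in> set A1 \<union> set A2 \<union> set B2" for p
      using that m(1,2) by (auto simp: map_eq_conv)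
    have RR: "R (R p) = p" for p using matchingD(1)[OF R] .
    have img: "set B1 = R ` set A2" "set C1 = R ` set B2" "set C2 = R ` set A1"
      unfolding R3 by auto
    have eqX: "R p = ?V p" if p: "p \<in> X" for p
    proof -
      have "p \<in> set A1 \<union> set A2 \<union> set B1 \<union> set B2 \<union> set C1 \<union> set C2"
        using p unfolding X_eq vl g by auto
      then have "p \<in> set A1 \<union> set A2 \<union> set B2 \<or> (\<exists>q \<in> set A1 \<union> set A2 \<union> set B2. p = R q)"
        unfolding img by blast
      then show ?thesis
      proof
        assume "\<exists>q \<in> set A1 \<union> set A2 \<union> set B2. p = R q"
        then obtain q where q: "q \<in> set A1 \<union> set A2 \<union> set B2" "p = R q" by blast
        then have "p = ?V q" using eq[OF q(1)] by simp
        then show ?thesis using q(2) RR[of q] VV[of q] by simp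
      qed (rule eq)
    qed
    have "R = VX"
    proof
      fix p
      show "R p = VX p"
        using eqX[of p] matchingD(3)[OF R, of p] by (simp add: VX_def)
    qed
    then show False using ne by simp
  qed
qed

text \<open>The outside of the distinguished vertex is a combination of noncrossing matchings of the
  \<open>6 n\<close> strand ends at the vertex. The boxes kill those with an arc inside one of the three edges,
  and \<open>VX\<close> is the only other one.\<close>

lemma vertex_removal:
  assumes L: "distinct (list_points L)" "set (list_points L) = P - X" "\<forall>(x, y)\<in>set L. vertex_matching N x = y"
  shows "\<exists>k. \<forall>\<Phi>. net_sum N (cap_op P L \<Phi>) = k * J \<Phi> VX"
proof -
  interpret G: three_groups X s1 s2 s3 "2 * n" "2 * n" "2 * n" by (rule three)
  have LP: "set (list_points L) \<subseteq> P" "P - set (list_points L) = X"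
    using L(2) X_sub by auto
  let ?M = "\<lambda>\<Phi>. net_sum N (cap_op P L \<Phi>)"
  have fM: "fcomb ?M"
    by (rule fcomb_comp[OF fcomb_net_sum]) (rule fcomb_op[OF linear_op_cap_op])
  have kill: "?M (hook_op X (d, i) (d, Suc i) \<Phi>) = 0" if d: "d \<in> {b, r b, r (r b)}" and i: "Suc i < 2 * n" for d i \<Phi>
  proof -
    have in_X: "(d, i) \<in> X" "(d, Suc i) \<in> X" using d i by (auto simp: X_def)
    then have "cap_op P L (hook_op X (d, i) (d, Suc i) \<Phi>) = hook_op P (d, i) (d, Suc i) (cap_op P L \<Phi>)"
      using cap_op_hook_op[OF L(1) LP(1), of "(d, i)" "(d, Suc i)" \<Phi>] X_sub L(2) unfolding LP(2) by auto
    then show ?thesis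
      using net_sum_kill[of d i] corners[OF d] i by simp
  qed
  have k1: "?M (strand_op X s1 i \<Phi>) = 0" if "Suc i < 2 * n" for i \<Phi>
    using kill[of b i \<Phi>] that by (simp add: strand_op_def s1_def)
  have k3: "?M (strand_op X s3 i \<Phi>) = 0" if "Suc i < 2 * n" for i \<Phi>
    using kill[of "r (r b)" i \<Phi>] that by (simp add: strand_op_def s3_def)
  have k2: "?M (strand_op X s2 i \<Phi>) = 0" if i: "Suc i < 2 * n" for i \<Phi>
  proof -
    let ?j = "2 * n - 2 - i"
    have "2 * n - 1 - i = Suc ?j" "2 * n - 1 - Suc i = ?j" "Suc ?j < 2 * n" using i by auto
    then show ?thesis
      using kill[of "r b" ?j \<Phi>] hook_op_commute[of "(r b, Suc ?j)" "(r b, ?j)" X] by (simp add: strand_op_def s2_def)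
  qed
  \<comment> \<open>The edges at the vertex carry boxes already, and these absorb the boxes of
    \<open>J\<close>.\<close>
  have MJ: "?M (J \<Phi>) = ?M \<Phi>" for \<Phi>
    unfolding J_def
    using jw_absorb[of ?M "2 * n" "strand_op X s1"] jw_absorb[of ?M "2 * n" "strand_op X s2"]
      jw_absorb[of ?M "2 * n" "strand_op X s3"] fM k1 k2 k3 by simp
  \<comment> \<open>The coefficient of \<open>VX\<close> in the outside of the vertex; by
    \<open>J_zero\<close> only this term passes the boxes.\<close>
  define k where "k = ?M (\<lambda>R. if R = VX then 1 else 0)"
  have "?M \<Phi> = k * J \<Phi> VX" for \<Phi>
  proof -
    have "cap_op P L (J \<Phi>) (edge_matching N F) = cap_op P L (\<lambda>R. if R = VX then 1 else 0) (edge_matching N F) * J \<Phi> VX"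
      if F: "F \<in> edge_states N" for F
    proof -
      let ?f = "edge_matching N F"
      let ?R = "caps L ?f"
      note mf = matching_edge_matching[OF F]
      have R: "matching X ?R"
        using caps_spec(1)[OF finite_P mf L(1) LP(1)] unfolding LP(2) .
      have "J \<Phi> ?R = (if ?R = VX then 1 else 0) * J \<Phi> VX"
      proof (cases "?R = VX")
        case False
        \<comment> \<open>For \<open>n = 0\<close> there are no strand ends at the vertex, and the
          identity is their only matching. So the genus argument is used with positive colors
          only.\<close>
        have "n > 0"
        proof (rule ccontr)
          assume "\<not> n > 0"
          then have "n = 0" by simp
          then have "{..<2 * n} = {}" by simp
          then have "X = {}" unfolding X_def by blast
          then have "?R = VX" using matchingD(3)[OF R] matchingD(3)[OF matching_VX] by auto
          then show False using False by simp
        qed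
        then have p: "c d > 0" if "d \<in> darts N" for d
          using pos[of "fst d"] that by (auto simp: darts_def dcolor_def)
        have "nc_list ?R (vertex_list b)"
          by (rule nc_list_outside[OF p pl F b_facts(1) L(1) L(2)[unfolded X_eq] L(3)])
        then show ?thesis using J_zero[OF R _ False] False by simp
      qed simp
      then show ?thesis using mf by (simp add: cap_op_def)
    qed
    then have "?M (J \<Phi>) = k * J \<Phi> VX"
      unfolding k_def net_sum_def sum_distrib_right by (intro sum.cong refl) (simp add: mult.assoc)
    then show ?thesis using MJ by simp
  qed
  then show ?thesis by blast
qed

lemma outside_arcs:
  obtains L where "distinct (list_points L)" "set (list_points L) = P - X" "\<forall>(x, y)\<in>set L. vertex_matching N x = y"
proof -
  have "vertex_matching N p \<in> P - X \<and> vertex_matching N p \<noteq> p \<and> vertex_matching N (vertex_matching N p) = p" if "p \<in> P - X" for p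
  proof -
    note m = matchingD[OF matching_vertex_matching]
    have "vertex_matching N p \<notin> X"
      using X_closed[of "vertex_matching N p"] m(1) that by auto
    then show ?thesis using m(1,2,5) that by auto
  qed
  then show ?thesis
    using arc_list_exists[of "P - X" "vertex_matching N"] finite_P that by blast
qed

lemma caps_VX:
  assumes L: "distinct (list_points L)" "set (list_points L) = P - X" "\<forall>(x, y)\<in>set L. vertex_matching N x = y"
  shows "caps L (vertex_matching N) = VX"
proof -
  have "caps L (vertex_matching N) = (\<lambda>p. if p \<in> set (list_points L) then p else vertex_matching N p)"
    by (rule caps_arcs[OF matching_vertex_matching L(1) _ L(3)]) (use L(2) in auto)
  then show ?thesis
    unfolding L(2) using matchingD(3)[OF matching_vertex_matching] X_sub by (auto simp: VX_def fun_eq_iff)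
qed

text \<open>The whole network is its outside paired with the removed vertex \<open>VX\<close>, and
  \<open>theta_VX\<close> gives the value of that vertex against itself through the boxes.\<close>

lemma evaluation_theta:
  assumes L: "distinct (list_points L)" "set (list_points L) = P - X" "\<forall>(x, y)\<in>set L. vertex_matching N x = y"
    and k: "\<And>\<Phi>. net_sum N (cap_op P L \<Phi>) = k * J \<Phi> VX"
  shows "evaluation N = k * theta n n n"
proof -
  have LP: "set (list_points L) \<subseteq> P" "P - set (list_points L) = X"
    using L(2) X_sub by auto
  have "evaluation N = net_sum N (cap_op P L (pairing X VX))"
    unfolding evaluation_net_sum
  proof (rule net_sum_cong)
    fix F assume F: "F \<in> edge_states N"
    note mf = matching_edge_matching[OF F]
    have R: "matching X (caps L (edge_matching N F))"
      using caps_spec(1)[OF finite_P mf L(1) LP(1)] unfolding LP(2) .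
    show "pairing P (vertex_matching N) (edge_matching N F) = cap_op P L (pairing X VX) (edge_matching N F)"
      using circles_caps[OF finite_P mf matching_vertex_matching L(1) LP(1) L(3)] mf R
        matching_vertex_matching matching_VX
      by (simp add: pairing_def cap_op_def caps_VX[OF L] LP(2) power_add)
  qed
  then show ?thesis using k theta_VX by simp
qed

end

section \<open>Gluing two networks\<close>

definition inl_strand :: "'a dart \<times> nat \<Rightarrow> ('a + 'b) dart \<times> nat" where
  "inl_strand = map_prod inl_dart id"

definition inr_strand :: "'b dart \<times> nat \<Rightarrow> ('a + 'b) dart \<times> nat" where
  "inr_strand = map_prod inr_dart id"

lemma inl_inr_dart [simp]:
  "inl_dart d = inl_dart d' \<longleftrightarrow> d = d'" "inr_dart e = inr_dart e' \<longleftrightarrow> e = e'" "inl_dart d \<noteq> inr_dart e" "inr_dart e \<noteq> inl_dart d"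
  by (auto simp: inl_dart_def inr_dart_def map_prod_def split: prod.splits)

lemma inl_inr_strand [simp]:
  "inl_strand p = inl_strand p' \<longleftrightarrow> p = p'" "inr_strand q = inr_strand q' \<longleftrightarrow> q = q'"
  "inl_strand p \<noteq> inr_strand q" "inr_strand q \<noteq> inl_strand p"
  by (auto simp: inl_strand_def inr_strand_def map_prod_def split: prod.splits)

lemma inl_inr_strand_image [simp]:
  "inl_strand p \<in> inl_strand ` A \<longleftrightarrow> p \<in> A" "inr_strand q \<in> inr_strand ` B \<longleftrightarrow> q \<in> B"
  "inl_strand p \<notin> inr_strand ` B" "inr_strand q \<notin> inl_strand ` A"
  by auto

lemma sum_dart_cases: obtains (inl) d' where "d = inl_dart d'" | (inr) d' where "d = inr_dart d'"
proof -
  obtain e s where d: "d = (e, s)" by fastforce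
  show ?thesis
    using inl[of "(_, s)"] inr[of "(_, s)"] d by (cases e) (auto simp: inl_dart_def inr_dart_def)
qed

lemma sum_strand_cases: obtains (inl) q where "p = inl_strand q" | (inr) q where "p = inr_strand q"
proof -
  obtain d i where p: "p = (d, i)" by fastforce
  show ?thesis
    by (rule sum_dart_cases[of d]) (use inl[of "(_, i)"] inr[of "(_, i)"] p in \<open>auto simp: inl_strand_def inr_strand_def\<close>)
qed

definition glued :: "('a dart \<times> nat \<Rightarrow> 'a dart \<times> nat) \<Rightarrow> ('b dart \<times> nat \<Rightarrow> 'b dart \<times> nat) \<Rightarrow>
    ('a + 'b) dart \<times> nat \<Rightarrow> ('a + 'b) dart \<times> nat" where
  "glued f g p = (case fst (fst p) of Inl x \<Rightarrow> inl_strand (f ((x, snd (fst p)), snd p))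
     | Inr y \<Rightarrow> inr_strand (g ((y, snd (fst p)), snd p)))"

lemma glued_apply [simp]: "glued f g (inl_strand p) = inl_strand (f p)" "glued f g (inr_strand q) = inr_strand (g q)"
  by (cases p; cases q; auto simp: glued_def inl_strand_def inr_strand_def inl_dart_def inr_dart_def)+

lemma matching_glued:
  assumes "matching A f" "matching B g"
  shows "matching (inl_strand ` A \<union> inr_strand ` B) (glued f g)"
  unfolding matching_def
proof
  fix p
  show "glued f g (glued f g p) = p \<and> (glued f g p \<noteq> p \<longleftrightarrow> p \<in> inl_strand ` A \<union> inr_strand ` B)"
    by (cases rule: sum_strand_cases[of p]) (use assms in \<open>simp_all add: matching_def del: split_paired_All\<close>)
qed

lemma del_glued:
  "del (inl_strand x) (inl_strand y) (glued f g) = glued (del x y f) g"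
  "del (inr_strand u) (inr_strand v) (glued f g) = glued f (del u v g)"
proof -
  show "del (inl_strand x) (inl_strand y) (glued f g) = glued (del x y f) g"
  proof
    fix p
    show "del (inl_strand x) (inl_strand y) (glued f g) p = glued (del x y f) g p"
      by (rule sum_strand_cases[of p]) (auto simp: del_def hook_def)
  qed
  show "del (inr_strand u) (inr_strand v) (glued f g) = glued f (del u v g)"
  proof
    fix p
    show "del (inr_strand u) (inr_strand v) (glued f g) p = glued f (del u v g) p"
      by (rule sum_strand_cases[of p]) (auto simp: del_def hook_def)
  qed
qed

abbreviation sum_arcs where
  "sum_arcs K L \<equiv> map (map_prod inl_strand inl_strand) K @ map (map_prod inr_strand inr_strand) L"

lemma caps_glued: "caps (sum_arcs K L) (glued f g) = glued (caps K f) (caps L g)"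
proof (induction K f rule: caps.induct)
  case (1 f)
  show ?case
    by (induction L g rule: caps.induct) (simp_all add: del_glued)
qed (simp add: del_glued)

lemma cap_circles_glued: "cap_circles (sum_arcs K L) (glued f g) = cap_circles K f + cap_circles L g"
proof (induction K f rule: caps.induct)
  case (1 f)
  show ?case
    by (induction L g rule: caps.induct) (simp_all add: del_glued)
qed (simp add: del_glued)

lemma list_points_map: "list_points (map (map_prod h h) K) = map h (list_points K)"
  by (induction K rule: list_points.induct) simp_all

lemma list_points_append: "list_points (K @ L) = list_points K @ list_points L"
  by (induction K rule: list_points.induct) simp_all

lemma hook_op_restrict:
  assumes "x \<in> P" "y \<in> P" "x \<noteq> y"
  shows "hook_op P x y (\<lambda>f. if matching P f then \<Phi> f else 0) = hook_op P x y \<Phi>"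
  by (rule ext) (simp add: hook_op_def matching_hook[OF _ assms])

context vertex_network
begin

text \<open>Transposition reverses the order of the three boxes, which sit on disjoint groups and
  commute.\<close>

lemma adjoint_J: "adjoint X J J"
proof -
  interpret T: three_groups X s1 s2 s3 "2 * n" "2 * n" "2 * n" by (rule three)
  have a: "adjoint X (jwp X s1 (2 * n)) (jwp X s1 (2 * n))" "adjoint X (jwp X s2 (2 * n)) (jwp X s2 (2 * n))"
    "adjoint X (jwp X s3 (2 * n)) (jwp X s3 (2 * n))"
    using T.groups[OF order_refl] by (intro adjoint_jwp[OF finite_X]; simp)+
  have "adjoint X (\<lambda>\<Phi>. jwp X s1 (2 * n) (jwp X s2 (2 * n) (jwp X s3 (2 * n) \<Phi>)))
      (\<lambda>\<Phi>. jwp X s3 (2 * n) (jwp X s2 (2 * n) (jwp X s1 (2 * n) \<Phi>)))"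
    by (rule adjoint_comp[OF a(1) adjoint_comp[OF a(2,3) linear_op_jwp linear_op_jwp] linear_op_jwp
      linear_op_comp[OF linear_op_jwp linear_op_jwp]])
  moreover have "jwp X s3 (2 * n) (jwp X s2 (2 * n) (jwp X s1 (2 * n) \<Phi>)) = J \<Phi>" for \<Phi>
    unfolding J_def
    by (simp only: T.jw_st[OF order_refl order_refl, symmetric] T.jw_su[OF order_refl order_refl, symmetric]
      T.jw_tu[OF order_refl order_refl, symmetric])
  ultimately show ?thesis
    by (simp add: J_def[abs_def])
qed

lemma J_fixed:
  assumes "\<And>d i. d \<in> {b, r b, r (r b)} \<Longrightarrow> Suc i < 2 * n \<Longrightarrow> hook_op X (d, i) (d, Suc i) \<Phi> = (\<lambda>_. 0)"
  shows "J \<Phi> = \<Phi>"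
proof -
  have "strand_op X s1 i \<Phi> = (\<lambda>_. 0)" "strand_op X s3 i \<Phi> = (\<lambda>_. 0)" if "Suc i < 2 * n" for i
    using assms[of b i] assms[of "r (r b)" i] that by (simp_all add: strand_op_def s1_def s3_def)
  moreover have "strand_op X s2 i \<Phi> = (\<lambda>_. 0)" if i: "Suc i < 2 * n" for i
  proof -
    let ?j = "2 * n - 2 - i"
    have "2 * n - 1 - i = Suc ?j" "2 * n - 1 - Suc i = ?j" "Suc ?j < 2 * n" using i by auto
    then show ?thesis
      using assms[of "r b" ?j] hook_op_commute[of "(r b, Suc ?j)" "(r b, ?j)" X] by (simp add: strand_op_def s2_def)
  qed
  moreover have "linear_op (strand_op X s i)" for s i
    by (simp add: strand_op_def linear_op_hook_op)
  ultimately have "jwp X s1 (2 * n) \<Phi> = \<Phi>" "jwp X s2 (2 * n) \<Phi> = \<Phi>" "jwp X s3 (2 * n) \<Phi> = \<Phi>"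
    by (intro jw_fixed; simp)+
  then show ?thesis by (simp add: J_def)
qed
lemma rot_outside: "d \<in> darts N \<Longrightarrow> d \<notin> {b, r b, r (r b)} \<Longrightarrow> r d \<notin> {b, r b, r (r b)}"
  using rot_inj[of d b] rot_inj[of d "r b"] rot_inj[of d "r (r b)"] b_facts(1-5) by auto

lemma outside_X: "p \<in> P \<Longrightarrow> p \<notin> X \<Longrightarrow> fst p \<notin> {b, r b, r (r b)}"
  using b_facts(9-11) by (auto simp: X_def strand_points_def)

end

locale glued_networks = A: vertex_network M a n + B: vertex_network N b n
  for M :: "'a spin_network" and a and N :: "'b spin_network" and b and n
begin

abbreviation G where "G \<equiv> glue M a N b"

lemma rot_glue:
  "rot G (inl_dart d) = (if d = a then inr_dart b else if d = A.r a then inr_dart (B.r (B.r b))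
     else if d = A.r (A.r a) then inr_dart (B.r b) else inl_dart (A.r d))"
  "rot G (inr_dart e) = (if e = b then inl_dart a else if e = B.r b then inl_dart (A.r (A.r a))
     else if e = B.r (B.r b) then inl_dart (A.r a) else inr_dart (B.r e))"
  by (cases d; cases e; simp add: glue_def inl_dart_def inr_dart_def)+

lemma dcolor_glue: "dcolor G (inl_dart d) = A.c d" "dcolor G (inr_dart e) = B.c e"
  by (cases d; cases e; simp add: glue_def inl_dart_def inr_dart_def dcolor_def)+

lemma edges_glue: "edges G = edges M <+> edges N"
  by (simp add: glue_def)

lemma color_glue: "color G (Inl x) = color M x" "color G (Inr y) = color N y"
  by (simp_all add: glue_def)

lemma darts_glue: "inl_dart d \<in> darts G \<longleftrightarrow> d \<in> darts M" "inr_dart e \<in> darts G \<longleftrightarrow> e \<in> darts N"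
  by (cases d; cases e; auto simp: darts_def edges_glue inl_dart_def inr_dart_def)+

lemma strand_points_glue: "strand_points G = inl_strand ` A.P \<union> inr_strand ` B.P"
proof (rule set_eqI)
  fix p
  have "inl_strand q \<in> strand_points G \<longleftrightarrow> q \<in> A.P" "inr_strand q' \<in> strand_points G \<longleftrightarrow> q' \<in> B.P" for q q'
    by (cases q; cases q'; simp add: strand_points_dart inl_strand_def inr_strand_def darts_glue dcolor_glue)+
  then show "p \<in> strand_points G \<longleftrightarrow> p \<in> inl_strand ` A.P \<union> inr_strand ` B.P"
    by (cases rule: sum_strand_cases[of p]) simp_all
qed

lemma outer_darts:
  "d \<in> {a, A.r a, A.r (A.r a)} \<Longrightarrow> joint_at G (inl_dart d) \<and> \<not> trivalent_at G (inl_dart d)"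
  "e \<in> {b, B.r b, B.r (B.r b)} \<Longrightarrow> joint_at G (inr_dart e) \<and> \<not> trivalent_at G (inr_dart e)"
  using A.b_facts B.b_facts by (auto simp: joint_at_def trivalent_at_def rot_glue dcolor_glue)

lemma inner_darts:
  "d \<in> darts M \<Longrightarrow> d \<notin> {a, A.r a, A.r (A.r a)} \<Longrightarrow> rot G (inl_dart d) = inl_dart (A.r d) \<and>
     (trivalent_at G (inl_dart d) \<longleftrightarrow> trivalent_at M d) \<and> (joint_at G (inl_dart d) \<longleftrightarrow> joint_at M d)"
  "e \<in> darts N \<Longrightarrow> e \<notin> {b, B.r b, B.r (B.r b)} \<Longrightarrow> rot G (inr_dart e) = inr_dart (B.r e) \<and>
     (trivalent_at G (inr_dart e) \<longleftrightarrow> trivalent_at N e) \<and> (joint_at G (inr_dart e) \<longleftrightarrow> joint_at N e)"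
proof -
  assume d: "d \<in> darts M" "d \<notin> {a, A.r a, A.r (A.r a)}"
  have "A.r d \<notin> {a, A.r a, A.r (A.r a)}" "A.r (A.r d) \<notin> {a, A.r a, A.r (A.r a)}"
    using A.rot_outside A.rot_in d by blast+
  with d(2) show "rot G (inl_dart d) = inl_dart (A.r d) \<and>
     (trivalent_at G (inl_dart d) \<longleftrightarrow> trivalent_at M d) \<and> (joint_at G (inl_dart d) \<longleftrightarrow> joint_at M d)"
    by (auto simp: joint_at_def trivalent_at_def rot_glue dcolor_glue)
next
  assume d: "e \<in> darts N" "e \<notin> {b, B.r b, B.r (B.r b)}"
  have "B.r e \<notin> {b, B.r b, B.r (B.r b)}" "B.r (B.r e) \<notin> {b, B.r b, B.r (B.r b)}"
    using B.rot_outside B.rot_in d by blast+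
  with d(2) show "rot G (inr_dart e) = inr_dart (B.r e) \<and>
     (trivalent_at G (inr_dart e) \<longleftrightarrow> trivalent_at N e) \<and> (joint_at G (inr_dart e) \<longleftrightarrow> joint_at N e)"
    by (auto simp: joint_at_def trivalent_at_def rot_glue dcolor_glue)
qed

sublocale G: network G
proof
  show "finite (edges G)"
    using A.fin B.fin by (simp add: edges_glue)
  show "rot G ` darts G \<subseteq> darts G"
  proof (rule image_subsetI)
    fix d assume d: "d \<in> darts G"
    show "rot G d \<in> darts G"
      by (rule sum_dart_cases[of d])
        (use d A.b_facts B.b_facts A.rot_in B.rot_in in \<open>auto simp: rot_glue darts_glue\<close>)
  qed
  show "trivalent_at G d \<or> joint_at G d" if d: "d \<in> darts G" for d
    by (rule sum_dart_cases[of d])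
      (use d outer_darts inner_darts A.loc B.loc in \<open>metis darts_glue\<close>)+
  show "admissible G"
    unfolding admissible_def
  proof (intro ballI impI)
    fix d assume d: "d \<in> darts G" "trivalent_at G d"
    show "admissible_triple (dcolor G d) (dcolor G (rot G d)) (dcolor G (rot G (rot G d)))"
    proof (rule sum_dart_cases[of d])
      fix d' assume i: "d = inl_dart d'"
      then have o: "d' \<in> darts M" "d' \<notin> {a, A.r a, A.r (A.r a)}"
        using d outer_darts(1) darts_glue(1) by blast+
      note o' = A.rot_in[OF o(1)] A.rot_outside[OF o]
      show ?thesis
        using A.adm o(1) inner_darts(1)[OF o] inner_darts(1)[OF o'] d(2)
        unfolding i admissible_def by (simp add: dcolor_glue)
    next
      fix d' assume i: "d = inr_dart d'"
      then have o: "d' \<in> darts N" "d' \<notin> {b, B.r b, B.r (B.r b)}"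
        using d outer_darts(2) darts_glue(2) by blast+
      note o' = B.rot_in[OF o(1)] B.rot_outside[OF o]
      show ?thesis
        using B.adm o(1) inner_darts(2)[OF o] inner_darts(2)[OF o'] d(2)
        unfolding i admissible_def by (simp add: dcolor_glue)
    qed
  qed
qed

lemma vertex_matching_inl:
  assumes "p \<in> A.P" "p \<notin> A.X"
  shows "vertex_matching G (inl_strand p) = inl_strand (vertex_matching M p)"
proof -
  have d: "fst p \<in> darts M" "fst p \<notin> {a, A.r a, A.r (A.r a)}"
    using assms A.outside_X by (auto simp: strand_points_def)
  note i = inner_darts(1)[OF d] inner_darts(1)[OF A.rot_in[OF d(1)] A.rot_outside[OF d]]
  have c: "corner_strands G (inl_dart (fst p)) = corner_strands M (fst p)"
    unfolding corner_strands_def using i by (simp add: dcolor_glue)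
  have "inl_strand p \<in> strand_points G"
    using assms by (simp add: strand_points_glue)
  then show ?thesis
    using assms c i by (cases p) (simp add: vertex_matching_def dcolor_glue inl_strand_def)
qed

lemma vertex_matching_inr:
  assumes "p \<in> B.P" "p \<notin> B.X"
  shows "vertex_matching G (inr_strand p) = inr_strand (vertex_matching N p)"
proof -
  have d: "fst p \<in> darts N" "fst p \<notin> {b, B.r b, B.r (B.r b)}"
    using assms B.outside_X by (auto simp: strand_points_def)
  note i = inner_darts(2)[OF d] inner_darts(2)[OF B.rot_in[OF d(1)] B.rot_outside[OF d]]
  have c: "corner_strands G (inr_dart (fst p)) = corner_strands N (fst p)"
    unfolding corner_strands_def using i by (simp add: dcolor_glue)
  have "inr_strand p \<in> strand_points G"
    using assms by (simp add: strand_points_glue)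
  then show ?thesis
    using assms c i by (cases p) (simp add: vertex_matching_def dcolor_glue inr_strand_def)
qed

text \<open>The other end of a strand through a joint. The two vertices face each other, so next and
  previous dart are exchanged and the strands are numbered from the other side.\<close>

definition opposite :: "'b dart \<times> nat \<Rightarrow> 'a dart \<times> nat" where
  "opposite p = (if fst p = b then a else if fst p = B.r b then A.r (A.r a) else A.r a, 2 * n - 1 - snd p)"

lemma vertex_matching_opposite:
  assumes "p \<in> B.X"
  shows "vertex_matching G (inr_strand p) = inl_strand (opposite p)"
    "vertex_matching G (inl_strand (opposite p)) = inr_strand p"
proof -
  have d: "fst p \<in> {b, B.r b, B.r (B.r b)}" "snd p < 2 * n"
    using assms by (auto simp: B.X_def)
  have c: "corner_strands G (inr_dart (fst p)) = 2 * n"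
    unfolding corner_strands_def using outer_darts(2)[OF d(1)] B.corners[OF d(1)] by (simp add: dcolor_glue)
  have "inr_strand p \<in> strand_points G"
    using assms B.X_sub by (auto simp: strand_points_glue)
  then show 1: "vertex_matching G (inr_strand p) = inl_strand (opposite p)"
    using c d A.b_facts B.b_facts
    by (cases p) (auto simp: vertex_matching_def rot_glue dcolor_glue inr_strand_def inl_strand_def opposite_def)
  show "vertex_matching G (inl_strand (opposite p)) = inr_strand p"
    unfolding 1[symmetric] by (rule matchingD(1)[OF G.matching_vertex_matching])
qed

lemma inj_opposite: "inj_on opposite B.X"
proof (rule inj_onI)
  fix p q assume "p \<in> B.X" "q \<in> B.X" "opposite p = opposite q"
  then show "p = q"
    using vertex_matching_opposite(2) by (metis inl_inr_strand(2))
qed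

lemma opposite_image: "opposite ` B.X = A.X"
proof
  show "opposite ` B.X \<subseteq> A.X"
    by (auto simp: opposite_def A.X_def B.X_def)
  show "A.X \<subseteq> opposite ` B.X"
  proof
    fix p assume "p \<in> A.X"
    then obtain d i where p: "p = (d, i)" "d \<in> {a, A.r a, A.r (A.r a)}" "i < 2 * n" by (auto simp: A.X_def)
    have i: "2 * n - 1 - (2 * n - 1 - i) = i" "2 * n - 1 - i < 2 * n" using p(3) by auto
    have "p = opposite (b, 2 * n - 1 - i) \<or> p = opposite (B.r b, 2 * n - 1 - i) \<or> p = opposite (B.r (B.r b), 2 * n - 1 - i)"
      using p i(1) B.b_facts(6-8) by (auto simp: opposite_def)
    moreover have "(b, 2 * n - 1 - i) \<in> B.X" "(B.r b, 2 * n - 1 - i) \<in> B.X" "(B.r (B.r b), 2 * n - 1 - i) \<in> B.X"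
      using i(2) by (auto simp: B.X_def)
    ultimately show "p \<in> opposite ` B.X" by blast
  qed
qed

text \<open>A matching at the second vertex as it is seen from the first one through the
  joints.\<close>

definition reflect :: "('b dart \<times> nat \<Rightarrow> 'b dart \<times> nat) \<Rightarrow> 'a dart \<times> nat \<Rightarrow> 'a dart \<times> nat" where
  "reflect = place B.X opposite (\<lambda>p. p)"

lemma reflect_opposite: "p \<in> B.X \<Longrightarrow> reflect R (opposite p) = opposite (R p)"
  unfolding reflect_def by (rule place_image[OF inj_opposite]) (auto simp: matching_def)

lemma matching_reflect: "matching B.X R \<Longrightarrow> matching A.X (reflect R)"
  using matching_place[OF inj_opposite, of "{}" "\<lambda>p. p" R] by (simp add: reflect_def opposite_image matching_def)

text \<open>The diagram of a vertex with three equal colors is its own mirror image: the corners are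
  permuted, but each has \<open>n\<close> strands.\<close>

lemma reflect_VX: "reflect B.VX = A.VX"
proof
  fix p
  show "reflect B.VX p = A.VX p"
  proof (cases "p \<in> A.X")
    case True
    then obtain q where q: "q \<in> B.X" "p = opposite q" using opposite_image by blast
    then obtain d i where d: "q = (d, i)" "d \<in> {b, B.r b, B.r (B.r b)}" "i < 2 * n" by (auto simp: B.X_def)
    have "opposite (B.VX q) = A.VX (opposite q)"
    proof (cases "i < n")
      case True
      then have "2 * n - 1 - (2 * n - 1 - i) = i" by simp
      then show ?thesis
        using d A.VX_arcs[OF True] B.VX_arcs[OF True] A.b_facts(6-8) B.b_facts(6-8)
        by (auto simp: opposite_def)
    next
      case False
      then have k: "2 * n - 1 - i < n" "2 * n - 1 - (2 * n - 1 - i) = i" using d(3) by auto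
      then show ?thesis
        using d A.VX_arcs[OF k(1)] B.VX_arcs[OF k(1)] A.b_facts(6-8) B.b_facts(6-8)
        by (auto simp: opposite_def)
    qed
    then show ?thesis using reflect_opposite[OF q(1)] q(2) by simp
  next
    case False
    then show ?thesis
      using matchingD(3)[OF A.matching_VX] matchingD(3)[OF matching_reflect[OF B.matching_VX]] by simp
  qed
qed

lemma edge_matching_glue:
  assumes "F1 \<in> edge_states M" "F2 \<in> edge_states N"
  shows "edge_matching G (case_sum F1 F2) = glued (edge_matching M F1) (edge_matching N F2)"
proof
  fix p
  have P: "inl_strand q \<in> strand_points G \<longleftrightarrow> q \<in> A.P" "inr_strand q' \<in> strand_points G \<longleftrightarrow> q' \<in> B.P" for q q'
    unfolding strand_points_glue by auto
  show "edge_matching G (case_sum F1 F2) p = glued (edge_matching M F1) (edge_matching N F2) p"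
  proof (rule sum_strand_cases[of p])
    fix q assume "p = inl_strand q"
    then show ?thesis
      using P(1)[of q] by (cases q) (auto simp: glued_def edge_matching_def edge_point_def edge_index_def color_glue inl_strand_def inl_dart_def)
  next
    fix q assume "p = inr_strand q"
    then show ?thesis
      using P(2)[of q] by (cases q) (auto simp: glued_def edge_matching_def edge_point_def edge_index_def color_glue inr_strand_def inr_dart_def)
  qed
qed

lemma net_sum_glue: "net_sum G \<Phi> = net_sum N (\<lambda>g. net_sum M (\<lambda>f. \<Phi> (glued f g)))"
proof -
  have bij: "bij_betw (\<lambda>(F1, F2). case_sum F1 F2) (edge_states M \<times> edge_states N) (edge_states G)"
    unfolding bij_betw_def
  proof
    show "inj_on (\<lambda>(F1, F2). case_sum F1 F2) (edge_states M \<times> edge_states N)"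
    proof (rule inj_onI, clarify)
      fix F1 F2 F1' F2' assume "case_sum F1 F2 = case_sum F1' F2'"
      then have "case_sum F1 F2 (Inl x) = case_sum F1' F2' (Inl x)" "case_sum F1 F2 (Inr y) = case_sum F1' F2' (Inr y)" for x y
        by simp_all
      then show "F1 = F1' \<and> F2 = F2'" by (simp add: fun_eq_iff)
    qed
    show "(\<lambda>(F1, F2). case_sum F1 F2) ` (edge_states M \<times> edge_states N) = edge_states G"
    proof
      show "(\<lambda>(F1, F2). case_sum F1 F2) ` (edge_states M \<times> edge_states N) \<subseteq> edge_states G"
        by (auto simp: edge_states_def edges_glue color_glue PiE_def Pi_def extensional_def split: sum.splits)
      show "edge_states G \<subseteq> (\<lambda>(F1, F2). case_sum F1 F2) ` (edge_states M \<times> edge_states N)"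
      proof
        fix F assume F: "F \<in> edge_states G"
        have "F = case_sum (F \<circ> Inl) (F \<circ> Inr)"
          by (auto simp: fun_eq_iff split: sum.splits)
        moreover have "F \<circ> Inl \<in> edge_states M" "F \<circ> Inr \<in> edge_states N"
          using F by (auto simp: edge_states_def edges_glue PiE_def Pi_def extensional_def color_glue[symmetric])
        ultimately show "F \<in> (\<lambda>(F1, F2). case_sum F1 F2) ` (edge_states M \<times> edge_states N)"
          by (intro image_eqI[of _ _ "(F \<circ> Inl, F \<circ> Inr)"]) auto
      qed
    qed
  qed
  have w: "weight G (case_sum F1 F2) = weight M F1 * weight N F2" for F1 F2
    unfolding weight_def edges_glue using A.fin B.fin by (simp add: prod.Plus color_glue)
  have "net_sum G \<Phi> = (\<Sum>(F1, F2)\<in>edge_states M \<times> edge_states N.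
      weight G (case_sum F1 F2) * \<Phi> (edge_matching G (case_sum F1 F2)))"
    unfolding net_sum_def using sum.reindex_bij_betw[OF bij, of "\<lambda>F. weight G F * \<Phi> (edge_matching G F)"]
    by (simp add: case_prod_unfold)
  also have "\<dots> = (\<Sum>F1\<in>edge_states M. \<Sum>F2\<in>edge_states N.
      weight M F1 * weight N F2 * \<Phi> (glued (edge_matching M F1) (edge_matching N F2)))"
    unfolding sum.cartesian_product[symmetric] by (intro sum.cong refl) (simp add: w edge_matching_glue)
  also have "\<dots> = (\<Sum>F2\<in>edge_states N. \<Sum>F1\<in>edge_states M.
      weight M F1 * weight N F2 * \<Phi> (glued (edge_matching M F1) (edge_matching N F2)))"
    by (rule sum.swap)
  also have "\<dots> = net_sum N (\<lambda>g. net_sum M (\<lambda>f. \<Phi> (glued f g)))"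
    unfolding net_sum_def sum_distrib_left by (intro sum.cong refl) (simp add: ac_simps)
  finally show ?thesis .
qed

text \<open>The arcs through the joints are contracted: each point of the second vertex moves to its
  opposite point, where \<open>R2\<close> appears as \<open>reflect R2\<close>.\<close>

lemma circles_glue:
  assumes R1: "matching A.X R1" and R2: "matching B.X R2"
  shows "circles (inl_strand ` A.X \<union> inr_strand ` B.X) (glued R1 R2)
      (\<lambda>p. if p \<in> inl_strand ` A.X \<union> inr_strand ` B.X then vertex_matching G p else p) =
    circles A.X R1 (reflect R2)" (is "circles ?Q ?h ?v = _")
proof -
  let ?G = "gr ?Q ?h \<union> gr ?Q ?v" and ?H = "gr A.X R1 \<union> gr A.X (reflect R2)"
  define \<rho> where "\<rho> p = (case fst (fst p) of Inl x \<Rightarrow> ((x, snd (fst p)), snd p)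
     | Inr y \<Rightarrow> opposite ((y, snd (fst p)), snd p))" for p :: "('a + 'b) dart \<times> nat"
  have \<rho>: "\<rho> (inl_strand p) = p" "\<rho> (inr_strand q) = opposite q" for p q
    by (cases p; cases q; auto simp: \<rho>_def inl_strand_def inr_strand_def inl_dart_def inr_dart_def)+
  have \<rho>Q: "\<rho> ` ?Q = A.X"
    using opposite_image by (auto simp: image_Un image_image \<rho>)
  have v: "?v (inr_strand q) = inl_strand (opposite q)" "?v (inl_strand (opposite q)) = inr_strand q" if "q \<in> B.X" for q
    using vertex_matching_opposite[OF that] that opposite_image by auto
  have fin: "finite ?Q"
    using A.finite_X B.finite_X by simp
  have e: "conn ?H (\<rho> p) (\<rho> (?h p)) \<and> \<rho> (?v p) = \<rho> p" if p: "p \<in> ?Q" for p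
  proof (rule sum_strand_cases[of p])
    fix q assume q: "p = inl_strand q"
    then have "q \<in> A.X" using p by auto
    moreover then obtain q' where "q' \<in> B.X" "q = opposite q'" using opposite_image by blast
    ultimately show ?thesis
      using conn_gr[of q A.X R1 ?H] v(2)[of q'] q by (simp add: \<rho>)
  next
    fix q assume q: "p = inr_strand q"
    then have "q \<in> B.X" using p by auto
    moreover then have "opposite q \<in> A.X" using opposite_image by blast
    ultimately show ?thesis
      using conn_gr[of "opposite q" A.X "reflect R2" ?H] v(1)[of q] reflect_opposite[of q R2] q by (simp add: \<rho>)
  qed
  have home: "conn ?G p (inl_strand (\<rho> p))" if p: "p \<in> ?Q" for p
  proof (rule sum_strand_cases[of p])
    fix q assume q: "p = inr_strand q"
    then have "q \<in> B.X" using p by auto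
    then show ?thesis
      using conn_gr[of p ?Q ?v ?G] v(1)[of q] p q by (simp add: \<rho>)
  qed (simp add: \<rho>)
  have lift: "conn ?G (inl_strand x) (inl_strand y)" if "conn ?H x y" for x y
    using that
  proof (rule conn_map)
    fix x y assume xy: "{x, y} \<in> ?H"
    have c1: "conn ?G (inl_strand x) (inl_strand (R1 x))" if "x \<in> A.X" for x
      using conn_gr[of "inl_strand x" ?Q ?h ?G] that by auto
    have c2: "conn ?G (inl_strand x) (inl_strand (reflect R2 x))" if x: "x \<in> A.X" for x
    proof -
      obtain q where q: "q \<in> B.X" "x = opposite q" using x opposite_image by blast
      have q2: "R2 q \<in> B.X" using matchingD(5)[OF R2] q(1) by blast
      have "conn ?G (inr_strand q) (inl_strand x)" "conn ?G (inr_strand (R2 q)) (inl_strand (reflect R2 x))"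
        using home[of "inr_strand q"] home[of "inr_strand (R2 q)"] q q2 by (auto simp: \<rho> reflect_opposite)
      moreover have "conn ?G (inr_strand q) (inr_strand (R2 q))"
        using conn_gr[of "inr_strand q" ?Q ?h ?G] q(1) by auto
      ultimately show ?thesis by (meson conn_sym conn_trans)
    qed
    from xy have "{x, y} \<in> gr A.X R1 \<or> {x, y} \<in> gr A.X (reflect R2)" by (rule UnE) simp_all
    then consider "x \<in> A.X" "y = R1 x" | "y \<in> A.X" "x = R1 y" | "x \<in> A.X" "y = reflect R2 x" | "y \<in> A.X" "x = reflect R2 y"
      unfolding gr_iff by blast
    then show "conn ?G (inl_strand x) (inl_strand y)"
    proof cases
      case 1 then show ?thesis using c1 by simp
    next
      case 2 then show ?thesis using conn_sym[OF c1[of y]] by simp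
    next
      case 3 then show ?thesis using c2 by simp
    next
      case 4 then show ?thesis using conn_sym[OF c2[of y]] by simp
    qed
  qed
  have "card (components ?Q ?G) = card ((\<lambda>p. cls ?H (\<rho> p)) ` ?Q)"
  proof (rule card_components_eq[OF fin])
    fix x y assume "{x, y} \<in> ?G"
    then have "{x, y} \<in> gr ?Q ?h \<or> {x, y} \<in> gr ?Q ?v" by (rule UnE) simp_all
    then consider "x \<in> ?Q" "y = ?h x" | "y \<in> ?Q" "x = ?h y" | "x \<in> ?Q" "y = ?v x" | "y \<in> ?Q" "x = ?v y"
      unfolding gr_iff by blast
    then show "cls ?H (\<rho> x) = cls ?H (\<rho> y)"
    proof cases
      case 1 then show ?thesis using e[of x] unfolding cls_eq_iff by simp
    next
      case 2 then show ?thesis using conn_sym[OF conjunct1[OF e[of y]]] unfolding cls_eq_iff by simp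
    next
      case 3 then show ?thesis using e[of x] by simp
    next
      case 4 then show ?thesis using e[of y] by simp
    qed
  next
    fix x y assume xy: "x \<in> ?Q" "y \<in> ?Q" "cls ?H (\<rho> x) = cls ?H (\<rho> y)"
    then have "conn ?G (inl_strand (\<rho> x)) (inl_strand (\<rho> y))"
      using lift by (simp add: cls_eq_iff)
    then show "conn ?G x y"
      using conn_trans[OF conn_trans[OF home[OF xy(1)]] conn_sym[OF home[OF xy(2)]]] by blast
  qed
  also have "(\<lambda>p. cls ?H (\<rho> p)) ` ?Q = cls ?H ` \<rho> ` ?Q"
    by (simp only: image_image)
  also have "\<dots> = components A.X ?H"
    unfolding \<rho>Q components_cls ..
  finally show ?thesis by (simp add: circles_def)
qed

text \<open>The outsides contribute scalars \<open>k\<close> and \<open>l\<close>. The boxes of the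
  first vertex are felt at the second one through the joints, so those which
  \<open>vertex_removal\<close> puts there act as the identity. Therefore a single theta remains,
  whereas the two separate networks have one each.\<close>

lemma evaluation_glue: "evaluation G * theta n n n = evaluation M * evaluation N"
proof -
  obtain K where K: "distinct (list_points K)" "set (list_points K) = A.P - A.X" "\<forall>(x, y)\<in>set K. vertex_matching M x = y"
    using A.outside_arcs .
  obtain L where L: "distinct (list_points L)" "set (list_points L) = B.P - B.X" "\<forall>(x, y)\<in>set L. vertex_matching N x = y"
    using B.outside_arcs .
  obtain k where k: "\<And>\<Phi>. net_sum M (cap_op A.P K \<Phi>) = k * A.J \<Phi> A.VX"
    using A.vertex_removal[OF K] by blast
  obtain l where l: "\<And>\<Phi>. net_sum N (cap_op B.P L \<Phi>) = l * B.J \<Phi> B.VX"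
    using B.vertex_removal[OF L] by blast
  let ?Q = "inl_strand ` A.X \<union> inr_strand ` B.X" and ?PG = "inl_strand ` A.P \<union> inr_strand ` B.P"
  have LP: "list_points (sum_arcs K L) = map inl_strand (list_points K) @ map inr_strand (list_points L)"
    by (simp add: list_points_append list_points_map)
  have S: "distinct (list_points (sum_arcs K L))" "set (list_points (sum_arcs K L)) = ?PG - ?Q"
    using K L A.X_sub B.X_sub unfolding LP by (auto simp: distinct_map inj_on_def)
  have arcs: "\<forall>(x, y)\<in>set (sum_arcs K L). vertex_matching G x = y"
  proof -
    have "vertex_matching G (inl_strand x) = inl_strand y" if "(x, y) \<in> set K" for x y
      using that vertex_matching_inl[of x] list_points_arc[OF that] K(2,3) by auto
    moreover have "vertex_matching G (inr_strand x) = inr_strand y" if "(x, y) \<in> set L" for x y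
      using that vertex_matching_inr[of x] list_points_arc[OF that] L(2,3) by auto
    ultimately show ?thesis by auto
  qed
  have capV: "caps (sum_arcs K L) (vertex_matching G) = (\<lambda>p. if p \<in> ?Q then vertex_matching G p else p)"
  proof -
    have "caps (sum_arcs K L) (vertex_matching G) =
        (\<lambda>p. if p \<in> set (list_points (sum_arcs K L)) then p else vertex_matching G p)"
      by (rule caps_arcs[OF G.matching_vertex_matching S(1) _ arcs]) (use S(2) strand_points_glue in blast)
    moreover have "vertex_matching G p = p" if "p \<notin> ?PG" for p
      using matchingD(3)[OF G.matching_vertex_matching] that unfolding strand_points_glue by blast
    ultimately show ?thesis
      unfolding S(2) using A.X_sub B.X_sub by (auto simp: fun_eq_iff)
  qed
  \<comment> \<open>The circles of the glued diagram are those closed inside either outside and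
    those which the two remaining matchings form across the joints.\<close>
  have fact: "pairing ?PG (vertex_matching G) (glued f g) =
      cap_op B.P L (\<lambda>R2. cap_op A.P K (pairing A.X (reflect R2)) f) g"
    if f: "matching A.P f" and g: "matching B.P g" for f g
  proof -
    have R1: "matching A.X (caps K f)"
      using caps_spec(1)[OF A.finite_P f K(1)] K(2) A.X_sub double_diff[OF A.X_sub subset_refl] by auto
    have R2: "matching B.X (caps L g)"
      using caps_spec(1)[OF B.finite_P g L(1)] L(2) B.X_sub double_diff[OF B.X_sub subset_refl] by auto
    have "circles ?PG (glued f g) (vertex_matching G) = cap_circles (sum_arcs K L) (glued f g) +
        circles (?PG - set (list_points (sum_arcs K L))) (caps (sum_arcs K L) (glued f g)) (caps (sum_arcs K L) (vertex_matching G))"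
      by (rule circles_caps[OF _ matching_glued[OF f g] _ S(1) _ arcs])
        (use A.finite_P B.finite_P S(2) G.matching_vertex_matching strand_points_glue in auto)
    moreover have "?PG - set (list_points (sum_arcs K L)) = ?Q"
      unfolding S(2) using A.X_sub B.X_sub by auto
    ultimately have "circles ?PG (glued f g) (vertex_matching G) = cap_circles K f + cap_circles L g +
        circles A.X (caps K f) (reflect (caps L g))"
      using circles_glue[OF R1 R2] unfolding capV caps_glued cap_circles_glued by simp
    then show ?thesis
      using matching_glued[OF f g] G.matching_vertex_matching R1 matching_reflect[OF R2] f g
      unfolding strand_points_glue by (simp add: pairing_def cap_op_def power_add)
  qed
  define \<Psi> where "\<Psi> R2 = A.J (pairing A.X (reflect R2)) A.VX" for R2
  have "evaluation G = net_sum N (\<lambda>g. net_sum M (\<lambda>f. pairing ?PG (vertex_matching G) (glued f g)))"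
    unfolding G.evaluation_net_sum strand_points_glue by (rule net_sum_glue)
  also have "\<dots> = net_sum N (\<lambda>g. net_sum M (\<lambda>f. cap_op B.P L (\<lambda>R2. cap_op A.P K (pairing A.X (reflect R2)) f) g))"
    by (intro B.net_sum_cong A.net_sum_cong fact matching_edge_matching)
  also have "\<dots> = net_sum N (cap_op B.P L (\<lambda>R2. net_sum M (cap_op A.P K (pairing A.X (reflect R2)))))"
    by (intro B.net_sum_cong) (simp add: net_sum_def cap_op_def sum_distrib_left ac_simps)
  also have "\<dots> = l * B.J (\<lambda>R2. k * \<Psi> R2) B.VX"
    unfolding k \<Psi>_def by (rule l)
  finally have ev: "evaluation G = l * B.J (\<lambda>R2. k * \<Psi> R2) B.VX" .
  \<comment> \<open>Adjointness moves the boxes from the fixed diagram \<open>A.VX\<close> to the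
    variable one, where they kill hooks.\<close>
  have \<Psi>: "\<Psi> R2 = A.J (pairing A.X A.VX) (reflect R2)" for R2
    using A.adjoint_J unfolding \<Psi>_def adjoint_def by blast
  \<comment> \<open>A hook at the second vertex is a hook at the opposite points of the first one,
    with the order of its two points reversed.\<close>
  have kill: "hook_op B.X (d, i) (d, Suc i) (\<lambda>R2. k * \<Psi> R2) = (\<lambda>_. 0)"
    if d: "d \<in> {b, B.r b, B.r (B.r b)}" and i: "Suc i < 2 * n" for d i
  proof -
    let ?\<Psi> = "A.J (pairing A.X A.VX)"
    have X: "(d, i) \<in> B.X" "(d, Suc i) \<in> B.X" using d i by (auto simp: B.X_def)
    define i' where "i' = 2 * n - 1 - Suc i"
    define d' where "d' = fst (opposite (d, i))"
    have o: "opposite (d, i) = (d', Suc i')" "opposite (d, Suc i) = (d', i')"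
      using i by (auto simp: opposite_def d'_def i'_def)
    have d': "d' \<in> {a, A.r a, A.r (A.r a)}" "Suc i' < 2 * n"
      using i by (auto simp: opposite_def d'_def i'_def)
    have "hook_op A.X (d', Suc i') (d', i') (\<lambda>R. k * ?\<Psi> R) = (\<lambda>_. 0)"
      using A.J_kill[OF d', of "pairing A.X A.VX"] hook_op_commute[of "(d', Suc i')" "(d', i')" A.X]
        linear_opD(2)[OF linear_op_hook_op, of A.X "(d', i')" "(d', Suc i')" k ?\<Psi>] by simp
    moreover have "(\<lambda>R2. if matching B.X R2 then hook_op A.X (d', Suc i') (d', i') (\<lambda>R. k * ?\<Psi> R) (reflect R2) else 0) =
        hook_op B.X (d, i) (d, Suc i) (\<lambda>R2. if matching B.X R2 then k * ?\<Psi> (reflect R2) else 0)"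
      using hook_op_place[OF inj_opposite _ _ X, of "{}" "\<lambda>p. p" "\<lambda>R. k * ?\<Psi> R"]
      unfolding o opposite_image reflect_def[symmetric] Un_empty_right by (simp add: matching_def[of "{}"])
    ultimately have "hook_op B.X (d, i) (d, Suc i) (\<lambda>R2. if matching B.X R2 then k * ?\<Psi> (reflect R2) else 0) = (\<lambda>_. 0)"
      by (simp cong: if_cong)
    then show ?thesis
      unfolding \<Psi> using hook_op_restrict[of "(d, i)" B.X "(d, Suc i)" "\<lambda>R2. k * ?\<Psi> (reflect R2)"] X by simp
  qed
  have "B.J (\<lambda>R2. k * \<Psi> R2) B.VX = k * \<Psi> B.VX"
    using B.J_fixed[OF kill] by simp
  then have "evaluation G = l * (k * theta n n n)"
    unfolding ev \<Psi>_def reflect_VX A.theta_VX by simp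
  then show ?thesis
    using A.evaluation_theta[OF K k] B.evaluation_theta[OF L l] by simp
qed

end

section \<open>Normalized power series\<close>

lemma laurent_of_ratfun_mult: "laurent_of_ratfun (x * y) = laurent_of_ratfun x * laurent_of_ratfun y"
proof -
  obtain a b c d where "x = Fract a b" "b \<noteq> 0" "y = Fract c d" "d \<noteq> 0"
    by (metis Fract_cases)
  then show ?thesis
    by (simp add: laurent_of_ratfun_Fract laurent_of_poly_def fps_of_poly_mult fls_times_fps_to_fls)
qed

lemma laurent_of_ratfun_diff: "laurent_of_ratfun (x - y) = laurent_of_ratfun x - laurent_of_ratfun y"
proof -
  obtain a b c d where x: "x = Fract a b" "b \<noteq> 0" "y = Fract c d" "d \<noteq> 0"
    by (metis Fract_cases)
  then have "laurent_of_poly b \<noteq> 0" "laurent_of_poly d \<noteq> 0"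
    by (simp_all add: laurent_of_poly_def)
  moreover have "laurent_of_poly (a * d - c * b) =
      laurent_of_poly a * laurent_of_poly d - laurent_of_poly c * laurent_of_poly b"
    by (simp add: laurent_of_poly_def fps_of_poly_mult fps_of_poly_diff fls_times_fps_to_fls)
  moreover have "laurent_of_poly (b * d) = laurent_of_poly b * laurent_of_poly d"
    by (simp add: laurent_of_poly_def fps_of_poly_mult fls_times_fps_to_fls)
  ultimately show ?thesis
    using x by (simp add: laurent_of_ratfun_Fract diff_frac_eq)
qed

lemma laurent_of_ratfun_1 [simp]: "laurent_of_ratfun 1 = 1"
  by (simp add: One_fract_def laurent_of_ratfun_Fract laurent_of_poly_def)

lemma laurent_of_ratfun_power: "laurent_of_ratfun (x ^ k) = laurent_of_ratfun x ^ k"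
  by (induction k) (simp_all add: laurent_of_ratfun_mult)

lemma laurent_of_ratfun_inverse: "x \<noteq> 0 \<Longrightarrow> laurent_of_ratfun (inverse x) = inverse (laurent_of_ratfun x)"
  using laurent_of_ratfun_mult[of x "inverse x"] by (simp add: inverse_unique)

lemma laurent_of_ratfun_varA: "laurent_of_ratfun varA = fls_X"
  by (simp add: varA_def laurent_of_ratfun_Fract laurent_of_poly_def fps_of_poly_pCons)

lemma laurent_of_qseries_mult: "laurent_of_qseries (F * G) = laurent_of_qseries F * laurent_of_qseries G"
  by (simp add: laurent_of_qseries_def fps_compose_mult_distrib fls_times_fps_to_fls)

lemma laurent_of_qseries_1 [simp]: "laurent_of_qseries 1 = 1"
  by (simp add: laurent_of_qseries_def)

lemma laurent_of_qseries_diff: "laurent_of_qseries (F - G) = laurent_of_qseries F - laurent_of_qseries G"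
  by (simp add: laurent_of_qseries_def fps_compose_sub_distrib)

lemma laurent_of_qseries_power: "laurent_of_qseries (F ^ k) = laurent_of_qseries F ^ k"
  by (induction k) (simp_all add: laurent_of_qseries_mult)

lemma laurent_of_qseries_X: "laurent_of_qseries fps_X = fls_X ^ 4"
  by (simp add: laurent_of_qseries_def fps_to_fls_power)

lemma laurent_of_qseries_inverse: "F $ 0 \<noteq> 0 \<Longrightarrow> laurent_of_qseries (inverse F) = inverse (laurent_of_qseries F)"
  using laurent_of_qseries_mult[of F "inverse F"] by (simp add: inverse_mult_eq_1' inverse_unique)

lemma normalizes_to_mult:
  assumes "normalizes_to P F" "normalizes_to P' F'"
  shows "normalizes_to (P * P') (F * F')"
proof -
  obtain k k' where k: "fls_X_intpow k * P = laurent_of_qseries F" "fls_X_intpow k' * P' = laurent_of_qseries F'"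
    using assms unfolding normalizes_to_def by blast
  have "fls_X_intpow (k + k') * (P * P') = (fls_X_intpow k * P) * (fls_X_intpow k' * P')"
    unfolding fls_X_intpow_times_fls_X_intpow[symmetric] by (simp only: mult_ac)
  then have "fls_X_intpow (k + k') * (P * P') = laurent_of_qseries (F * F')"
    unfolding k laurent_of_qseries_mult .
  moreover have "(F * F') $ 0 \<noteq> 0"
    using assms by (simp add: normalizes_to_def)
  ultimately show ?thesis
    unfolding normalizes_to_def by blast
qed

lemma normalizes_to_inverse:
  assumes "normalizes_to P F"
  shows "normalizes_to (inverse P) (inverse F)"
proof -
  obtain k where k: "fls_X_intpow k * P = laurent_of_qseries F" "F $ 0 \<noteq> 0"
    using assms unfolding normalizes_to_def by blast
  have "fls_X_intpow (- k) * inverse P = inverse (fls_X_intpow k * P)"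
    by (simp add: fls_inverse_X_intpow)
  also have "\<dots> = laurent_of_qseries (inverse F)"
    unfolding k(1) using k(2) by (simp add: laurent_of_qseries_inverse)
  finally have "fls_X_intpow (- k) * inverse P = laurent_of_qseries (inverse F)" .
  moreover have "inverse F $ 0 \<noteq> 0"
    using k(2) by simp
  ultimately show ?thesis
    unfolding normalizes_to_def by blast
qed

lemma normalizes_to_qseries: "F $ 0 \<noteq> 0 \<Longrightarrow> normalizes_to (laurent_of_qseries F) F"
  unfolding normalizes_to_def by (intro conjI exI[of _ 0]) simp_all

lemma normalizes_to_1: "normalizes_to 1 1"
  using normalizes_to_qseries[of 1] by simp

lemma normalizes_to_power: "normalizes_to P F \<Longrightarrow> normalizes_to (P ^ k) (F ^ k)"
  by (induction k) (simp_all add: normalizes_to_1 normalizes_to_mult)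

lemma fls_X_power_intpow: "(fls_X :: rat fls) ^ k = fls_X_intpow (int k)"
  by (metis fls_X_conv_shift_1 fls_X_intpow_power mult.right_neutral)

section \<open>The products \<open>(q;q)_m\<close> and the normalized quantum factorials\<close>

definition qfact :: "nat \<Rightarrow> rat fps" where
  "qfact m = (\<Prod>i<m. 1 - fps_X ^ Suc i)"

lemma qfact_Suc: "qfact (Suc m) = qfact m * (1 - fps_X ^ Suc m)"
  by (simp add: qfact_def)

lemma qfact_0 [simp]: "qfact 0 = 1"
  by (simp add: qfact_def)

lemma qfact_nth_0 [simp]: "qfact m $ 0 = 1"
  by (induction m) (simp_all add: qfact_Suc)

text \<open>Multiplication by \<open>varA ^ (2 * i)\<close> removes the negative exponents of the
  quantum integer \<open>[i + 1]\<close> and leaves \<open>(1 - q ^ (i + 1)) / (1 - q)\<close> with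
  \<open>q = varA ^ 4\<close>, up to sign.\<close>

lemma normalizes_to_circle_poly:
  "normalizes_to (laurent_of_ratfun (circle_poly i)) ((-1) ^ i * ((1 - fps_X ^ Suc i) * inverse (1 - fps_X)))"
proof -
  define b where "b = varA ^ 2"
  have b: "b \<noteq> 0" by (simp add: b_def)
  have ne: "b - inverse b \<noteq> 0" using varA_diff_nonzero[of 0] by (simp add: b_def)
  have "circle_poly i * (b - inverse b) = (-1) ^ i * (b ^ Suc i - inverse (b ^ Suc i))"
    using ne by (simp add: circle_poly_eq b_def[symmetric])
  then have "circle_poly i * (b - inverse b) * b * b ^ i = (-1) ^ i * (b ^ Suc i - inverse (b ^ Suc i)) * b ^ Suc i"
    by (simp add: mult_ac)
  moreover have "circle_poly i * (b - inverse b) * b * b ^ i = circle_poly i * (b ^ 2 - 1) * b ^ i"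
    using b by (simp add: algebra_simps power2_eq_square)
  moreover have "(-1) ^ i * (b ^ Suc i - inverse (b ^ Suc i)) * b ^ Suc i = (-1) ^ i * ((b ^ 2) ^ Suc i - 1)"
  proof -
    have "inverse (b ^ Suc i) * b ^ Suc i = 1" by (rule left_inverse) (use b in simp)
    then have "(b ^ Suc i - inverse (b ^ Suc i)) * b ^ Suc i = (b ^ Suc i) ^ 2 - 1"
      unfolding left_diff_distrib power2_eq_square by (simp only:)
    then show ?thesis by (simp only: mult.assoc power_commutes flip: power_mult) (simp only: mult.commute)
  qed
  ultimately have "circle_poly i * (b ^ 2 - 1) * b ^ i = (-1) ^ i * ((b ^ 2) ^ Suc i - 1)" by metis
  then have *: "varA ^ (2 * i) * circle_poly i * (1 - varA ^ 4) = (-1) ^ i * (1 - (varA ^ 4) ^ Suc i)"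
    by (simp add: b_def algebra_simps flip: power_mult)
  have m1: "laurent_of_ratfun (-1) = -1" "laurent_of_qseries (-1) = -1"
    using laurent_of_ratfun_diff[of 0 1] laurent_of_ratfun_diff[of 0 0] laurent_of_qseries_diff[of 0 1]
      laurent_of_qseries_diff[of 0 0] by simp_all
  have "laurent_of_qseries (1 - fps_X) \<noteq> 0"
    using laurent_of_qseries_mult[of "1 - fps_X" "inverse (1 - fps_X)"] inverse_mult_eq_1'[of "1 - fps_X :: rat fps"] by auto
  moreover have "fls_X ^ (2 * i) * laurent_of_ratfun (circle_poly i) * laurent_of_qseries (1 - fps_X) =
      laurent_of_qseries ((-1) ^ i * (1 - fps_X ^ Suc i))"
    using arg_cong[OF *, of laurent_of_ratfun]
    by (simp add: laurent_of_ratfun_mult laurent_of_ratfun_power laurent_of_ratfun_diff laurent_of_ratfun_varA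
      laurent_of_qseries_mult laurent_of_qseries_power laurent_of_qseries_diff laurent_of_qseries_X m1)
  ultimately have "fls_X ^ (2 * i) * laurent_of_ratfun (circle_poly i) =
      laurent_of_qseries ((-1) ^ i * ((1 - fps_X ^ Suc i) * inverse (1 - fps_X)))"
    unfolding mult.assoc[symmetric] laurent_of_qseries_mult[of _ "inverse (1 - fps_X)"]
    by (simp add: laurent_of_qseries_inverse nonzero_eq_divide_eq flip: divide_inverse)
  then have "fls_X_intpow (int (2 * i)) * laurent_of_ratfun (circle_poly i) =
      laurent_of_qseries ((-1) ^ i * ((1 - fps_X ^ Suc i) * inverse (1 - fps_X)))"
    unfolding fls_X_power_intpow .
  moreover have "((-1) ^ i * ((1 - fps_X ^ Suc i) * inverse (1 - fps_X)) :: rat fps) $ 0 \<noteq> 0"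
    by simp
  ultimately show ?thesis
    unfolding normalizes_to_def by blast
qed

lemma normalizes_to_circle_fact:
  "\<exists>s. (s = 1 \<or> s = -1) \<and> normalizes_to (laurent_of_ratfun (circle_fact m)) (s * (qfact m * inverse (1 - fps_X) ^ m))"
proof (induction m)
  case 0
  then show ?case using normalizes_to_1 by auto
next
  case (Suc m)
  then obtain s where s: "s = 1 \<or> s = -1"
    "normalizes_to (laurent_of_ratfun (circle_fact m)) (s * (qfact m * inverse (1 - fps_X) ^ m))" by blast
  have "normalizes_to (laurent_of_ratfun (circle_fact (Suc m)))
      ((s * (-1) ^ m) * (qfact (Suc m) * inverse (1 - fps_X) ^ Suc m))"
    using normalizes_to_mult[OF s(2) normalizes_to_circle_poly[of m]]
    by (simp add: laurent_of_ratfun_mult qfact_Suc mult_ac)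
  moreover have "s * (-1) ^ m = 1 \<or> s * (-1) ^ m = -1"
    using s(1) by (cases "even m") auto
  ultimately show ?case by blast
qed

text \<open>Agreement of the first \<open>n\<close> coefficients is written as divisibility by a
  power of the variable, which makes it compatible with products and inverses; the signs multiply
  along the way.\<close>

definition eq_upto :: "nat \<Rightarrow> rat fps \<Rightarrow> rat fps \<Rightarrow> bool" where
  "eq_upto n F G \<longleftrightarrow> (\<exists>s. (s = 1 \<or> s = -1) \<and> fps_X ^ n dvd F - s * G)"

lemma eq_uptoI: "fps_X ^ n dvd F - G \<Longrightarrow> eq_upto n F G"
  unfolding eq_upto_def by (intro exI[of _ 1]) simp

lemma eq_upto_mult:
  assumes "eq_upto n F F'" "eq_upto n G G'"
  shows "eq_upto n (F * G) (F' * G')"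
proof -
  obtain s t where s: "s = 1 \<or> s = -1" "fps_X ^ n dvd F - s * F'" and t: "t = 1 \<or> t = -1" "fps_X ^ n dvd G - t * G'"
    using assms unfolding eq_upto_def by blast
  have "F * G - (s * t) * (F' * G') = (F - s * F') * G + s * F' * (G - t * G')"
    by (simp add: algebra_simps)
  then have "fps_X ^ n dvd F * G - (s * t) * (F' * G')"
    using s(2) t(2) by simp
  then show ?thesis
    unfolding eq_upto_def using s(1) t(1) by (intro exI[of _ "s * t"]) auto
qed

lemma eq_upto_trans:
  assumes "eq_upto n F G" "eq_upto n G H"
  shows "eq_upto n F H"
proof -
  obtain s t where s: "s = 1 \<or> s = -1" "fps_X ^ n dvd F - s * G" and t: "t = 1 \<or> t = -1" "fps_X ^ n dvd G - t * H"
    using assms unfolding eq_upto_def by blast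
  have "F - (s * t) * H = (F - s * G) + s * (G - t * H)"
    by (simp add: algebra_simps)
  then have "fps_X ^ n dvd F - (s * t) * H"
    using dvd_add[OF s(2) dvd_mult[OF t(2), of s]] by metis
  then show ?thesis
    unfolding eq_upto_def using s(1) t(1) by (intro exI[of _ "s * t"]) auto
qed

lemma eq_upto_sym: "eq_upto n F G \<Longrightarrow> eq_upto n G F"
proof -
  assume "eq_upto n F G"
  then obtain s where s: "s = 1 \<or> s = -1" "fps_X ^ n dvd F - s * G" unfolding eq_upto_def by blast
  have "G - s * F = - s * (F - s * G)" using s(1) by (auto simp: algebra_simps)
  then have "fps_X ^ n dvd G - s * F" using s(2) by simp
  then show ?thesis unfolding eq_upto_def using s(1) by blast
qed

lemma eq_upto_refl: "eq_upto n F F"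
  by (rule eq_uptoI) simp

lemma eq_upto_power: "eq_upto n F G \<Longrightarrow> eq_upto n (F ^ k) (G ^ k)"
  by (induction k) (simp_all add: eq_upto_refl eq_upto_mult)

lemma eq_upto_sign: "s = 1 \<or> s = -1 \<Longrightarrow> eq_upto n (s * F) F"
  unfolding eq_upto_def by (intro exI[of _ s]) simp

lemma eq_upto_inverse:
  assumes "eq_upto n F G" "F $ 0 \<noteq> 0" "G $ 0 \<noteq> 0"
  shows "eq_upto n (inverse F) (inverse G)"
proof -
  have "eq_upto n (inverse F * inverse G * G) (inverse F * inverse G * F)"
    by (rule eq_upto_mult[OF eq_upto_refl eq_upto_sym[OF assms(1)]])
  moreover have "inverse F * inverse G * G = inverse F" "inverse F * inverse G * F = inverse G"
    using inverse_mult_eq_1[OF assms(2)] inverse_mult_eq_1[OF assms(3)] by (simp_all add: mult.assoc mult.left_commute)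
  ultimately show ?thesis by simp
qed

lemma eq_upto_iff: "eq_upto n F G \<longleftrightarrow> (\<exists>s. (s = 1 \<or> s = -1) \<and> (\<forall>i<n. F $ i = s * G $ i))"
proof -
  have d: "fps_X ^ n dvd H \<longleftrightarrow> (\<forall>i<n. H $ i = 0)" for H :: "rat fps"
  proof
    assume "fps_X ^ n dvd H"
    then show "\<forall>i<n. H $ i = 0" by (auto elim!: dvdE simp: fps_X_power_mult_nth)
  next
    assume "\<forall>i<n. H $ i = 0"
    then have "H = fps_X ^ n * fps_shift n H" by (auto simp: fps_eq_iff fps_X_power_mult_nth)
    then show "fps_X ^ n dvd H" by (rule dvdI)
  qed
  show ?thesis
    unfolding eq_upto_def d
  proof
    assume "\<exists>s. (s = 1 \<or> s = -1) \<and> (\<forall>i<n. (F - s * G) $ i = 0)"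
    then show "\<exists>s. (s = 1 \<or> s = -1) \<and> (\<forall>i<n. F $ i = s * G $ i)"
      by (auto intro: exI[of _ 1] exI[of _ "-1"])
  next
    assume "\<exists>s. (s = 1 \<or> s = -1) \<and> (\<forall>i<n. F $ i = s * G $ i)"
    then show "\<exists>s. (s = 1 \<or> s = -1) \<and> (\<forall>i<n. (F - s * G) $ i = 0)"
      by (auto intro: exI[of _ 1] exI[of _ "-1"])
  qed
qed

lemma doteq_iff: "doteq n P1 P2 \<longleftrightarrow> (\<exists>F1 F2. normalizes_to P1 F1 \<and> normalizes_to P2 F2 \<and> eq_upto n F1 F2)"
  unfolding doteq_def eq_upto_iff by blast

text \<open>A further factor \<open>1 - q ^ (m + 1)\<close> with \<open>n \<le> m\<close> changes no
  coefficient below degree \<open>n\<close>.\<close>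

lemma eq_upto_qfact: "n \<le> m \<Longrightarrow> eq_upto n (qfact m) (qfact n)"
proof (induction m rule: dec_induct)
  case (step m)
  have "eq_upto n (qfact (Suc m)) (qfact m)"
  proof (rule eq_uptoI)
    have "qfact (Suc m) - qfact m = fps_X ^ n * (- qfact m * fps_X ^ (Suc m - n))"
      using step(1) by (simp add: qfact_Suc algebra_simps flip: power_add power_Suc)
    then show "fps_X ^ n dvd qfact (Suc m) - qfact m" by simp
  qed
  then show ?case using step(3) eq_upto_trans by blast
qed (rule eq_upto_refl)

lemma qpochhammer_qfact: "qpochhammer (fps_X ^ 2) fps_X n = qfact (Suc n) * inverse (1 - fps_X)"
proof -
  have "qfact (Suc n) = (1 - fps_X) * qpochhammer (fps_X ^ 2) fps_X n"
    unfolding qfact_def qpochhammer_def prod.lessThan_Suc_shift by (simp add: power2_eq_square mult.assoc)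
  then show ?thesis
    using inverse_mult_eq_1[of "1 - fps_X :: rat fps"] by (simp add: mult_ac)
qed

text \<open>Up to order \<open>n\<close> every \<open>qfact\<close> may be replaced by
  \<open>qfact n\<close>, and one of them survives since \<open>1 + 3 - 3 = 1\<close>. The powers of
  \<open>1 / (1 - q)\<close> have the exponents \<open>3 n + 1\<close>, \<open>3 n\<close> and
  \<open>- 6 n\<close>, so one of these survives as well. The quotient
  \<open>qfact n / (1 - q)\<close> agrees with \<open>(q^2;q)_n\<close> to this order.\<close>

lemma normalizes_to_theta:
  obtains H where "normalizes_to (laurent_of_ratfun (theta n n n)) H"
    "eq_upto n H (qpochhammer (fps_X ^ 2) fps_X n)"
proof -
  let ?i = "inverse (1 - fps_X) :: rat fps"
  obtain s t u where s: "s = 1 \<or> s = -1" "t = 1 \<or> t = -1" "u = 1 \<or> u = -1"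
    and f: "normalizes_to (laurent_of_ratfun (circle_fact (Suc (3 * n)))) (s * (qfact (Suc (3 * n)) * ?i ^ Suc (3 * n)))"
      "normalizes_to (laurent_of_ratfun (circle_fact n)) (t * (qfact n * ?i ^ n))"
      "normalizes_to (laurent_of_ratfun (circle_fact (2 * n))) (u * (qfact (2 * n) * ?i ^ (2 * n)))"
    using normalizes_to_circle_fact by metis
  have th: "theta n n n = circle_fact (Suc (3 * n)) * circle_fact n ^ 3 * inverse (circle_fact (2 * n)) ^ 3"
  proof -
    have "n + n + n = 3 * n" "n + n = 2 * n" by simp_all
    then show ?thesis by (simp only: theta_def power3_eq_cube divide_inverse inverse_mult_distrib ac_simps)
  qed
  let ?H = "s * (qfact (Suc (3 * n)) * ?i ^ Suc (3 * n)) * (t * (qfact n * ?i ^ n)) ^ 3 *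
      inverse (u * (qfact (2 * n) * ?i ^ (2 * n))) ^ 3"
  have "normalizes_to (laurent_of_ratfun (theta n n n)) ?H"
    unfolding th laurent_of_ratfun_mult laurent_of_ratfun_power laurent_of_ratfun_inverse[OF circle_fact_nonzero]
    by (intro normalizes_to_mult normalizes_to_power normalizes_to_inverse f)
  moreover have "eq_upto n ?H (qpochhammer (fps_X ^ 2) fps_X n)"
  proof -
    have e: "eq_upto n (s * (qfact m * ?i ^ k)) (qfact n * ?i ^ k)" if "s = 1 \<or> s = -1" "n \<le> m" for s m k
      using eq_upto_trans[OF eq_upto_sign[OF that(1)] eq_upto_mult[OF eq_upto_qfact[OF that(2)] eq_upto_refl]] .
    have u: "(u * (qfact (2 * n) * ?i ^ (2 * n))) $ 0 \<noteq> 0"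
      using s(3) by auto
    have "eq_upto n ?H ((qfact n * ?i ^ Suc (3 * n)) * (qfact n * ?i ^ n) ^ 3 * inverse (qfact n * ?i ^ (2 * n)) ^ 3)"
      by (intro eq_upto_mult eq_upto_power e s eq_upto_inverse u) simp_all
    also have "(qfact n * ?i ^ Suc (3 * n)) * (qfact n * ?i ^ n) ^ 3 * inverse (qfact n * ?i ^ (2 * n)) ^ 3 = qfact n * ?i"
    proof -
      have "?i ^ Suc (3 * n) * (?i ^ n) ^ 3 = ?i * (?i ^ (2 * n)) ^ 3"
        by (simp add: mult_ac flip: power_mult power_add)
      then have e1: "(qfact n * ?i ^ Suc (3 * n)) * (qfact n * ?i ^ n) ^ 3 = qfact n * ?i * (qfact n * ?i ^ (2 * n)) ^ 3"
        by (simp add: power_mult_distrib mult_ac)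
      have e2: "(qfact n * ?i ^ (2 * n)) ^ 3 * inverse (qfact n * ?i ^ (2 * n)) ^ 3 = 1"
        unfolding power_mult_distrib[symmetric] using inverse_mult_eq_1'[of "qfact n * ?i ^ (2 * n)"] by simp
      show ?thesis unfolding e1 by (simp only: mult.assoc[of "qfact n * ?i"] e2 mult_1_right)
    qed
    finally have "eq_upto n ?H (qfact n * ?i)" .
    moreover have "eq_upto n (qpochhammer (fps_X ^ 2) fps_X n) (qfact n * ?i)"
      unfolding qpochhammer_qfact by (intro eq_upto_mult eq_upto_qfact eq_upto_refl) simp
    ultimately show ?thesis using eq_upto_trans eq_upto_sym by blast
  qed
  ultimately show ?thesis using that by blast
qed

lemma theta_nonzero: "theta n n n \<noteq> 0"
  by (simp add: theta_def)

theorem theorem5p1: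
  fixes \<Gamma>1 :: "nat \<Rightarrow> 'a spin_network" and \<Gamma>2 :: "nat \<Rightarrow> 'b spin_network"
    and v1 :: "nat \<Rightarrow> 'a dart" and v2 :: "nat \<Rightarrow> 'b dart"
    and T1 T2 :: "int fps"
  assumes "\<And>n. is_spin_network (\<Gamma>1 n) \<and> admissible (\<Gamma>1 n)"
    and "\<And>n. is_spin_network (\<Gamma>2 n) \<and> admissible (\<Gamma>2 n)"
    and "\<And>n e. e \<in> edges (\<Gamma>1 n) \<Longrightarrow> color (\<Gamma>1 n) e \<in> {n, 2 * n}"
    and "\<And>n e. e \<in> edges (\<Gamma>2 n) \<Longrightarrow> color (\<Gamma>2 n) e \<in> {n, 2 * n}"
    and "\<And>n. distinguished_vertex (\<Gamma>1 n) (2 * n) (v1 n)"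
    and "\<And>n. distinguished_vertex (\<Gamma>2 n) (2 * n) (v2 n)"
    and "is_tail (\<lambda>n. evaluation (\<Gamma>1 n)) T1"
    and "is_tail (\<lambda>n. evaluation (\<Gamma>2 n)) T2"
  shows "\<forall>n. doteq n
     (laurent_of_ratfun (evaluation (glue (\<Gamma>1 n) (v1 n) (\<Gamma>2 n) (v2 n))))
     (laurent_of_qseries
        (inverse (qpochhammer (fps_X ^ 2) fps_X n) * rat_series T1 * rat_series T2))"
proof
  fix n
  let ?L = laurent_of_ratfun and ?Q = laurent_of_qseries and ?q = "qpochhammer (fps_X ^ 2) fps_X n :: rat fps"
  let ?ev = "evaluation (glue (\<Gamma>1 n) (v1 n) (\<Gamma>2 n) (v2 n))"
  interpret A: vertex_network "\<Gamma>1 n" "v1 n" n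
    using assms(1)[of n] assms(3)[of _ n] assms(5)[of n]
    by unfold_locales (fastforce simp: is_spin_network_def)+
  interpret B: vertex_network "\<Gamma>2 n" "v2 n" n
    using assms(2)[of n] assms(4)[of _ n] assms(6)[of n]
    by unfold_locales (fastforce simp: is_spin_network_def)+
  interpret glued_networks "\<Gamma>1 n" "v1 n" "\<Gamma>2 n" "v2 n" n ..
  obtain H where H: "normalizes_to (?L (theta n n n)) H" "eq_upto n H ?q"
    by (rule normalizes_to_theta)
  \<comment> \<open>The constant coefficient of a tail may vanish, so its normal form
    \<open>S1\<close> is used in place of \<open>rat_series T1\<close>.\<close>
  obtain S1 F1 where F1: "normalizes_to (?Q (rat_series T1)) S1" "normalizes_to (?L (evaluation (\<Gamma>1 n))) F1" "eq_upto n S1 F1"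
    using assms(7) unfolding is_tail_def doteq_iff by blast
  obtain S2 F2 where F2: "normalizes_to (?Q (rat_series T2)) S2" "normalizes_to (?L (evaluation (\<Gamma>2 n))) F2" "eq_upto n S2 F2"
    using assms(8) unfolding is_tail_def doteq_iff by blast
  have "?ev = inverse (theta n n n) * evaluation (\<Gamma>1 n) * evaluation (\<Gamma>2 n)"
    using evaluation_glue theta_nonzero[of n] by (simp add: field_simps)
  then have "normalizes_to (?L ?ev) (inverse H * F1 * F2)"
    using normalizes_to_mult[OF normalizes_to_mult[OF normalizes_to_inverse[OF H(1)] F1(2)] F2(2)]
    by (simp add: laurent_of_ratfun_mult laurent_of_ratfun_inverse theta_nonzero)
  moreover have q: "?q $ 0 = 1"
    by (simp add: qpochhammer_qfact)
  then have "normalizes_to (?Q (inverse ?q * rat_series T1 * rat_series T2)) (inverse ?q * S1 * S2)"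
    unfolding laurent_of_qseries_mult by (intro normalizes_to_mult normalizes_to_qseries F1 F2) simp
  moreover have "H $ 0 \<noteq> 0" using H(1) by (simp add: normalizes_to_def)
  then have "eq_upto n (inverse H * F1 * F2) (inverse ?q * S1 * S2)"
    using q by (intro eq_upto_mult eq_upto_inverse H(2) eq_upto_sym[OF F1(3)] eq_upto_sym[OF F2(3)]) simp_all
  ultimately show "doteq n (?L ?ev) (?Q (inverse ?q * rat_series T1 * rat_series T2))"
    unfolding doteq_iff by blast
qed

end
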